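(* Under the standing assumptions listed in the context, there exists $r_0>0$ such that for any $r\in(0,r_0)$ the following holds for the discounted master equation with unknown $U_r:[d]\times\mathcal{P}([d])\to\mathbb{R}$: for all $x\in[d]$, $\eta\in\mathcal{P}([d])$, $$rU_r(x,\eta)=H(x,\Delta_xU_r(\cdot,\eta))+\sum_{y,z\in[d]}\eta_y\,D^\eta_{yz}U_r(x,\eta)\,\gamma^*_z(y,\Delta_yU_r(\cdot,\eta))+F(x,\eta).\qquad(\mathrm{ME}_r)$$ (i) Equation $(\mathrm{ME}_r)$ admits a solution. (ii) The solution $U_r$ is unique and satisfies $U_r(x,\mu_0)=u^r_x(0)$ for all $x\in[d]$ and $\mu_0\in\mathcal{P}([d])$, where $(u^r,\mu^r)$ solves the discounted mean field game system $(\mathrm{MFG}_r)$ (see context) with $\mu^r(0)=\mu_0$. In particular $U_r(x,\bar\mu^r)=\bar u^r_x$, where $(\bar u^r,\bar\mu^r)\in\mathbb{R}^d\times\mathcal{P}([d])$ solves the stationary discounted system $-r\bar u^r_x+H(x,\Delta_x\bar u^r)+F(x,\bar\mu^r)=0$, $\sum_y\bar\mu^r_y\gamma^*_x(y,\Delta_y\bar u^r)=0$, $x\in[d]$. (iii) $U_r$ is differentiable with respect to $\eta$ and there is a constant $C>0$ such that for any $\eta_1,\eta_2\in\mathcal{P}([d])$, $r\in(0,r_0)$ and $x\in[d]$, $$|rU_r(x,\eta_1)|+|D^\eta_1U_r(x,\eta_1)|\le C\quad\text{and}\quad|D^\eta_1U_r(x,\eta_1)-D^\eta_1U_r(x,\eta_2)|\le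 C|\eta_1-\eta_2|.$$ (iv) $U_r$ is monotone in the Lasry--Lions sense: $\sum_{x\in[d]}(U_r(x,\eta)-U_r(x,\hat\eta))(\eta_x-\hat\eta_x)\ge0$ for all $\eta,\hat\eta\in\mathcal{P}([d])$.
   Context: Notation. $d\ge2$ is a fixed integer, $[d]=\{1,\dots,d\}$, $|\cdot|$ is the Euclidean norm, $\mathcal{P}([d])=\{\eta\in[0,\infty)^d:\sum_x\eta_x=1\}$. For $p\in\mathbb{R}^d$, $\Delta_xp=(p_y-p_x)_{y\in[d]}$; $\Delta_xU(\cdot,\eta)=(U(y,\eta)-U(x,\eta))_{y\in[d]}$. With $(e_i)$ the standard basis and $e_{yz}=e_z-e_y$, for $K:\mathcal{P}([d])\to\mathbb{R}$ set $D^\eta_{yz}K(\eta)=\lim_{h\to0^+}\frac{K(\eta+he_{yz})-K(\eta)}{h}$ (at boundary points where $\eta+he_{yz}$ leaves the simplex, understood as the continuous extension from the relative interior), $D^\eta_yK=(D^\eta_{yz}K)_{z\in[d]}$, $D^\eta K=(D^\eta_{yz}K)_{y,z}$. $\mathcal{C}^1(\mathcal{P}([d]))$ is the set of continuously differentiable $K$ in this sense. A solution of $(\mathrm{ME}_r)$ is understood classically: $U_r(x,\cdot)\in\mathcal{C}^1(\mathcal{P}([d]))$ for each $x$. Data and standing assumptions. $f(x,a)$ is a real-valued, measurable, bounded running cost which does not depend on $a_x$; $F:[d]\times\mathcal{P}([d])\to\mathbb{R}$. (A1) The action set is $\mathbb{A}=[\mathfrak{a}_l,\mathfrak{a}_u]$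 with $0<\mathfrak{a}_l<\mathfrak{a}_u<\infty$. A rate vector at $x$ is $a\in\mathbb{R}^d$ with $a_y\in\mathbb{A}$ for $y\ne x$ and $a_x=-\sum_{y\ne x}a_y$. The Hamiltonian is $H(x,p)=\inf_a\{f(x,a)+a\cdot p\}$, infimum over rate vectors at $x$. (A2) For each $(x,p)\in[d]\times\mathbb{R}^d$ there is a unique minimizing rate vector $\gamma^*(x,p)=\arg\min_a\{f(x,a)+a\cdot p\}$, and $\gamma^*$ is measurable; $\gamma^*_y(x,p)$ is its $y$-th component. (When $H$ is differentiable, $\gamma^*=D_pH$.) (A3) $F(x,\cdot)\in\mathcal{C}^1(\mathcal{P}([d]))$ and $D^\eta F(x,\cdot)$ is Lipschitz for each $x$. (A4) $\sum_x(F(x,\eta)-F(x,\hat\eta))(\eta_x-\hat\eta_x)\ge0$ for all $\eta,\hat\eta\in\mathcal{P}([d])$. (A5) $H(x,\cdot)$ is $\mathcal{C}^2$; on any compact set of $p$'s, $D_pH$ and $D^2_{pp}H$ are Lipschitz in $p$ and there is $C_{2,H}>0$ with $q^\top D^2_{pp}H(x,p)q\le-C_{2,H}|q|^2$ for all $q\in\mathbb{R}^d$ with $q_x=0$. The discounted mean field game system $(\mathrm{MFG}_r)$ with initial datum $\mu_0\in\mathcal{P}([d])$ is, for $t\ge0$, $x\in[d]$, $$-\tfrac{d}{dt}u^r_x(t)=-ru^r_x(t)+H(x,\Delta_xu^r(t))+F(x,\mu^r(t)),\quad \tfrac{d}{dt}\mu^r_x(t)=\sum_{y\in[d]}\mu^r_y(t)\gamma^*_x(y,\Delta_yu^r(t)),\quad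 \mu^r(0)=\mu_0,$$ with $u^r:[0,\infty)\to\mathbb{R}^d$ bounded and $\mu^r:[0,\infty)\to\mathcal{P}([d])$. *)

theory Defs
  imports "HOL-Analysis.Analysis"
begin

text \<open>
  The state space $[d]$ is a finite type \<open>'n\<close> (with \<open>CARD('n) = d\<close>), so that
  $\<real>^d$ is \<open>real ^ 'n\<close>, whose norm is the Euclidean one.
\<close>

definition prob_simplex :: "(real ^ 'n) set" where
  "prob_simplex = {\<eta>. (\<forall>x. 0 \<le> \<eta> $ x) \<and> (\<Sum>x\<in>UNIV. \<eta> $ x) = 1}"

definition Delta :: "'n \<Rightarrow> real ^ 'n \<Rightarrow> real ^ 'n" where
  "Delta x p = (\<chi> y. p $ y - p $ x)"


section \<open>Derivatives on the simplex\<close>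

definition transfer :: "'n \<Rightarrow> 'n \<Rightarrow> real ^ 'n" where
  "transfer y z = axis z 1 - axis y 1"

definition diff_quotient :: "(real ^ 'n \<Rightarrow> real) \<Rightarrow> 'n \<Rightarrow> 'n \<Rightarrow> real ^ 'n \<Rightarrow> real \<Rightarrow> real" where
  "diff_quotient K y z \<eta> h = (K (\<eta> + h *\<^sub>R transfer y z) - K \<eta>) / h"

definition stays_in_simplex :: "'n \<Rightarrow> 'n \<Rightarrow> real ^ 'n \<Rightarrow> bool" where
  "stays_in_simplex y z \<eta> \<longleftrightarrow>
     eventually (\<lambda>h. \<eta> + h *\<^sub>R transfer y z \<in> prob_simplex) (at_right 0)"

text \<open>
  The second branch concerns the points of the simplex with \<open>\<eta> $ y = 0\<close> (and \<open>y \<noteq> z\<close>), where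
  the quotient would evaluate \<open>K\<close> outside the simplex.  There the derivative is the limit, from
  the relative interior, of the one-sided derivatives.
\<close>

definition has_simplex_deriv ::
    "(real ^ 'n \<Rightarrow> real) \<Rightarrow> 'n \<Rightarrow> 'n \<Rightarrow> real ^ 'n \<Rightarrow> real \<Rightarrow> bool" where
  "has_simplex_deriv K y z \<eta> D \<longleftrightarrow>
     (if stays_in_simplex y z \<eta>
      then (diff_quotient K y z \<eta> \<longlongrightarrow> D) (at_right 0)
      else ((\<lambda>\<theta>. Lim (at_right 0) (diff_quotient K y z \<theta>)) \<longlongrightarrow> D)
             (at \<eta> within rel_interior prob_simplex))"

definition simplex_deriv :: "(real ^ 'n \<Rightarrow> real) \<Rightarrow> 'n \<Rightarrow> 'n \<Rightarrow> real ^ 'n \<Rightarrow> real" where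
  "simplex_deriv K y z \<eta> = (THE D. has_simplex_deriv K y z \<eta> D)"

definition simplex_grad :: "(real ^ 'n \<Rightarrow> real) \<Rightarrow> 'n \<Rightarrow> real ^ 'n \<Rightarrow> real ^ 'n" where
  "simplex_grad K y \<eta> = (\<chi> z. simplex_deriv K y z \<eta>)"

definition simplex_jac :: "(real ^ 'n \<Rightarrow> real) \<Rightarrow> real ^ 'n \<Rightarrow> real ^ 'n ^ 'n" where
  "simplex_jac K \<eta> = (\<chi> y z. simplex_deriv K y z \<eta>)"

definition simplex_differentiable :: "(real ^ 'n \<Rightarrow> real) \<Rightarrow> bool" where
  "simplex_differentiable K \<longleftrightarrow>
     (\<forall>\<eta>\<in>prob_simplex. \<forall>y z. \<exists>D. has_simplex_deriv K y z \<eta> D)"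

definition simplex_C1 :: "(real ^ 'n \<Rightarrow> real) \<Rightarrow> bool" where
  "simplex_C1 K \<longleftrightarrow> simplex_differentiable K \<and> continuous_on prob_simplex (simplex_jac K)"


section \<open>Controls and Hamiltonian\<close>

definition off_diagonal_rates :: "real \<Rightarrow> real \<Rightarrow> 'n \<Rightarrow> (real ^ 'n) set" where
  "off_diagonal_rates al au x = {a. \<forall>y. y \<noteq> x \<longrightarrow> a $ y \<in> {al..au}}"

definition rate_vectors :: "real \<Rightarrow> real \<Rightarrow> 'n \<Rightarrow> (real ^ 'n) set" where
  "rate_vectors al au x =
     {a \<in> off_diagonal_rates al au x. a $ x = - (\<Sum>y\<in>UNIV - {x}. a $ y)}"

definition running_cost :: "real \<Rightarrow> real \<Rightarrow> ('n \<Rightarrow> real ^ 'n \<Rightarrow> real) \<Rightarrow> bool" where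
  "running_cost al au f \<longleftrightarrow>
     (\<forall>x. f x \<in> borel_measurable (restrict_space borel (off_diagonal_rates al au x)) \<and>
          bounded (f x ` off_diagonal_rates al au x) \<and>
          (\<forall>a\<in>off_diagonal_rates al au x. \<forall>b\<in>off_diagonal_rates al au x.
             (\<forall>y. y \<noteq> x \<longrightarrow> a $ y = b $ y) \<longrightarrow> f x a = f x b))"

definition hamiltonian ::
    "real \<Rightarrow> real \<Rightarrow> ('n \<Rightarrow> real ^ 'n \<Rightarrow> real) \<Rightarrow> 'n \<Rightarrow> real ^ 'n \<Rightarrow> real" where
  "hamiltonian al au f x p = (INF a\<in>rate_vectors al au x. f x a + a \<bullet> p)"

definition minimizing_rate ::
    "real \<Rightarrow> real \<Rightarrow> ('n \<Rightarrow> real ^ 'n \<Rightarrow> real) \<Rightarrow> 'n \<Rightarrow> real ^ 'n \<Rightarrow> real ^ 'n \<Rightarrow> bool" where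
  "minimizing_rate al au f x p a \<longleftrightarrow>
     a \<in> rate_vectors al au x \<and> (\<forall>b\<in>rate_vectors al au x. f x a + a \<bullet> p \<le> f x b + b \<bullet> p)"

definition opt_rate ::
    "real \<Rightarrow> real \<Rightarrow> ('n \<Rightarrow> real ^ 'n \<Rightarrow> real) \<Rightarrow> 'n \<Rightarrow> real ^ 'n \<Rightarrow> real ^ 'n" where
  "opt_rate al au f x p = (THE a. minimizing_rate al au f x p a)"

text \<open>
  \<open>G\<close> and \<open>Q\<close> are the gradient and the Hessian of \<open>h\<close>.  The Lipschitz and concavity constants
  may depend on the compact set, and concavity is required only in directions \<open>q\<close> with
  \<open>q $ x = 0\<close>.
\<close>

definition regular_concave_at :: "'n \<Rightarrow> (real ^ 'n \<Rightarrow> real) \<Rightarrow> bool" where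
  "regular_concave_at x h \<longleftrightarrow>
     (\<exists>(G :: real ^ 'n \<Rightarrow> real ^ 'n) (Q :: real ^ 'n \<Rightarrow> real ^ 'n ^ 'n).
        (\<forall>p. GDERIV h p :> G p) \<and>
        (\<forall>p. (G has_derivative (\<lambda>q. Q p *v q)) (at p)) \<and>
        continuous_on UNIV Q \<and>
        (\<forall>S. compact S \<longrightarrow>
           (\<exists>L. L-lipschitz_on S G) \<and>
           (\<exists>L. L-lipschitz_on S Q) \<and>
           (\<exists>c>0. \<forall>p\<in>S. \<forall>q. q $ x = 0 \<longrightarrow> q \<bullet> (Q p *v q) \<le> - c * (norm q)\<^sup>2)))"

definition lasry_lions_monotone :: "('n \<Rightarrow> real ^ 'n \<Rightarrow> real) \<Rightarrow> bool" where
  "lasry_lions_monotone F \<longleftrightarrow>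
     (\<forall>\<eta>\<in>prob_simplex. \<forall>\<theta>\<in>prob_simplex.
        (\<Sum>x\<in>UNIV. (F x \<eta> - F x \<theta>) * (\<eta> $ x - \<theta> $ x)) \<ge> 0)"


section \<open>Discounted master equation and mean field game system\<close>

text \<open>In the following, \<open>H\<close> is the Hamiltonian and \<open>g\<close> the optimal rate selector.\<close>

definition master_solution ::
    "('n \<Rightarrow> real ^ 'n \<Rightarrow> real) \<Rightarrow> ('n \<Rightarrow> real ^ 'n \<Rightarrow> real ^ 'n) \<Rightarrow> ('n \<Rightarrow> real ^ 'n \<Rightarrow> real) \<Rightarrow>
     real \<Rightarrow> ('n \<Rightarrow> real ^ 'n \<Rightarrow> real) \<Rightarrow> bool" where
  "master_solution H g F r U \<longleftrightarrow>
     (\<forall>x. simplex_C1 (U x)) \<and>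
     (\<forall>x. \<forall>\<eta>\<in>prob_simplex.
        r * U x \<eta> = H x (Delta x (\<chi> w. U w \<eta>))
          + (\<Sum>y\<in>UNIV. \<Sum>z\<in>UNIV. \<eta> $ y * simplex_deriv (U x) y z \<eta> * g y (Delta y (\<chi> w. U w \<eta>)) $ z)
          + F x \<eta>)"

definition mfg_solution ::
    "('n \<Rightarrow> real ^ 'n \<Rightarrow> real) \<Rightarrow> ('n \<Rightarrow> real ^ 'n \<Rightarrow> real ^ 'n) \<Rightarrow> ('n \<Rightarrow> real ^ 'n \<Rightarrow> real) \<Rightarrow>
     real \<Rightarrow> real ^ 'n \<Rightarrow> (real \<Rightarrow> real ^ 'n) \<Rightarrow> (real \<Rightarrow> real ^ 'n) \<Rightarrow> bool" where
  "mfg_solution H g F r \<mu>0 u \<mu> \<longleftrightarrow>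
     bounded (u ` {0..}) \<and> \<mu> ` {0..} \<subseteq> prob_simplex \<and> \<mu> 0 = \<mu>0 \<and>
     (\<forall>t\<ge>0. \<forall>x.
        ((\<lambda>s. u s $ x) has_real_derivative
            - (- r * u t $ x + H x (Delta x (u t)) + F x (\<mu> t))) (at t within {0..}) \<and>
        ((\<lambda>s. \<mu> s $ x) has_real_derivative
            (\<Sum>y\<in>UNIV. \<mu> t $ y * g y (Delta y (u t)) $ x)) (at t within {0..}))"

definition stationary_solution ::
    "('n \<Rightarrow> real ^ 'n \<Rightarrow> real) \<Rightarrow> ('n \<Rightarrow> real ^ 'n \<Rightarrow> real ^ 'n) \<Rightarrow> ('n \<Rightarrow> real ^ 'n \<Rightarrow> real) \<Rightarrow>
     real \<Rightarrow> real ^ 'n \<Rightarrow> real ^ 'n \<Rightarrow> bool" where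
  "stationary_solution H g F r u \<mu> \<longleftrightarrow>
     \<mu> \<in> prob_simplex \<and>
     (\<forall>x. - r * u $ x + H x (Delta x u) + F x \<mu> = 0 \<and>
          (\<Sum>y\<in>UNIV. \<mu> $ y * g y (Delta y u) $ x) = 0)"

end

theory Submission
  imports Defs
begin

text \<open>
  The solution is the value of the mean field game: \<open>U\<close> at a distribution \<open>\<mu>0\<close> is the initial value \<open>u 0\<close> of
  the bounded solution \<open>(u, \<mu>)\<close> of the discounted system started at \<open>\<mu>0\<close>, called an equilibrium below.  Equilibria are the
  characteristics of the master equation: restarting an equilibrium gives an equilibrium, hence \<open>U (\<mu> t) = u t\<close>, and
  differentiating this identity in time is the master equation as soon as \<open>U\<close> is differentiable (\<open>value_master\<close>).
  Conversely, the flow of distributions under the feedback of any solution produces an equilibrium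
  (\<open>master_equilibrium\<close>).  So everything reduces to existence, uniqueness and smooth dependence on the initial
  distribution of equilibria, with constants that do not deteriorate as the discount \<open>r\<close> tends to \<open>0\<close>.

  The estimates for differences of equilibria come from one abstract result, \<open>coupled_pair_decay\<close>.  It concerns a pair of a value \<open>w\<close>, solving a discounted
  backward equation, and a signed density \<open>n\<close> of mass \<open>0\<close>, solving a forward equation, driven by each other.  Two mechanisms
  act.  First, all jump rates are at least \<open>al > 0\<close>, so by Doeblin's argument the mass norm of \<open>n\<close> contracts
  forwards in time and the oscillation of \<open>w\<close> contracts backwards in time.  Second, the Lasry--Lions pairing of \<open>w\<close> and \<open>n\<close>
  loses at least a multiple of \<open>osc w ^ 2\<close> per unit of time, because the Hamiltonian is strongly concave and the
  coupling cost is monotone.  Correcting the pairing by suitable multiples of the squared norms gives Lyapunov functions, and both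
  \<open>n\<close> and \<open>w\<close>, including the components of \<open>w\<close> and not only its oscillation, decay exponentially at a rate independent
  of \<open>r < r0\<close>.  It is this decay that makes the bounds uniform: a discounted equation with a decaying source
  has a solution bounded independently of the discount.

  The result is used three times.  For systems with the same initial distribution and different sources it shows that the
  density depends on the source in a Lipschitz way; the coupling can therefore be switched on in finitely many small steps,
  each a contraction, which yields existence (\<open>system_exists\<close>).  For two equilibria it gives
  uniqueness, the Lipschitz bound for \<open>U\<close> and convergence to a stationary equilibrium; the inequality for their pairing
  gives the monotonicity of \<open>U\<close>.  For
  second differences of four equilibria, which satisfy the linearised system up to products of two decaying first
  differences (\<open>second_difference_coupled\<close>), it bounds the second differences of \<open>U\<close> quadratically.  By the elementary
  criterion \<open>gradient_of_second_differences\<close> such a function has a Lipschitz continuous gradient on the simplex, boundary included.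
  The regularity of \<open>U\<close> is thus obtained from differences of equilibria at positive distance.

  The derivatives in the statement are one-sided limits along mass transfers, extended from the relative interior.  They are
  related to ordinary derivatives relative to the simplex by \<open>simplex_C1_of_gradient\<close> and
  \<open>gradient_of_simplex_C1\<close>.
\<close>

section \<open>Scalar differential equations on the half line\<close>

text \<open>At time \<open>0\<close> only the one-sided derivative is meant, so that the initial time is treated like
  any other.\<close>

abbreviation has_rate :: "(real \<Rightarrow> real) \<Rightarrow> real \<Rightarrow> real \<Rightarrow> bool" (infix "has'_rate" 50) where
  "(f has_rate D) t \<equiv> (f has_real_derivative D) (at t within {0..})"

lemma has_deriv_half_line_imp_at:
  fixes f :: "real \<Rightarrow> real"
  assumes "(f has_rate D) t" "0 < t"
  shows "(f has_real_derivative D) (at t)"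
proof -
  have "t \<in> interior {0::real..}" using assms(2) by simp
  then show ?thesis using assms(1) at_within_interior by metis
qed

lemma half_line_continuous_on:
  fixes f :: "real \<Rightarrow> real"
  assumes "\<And>t. 0 \<le> t \<Longrightarrow> \<exists>D. (f has_rate D) t"
  shows "continuous_on {0..} f"
  unfolding continuous_on_eq_continuous_within
  using assms DERIV_continuous by fastforce

lemma antimono_half_line:
  fixes f :: "real \<Rightarrow> real"
  assumes d: "\<And>t. a \<le> t \<Longrightarrow> t \<le> b \<Longrightarrow> \<exists>D\<le>0. (f has_rate D) t"
    and "0 \<le> a" "a \<le> b"
  shows "f b \<le> f a"
proof (rule DERIV_nonpos_imp_decreasing_open[OF assms(3)])
  show "\<exists>y. (f has_real_derivative y) (at x) \<and> y \<le> 0" if "a < x" "x < b" for x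
    using d[of x] that assms has_deriv_half_line_imp_at[of f _ x] by fastforce
  have "continuous (at x within {a..b}) f" if "x \<in> {a..b}" for x
  proof -
    have x: "a \<le> x" "x \<le> b" using that by auto
    obtain D where "(f has_rate D) x" using d[OF x] by blast
    then have "continuous (at x within {0..}) f" by (rule DERIV_continuous)
    then show ?thesis
      by (rule continuous_within_subset) (use assms in auto)
  qed
  then show "continuous_on {a..b} f" by (simp add: continuous_on_eq_continuous_within)
qed

lemma mono_half_line:
  fixes f :: "real \<Rightarrow> real"
  assumes d: "\<And>t. a \<le> t \<Longrightarrow> t \<le> b \<Longrightarrow> \<exists>D\<ge>0. (f has_rate D) t"
    and "0 \<le> a" "a \<le> b"
  shows "f a \<le> f b"
proof -
  have "- f b \<le> - f a"
  proof (rule antimono_half_line[of a b "\<lambda>t. - f t"])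
    fix t assume t: "a \<le> t" "t \<le> b"
    obtain D where D: "D \<ge> 0" "(f has_rate D) t"
      using d[OF t] by auto
    have "((\<lambda>t. - f t) has_rate (- D)) t"
      using D(2) by (auto intro!: derivative_eq_intros)
    with D(1) show "\<exists>D\<le>0. ((\<lambda>t. - f t) has_rate D) t"
      by (intro exI[of _ "-D"]) auto
  qed (use assms in auto)
  then show ?thesis by simp
qed

lemma antiderivative_half_line:
  fixes q :: "real \<Rightarrow> real"
  assumes q: "continuous_on {0..} q"
  shows "\<exists>Q. Q 0 = 0 \<and> (\<forall>t\<ge>0. (Q has_rate q t) t)"
proof (intro exI[of _ "\<lambda>t. integral {0..t} q"] conjI allI impI)
  fix t :: real assume t: "0 \<le> t"
  have "((\<lambda>t. integral {0..t} q) has_real_derivative q t) (at t within {0..t+1})"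
    using t by (intro integral_has_real_derivative continuous_on_subset[OF q]) auto
  moreover have "at t within {0..t+1} = at t within {0..}"
    by (rule at_within_nhd[of t "{..<t+1}"]) auto
  ultimately show "((\<lambda>t. integral {0..t} q) has_rate q t) t"
    by simp
qed simp

lemma half_line_shift:
  fixes f :: "real \<Rightarrow> real"
  assumes "(f has_rate D) (\<tau> + t)" "0 \<le> \<tau>"
  shows "((\<lambda>s. f (\<tau> + s)) has_rate D) t"
proof -
  have "(f has_real_derivative D) (at (\<tau> + t) within (\<lambda>s. \<tau> + s) ` {0..})"
    using assms by (auto intro: DERIV_subset)
  moreover have "((\<lambda>s. \<tau> + s) has_rate 1) t"
    by (auto intro!: derivative_eq_intros)
  ultimately show ?thesis
    using DERIV_image_chain[of f D "\<lambda>s. \<tau> + s" t "{0..}" 1] by (simp add: o_def)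
qed

lemma exp_decay_tendsto:
  fixes r :: real
  assumes "0 < r"
  shows "((\<lambda>T. exp (- (r * T))) \<longlongrightarrow> 0) at_top"
  by (rule filterlim_compose[OF exp_at_bot])
    (simp add: filterlim_uminus_at_bot filterlim_tendsto_pos_mult_at_top[OF tendsto_const assms filterlim_ident])

text \<open>Discounted quantities are estimated by following a monotone expression up to a time \<open>T\<close>.
  Boundedness of the solution makes the contribution of the terminal time of order \<open>exp (- r * T)\<close>, and
  this lemma removes it.\<close>

lemma nonpos_of_decaying_bound:
  fixes x B r :: real
  assumes "0 < r" and le: "\<And>T. t \<le> T \<Longrightarrow> x \<le> B * exp (- (r * T))"
  shows "x \<le> 0"
proof -
  have "((\<lambda>T. B * exp (- (r * T))) \<longlongrightarrow> B * 0) at_top"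
    by (intro tendsto_mult tendsto_const exp_decay_tendsto assms(1))
  then have "x \<le> B * 0"
    by (rule tendsto_lowerbound) (use le in \<open>auto simp: eventually_at_top_linorder\<close>)
  then show ?thesis by simp
qed

lemma Cauchy_of_tail_bound:
  fixes a :: "nat \<Rightarrow> 'a::metric_space"
  assumes tail: "\<And>i j. i \<le> j \<Longrightarrow> dist (a i) (a j) \<le> b i" and b: "b \<longlonglongrightarrow> (0 :: real)"
  shows "Cauchy a"
proof (rule metric_CauchyI)
  fix e :: real assume "0 < e"
  then have "eventually (\<lambda>i. b i < e) sequentially" using b by (auto simp: order_tendsto_iff)
  then obtain N where "\<And>i. N \<le> i \<Longrightarrow> b i < e" by (auto simp: eventually_sequentially)
  then have "dist (a i) (a j) < e" if "N \<le> i" "i \<le> j" for i j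
    using tail[OF that(2)] that(1) by (meson le_less_trans)
  then show "\<exists>M. \<forall>i\<ge>M. \<forall>j\<ge>M. dist (a i) (a j) < e" by (metis dist_commute nle_le)
qed

text \<open>The homogeneous solutions of \<open>y' = r y - h\<close> grow like \<open>exp (r t)\<close>, so
  boundedness plays the part of a terminal condition and forces \<open>y\<close> to be the discounted integral of the
  future of \<open>h\<close>. The decisive feature is the denominator \<open>r + l\<close>: for a decaying source
  (\<open>l > 0\<close>) the bound does not degenerate as \<open>r\<close> tends to \<open>0\<close>.\<close>

lemma bounded_ode_decay:
  fixes y h :: "real \<Rightarrow> real"
  assumes y: "\<And>t. 0 \<le> t \<Longrightarrow> (y has_rate (r * y t - h t)) t"
    and h: "\<And>t. 0 \<le> t \<Longrightarrow> \<bar>h t\<bar> \<le> K * exp (- (l * t))"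
    and bd: "\<And>t. 0 \<le> t \<Longrightarrow> \<bar>y t\<bar> \<le> B"
    and r: "0 < r" "0 \<le> l" and t: "0 \<le> t"
  shows "\<bar>y t\<bar> \<le> K * exp (- (l * t)) / (r + l)"
proof -
  have K: "K \<ge> 0" using h[of 0] by simp
  have B: "B \<ge> 0" using bd[of 0] by simp
  define k where "k = K / (r + l)"
  have Kk: "K = (r + l) * k" using r by (simp add: k_def)
  have k: "k \<ge> 0" using K r by (simp add: k_def)
  have one_side: "s * y t \<le> k * exp (- (l * t))" if s: "s = 1 \<or> s = -1" for s :: real
  proof -
    \<comment> \<open>The sign \<open>s\<close> treats upper and lower bound at once; \<open>k * exp (- l t)\<close>
      solves the equation with the extremal source.\<close>
    define f where "f = (\<lambda>t. exp (- (r * t)) * (s * y t - k * exp (- (l * t))))"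
    have mono: "f t \<le> f T" if "t \<le> T" for T
    proof (rule mono_half_line[OF _ t that])
      fix u assume u: "t \<le> u"
      have "(f has_rate (exp (- (r * u)) * (- r) * (s * y u - k * exp (- (l * u)))
         + exp (- (r * u)) * (s * (r * y u - h u) - k * (exp (- (l * u)) * (- l))))) u"
        unfolding f_def using u t
        by (auto intro!: derivative_eq_intros y)
      then have "(f has_rate (exp (- (r * u)) * (K * exp (- (l * u)) - s * h u))) u"
        by (rule DERIV_cong) (simp add: Kk algebra_simps)
      moreover have "exp (- (r * u)) * (K * exp (- (l * u)) - s * h u) \<ge> 0"
        using h[of u] u t s by (auto simp: abs_le_iff)
      ultimately show "\<exists>D\<ge>0. (f has_rate D) u" by blast
    qed
    have "f T \<le> B * exp (- (r * T))" if "t \<le> T" for T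
    proof -
      have "s * y T \<le> B" using bd[of T] that t s by (auto simp: abs_le_iff)
      moreover have "k * exp (- (l * T)) \<ge> 0" using k by simp
      ultimately show ?thesis unfolding f_def mult.commute[of B] by (intro mult_left_mono) auto
    qed
    then have "f t \<le> 0" using mono order_trans by (intro nonpos_of_decaying_bound[OF r(1)]) blast
    then show ?thesis unfolding f_def by (simp add: mult_le_0_iff)
  qed
  show ?thesis using one_side[of 1] one_side[of "-1"] by (auto simp: abs_le_iff k_def)
qed

text \<open>The solution is \<open>exp (r t)\<close> times the integral of \<open>exp (- r s) * h s\<close> over
  \<open>s \<ge> t\<close>, here written as the limit \<open>c\<close> of an antiderivative minus its value at
  \<open>t\<close>.\<close>

lemma bounded_ode_exists:
  fixes h :: "real \<Rightarrow> real"
  assumes h: "continuous_on {0..} h" and bd: "\<And>t. 0 \<le> t \<Longrightarrow> \<bar>h t\<bar> \<le> K" and r: "0 < r"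
  shows "\<exists>y. (\<forall>t\<ge>0. (y has_rate (r * y t - h t)) t) \<and> (\<forall>t\<ge>0. \<bar>y t\<bar> \<le> K / r)"
proof -
  have "continuous_on {0..} (\<lambda>t. exp (- (r * t)) * h t)"
    by (intro continuous_intros h)
  then obtain J where J: "\<And>t. 0 \<le> t \<Longrightarrow> (J has_rate (exp (- (r * t)) * h t)) t"
    using antiderivative_half_line by blast
  have inc: "\<bar>J b - J a\<bar> \<le> K / r * exp (- (r * a))" if ab: "0 \<le> a" "a \<le> b" for a b
  proof -
    have K: "K \<ge> 0" using bd[of 0] by simp
    have "s * (J b - J a) \<le> K / r * exp (- (r * a))" if s: "s = 1 \<or> s = -1" for s :: real
    proof -
      have "s * J b + K / r * exp (- (r * b)) \<le> s * J a + K / r * exp (- (r * a))"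
      proof (rule antimono_half_line[OF _ ab])
        fix t assume t: "a \<le> t"
        have "((\<lambda>t. s * J t + K / r * exp (- (r * t))) has_rate (s * (exp (- (r * t)) * h t) + K / r * (exp (- (r * t)) * (- r)))) t"
          using t ab r by (auto intro!: derivative_eq_intros J)
        moreover have "s * (exp (- (r * t)) * h t) + K / r * (exp (- (r * t)) * (- r)) = exp (- (r * t)) * (s * h t - K)"
          using r by (simp add: field_simps)
        moreover have "exp (- (r * t)) * (s * h t - K) \<le> 0"
          using bd[of t] t ab s by (auto simp: abs_le_iff mult_le_0_iff)
        ultimately show "\<exists>D\<le>0. ((\<lambda>t. s * J t + K / r * exp (- (r * t))) has_rate D) t"
          by metis
      qed
      moreover have "K / r * exp (- (r * b)) \<ge> 0" using K r by simp
      ultimately show ?thesis by (simp add: right_diff_distrib)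
    qed
    from this[of 1] this[of "-1"] show ?thesis by (auto simp: abs_le_iff)
  qed
  have "((\<lambda>n. K / r * exp (- (r * real n))) \<longlongrightarrow> K / r * 0) sequentially"
    by (intro tendsto_mult tendsto_const filterlim_compose[OF exp_decay_tendsto[OF r] filterlim_real_sequentially])
  then have "Cauchy (\<lambda>n. J (real n))"
    by (intro Cauchy_of_tail_bound[where b = "\<lambda>n. K / r * exp (- (r * real n))"])
      (use inc in \<open>simp_all add: dist_real_def abs_minus_commute\<close>)
  then obtain c where c: "(\<lambda>n. J (real n)) \<longlonglongrightarrow> c"
    using Cauchy_convergent convergent_def by blast
  have cJ: "\<bar>c - J t\<bar> \<le> K / r * exp (- (r * t))" if t: "0 \<le> t" for t
  proof -
    have "((\<lambda>n. \<bar>J (real n) - J t\<bar>) \<longlongrightarrow> \<bar>c - J t\<bar>) sequentially"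
      by (intro tendsto_intros c)
    moreover have "eventually (\<lambda>n. \<bar>J (real n) - J t\<bar> \<le> K / r * exp (- (r * t))) sequentially"
      using eventually_ge_at_top[of "nat \<lceil>t\<rceil>"]
    proof eventually_elim
      case (elim n)
      then have "t \<le> real n" by linarith
      then show ?case by (rule inc[OF t])
    qed
    ultimately show ?thesis by (rule tendsto_upperbound) simp
  qed
  define y where "y = (\<lambda>t. exp (r * t) * (c - J t))"
  have "(y has_rate (r * y t - h t)) t" if "0 \<le> t" for t
  proof -
    have "(y has_rate (exp (r * t) * r * (c - J t) + exp (r * t) * (- (exp (- (r * t)) * h t)))) t"
      unfolding y_def using that by (auto intro!: derivative_eq_intros J)
    moreover have "exp (r * t) * r * (c - J t) + exp (r * t) * (- (exp (- (r * t)) * h t)) = r * y t - h t"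
      unfolding y_def by (simp add: algebra_simps exp_minus)
    ultimately show ?thesis by simp
  qed
  moreover have "\<bar>y t\<bar> \<le> K / r" if "0 \<le> t" for t
  proof -
    have "\<bar>y t\<bar> = exp (r * t) * \<bar>c - J t\<bar>" unfolding y_def by (simp add: abs_mult)
    also have "\<dots> \<le> exp (r * t) * (K / r * exp (- (r * t)))" by (intro mult_left_mono cJ that) auto
    also have "\<dots> = K / r" by (simp add: exp_minus)
    finally show ?thesis .
  qed
  ultimately show ?thesis by blast
qed

section \<open>Contraction of oscillation and mass under generators\<close>

definition l1 :: "real ^ 'n::finite \<Rightarrow> real" where
  "l1 v = (\<Sum>x\<in>UNIV. \<bar>v $ x\<bar>)"

definition osc :: "real ^ 'n::finite \<Rightarrow> real" where
  "osc v = Max (range (($) v)) - Min (range (($) v))"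

lemma osc_upper: "v $ x - v $ y \<le> osc v"
  unfolding osc_def by (intro diff_mono) auto

lemma osc_attained: "\<exists>x y. osc v = v $ x - v $ y"
proof -
  have "Max (range (($) v)) \<in> range (($) v)" "Min (range (($) v)) \<in> range (($) v)"
    by (intro Max_in Min_in; simp)+
  then obtain x y where "Max (range (($) v)) = v $ x" "Min (range (($) v)) = v $ y" by blast
  then show ?thesis unfolding osc_def by metis
qed

lemma osc_nonneg: "0 \<le> osc v"
  using osc_upper[of v undefined undefined] by simp

lemma osc_abs: "\<bar>v $ x - v $ y\<bar> \<le> osc v"
  using osc_upper[of v x y] osc_upper[of v y x] by (simp add: abs_le_iff)

lemma osc_least: "(\<And>x y. v $ x - v $ y \<le> B) \<Longrightarrow> osc v \<le> B"
  using osc_attained[of v] by auto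

lemma osc_triangle: "osc (v + w) \<le> osc v + osc w"
proof (rule osc_least)
  fix x y show "(v + w) $ x - (v + w) $ y \<le> osc v + osc w"
    using osc_upper[of v x y] osc_upper[of w x y] by simp
qed

lemma osc_norm: "osc v \<le> 2 * norm v"
proof (rule osc_least)
  fix x y show "v $ x - v $ y \<le> 2 * norm v"
    using component_le_norm_cart[of v x] component_le_norm_cart[of v y] by linarith
qed

lemma l1_nonneg: "0 \<le> l1 v" unfolding l1_def by (simp add: sum_nonneg)

lemma l1_component: "\<bar>v $ x\<bar> \<le> l1 v"
  unfolding l1_def by (rule member_le_sum) auto

lemma l1_triangle: "l1 (v + w) \<le> l1 v + l1 w"
  unfolding l1_def sum.distrib[symmetric] by (intro sum_mono) auto

lemma norm_le_l1: "norm v \<le> l1 v"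
  unfolding l1_def by (rule norm_le_l1_cart)

lemma norm_le_card_bound:
  fixes v :: "real ^ 'n::finite"
  assumes "\<And>x. \<bar>v $ x\<bar> \<le> B"
  shows "norm v \<le> real CARD('n) * B"
  using norm_le_l1[of v] sum_bounded_above[of UNIV "\<lambda>x. \<bar>v $ x\<bar>" B] assms by (simp add: l1_def)

lemma l1_le_norm: "l1 (v :: real ^ 'n) \<le> real CARD('n::finite) * norm v"
  unfolding l1_def using sum_bounded_above[of UNIV "\<lambda>x. \<bar>v $ x\<bar>" "norm v"] component_le_norm_cart[of v] by auto

lemma continuous_on_osc:
  assumes "continuous_on S w" shows "continuous_on S (\<lambda>t. osc (w t))"
proof -
  have le: "osc v - osc u \<le> 2 * dist v u" for v u :: "real ^ 'n"
    using osc_triangle[of u "v - u"] osc_norm[of "v - u"] by (simp add: dist_norm)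
  have "dist (osc v) (osc u) \<le> 2 * dist v u" for v u :: "real ^ 'n"
    using le[of v u] le[of u v] by (simp add: dist_real_def dist_commute abs_le_iff)
  then have "continuous_on UNIV (osc :: real ^ 'n \<Rightarrow> real)"
    by (intro lipschitz_on_continuous_on[of 2] lipschitz_onI) auto
  from continuous_on_compose2[OF this assms] show ?thesis by simp
qed

lemma continuous_on_l1:
  assumes "continuous_on S w" shows "continuous_on S (\<lambda>t. l1 (w t))"
  unfolding l1_def by (intro continuous_intros assms)

text \<open>Against a vector of total mass \<open>0\<close> the constants in \<open>v\<close> are invisible. The
  oscillation is therefore the seminorm dual to the mass norm on differences of probability vectors.\<close>

lemma inner_le_osc_l1:
  fixes v n :: "real ^ 'n::finite"
  assumes "(\<Sum>x\<in>UNIV. n $ x) = 0"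
  shows "\<bar>v \<bullet> n\<bar> \<le> osc v * l1 n"
proof -
  fix x0 :: 'n
  have "v \<bullet> n = (\<Sum>x\<in>UNIV. (v $ x - v $ x0) * n $ x)"
    using assms by (simp add: inner_vec_def left_diff_distrib sum_subtractf flip: sum_distrib_left)
  then have "\<bar>v \<bullet> n\<bar> \<le> (\<Sum>x\<in>UNIV. \<bar>(v $ x - v $ x0) * n $ x\<bar>)"
    by (metis sum_abs)
  also have "\<dots> \<le> (\<Sum>x\<in>UNIV. osc v * \<bar>n $ x\<bar>)"
    unfolding abs_mult by (intro sum_mono mult_right_mono osc_abs) auto
  finally show ?thesis by (simp add: l1_def sum_distrib_left)
qed

definition generator :: "real \<Rightarrow> real \<Rightarrow> ('n \<Rightarrow> 'n \<Rightarrow> real) \<Rightarrow> bool" where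
  "generator al au M \<longleftrightarrow>
     (\<forall>x y. x \<noteq> y \<longrightarrow> al \<le> M x y \<and> M x y \<le> au) \<and> (\<forall>x. (\<Sum>y\<in>UNIV. M x y) = 0)"

lemma generator_diag:
  fixes M :: "'n::finite \<Rightarrow> 'n \<Rightarrow> real"
  assumes "generator al au M"
  shows "M x x + au * real CARD('n) \<ge> au"
proof -
  have "0 = M x x + (\<Sum>y\<in>UNIV - {x}. M x y)"
    using assms by (simp add: generator_def sum.remove[of UNIV x])
  moreover have "(\<Sum>y\<in>UNIV - {x}. M x y) \<le> real (card (UNIV - {x})) * au"
    using assms by (intro sum_bounded_above) (auto simp: generator_def)
  moreover have "real (card (UNIV - {x})) = real CARD('n) - 1"
    by (simp add: card_Diff_singleton of_nat_diff Suc_leI)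
  ultimately show ?thesis by (simp add: algebra_simps)
qed

text \<open>Adding \<open>au * d\<close> on the diagonal (\<open>d\<close> the number of states) and subtracting the
  common part \<open>al\<close> of all entries turns a generator into a nonnegative matrix with row sums
  \<open>(au - al) * d\<close>. The subtracted constant matrix acts trivially on vectors of total mass
  \<open>0\<close> and on differences of components; this is Doeblin's minorisation in continuous time, with
  contraction rate \<open>al * d\<close>.\<close>

definition excess_rate :: "real \<Rightarrow> real \<Rightarrow> ('n::finite \<Rightarrow> 'n \<Rightarrow> real) \<Rightarrow> 'n \<Rightarrow> 'n \<Rightarrow> real" where
  "excess_rate al au M x z = M x z + (if z = x then au * real CARD('n) else 0) - al"

lemma excess_rate_nonneg:
  assumes "generator al au M" "al \<le> au"
  shows "0 \<le> excess_rate al au M x z"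
  using generator_diag[OF assms(1), of x] assms unfolding excess_rate_def generator_def
  by (cases "z = x") (auto simp: algebra_simps)

lemma excess_rate_sum:
  fixes M :: "'n::finite \<Rightarrow> 'n \<Rightarrow> real"
  assumes "generator al au M"
  shows "(\<Sum>z\<in>UNIV. excess_rate al au M x z) = (au - al) * real CARD('n)"
  using assms by (simp add: excess_rate_def generator_def sum_subtractf sum.distrib algebra_simps)

lemma generator_osc_contraction:
  fixes w :: "real ^ 'n::finite"
  assumes "generator al au M" "al \<le> au"
  shows "((\<Sum>z\<in>UNIV. M x z * w $ z) + au * real CARD('n) * w $ x)
       - ((\<Sum>z\<in>UNIV. M y z * w $ z) + au * real CARD('n) * w $ y) \<le> (au - al) * real CARD('n) * osc w"
proof -
  let ?E = "excess_rate al au M"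
  have eq: "(\<Sum>z\<in>UNIV. M x z * w $ z) + au * real CARD('n) * w $ x
      = (\<Sum>z\<in>UNIV. ?E x z * w $ z) + al * (\<Sum>z\<in>UNIV. w $ z)" for x
  proof -
    have "?E x z * w $ z = M x z * w $ z + (if z = x then au * real CARD('n) * w $ z else 0) - al * w $ z" for z
      by (simp add: excess_rate_def algebra_simps)
    then show ?thesis by (simp add: sum_subtractf sum.distrib sum_distrib_left)
  qed
  have "(\<Sum>z\<in>UNIV. ?E x z * w $ z) \<le> (\<Sum>z\<in>UNIV. ?E x z * Max (range (($) w)))"
    by (intro sum_mono mult_left_mono excess_rate_nonneg assms) auto
  moreover have "(\<Sum>z\<in>UNIV. ?E y z * w $ z) \<ge> (\<Sum>z\<in>UNIV. ?E y z * Min (range (($) w)))"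
    by (intro sum_mono mult_left_mono excess_rate_nonneg assms) auto
  ultimately show ?thesis
    unfolding eq osc_def sum_distrib_right[symmetric] excess_rate_sum[OF assms(1)]
    by (simp add: algebra_simps)
qed

lemma generator_l1_contraction:
  fixes n :: "real ^ 'n::finite"
  assumes "generator al au N" "al \<le> au" and n: "(\<Sum>x\<in>UNIV. n $ x) = 0"
  shows "(\<Sum>x\<in>UNIV. \<bar>(\<Sum>y\<in>UNIV. N y x * n $ y) + au * real CARD('n) * n $ x\<bar>) \<le> (au - al) * real CARD('n) * l1 n"
proof -
  let ?E = "excess_rate al au N"
  have eq: "(\<Sum>y\<in>UNIV. N y x * n $ y) + au * real CARD('n) * n $ x
      = (\<Sum>y\<in>UNIV. ?E y x * n $ y)" for x
  proof -
    have "?E y x * n $ y = N y x * n $ y + (if y = x then au * real CARD('n) * n $ y else 0) - al * n $ y" for y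
      by (simp add: excess_rate_def algebra_simps)
    then show ?thesis using n by (simp add: sum_subtractf sum.distrib flip: sum_distrib_left)
  qed
  have "(\<Sum>x\<in>UNIV. \<bar>\<Sum>y\<in>UNIV. ?E y x * n $ y\<bar>) \<le> (\<Sum>x\<in>UNIV. \<Sum>y\<in>UNIV. ?E y x * \<bar>n $ y\<bar>)"
    by (intro sum_mono order.trans[OF sum_abs]) (simp add: abs_mult excess_rate_nonneg[OF assms(1,2)])
  also have "\<dots> = (\<Sum>y\<in>UNIV. (\<Sum>x\<in>UNIV. ?E y x) * \<bar>n $ y\<bar>)"
    by (subst sum.swap) (simp add: sum_distrib_right)
  also have "\<dots> = (au - al) * real CARD('n) * l1 n"
    by (simp add: excess_rate_sum[OF assms(1)] l1_def sum_distrib_left)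
  finally show ?thesis unfolding eq .
qed

lemma half_line_continuous_vec:
  fixes w :: "real \<Rightarrow> real ^ 'n::finite"
  assumes "\<And>t x. 0 \<le> t \<Longrightarrow> \<exists>D. ((\<lambda>s. w s $ x) has_rate D) t"
  shows "continuous_on {0..} w"
proof -
  have "continuous_on {0..} (\<lambda>t. \<chi> x. w t $ x)"
    by (intro continuous_on_vec_lambda half_line_continuous_on assms)
  then show ?thesis by simp
qed

text \<open>The two drifts describe a Kolmogorov forward equation with source \<open>\<psi>\<close> of size
  \<open>b\<close> and a discounted backward equation with source \<open>\<phi>\<close> of size \<open>b\<close>, at
  one instant. The generator is existentially quantified because no regularity in time is asked of it: for the
  difference of two values it is a convex combination of optimal rates, chosen separately at each instant.\<close>

definition forward_drift :: "real \<Rightarrow> real \<Rightarrow> (real \<Rightarrow> real ^ 'n::finite) \<Rightarrow> real \<Rightarrow> real \<Rightarrow> bool" where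
  "forward_drift al au n t b \<longleftrightarrow> (\<exists>N \<psi>. generator al au N \<and> (\<Sum>x\<in>UNIV. \<bar>\<psi> x\<bar>) \<le> b \<and>
     (\<forall>x. ((\<lambda>s. n s $ x) has_rate ((\<Sum>y\<in>UNIV. N y x * n t $ y) + \<psi> x)) t))"

definition backward_drift :: "real \<Rightarrow> real \<Rightarrow> real \<Rightarrow> (real \<Rightarrow> real ^ 'n::finite) \<Rightarrow> real \<Rightarrow> real \<Rightarrow> bool" where
  "backward_drift al au r w t b \<longleftrightarrow> (\<exists>M \<phi>. generator al au M \<and> (\<forall>x. \<bar>\<phi> x\<bar> \<le> b) \<and>
     (\<forall>x. ((\<lambda>s. w s $ x) has_rate (r * w t $ x - (\<Sum>z\<in>UNIV. M x z * w t $ z) - \<phi> x)) t))"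

lemma forward_drift_continuous:
  assumes "\<And>t. 0 \<le> t \<Longrightarrow> forward_drift al au n t (b t)"
  shows "continuous_on {0..} n"
  using assms unfolding forward_drift_def by (intro half_line_continuous_vec) blast

lemma backward_drift_continuous:
  assumes "\<And>t. 0 \<le> t \<Longrightarrow> backward_drift al au r w t (b t)"
  shows "continuous_on {0..} w"
  using assms unfolding backward_drift_def by (intro half_line_continuous_vec) blast

lemma forward_drift_shift:
  assumes "forward_drift al au n (\<tau> + t) b" "0 \<le> \<tau>"
  shows "forward_drift al au (\<lambda>t. n (\<tau> + t)) t b"
  using assms(1) half_line_shift[OF _ assms(2)] unfolding forward_drift_def by blast

lemma backward_drift_shift:
  assumes "backward_drift al au r w (\<tau> + t) b" "0 \<le> \<tau>"
  shows "backward_drift al au r (\<lambda>t. w (\<tau> + t)) t b"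
  using assms(1) half_line_shift[OF _ assms(2)] unfolding backward_drift_def by blast

lemma backward_drift_mono:
  assumes "backward_drift al au r w t b" "b \<le> b'"
  shows "backward_drift al au r w t b'"
  using assms unfolding backward_drift_def by (meson order_trans)

text \<open>The norm \<open>l1 (n t)\<close> decays up to the source, at a rate of \<open>al\<close> times the number
  of states, but it is not differentiable. It is replaced by a differentiable majorant that satisfies the same
  differential inequality, so that it can enter Lyapunov functions.\<close>

lemma forward_majorant:
  fixes n :: "real \<Rightarrow> real ^ 'n::finite"
  assumes al: "al \<le> au" and dn: "\<And>t. 0 \<le> t \<Longrightarrow> forward_drift al au n t (b t)"
    and n0: "\<And>t. 0 \<le> t \<Longrightarrow> (\<Sum>x\<in>UNIV. n t $ x) = 0"
    and b: "continuous_on {0..} b"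
  shows "\<exists>y y'. y 0 = l1 (n 0) \<and> (\<forall>t\<ge>0. l1 (n t) \<le> y t \<and> (y has_rate y' t) t
           \<and> y' t \<le> - (al * real CARD('n)) * y t + b t)"
proof -
  define \<Lambda> where "\<Lambda> = au * real CARD('n)"
  define \<kappa> where "\<kappa> = al * real CARD('n)"
  have \<Lambda>\<kappa>: "(au - al) * real CARD('n) = \<Lambda> - \<kappa>" by (simp add: \<Lambda>_def \<kappa>_def algebra_simps)
  have \<kappa>le: "\<kappa> \<le> \<Lambda>" using al by (simp add: \<Lambda>_def \<kappa>_def mult_right_mono)
  have cn: "continuous_on {0..} n" by (rule forward_drift_continuous[OF dn])
  have "continuous_on {0..} (\<lambda>t. exp (\<Lambda> * t) * ((\<Lambda> - \<kappa>) * l1 (n t) + b t))"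
    by (intro continuous_intros continuous_on_l1 cn b)
  then obtain Q where Q0: "Q 0 = 0"
    and Q: "\<And>t. 0 \<le> t \<Longrightarrow> (Q has_rate (exp (\<Lambda> * t) * ((\<Lambda> - \<kappa>) * l1 (n t) + b t))) t"
    using antiderivative_half_line by blast
  \<comment> \<open>Variation of constants for the equation shifted by \<open>\<Lambda>\<close>;
    \<open>l1 (n t)\<close> itself stays on the right-hand side.\<close>
  define y where "y = (\<lambda>t. exp (- (\<Lambda> * t)) * (l1 (n 0) + Q t))"
  define y' where "y' = (\<lambda>t. - \<Lambda> * y t + ((\<Lambda> - \<kappa>) * l1 (n t) + b t))"
  have bound: "l1 (n t) \<le> y t" if t: "0 \<le> t" for t
  proof -
    \<comment> \<open>The signs are frozen at the final time \<open>t\<close>: the tested quantity \<open>f\<close> is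
      then differentiable and still attains the norm at \<open>t\<close>.\<close>
    define s where "s = (\<lambda>x. sgn (n t $ x))"
    have s1: "\<bar>s x\<bar> \<le> 1" for x by (simp add: s_def abs_sgn_eq)
    define f where "f = (\<lambda>\<tau>. (\<Sum>x\<in>UNIV. s x * (exp (\<Lambda> * \<tau>) * n \<tau> $ x)) - Q \<tau>)"
    have "f t \<le> f 0"
    proof (rule antimono_half_line[OF _ _ t])
      fix \<tau> :: real assume \<tau>: "0 \<le> \<tau>"
      obtain N \<psi> where N: "generator al au N" and \<psi>: "(\<Sum>x\<in>UNIV. \<bar>\<psi> x\<bar>) \<le> b \<tau>"
        and D: "\<And>x. ((\<lambda>s. n s $ x) has_rate ((\<Sum>y\<in>UNIV. N y x * n \<tau> $ y) + \<psi> x)) \<tau>"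
        using dn[OF \<tau>] unfolding forward_drift_def by blast
      let ?g = "\<lambda>x. (\<Sum>y\<in>UNIV. N y x * n \<tau> $ y) + \<Lambda> * n \<tau> $ x + \<psi> x"
      have "(f has_rate ((\<Sum>x\<in>UNIV. s x * (exp (\<Lambda> * \<tau>) * ?g x)) - exp (\<Lambda> * \<tau>) * ((\<Lambda> - \<kappa>) * l1 (n \<tau>) + b \<tau>))) \<tau>"
        unfolding f_def
      proof (rule DERIV_diff[OF DERIV_sum Q[OF \<tau>]])
        fix x
        have "((\<lambda>\<tau>. s x * (exp (\<Lambda> * \<tau>) * n \<tau> $ x)) has_rate s x * (exp (\<Lambda> * \<tau>) * \<Lambda> * n \<tau> $ x + exp (\<Lambda> * \<tau>) * ((\<Sum>y\<in>UNIV. N y x * n \<tau> $ y) + \<psi> x))) \<tau>"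
          by (auto intro!: derivative_eq_intros D)
        then show "((\<lambda>\<tau>. s x * (exp (\<Lambda> * \<tau>) * n \<tau> $ x)) has_rate s x * (exp (\<Lambda> * \<tau>) * ?g x)) \<tau>"
          by (rule DERIV_cong) (simp add: algebra_simps)
      qed
      moreover have "(\<Sum>x\<in>UNIV. s x * (exp (\<Lambda> * \<tau>) * ?g x)) \<le> exp (\<Lambda> * \<tau>) * ((\<Lambda> - \<kappa>) * l1 (n \<tau>) + b \<tau>)"
      proof -
        have "(\<Sum>x\<in>UNIV. s x * (exp (\<Lambda> * \<tau>) * ?g x)) = exp (\<Lambda> * \<tau>) * (\<Sum>x\<in>UNIV. s x * ?g x)"
          by (simp add: sum_distrib_left algebra_simps)
        moreover have "(\<Sum>x\<in>UNIV. s x * ?g x) \<le> (\<Sum>x\<in>UNIV. \<bar>(\<Sum>y\<in>UNIV. N y x * n \<tau> $ y) + \<Lambda> * n \<tau> $ x\<bar> + \<bar>\<psi> x\<bar>)"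
        proof (rule sum_mono)
          fix x
          have "s x * ?g x \<le> \<bar>s x\<bar> * \<bar>?g x\<bar>" by (metis abs_ge_self abs_mult)
          also have "\<dots> \<le> 1 * \<bar>?g x\<bar>" by (intro mult_right_mono s1) auto
          finally show "s x * ?g x \<le> \<bar>(\<Sum>y\<in>UNIV. N y x * n \<tau> $ y) + \<Lambda> * n \<tau> $ x\<bar> + \<bar>\<psi> x\<bar>" by simp
        qed
        moreover have "\<dots> \<le> (\<Lambda> - \<kappa>) * l1 (n \<tau>) + b \<tau>"
          using generator_l1_contraction[OF N al n0[OF \<tau>]] \<psi>
          unfolding sum.distrib \<Lambda>\<kappa> \<Lambda>_def[symmetric] by linarith
        ultimately show ?thesis by (simp add: mult_left_mono)
      qed
      ultimately show "\<exists>D\<le>0. (f has_rate D) \<tau>"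
        by (meson diff_le_0_iff_le)
    qed simp
    moreover have "f 0 \<le> l1 (n 0)"
    proof -
      have "s x * n 0 $ x \<le> \<bar>n 0 $ x\<bar>" for x
      proof -
        have "s x * n 0 $ x \<le> \<bar>s x\<bar> * \<bar>n 0 $ x\<bar>" by (metis abs_ge_self abs_mult)
        also have "\<dots> \<le> 1 * \<bar>n 0 $ x\<bar>" by (intro mult_right_mono s1) auto
        finally show ?thesis by simp
      qed
      then show ?thesis by (simp add: f_def Q0 l1_def sum_mono)
    qed
    moreover have "f t = exp (\<Lambda> * t) * l1 (n t) - Q t"
      by (simp add: f_def s_def l1_def sum_distrib_left sgn_mult_self_eq abs_sgn algebra_simps)
    ultimately have "exp (\<Lambda> * t) * l1 (n t) \<le> l1 (n 0) + Q t" by simp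
    then have "exp (- (\<Lambda> * t)) * (exp (\<Lambda> * t) * l1 (n t)) \<le> y t"
      unfolding y_def by (intro mult_left_mono) auto
    then show ?thesis by (simp flip: mult.assoc exp_add)
  qed
  have der: "(y has_rate y' t) t" if t: "0 \<le> t" for t
  proof -
    have "(y has_rate (exp (- (\<Lambda> * t)) * (- \<Lambda>) * (l1 (n 0) + Q t)
        + exp (- (\<Lambda> * t)) * (exp (\<Lambda> * t) * ((\<Lambda> - \<kappa>) * l1 (n t) + b t)))) t"
      unfolding y_def by (auto intro!: derivative_eq_intros Q t)
    then show ?thesis
      by (rule DERIV_cong) (simp add: y'_def y_def exp_minus algebra_simps)
  qed
  have "y' t \<le> - \<kappa> * y t + b t" if t: "0 \<le> t" for t
  proof -
    have "(\<Lambda> - \<kappa>) * l1 (n t) \<le> (\<Lambda> - \<kappa>) * y t" using bound[OF t] \<kappa>le by (intro mult_left_mono) auto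
    then show ?thesis by (simp add: y'_def algebra_simps)
  qed
  then show ?thesis using bound der Q0 by (intro exI[of _ y] exI[of _ y']) (auto simp: y_def \<kappa>_def)
qed

text \<open>The counterpart for the value: the oscillation contracts when time runs backwards from \<open>T\<close>,
  and the discount helps. The factor \<open>2\<close> arises because an oscillation sees the source at two
  states.\<close>

lemma backward_majorant:
  fixes w :: "real \<Rightarrow> real ^ 'n::finite"
  assumes al: "al \<le> au" and T: "0 \<le> T" and dw: "\<And>t. 0 \<le> t \<Longrightarrow> backward_drift al au r w t (b t)"
    and b: "continuous_on {0..} b"
  shows "\<exists>y y'. y T = osc (w T) \<and> (\<forall>t. 0 \<le> t \<and> t \<le> T \<longrightarrow> osc (w t) \<le> y t \<and> (y has_rate y' t) t
           \<and> y' t \<ge> (al * real CARD('n) + r) * y t - 2 * b t)"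
proof -
  define \<Lambda> where "\<Lambda> = au * real CARD('n)"
  define \<kappa> where "\<kappa> = al * real CARD('n)"
  have \<Lambda>\<kappa>: "(au - al) * real CARD('n) = \<Lambda> - \<kappa>" by (simp add: \<Lambda>_def \<kappa>_def algebra_simps)
  have \<kappa>le: "\<kappa> \<le> \<Lambda>" using al by (simp add: \<Lambda>_def \<kappa>_def mult_right_mono)
  define \<sigma> where "\<sigma> = \<Lambda> + r"
  have cw: "continuous_on {0..} w" by (rule backward_drift_continuous[OF dw])
  let ?q = "\<lambda>t. (\<Lambda> - \<kappa>) * osc (w t) + 2 * b t"
  have "continuous_on {0..} (\<lambda>t. exp (- (\<sigma> * t)) * ?q t)"
    by (intro continuous_intros continuous_on_osc cw b)
  then obtain R where R: "\<And>t. 0 \<le> t \<Longrightarrow> (R has_rate (exp (- (\<sigma> * t)) * ?q t)) t"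
    using antiderivative_half_line by blast
  define y where "y = (\<lambda>t. exp (\<sigma> * t) * (exp (- (\<sigma> * T)) * osc (w T) + R T - R t))"
  define y' where "y' = (\<lambda>t. \<sigma> * y t - ?q t)"
  have bound: "osc (w t) \<le> y t" if t: "0 \<le> t" "t \<le> T" for t
  proof -
    \<comment> \<open>The pair of states is frozen at the time \<open>t\<close> where the bound is sought.\<close>
    obtain x x' where xx: "osc (w t) = w t $ x - w t $ x'" using osc_attained by blast
    define f where "f = (\<lambda>\<tau>. exp (- (\<sigma> * \<tau>)) * (w \<tau> $ x - w \<tau> $ x') + R \<tau>)"
    have "f t \<le> f T"
    proof (rule mono_half_line[OF _ t])
      fix \<tau> :: real assume "t \<le> \<tau>"
      then have \<tau>: "0 \<le> \<tau>" using t by simp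
      obtain M \<phi> where M: "generator al au M" and \<phi>: "\<And>x. \<bar>\<phi> x\<bar> \<le> b \<tau>"
        and D: "\<And>x. ((\<lambda>s. w s $ x) has_rate (r * w \<tau> $ x - (\<Sum>z\<in>UNIV. M x z * w \<tau> $ z) - \<phi> x)) \<tau>"
        using dw[OF \<tau>] unfolding backward_drift_def by blast
      let ?m = "\<lambda>x. (\<Sum>z\<in>UNIV. M x z * w \<tau> $ z) + \<Lambda> * w \<tau> $ x"
      have "(f has_rate (exp (- (\<sigma> * \<tau>)) * (- \<sigma>) * (w \<tau> $ x - w \<tau> $ x')
          + exp (- (\<sigma> * \<tau>)) * ((r * w \<tau> $ x - (\<Sum>z\<in>UNIV. M x z * w \<tau> $ z) - \<phi> x)
             - (r * w \<tau> $ x' - (\<Sum>z\<in>UNIV. M x' z * w \<tau> $ z) - \<phi> x'))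
          + exp (- (\<sigma> * \<tau>)) * ?q \<tau>)) \<tau>"
        unfolding f_def using \<tau> by (auto intro!: derivative_eq_intros D R)
      then have "(f has_rate (exp (- (\<sigma> * \<tau>)) * (?q \<tau> - (?m x - ?m x') - (\<phi> x - \<phi> x')))) \<tau>"
        by (rule DERIV_cong) (simp add: \<sigma>_def algebra_simps)
      moreover have "?m x - ?m x' \<le> (\<Lambda> - \<kappa>) * osc (w \<tau>)"
        using generator_osc_contraction[OF M al] unfolding \<Lambda>\<kappa> \<Lambda>_def[symmetric] .
      then have "exp (- (\<sigma> * \<tau>)) * (?q \<tau> - (?m x - ?m x') - (\<phi> x - \<phi> x')) \<ge> 0"
        using \<phi>[of x] \<phi>[of x'] by (intro mult_nonneg_nonneg) (auto simp: abs_le_iff)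
      ultimately show "\<exists>D\<ge>0. (f has_rate D) \<tau>" by blast
    qed
    also have "f T \<le> exp (- (\<sigma> * T)) * osc (w T) + R T"
      unfolding f_def using osc_upper[of "w T" x x'] by simp
    finally have "exp (- (\<sigma> * t)) * osc (w t) \<le> exp (- (\<sigma> * T)) * osc (w T) + R T - R t"
      by (simp add: f_def xx)
    then have "exp (\<sigma> * t) * (exp (- (\<sigma> * t)) * osc (w t)) \<le> y t"
      unfolding y_def by (intro mult_left_mono) auto
    then show ?thesis by (simp flip: mult.assoc exp_add)
  qed
  have der: "(y has_rate y' t) t" if t: "0 \<le> t" for t
  proof -
    have "(y has_rate (exp (\<sigma> * t) * \<sigma> * (exp (- (\<sigma> * T)) * osc (w T) + R T - R t)
        + exp (\<sigma> * t) * (- (exp (- (\<sigma> * t)) * ?q t)))) t"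
      unfolding y_def by (auto intro!: derivative_eq_intros R t)
    then show ?thesis
      by (rule DERIV_cong) (simp add: y'_def y_def exp_minus algebra_simps)
  qed
  have "y' t \<ge> (\<kappa> + r) * y t - 2 * b t" if t: "0 \<le> t" "t \<le> T" for t
  proof -
    have "(\<Lambda> - \<kappa>) * osc (w t) \<le> (\<Lambda> - \<kappa>) * y t" using bound[OF t] \<kappa>le by (intro mult_left_mono) auto
    then show ?thesis by (simp add: y'_def \<sigma>_def algebra_simps)
  qed
  moreover have "y T = osc (w T)" by (simp add: y_def exp_minus)
  ultimately show ?thesis using bound der by (intro exI[of _ y] exI[of _ y']) (auto simp: \<kappa>_def)
qed

section \<open>Decay of coupled forward-backward pairs\<close>

text \<open>This abstracts what differences of solutions of the mean field game system have in common: a value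
  \<open>w\<close> solving a backward equation, a signed density \<open>n\<close> of mass \<open>0\<close> solving a
  forward one, each driven by the other with strength \<open>L\<close>, and the Lasry--Lions inequality: up to
  discounting, the pairing of \<open>w\<close> and \<open>n\<close> decreases at least as fast as
  \<open>c * osc w ^ 2\<close>. All three relations are perturbed by an error of size
  \<open>\<epsilon> * exp (- l t)\<close>. First differences of equilibria have \<open>\<epsilon> = 0\<close>, second
  differences have an error quadratic in the data, and differences of systems with different sources have
  \<open>l = 0\<close>.\<close>

definition coupled_pair ::
    "real \<Rightarrow> real \<Rightarrow> real \<Rightarrow> real \<Rightarrow> real \<Rightarrow> real \<Rightarrow> real \<Rightarrow> (real \<Rightarrow> real ^ 'n::finite) \<Rightarrow> (real \<Rightarrow> real ^ 'n) \<Rightarrow> bool" where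
  "coupled_pair al au L c r \<epsilon> l w n \<longleftrightarrow>
     (\<exists>B. \<forall>t\<ge>0. \<forall>x. \<bar>w t $ x\<bar> \<le> B \<and> \<bar>n t $ x\<bar> \<le> B) \<and>
     (\<forall>t\<ge>0. (\<Sum>x\<in>UNIV. n t $ x) = 0) \<and>
     (\<forall>t\<ge>0. backward_drift al au r w t (L * l1 (n t) + \<epsilon> * exp (- (l * t)))) \<and>
     (\<forall>t\<ge>0. forward_drift al au n t (L * osc (w t) + \<epsilon> * exp (- (l * t)))) \<and>
     (\<forall>t\<ge>0. \<exists>D. ((\<lambda>s. w s \<bullet> n s) has_rate D) t \<and>
        D \<le> r * (w t \<bullet> n t) - c * (osc (w t))\<^sup>2 + \<epsilon> * exp (- (l * t)) * (l1 (n t) + osc (w t)))"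

lemma coupled_pairD:
  assumes "coupled_pair al au L c r \<epsilon> l w n"
  shows "\<exists>B. \<forall>t\<ge>0. \<forall>x. \<bar>w t $ x\<bar> \<le> B \<and> \<bar>n t $ x\<bar> \<le> B"
    and "0 \<le> t \<Longrightarrow> (\<Sum>x\<in>UNIV. n t $ x) = 0"
    and "0 \<le> t \<Longrightarrow> backward_drift al au r w t (L * l1 (n t) + \<epsilon> * exp (- (l * t)))"
    and "0 \<le> t \<Longrightarrow> forward_drift al au n t (L * osc (w t) + \<epsilon> * exp (- (l * t)))"
    and "0 \<le> t \<Longrightarrow> \<exists>D. ((\<lambda>s. w s \<bullet> n s) has_rate D) t \<and>
        D \<le> r * (w t \<bullet> n t) - c * (osc (w t))\<^sup>2 + \<epsilon> * exp (- (l * t)) * (l1 (n t) + osc (w t))"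
  using assms unfolding coupled_pair_def by simp_all

lemma coupled_pair_shift:
  assumes "coupled_pair al au L c r \<epsilon> l w n" and \<tau>: "0 \<le> \<tau>"
  shows "coupled_pair al au L c r (\<epsilon> * exp (- (l * \<tau>))) l (\<lambda>t. w (\<tau> + t)) (\<lambda>t. n (\<tau> + t))"
proof -
  have e: "\<epsilon> * exp (- (l * \<tau>)) * exp (- (l * t)) = \<epsilon> * exp (- (l * (\<tau> + t)))" for t
    by (simp add: exp_add[symmetric] algebra_simps)
  show ?thesis unfolding coupled_pair_def e
  proof (intro conjI allI impI)
    show "\<exists>B. \<forall>t\<ge>0. \<forall>x. \<bar>w (\<tau> + t) $ x\<bar> \<le> B \<and> \<bar>n (\<tau> + t) $ x\<bar> \<le> B"
      using coupled_pairD(1)[OF assms(1)] \<tau> by (metis add_nonneg_nonneg)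
  next
    fix t :: real assume "0 \<le> t"
    then have t: "0 \<le> \<tau> + t" using \<tau> by simp
    note C = coupled_pairD[OF assms(1)]
    show "(\<Sum>x\<in>UNIV. n (\<tau> + t) $ x) = 0" by (rule C(2)[OF t])
    show "backward_drift al au r (\<lambda>t. w (\<tau> + t)) t (L * l1 (n (\<tau> + t)) + \<epsilon> * exp (- (l * (\<tau> + t))))"
      by (rule backward_drift_shift[OF C(3)[OF t] \<tau>])
    show "forward_drift al au (\<lambda>t. n (\<tau> + t)) t (L * osc (w (\<tau> + t)) + \<epsilon> * exp (- (l * (\<tau> + t))))"
      by (rule forward_drift_shift[OF C(4)[OF t] \<tau>])
    show "\<exists>D. ((\<lambda>s. w (\<tau> + s) \<bullet> n (\<tau> + s)) has_rate D) t \<and>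
        D \<le> r * (w (\<tau> + t) \<bullet> n (\<tau> + t)) - c * (osc (w (\<tau> + t)))\<^sup>2
          + \<epsilon> * exp (- (l * (\<tau> + t))) * (l1 (n (\<tau> + t)) + osc (w (\<tau> + t)))"
      using C(5)[OF t] half_line_shift[of "\<lambda>s. w s \<bullet> n s" _ \<tau> t, OF _ \<tau>] by blast
  qed
qed

lemma generator_apply_bound:
  fixes w :: "real ^ 'n::finite"
  assumes "generator al au M" "0 \<le> al"
  shows "\<bar>\<Sum>z\<in>UNIV. M x z * w $ z\<bar> \<le> au * real CARD('n) * osc w"
proof -
  have "(\<Sum>z\<in>UNIV. M x z * w $ z) = (\<Sum>z\<in>UNIV. M x z * (w $ z - w $ x))"
    using assms by (simp add: generator_def right_diff_distrib sum_subtractf flip: sum_distrib_right)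
  then have "\<bar>\<Sum>z\<in>UNIV. M x z * w $ z\<bar> \<le> (\<Sum>z\<in>UNIV. \<bar>M x z * (w $ z - w $ x)\<bar>)"
    by (metis sum_abs)
  also have "\<dots> \<le> (\<Sum>z\<in>(UNIV::'n set). au * osc w)"
  proof (rule sum_mono)
    fix z
    show "\<bar>M x z * (w $ z - w $ x)\<bar> \<le> au * osc w"
    proof (cases "z = x")
      case True
      have "0 \<le> au * osc w"
      proof (cases "\<exists>y. y \<noteq> x")
        case True
        then show ?thesis using assms osc_nonneg[of w] unfolding generator_def
          by (metis mult_nonneg_nonneg order_trans)
      next
        case False
        obtain u v where "osc w = w $ u - w $ v" using osc_attained[of w] by blast
        moreover have "u = v" using False by metis
        ultimately have "osc w = 0" by simp
        then show ?thesis by simp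
      qed
      then show ?thesis using True by simp
    next
      case False
      then have "al \<le> M x z" "M x z \<le> au" using assms(1) by (auto simp: generator_def)
      then have "\<bar>M x z\<bar> \<le> au" using assms(2) by simp
      then show ?thesis unfolding abs_mult by (intro mult_mono osc_abs) auto
    qed
  qed
  finally show ?thesis by (simp add: algebra_simps)
qed

lemma young: "0 < a \<Longrightarrow> x * y \<le> a * x\<^sup>2 + y\<^sup>2 / (4 * a)" for a x y :: real
proof -
  assume a: "0 < a"
  have "0 \<le> (2 * a * x - y)\<^sup>2 / (4 * a)" using a by simp
  also have "\<dots> = a * x\<^sup>2 + y\<^sup>2 / (4 * a) - x * y" using a by (simp add: power2_eq_square field_simps)
  finally show ?thesis by simp
qed

text \<open>The constants are chosen backwards through the estimates. \<open>\<delta>\<close> is such that a quarter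
  of the dissipation \<open>c * osc w ^ 2\<close> absorbs the action of the value on the density in
  \<open>\<delta> * l1 n ^ 2\<close>; \<open>\<delta>'\<close> is such that a quarter of the resulting damping
  \<open>\<delta> * \<kappa> * l1 n ^ 2\<close> absorbs the action of the density on the value in
  \<open>\<delta>' * osc w ^ 2\<close>; and \<open>r0\<close> is such that the discount term in the pairing is
  absorbed by half of that damping. \<open>c5\<close> is the resulting exponential rate; the other constants bookkeep
  the errors.\<close>

locale coupling_constants =
  fixes al au L c :: real and n_type :: "'n::finite itself"
  assumes al: "0 < al" and au: "al \<le> au" and L: "0 < L" and c: "0 < c"
begin

definition "\<kappa> = al * real CARD('n)"
definition "\<delta> = c * \<kappa> / (8 * L\<^sup>2)"
definition "\<delta>' = \<delta> * \<kappa>\<^sup>2 / (16 * L\<^sup>2)"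
definition "C1 = 1 / (\<delta> * \<kappa>) + 1 / c + 2 * \<delta> / \<kappa> + 4 * \<delta>' / \<kappa>"
definition "C2 = (2 / \<delta>') * (\<delta> + 1 / (2 * \<delta>'))"
definition "C3 = 2 * C1 / \<delta>'"
definition "C4 = 1 / (\<delta> * \<kappa>) + 1 / c + 4 * \<delta> / \<kappa>"
definition "C5 = (C2 + 1) / 2 + 2 * \<delta>"
definition "c5 = \<delta> * \<kappa> / (2 * C5)"
definition "r0 = min 1 (\<delta> * \<kappa> / (C2 + 1))"

lemma constants_pos: "0 < \<kappa>" "0 < \<delta>" "0 < \<delta>'" "0 < C1" "0 < C2" "0 < C3" "0 < C4" "0 < C5" "0 < c5" "0 < r0"
proof -
  show k: "0 < \<kappa>" using al by (simp add: \<kappa>_def)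
  show d: "0 < \<delta>" using k c L by (simp add: \<delta>_def)
  show d': "0 < \<delta>'" using k d L by (simp add: \<delta>'_def)
  show C1: "0 < C1" using k d d' c by (auto simp: C1_def intro!: add_pos_pos)
  show C2: "0 < C2" using d d' unfolding C2_def by (intro mult_pos_pos add_pos_pos divide_pos_pos) auto
  show "0 < C3" using C1 d' by (simp add: C3_def)
  show "0 < C4" using k d c by (auto simp: C4_def intro!: add_pos_pos)
  show C5: "0 < C5" using C2 d by (auto simp: C5_def intro!: add_pos_pos)
  show "0 < c5" using k d C5 by (simp add: c5_def)
  show "0 < r0" using k d C2 by (simp add: r0_def)
qed

text \<open>\<open>m\<close> stands for the forward majorant and \<open>o1\<close> for the oscillation of the value;
  \<open>\<delta>\<close> is chosen so that exactly \<open>c / 4\<close> remains in front of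
  \<open>o1 ^ 2\<close>.\<close>

lemma forward_young:
  assumes m': "m' \<le> - \<kappa> * m + L * o1 + e" and "0 \<le> m"
  shows "2 * (\<delta> * m * m') \<le> - (\<delta> * \<kappa> * m\<^sup>2) + (c * o1\<^sup>2) / 4 + (2 * \<delta> / \<kappa>) * e\<^sup>2"
proof -
  note p = constants_pos
  have "m * m' \<le> m * (- \<kappa> * m + L * o1 + e)" using assms by (intro mult_left_mono) auto
  also have "\<dots> = - \<kappa> * m\<^sup>2 + m * (L * o1) + m * e" by (simp add: algebra_simps power2_eq_square)
  also have "\<dots> \<le> - \<kappa> * m\<^sup>2 + (\<kappa> / 4 * m\<^sup>2 + (L * o1)\<^sup>2 / (4 * (\<kappa> / 4))) + (\<kappa> / 4 * m\<^sup>2 + e\<^sup>2 / (4 * (\<kappa> / 4)))"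
    using young[of "\<kappa> / 4" m "L * o1"] young[of "\<kappa> / 4" m e] p(1) by linarith
  also have "\<dots> = - (\<kappa> / 2) * m\<^sup>2 + L\<^sup>2 / \<kappa> * o1\<^sup>2 + e\<^sup>2 / \<kappa>" by (simp add: power_mult_distrib)
  finally have "2 * \<delta> * (m * m') \<le> 2 * \<delta> * (- (\<kappa> / 2) * m\<^sup>2 + L\<^sup>2 / \<kappa> * o1\<^sup>2 + e\<^sup>2 / \<kappa>)"
    using p(2) by (intro mult_left_mono) auto
  also have "\<dots> = - \<delta> * \<kappa> * m\<^sup>2 + (2 * \<delta> * L\<^sup>2 / \<kappa>) * o1\<^sup>2 + 2 * \<delta> / \<kappa> * e\<^sup>2"
    by (simp add: algebra_simps)
  also have "2 * \<delta> * L\<^sup>2 / \<kappa> = c / 4" using p(1) L by (simp add: \<delta>_def)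
  finally show ?thesis by (simp add: algebra_simps)
qed

text \<open>\<open>o2\<close> stands for the backward majorant; \<open>\<delta>'\<close> is chosen so that exactly
  \<open>\<delta> * \<kappa> / 4\<close> remains in front of \<open>m ^ 2\<close>.\<close>

lemma backward_young:
  assumes o': "o' \<ge> (\<kappa> + r) * o2 - 2 * (L * m + e)" and "0 \<le> o2" "0 < r"
  shows "- 2 * (\<delta>' * o2 * o') \<le> - (\<delta>' * r * o2\<^sup>2) + (\<delta> * \<kappa> * m\<^sup>2) / 4 + (4 * \<delta>' / \<kappa>) * e\<^sup>2"
proof -
  note p = constants_pos
  have "o2 * ((\<kappa> + r) * o2 - 2 * (L * m + e)) \<le> o2 * o'" using assms by (intro mult_left_mono) auto
  then have "- (o2 * o') \<le> - (\<kappa> + r) * o2\<^sup>2 + o2 * (2 * L * m) + o2 * (2 * e)"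
    by (simp add: algebra_simps power2_eq_square)
  also have "\<dots> \<le> - (\<kappa> + r) * o2\<^sup>2 + (\<kappa> / 2 * o2\<^sup>2 + (2 * L * m)\<^sup>2 / (4 * (\<kappa> / 2))) + (\<kappa> / 2 * o2\<^sup>2 + (2 * e)\<^sup>2 / (4 * (\<kappa> / 2)))"
    using young[of "\<kappa> / 2" o2 "2 * L * m"] young[of "\<kappa> / 2" o2 "2 * e"] p(1) by linarith
  also have "\<dots> = - r * o2\<^sup>2 + 2 * L\<^sup>2 / \<kappa> * m\<^sup>2 + 2 * e\<^sup>2 / \<kappa>" using p(1)
    by (simp add: power_mult_distrib field_simps)
  finally have "2 * \<delta>' * (- (o2 * o')) \<le> 2 * \<delta>' * (- r * o2\<^sup>2 + 2 * L\<^sup>2 / \<kappa> * m\<^sup>2 + 2 * e\<^sup>2 / \<kappa>)"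
    using p(3) by (intro mult_left_mono) auto
  also have "\<dots> = - 2 * \<delta>' * r * o2\<^sup>2 + (4 * \<delta>' * L\<^sup>2 / \<kappa>) * m\<^sup>2 + 4 * \<delta>' / \<kappa> * e\<^sup>2"
    by (simp add: algebra_simps)
  also have "4 * \<delta>' * L\<^sup>2 / \<kappa> = \<delta> * \<kappa> / 4" using p(1) L by (simp add: \<delta>'_def power2_eq_square)
  finally have "- 2 * (\<delta>' * o2 * o') \<le> - 2 * (\<delta>' * r * o2\<^sup>2) + (\<delta> * \<kappa> * m\<^sup>2) / 4 + (4 * \<delta>' / \<kappa>) * e\<^sup>2" by (simp add: mult.assoc)
  moreover have "0 \<le> \<delta>' * r * o2\<^sup>2" using p(3) assms by simp
  ultimately show ?thesis by linarith
qed

lemma source_young: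
  assumes "0 \<le> e" "l \<le> m"
  shows "e * (l + o1) \<le> (\<delta> * \<kappa> * m\<^sup>2) / 4 + (c * o1\<^sup>2) / 4 + (1 / (\<delta> * \<kappa>) + 1 / c) * e\<^sup>2"
proof -
  note p = constants_pos
  have "e * (l + o1) \<le> m * e + o1 * e" using mult_left_mono[OF assms(2,1)] by (simp add: algebra_simps)
  also have "\<dots> \<le> (\<delta> * \<kappa> / 4 * m\<^sup>2 + e\<^sup>2 / (4 * (\<delta> * \<kappa> / 4))) + (c / 4 * o1\<^sup>2 + e\<^sup>2 / (4 * (c / 4)))"
    using young[of "\<delta> * \<kappa> / 4" m e] young[of "c / 4" o1 e] p c by (intro add_mono) auto
  also have "\<dots> = (\<delta> * \<kappa> * m\<^sup>2) / 4 + (c * o1\<^sup>2) / 4 + (1 / (\<delta> * \<kappa>) + 1 / c) * e\<^sup>2"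
    by (simp add: algebra_simps)
  finally show ?thesis .
qed

lemma coupled_pair_density_majorant:
  fixes w n :: "real \<Rightarrow> real ^ 'n"
  assumes cp: "coupled_pair al au L c r \<epsilon> l w n"
  shows "\<exists>m m'. m 0 = l1 (n 0) \<and> (\<forall>t\<ge>0. l1 (n t) \<le> m t \<and> (m has_rate m' t) t
           \<and> m' t \<le> - \<kappa> * m t + (L * osc (w t) + \<epsilon> * exp (- (l * t))))"
  unfolding \<kappa>_def
proof (rule forward_majorant[OF au coupled_pairD(4)[OF cp] coupled_pairD(2)[OF cp]])
  show "continuous_on {0..} (\<lambda>t. L * osc (w t) + \<epsilon> * exp (- (l * t)))"
    by (intro continuous_intros continuous_on_osc backward_drift_continuous[OF coupled_pairD(3)[OF cp]])
qed

text \<open>A bound for the value at time \<open>0\<close> in terms of the density at time \<open>0\<close>, uniform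
  in \<open>r\<close>. It rests on the Lyapunov function \<open>Z\<close>: the pairing plus a multiple of the squared
  mass norm, minus a multiple of the squared oscillation. The signs are those for which forward damping and backward
  damping both help, and the dissipation of the pairing pays for the cross terms.\<close>

lemma initial_estimate:
  fixes w n :: "real \<Rightarrow> real ^ 'n"
  assumes cp: "coupled_pair al au L c r \<epsilon> l w n" and r: "0 < r" and l: "0 \<le> l" and \<epsilon>: "0 \<le> \<epsilon>"
  shows "\<delta>' * (osc (w 0))\<^sup>2 \<le> w 0 \<bullet> n 0 + \<delta> * (l1 (n 0))\<^sup>2 + C1 * \<epsilon>\<^sup>2 / (r + 2 * l)"
proof -
  note p = constants_pos
  define e where "e = (\<lambda>t. \<epsilon> * exp (- (l * t)))"
  have e0: "0 \<le> e t" for t using \<epsilon> by (simp add: e_def)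
  obtain B where B: "\<And>t x. 0 \<le> t \<Longrightarrow> \<bar>w t $ x\<bar> \<le> B \<and> \<bar>n t $ x\<bar> \<le> B"
    using coupled_pairD(1)[OF cp] by blast
  note n0 = coupled_pairD(2)[OF cp] and dw = coupled_pairD(3)[OF cp] and dX = coupled_pairD(5)[OF cp]
  have ce: "continuous_on {0..} e" unfolding e_def by (intro continuous_intros)
  obtain m m' where "m 0 = l1 (n 0) \<and> (\<forall>t\<ge>0. l1 (n t) \<le> m t \<and> (m has_rate m' t) t
           \<and> m' t \<le> - \<kappa> * m t + (L * osc (w t) + \<epsilon> * exp (- (l * t))))"
    using coupled_pair_density_majorant[OF cp] by (elim exE)
  then have m0: "m 0 = l1 (n 0)" and nm: "\<And>t. 0 \<le> t \<Longrightarrow> l1 (n t) \<le> m t"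
    and dm: "\<And>t. 0 \<le> t \<Longrightarrow> (m has_rate m' t) t"
    and m': "\<And>t. 0 \<le> t \<Longrightarrow> m' t \<le> - \<kappa> * m t + (L * osc (w t) + e t)"
    by (simp_all add: e_def)
  have mpos: "0 \<le> m t" if "0 \<le> t" for t using nm[OF that] l1_nonneg[of "n t"] by linarith
  have cm: "continuous_on {0..} m" using dm by (intro half_line_continuous_on) blast
  define CB where "CB = 2 * B * (real CARD('n) * B) + \<delta>' * (2 * B)\<^sup>2"
  have main: "- CB * exp (- (r * T)) \<le> w 0 \<bullet> n 0 + \<delta> * (l1 (n 0))\<^sup>2 - \<delta>' * (osc (w 0))\<^sup>2 + C1 * \<epsilon>\<^sup>2 / (r + 2 * l)"
    if T: "0 \<le> T" for T
  proof -
    \<comment> \<open>The Lyapunov function sees the density only through its differentiable majorant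
      \<open>m\<close>.\<close>
    have dw': "backward_drift al au r w t (L * m t + e t)" if t: "0 \<le> t" for t
      using dw[OF t] mult_left_mono[OF nm[OF t], of L] L by (intro backward_drift_mono[OF dw[OF t]]) (auto simp: e_def)
    have cb: "continuous_on {0..} (\<lambda>t. L * m t + e t)" by (intro continuous_intros cm ce)
    obtain q q' where "q T = osc (w T) \<and> (\<forall>t. 0 \<le> t \<and> t \<le> T \<longrightarrow> osc (w t) \<le> q t \<and> (q has_rate q' t) t
           \<and> q' t \<ge> (al * real CARD('n) + r) * q t - 2 * (L * m t + e t))"
      by (rule exE[OF backward_majorant[OF au T dw' cb]], assumption, erule exE, rule that)
    then have qT: "q T = osc (w T)" and wq: "\<And>t. 0 \<le> t \<Longrightarrow> t \<le> T \<Longrightarrow> osc (w t) \<le> q t"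
      and dq: "\<And>t. 0 \<le> t \<Longrightarrow> t \<le> T \<Longrightarrow> (q has_rate q' t) t"
      and q': "\<And>t. 0 \<le> t \<Longrightarrow> t \<le> T \<Longrightarrow> q' t \<ge> (\<kappa> + r) * q t - 2 * (L * m t + e t)"
      by (simp_all add: \<kappa>_def)
    \<comment> \<open>The derivative of the last summand cancels the error terms.\<close>
    define Z where "Z = (\<lambda>t. exp (- (r * t)) * (w t \<bullet> n t + \<delta> * (m t)\<^sup>2 - \<delta>' * (q t)\<^sup>2)
        + C1 * \<epsilon>\<^sup>2 / (r + 2 * l) * exp (- ((r + 2 * l) * t)))"
    have "Z T \<le> Z 0"
    proof (rule antimono_half_line[OF _ _ T])
      fix t :: real assume t: "0 \<le> t" "t \<le> T"
      obtain D where D: "((\<lambda>s. w s \<bullet> n s) has_rate D) t"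
        and Dle: "D \<le> r * (w t \<bullet> n t) - c * (osc (w t))\<^sup>2 + e t * (l1 (n t) + osc (w t))"
        using dX[OF t(1)] unfolding e_def by blast
      have ee: "\<epsilon>\<^sup>2 * exp (- ((r + 2 * l) * t)) = exp (- (r * t)) * (e t)\<^sup>2"
        by (simp add: e_def power_mult_distrib power2_eq_square exp_add[symmetric] algebra_simps)
      have dE: "((\<lambda>t. exp (- (k * t))) has_rate (- k * exp (- (k * t)))) t" for k
        by (auto intro!: derivative_eq_intros)
      have dm2: "((\<lambda>t. (m t)\<^sup>2) has_rate (2 * m t * m' t)) t"
        using DERIV_power[OF dm[OF t(1)], of 2] by (simp add: mult.commute mult.left_commute)
      have dq2: "((\<lambda>t. (q t)\<^sup>2) has_rate (2 * q t * q' t)) t"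
        using DERIV_power[OF dq[OF t], of 2] by (simp add: mult.commute mult.left_commute)
      let ?X = "D - r * (w t \<bullet> n t) - r * (\<delta> * (m t)\<^sup>2) + \<delta>' * r * (q t)\<^sup>2
              + 2 * (\<delta> * m t * m' t) - 2 * (\<delta>' * q t * q' t) - C1 * (e t)\<^sup>2"
      have "C1 * \<epsilon>\<^sup>2 / (r + 2 * l) * (- (r + 2 * l) * exp (- ((r + 2 * l) * t))) = - C1 * (\<epsilon>\<^sup>2 * exp (- ((r + 2 * l) * t)))"
        using r l by (simp add: field_simps)
      then have c1: "C1 * \<epsilon>\<^sup>2 / (r + 2 * l) * (- (r + 2 * l) * exp (- ((r + 2 * l) * t))) = - C1 * (exp (- (r * t)) * (e t)\<^sup>2)"
        unfolding ee .
      have "(Z has_rate (exp (- (r * t)) * ?X)) t"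
        unfolding Z_def
        by (rule DERIV_cong[OF DERIV_add[OF DERIV_mult[OF dE DERIV_diff[OF DERIV_add[OF D DERIV_cmult[OF dm2]]
              DERIV_cmult[OF dq2]]] DERIV_cmult[OF dE]]], unfold c1) (simp add: algebra_simps)
      moreover have "D - r * (w t \<bullet> n t) - r * (\<delta> * (m t)\<^sup>2) + \<delta>' * r * (q t)\<^sup>2
              + 2 * (\<delta> * m t * m' t) - 2 * (\<delta>' * q t * q' t) - C1 * (e t)\<^sup>2 \<le> 0"
      proof -
        have qpos: "0 \<le> q t" using wq[OF t] osc_nonneg[of "w t"] by linarith
        have m'': "m' t \<le> - \<kappa> * m t + L * osc (w t) + e t" using m'[OF t(1)] by simp
        have C1e: "C1 * (e t)\<^sup>2 = (1 / (\<delta> * \<kappa>) + 1 / c) * (e t)\<^sup>2 + (2 * \<delta> / \<kappa>) * (e t)\<^sup>2 + (4 * \<delta>' / \<kappa>) * (e t)\<^sup>2"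
          unfolding C1_def by (simp add: algebra_simps)
        have "0 \<le> r * (\<delta> * (m t)\<^sup>2)" "0 \<le> c * (osc (w t))\<^sup>2" "0 \<le> \<delta> * \<kappa> * (m t)\<^sup>2" using r p c by simp_all
        moreover note forward_young[OF m'' mpos[OF t(1)]] backward_young[OF q'[OF t] qpos r]
            source_young[OF e0 nm[OF t(1)], of t "osc (w t)"] Dle C1e
        ultimately show ?thesis by linarith
      qed
      then have "exp (- (r * t)) * ?X \<le> 0" by (intro mult_nonneg_nonpos) auto
      ultimately show "\<exists>D\<le>0. (Z has_rate D) t" by blast
    qed simp
    moreover have "Z T \<ge> - CB * exp (- (r * T))"
    proof -
      have oB: "osc (w T) \<le> 2 * B"
      proof (rule osc_least)
        fix x y show "w T $ x - w T $ y \<le> 2 * B" using B[OF T, of x] B[OF T, of y] by (auto simp: abs_le_iff)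
      qed
      have lB: "l1 (n T) \<le> real CARD('n) * B" unfolding l1_def
        using sum_bounded_above[of UNIV "\<lambda>x. \<bar>n T $ x\<bar>" B] B[OF T] by simp
      have "\<bar>w T \<bullet> n T\<bar> \<le> osc (w T) * l1 (n T)" by (rule inner_le_osc_l1[OF n0[OF T]])
      also have "\<dots> \<le> 2 * B * (real CARD('n) * B)"
        using oB lB osc_nonneg[of "w T"] by (intro mult_mono l1_nonneg) auto
      finally have "w T \<bullet> n T \<ge> - (2 * B * (real CARD('n) * B))" by linarith
      moreover have "\<delta>' * (q T)\<^sup>2 \<le> \<delta>' * (2 * B)\<^sup>2"
        unfolding qT using p oB by (intro mult_left_mono power_mono osc_nonneg) auto
      moreover have "0 \<le> \<delta> * (m T)\<^sup>2" using p by simp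
      ultimately have "- CB \<le> w T \<bullet> n T + \<delta> * (m T)\<^sup>2 - \<delta>' * (q T)\<^sup>2" unfolding CB_def by linarith
      then have "- CB * exp (- (r * T)) \<le> exp (- (r * T)) * (w T \<bullet> n T + \<delta> * (m T)\<^sup>2 - \<delta>' * (q T)\<^sup>2)"
        by (subst mult.commute) (intro mult_left_mono, auto)
      moreover have "0 \<le> C1 * \<epsilon>\<^sup>2 / (r + 2 * l) * exp (- ((r + 2 * l) * T))"
        using p r l by (intro mult_nonneg_nonneg divide_nonneg_nonneg) auto
      ultimately show ?thesis unfolding Z_def by linarith
    qed
    moreover have "Z 0 \<le> w 0 \<bullet> n 0 + \<delta> * (l1 (n 0))\<^sup>2 - \<delta>' * (osc (w 0))\<^sup>2 + C1 * \<epsilon>\<^sup>2 / (r + 2 * l)"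
      using mult_left_mono[OF power_mono[OF wq[of 0] osc_nonneg], of \<delta>' 2] T p(3)
      by (simp add: Z_def m0)
    ultimately show ?thesis by linarith
  qed
  have "- (w 0 \<bullet> n 0 + \<delta> * (l1 (n 0))\<^sup>2 - \<delta>' * (osc (w 0))\<^sup>2 + C1 * \<epsilon>\<^sup>2 / (r + 2 * l)) \<le> CB * exp (- (r * T))"
    if "0 \<le> T" for T using main[OF that] by simp
  then have "- (w 0 \<bullet> n 0 + \<delta> * (l1 (n 0))\<^sup>2 - \<delta>' * (osc (w 0))\<^sup>2 + C1 * \<epsilon>\<^sup>2 / (r + 2 * l)) \<le> 0"
    by (rule nonpos_of_decaying_bound[OF r])
  then show ?thesis by linarith
qed

end

context coupling_constants
begin

text \<open>The estimate at time \<open>0\<close> is applied to the pair restarted at \<open>t\<close>. Since the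
  pairing is at most \<open>osc w * l1 n\<close>, the oscillation is controlled by the mass norm at the same time, and
  the pairing cannot be very negative.\<close>

lemma pointwise_estimates:
  fixes w n :: "real \<Rightarrow> real ^ 'n"
  assumes cp: "coupled_pair al au L c r \<epsilon> l w n" and r: "0 < r" and l: "0 \<le> l" and \<epsilon>: "0 \<le> \<epsilon>"
    and N: "1 / (r + 2 * l) \<le> N" and t: "0 \<le> t"
  shows "(osc (w t))\<^sup>2 \<le> C2 * (l1 (n t))\<^sup>2 + C3 * N * (\<epsilon> * exp (- (l * t)))\<^sup>2" (is ?o)
    and "w t \<bullet> n t \<ge> - (\<delta> * (l1 (n t))\<^sup>2) - C1 * N * (\<epsilon> * exp (- (l * t)))\<^sup>2" (is ?X)
proof -
  note p = constants_pos
  define e where "e = \<epsilon> * exp (- (l * t))"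
  have "\<delta>' * (osc (w (t + 0)))\<^sup>2 \<le> w (t + 0) \<bullet> n (t + 0) + \<delta> * (l1 (n (t + 0)))\<^sup>2 + C1 * e\<^sup>2 / (r + 2 * l)"
    unfolding e_def by (rule initial_estimate[OF coupled_pair_shift[OF cp t] r l]) (use \<epsilon> in simp)
  moreover have "C1 * e\<^sup>2 / (r + 2 * l) \<le> C1 * N * e\<^sup>2"
    using mult_left_mono[OF N, of "C1 * e\<^sup>2"] p by (simp add: mult_ac)
  ultimately have main: "\<delta>' * (osc (w t))\<^sup>2 \<le> w t \<bullet> n t + \<delta> * (l1 (n t))\<^sup>2 + C1 * N * e\<^sup>2" by simp
  moreover have "0 \<le> \<delta>' * (osc (w t))\<^sup>2" using p by simp
  ultimately show ?X unfolding e_def by linarith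
  have "w t \<bullet> n t \<le> osc (w t) * l1 (n t)"
    using inner_le_osc_l1[OF coupled_pairD(2)[OF cp t], of "w t"] by (simp add: abs_le_iff)
  also have "\<dots> \<le> \<delta>' / 2 * (osc (w t))\<^sup>2 + (l1 (n t))\<^sup>2 / (4 * (\<delta>' / 2))"
    using p by (intro young) auto
  finally have "\<delta>' / 2 * (osc (w t))\<^sup>2 \<le> (\<delta> + 1 / (2 * \<delta>')) * (l1 (n t))\<^sup>2 + C1 * N * e\<^sup>2"
    using main by (simp add: algebra_simps)
  then have "2 / \<delta>' * (\<delta>' / 2 * (osc (w t))\<^sup>2) \<le> 2 / \<delta>' * ((\<delta> + 1 / (2 * \<delta>')) * (l1 (n t))\<^sup>2 + C1 * N * e\<^sup>2)"
    using p by (intro mult_left_mono) auto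
  also have "\<dots> = C2 * (l1 (n t))\<^sup>2 + C3 * N * e\<^sup>2"
    unfolding C2_def C3_def using p by (simp add: field_simps)
  finally show ?o using p unfolding e_def by simp
qed

text \<open>In the following \<open>N\<close> is a bound for \<open>1 / (r + 2 l)\<close>, the only way in which the
  discount enters.\<close>

definition "K5 N = C4 + C3 * N + c5 * (C3 * N)"
definition "A5 N = C5 + C3 * N + 2 * K5 N / c5 + C1 * N"

text \<open>By the pointwise estimates, \<open>W\<close>, the pairing plus \<open>2 \<delta>\<close> times the squared
  mass, is comparable to the squared mass up to the error. Its derivative is bounded by a negative multiple of the
  squared mass plus the error, because the dissipation pays for the cross terms and \<open>r < r0\<close> keeps the
  discount term small. Hence \<open>W\<close> decays at the rate \<open>c5\<close> until it has the size of the
  squared error, which decays more slowly.\<close>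

lemma density_decay:
  fixes w n :: "real \<Rightarrow> real ^ 'n"
  assumes cp: "coupled_pair al au L c r \<epsilon> l w n" and r: "0 < r" "r < r0" and l: "0 \<le> l" "l \<le> c5 / 4" and \<epsilon>: "0 \<le> \<epsilon>"
    and N: "1 / (r + 2 * l) \<le> N" and t: "0 \<le> t"
  shows "\<delta> * (l1 (n t))\<^sup>2 \<le> A5 N * (exp (- (l * t)) * (l1 (n 0) + \<epsilon>))\<^sup>2"
proof -
  note p = constants_pos
  have "0 < 1 / (r + 2 * l)" using r l by (intro divide_pos_pos) auto
  then have N0: "0 < N" using N by linarith
  have K5: "0 < K5 N" unfolding K5_def using p N0 by (intro add_pos_pos mult_pos_pos) auto
  define e where "e = (\<lambda>t. \<epsilon> * exp (- (l * t)))"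
  have e0: "0 \<le> e t" for t using \<epsilon> by (simp add: e_def)
  note n0 = coupled_pairD(2)[OF cp] and dX = coupled_pairD(5)[OF cp]
  obtain m m' where "m 0 = l1 (n 0) \<and> (\<forall>t\<ge>0. l1 (n t) \<le> m t \<and> (m has_rate m' t) t
           \<and> m' t \<le> - \<kappa> * m t + (L * osc (w t) + \<epsilon> * exp (- (l * t))))"
    using coupled_pair_density_majorant[OF cp] by (elim exE)
  then have m0: "m 0 = l1 (n 0)" and nm: "\<And>t. 0 \<le> t \<Longrightarrow> l1 (n t) \<le> m t"
    and dm: "\<And>t. 0 \<le> t \<Longrightarrow> (m has_rate m' t) t"
    and m': "\<And>t. 0 \<le> t \<Longrightarrow> m' t \<le> - \<kappa> * m t + (L * osc (w t) + e t)"
    by (simp_all add: e_def)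
  have mpos: "0 \<le> m t" if "0 \<le> t" for t using nm[OF that] l1_nonneg[of "n t"] by linarith
  have nm2: "(l1 (n t))\<^sup>2 \<le> (m t)\<^sup>2" if "0 \<le> t" for t
    using nm[OF that] l1_nonneg by (intro power_mono) auto
  have osc2: "(osc (w t))\<^sup>2 \<le> C2 * (m t)\<^sup>2 + C3 * N * (e t)\<^sup>2" if "0 \<le> t" for t
    using pointwise_estimates(1)[OF cp r(1) l(1) \<epsilon> N that] mult_left_mono[OF nm2[OF that], of C2] p
    unfolding e_def by linarith
  have Xup: "w t \<bullet> n t \<le> (C2 + 1) / 2 * (m t)\<^sup>2 + C3 * N * (e t)\<^sup>2 / 2" if "0 \<le> t" for t
  proof -
    have "w t \<bullet> n t \<le> osc (w t) * l1 (n t)"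
      using inner_le_osc_l1[OF n0[OF that], of "w t"] by (simp add: abs_le_iff)
    also have "\<dots> \<le> (osc (w t))\<^sup>2 / 2 + (l1 (n t))\<^sup>2 / 2"
      using young[of "1/2" "osc (w t)" "l1 (n t)"] by simp
    finally show ?thesis using osc2[OF that] nm2[OF that] by (simp add: algebra_simps add_divide_distrib)
  qed
  have Xlow: "w t \<bullet> n t \<ge> - (\<delta> * (m t)\<^sup>2) - C1 * N * (e t)\<^sup>2" if "0 \<le> t" for t
    using pointwise_estimates(2)[OF cp r(1) l(1) \<epsilon> N that] mult_left_mono[OF nm2[OF that], of \<delta>] p
    unfolding e_def by linarith
  define W where "W = (\<lambda>t. w t \<bullet> n t + 2 * \<delta> * (m t)\<^sup>2)"
  have Wup: "W t \<le> C5 * (m t)\<^sup>2 + C3 * N * (e t)\<^sup>2" if "0 \<le> t" for t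
  proof -
    have "0 \<le> C3 * N * (e t)\<^sup>2" using p N0 by simp
    then show ?thesis using Xup[OF that] unfolding W_def C5_def by (simp add: algebra_simps)
  qed
  have Wlow: "W t \<ge> \<delta> * (m t)\<^sup>2 - C1 * N * (e t)\<^sup>2" if "0 \<le> t" for t
    using Xlow[OF that] unfolding W_def by (simp add: algebra_simps)
  have dW: "\<exists>D. (W has_rate D) t \<and> D \<le> - c5 * W t + K5 N * (e t)\<^sup>2" if t: "0 \<le> t" for t
  proof -
    obtain D where D: "((\<lambda>s. w s \<bullet> n s) has_rate D) t"
      and Dle: "D \<le> r * (w t \<bullet> n t) - c * (osc (w t))\<^sup>2 + e t * (l1 (n t) + osc (w t))"
      using dX[OF t] unfolding e_def by blast
    have dm2: "((\<lambda>t. (m t)\<^sup>2) has_rate (2 * m t * m' t)) t"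
      using DERIV_power[OF dm[OF t], of 2] by (simp add: mult.commute mult.left_commute)
    have der: "(W has_rate (D + 2 * \<delta> * (2 * m t * m' t))) t"
      unfolding W_def by (rule DERIV_add[OF D DERIV_cmult[OF dm2]])
    have m'': "m' t \<le> - \<kappa> * m t + L * osc (w t) + e t" using m'[OF t] by simp
    have rX: "r * (w t \<bullet> n t) \<le> (\<delta> * \<kappa> * (m t)\<^sup>2) / 2 + C3 * N * (e t)\<^sup>2"
    proof -
      have a: "r * ((C2 + 1) / 2) \<le> \<delta> * \<kappa> / 2" and b: "r \<le> 1"
        using r(2) p unfolding r0_def by (auto simp: field_simps)
      have "r * (w t \<bullet> n t) \<le> r * ((C2 + 1) / 2 * (m t)\<^sup>2 + C3 * N * (e t)\<^sup>2 / 2)"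
        using r Xup[OF t] by (intro mult_left_mono) auto
      also have "\<dots> = r * ((C2 + 1) / 2) * (m t)\<^sup>2 + r * (C3 * N * (e t)\<^sup>2 / 2)" by (simp add: algebra_simps)
      also have "\<dots> \<le> \<delta> * \<kappa> / 2 * (m t)\<^sup>2 + 2 * (C3 * N * (e t)\<^sup>2 / 2)"
        using a b p N0 by (intro add_mono mult_right_mono) auto
      finally show ?thesis by simp
    qed
    have C4e: "C4 * (e t)\<^sup>2 = (1 / (\<delta> * \<kappa>) + 1 / c) * (e t)\<^sup>2 + 2 * ((2 * \<delta> / \<kappa>) * (e t)\<^sup>2)"
      unfolding C4_def by (simp add: algebra_simps)
    have m2: "0 \<le> \<delta> * \<kappa> * (m t)\<^sup>2" "0 \<le> c * (osc (w t))\<^sup>2" using p c by simp_all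
    note forward_young[OF m'' mpos[OF t]] source_young[OF e0 nm[OF t], of t "osc (w t)"]
    then have "D + 2 * \<delta> * (2 * m t * m' t) \<le> - (\<delta> * \<kappa> * (m t)\<^sup>2) / 2 + C4 * (e t)\<^sup>2 + C3 * N * (e t)\<^sup>2"
      using rX Dle C4e m2 by linarith
    also have "- (\<delta> * \<kappa> * (m t)\<^sup>2) / 2 = - c5 * (C5 * (m t)\<^sup>2)" using p by (simp add: c5_def)
    also have "\<dots> \<le> - c5 * (W t - C3 * N * (e t)\<^sup>2)"
      using mult_left_mono[OF Wup[OF t], of c5] p by (simp add: algebra_simps)
    finally have "D + 2 * \<delta> * (2 * m t * m' t) \<le> - c5 * W t + K5 N * (e t)\<^sup>2"
      by (simp add: K5_def algebra_simps)
    with der show ?thesis by blast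
  qed
  \<comment> \<open>Subtracting a multiple of the squared error turns the perturbed inequality for \<open>W\<close>
    into plain monotonicity; this is where \<open>4 l \<le> c5\<close> is used.\<close>
  define V where "V = (\<lambda>t. exp (c5 * t) * (W t - (2 * K5 N / c5) * (\<epsilon>\<^sup>2 * exp (- (2 * l * t)))))"
  have e2: "(e t)\<^sup>2 = \<epsilon>\<^sup>2 * exp (- (2 * l * t))" for t
    by (simp add: e_def power_mult_distrib power2_eq_square exp_add[symmetric] algebra_simps)
  have "V t \<le> V 0"
  proof (rule antimono_half_line[OF _ _ t])
    fix s :: real assume s: "0 \<le> s"
    obtain D where D: "(W has_rate D) s" "D \<le> - c5 * W s + K5 N * (e s)\<^sup>2"
      using dW[OF s] by blast
    have dE: "((\<lambda>t. exp (k * t)) has_rate (k * exp (k * s))) s" for k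
      by (auto intro!: derivative_eq_intros)
    have d2: "((\<lambda>t. (2 * K5 N / c5) * (\<epsilon>\<^sup>2 * exp (- (2 * l * t)))) has_rate ((2 * K5 N / c5) * (\<epsilon>\<^sup>2 * (- (2 * l) * exp (- (2 * l * s)))))) s"
    proof (intro DERIV_cmult)
      show "((\<lambda>t. exp (- (2 * l * t))) has_rate (- (2 * l) * exp (- (2 * l * s)))) s"
        by (auto intro!: derivative_eq_intros)
    qed
    have "(V has_rate (exp (c5 * s) * (c5 * W s + D - 2 * K5 N * (e s)\<^sup>2 + (4 * l / c5) * (K5 N * (e s)\<^sup>2)))) s"
      unfolding V_def
      by (rule DERIV_cong[OF DERIV_mult[OF dE DERIV_diff[OF D(1) d2]]]) (use p in \<open>simp add: e2 field_simps\<close>)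
    moreover have "(4 * l / c5) * (K5 N * (e s)\<^sup>2) \<le> 1 * (K5 N * (e s)\<^sup>2)"
      using l p K5 by (intro mult_right_mono) (auto simp: field_simps)
    then have "c5 * W s + D - 2 * K5 N * (e s)\<^sup>2 + (4 * l / c5) * (K5 N * (e s)\<^sup>2) \<le> 0"
      using D(2) by linarith
    then have "exp (c5 * s) * (c5 * W s + D - 2 * K5 N * (e s)\<^sup>2 + (4 * l / c5) * (K5 N * (e s)\<^sup>2)) \<le> 0"
      by (intro mult_nonneg_nonpos) auto
    ultimately show "\<exists>D\<le>0. (V has_rate D) s" by blast
  qed simp
  also have "V 0 \<le> C5 * (l1 (n 0))\<^sup>2 + C3 * N * \<epsilon>\<^sup>2"
  proof -
    have "0 \<le> (2 * K5 N / c5) * \<epsilon>\<^sup>2" using K5 p by simp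
    moreover have "W 0 \<le> C5 * (l1 (n 0))\<^sup>2 + C3 * N * \<epsilon>\<^sup>2" using Wup[of 0] by (simp add: m0 e_def)
    ultimately show ?thesis unfolding V_def by simp
  qed
  finally have "exp (- (c5 * t)) * V t \<le> exp (- (c5 * t)) * (C5 * (l1 (n 0))\<^sup>2 + C3 * N * \<epsilon>\<^sup>2)"
    by (intro mult_left_mono) auto
  also have "\<dots> \<le> exp (- (2 * l * t)) * (C5 * (l1 (n 0))\<^sup>2 + C3 * N * \<epsilon>\<^sup>2)"
  proof (rule mult_right_mono)
    have "2 * l * t \<le> c5 * t" using l p t by (intro mult_right_mono) auto
    then show "exp (- (c5 * t)) \<le> exp (- (2 * l * t))" by simp
    show "0 \<le> C5 * (l1 (n 0))\<^sup>2 + C3 * N * \<epsilon>\<^sup>2" using p N0 by simp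
  qed
  also have "exp (- (c5 * t)) * V t = W t - (2 * K5 N / c5) * (e t)\<^sup>2"
    unfolding V_def e2 by (simp flip: mult.assoc exp_add)
  finally have "\<delta> * (m t)\<^sup>2 \<le> exp (- (2 * l * t)) * (C5 * (l1 (n 0))\<^sup>2 + C3 * N * \<epsilon>\<^sup>2)
      + (2 * K5 N / c5) * (e t)\<^sup>2 + C1 * N * (e t)\<^sup>2"
    using Wlow[OF t] by linarith
  also have "\<dots> = exp (- (2 * l * t)) * (C5 * (l1 (n 0))\<^sup>2 + (C3 * N + 2 * K5 N / c5 + C1 * N) * \<epsilon>\<^sup>2)"
    unfolding e2 by (simp add: algebra_simps)
  also have "\<dots> \<le> exp (- (2 * l * t)) * (A5 N * (l1 (n 0) + \<epsilon>)\<^sup>2)"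
  proof (rule mult_left_mono)
    define k where "k = C3 * N + 2 * K5 N / c5 + C1 * N"
    have k: "0 \<le> k" unfolding k_def using p N0 K5 by (intro add_nonneg_nonneg mult_nonneg_nonneg divide_nonneg_nonneg) auto
    have A: "A5 N = C5 + k" by (simp add: A5_def k_def)
    have "(l1 (n 0))\<^sup>2 \<le> (l1 (n 0) + \<epsilon>)\<^sup>2" "\<epsilon>\<^sup>2 \<le> (l1 (n 0) + \<epsilon>)\<^sup>2"
      using l1_nonneg[of "n 0"] \<epsilon> by (intro power_mono; simp)+
    then have "C5 * (l1 (n 0))\<^sup>2 + k * \<epsilon>\<^sup>2 \<le> C5 * (l1 (n 0) + \<epsilon>)\<^sup>2 + k * (l1 (n 0) + \<epsilon>)\<^sup>2"
      using k p by (intro add_mono mult_left_mono) auto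
    then show "C5 * (l1 (n 0))\<^sup>2 + (C3 * N + 2 * K5 N / c5 + C1 * N) * \<epsilon>\<^sup>2 \<le> A5 N * (l1 (n 0) + \<epsilon>)\<^sup>2"
      unfolding A k_def[symmetric] by (simp add: algebra_simps)
  qed simp
  also have "\<dots> = A5 N * (exp (- (l * t)) * (l1 (n 0) + \<epsilon>))\<^sup>2"
    by (simp add: power_mult_distrib power2_eq_square exp_add[symmetric] algebra_simps)
  finally show ?thesis using mult_left_mono[OF nm2[OF t], of \<delta>] p by linarith
qed

text \<open>The square roots of the constants for the mass norm and for the oscillation.\<close>

definition "M6 N = sqrt (A5 N / \<delta>)"
definition "O6 N = sqrt (C2 * (M6 N)\<^sup>2 + C3 * N)"
definition "decay_constant \<rho> = M6 (1/\<rho>) + O6 (1/\<rho>) + (au * real CARD('n) * O6 (1/\<rho>) + L * M6 (1/\<rho>) + 1) / \<rho>"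

text \<open>The main quantitative result. The components of \<open>w\<close>, not only its oscillation, are bounded
  because they solve a discounted equation with a decaying right-hand side. \<open>\<rho>\<close> is any lower bound
  of \<open>r + l\<close>: the choice \<open>\<rho> = r\<close>, \<open>l = 0\<close> is good enough for existence at
  a fixed discount, and \<open>\<rho> = l > 0\<close> gives constants that do not depend on the discount.\<close>

theorem coupled_pair_decay:
  fixes w n :: "real \<Rightarrow> real ^ 'n"
  assumes cp: "coupled_pair al au L c r \<epsilon> l w n" and r: "0 < r" "r < r0" and l: "0 \<le> l" "l \<le> c5 / 4" and \<epsilon>: "0 \<le> \<epsilon>"
    and \<rho>: "0 < \<rho>" "\<rho> \<le> r + l" and t: "0 \<le> t"
  shows "l1 (n t) \<le> decay_constant \<rho> * (exp (- (l * t)) * (l1 (n 0) + \<epsilon>))"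
    and "osc (w t) \<le> decay_constant \<rho> * (exp (- (l * t)) * (l1 (n 0) + \<epsilon>))"
    and "\<bar>w t $ x\<bar> \<le> decay_constant \<rho> * (exp (- (l * t)) * (l1 (n 0) + \<epsilon>))"
    and "0 \<le> decay_constant \<rho>"
proof -
  note p = constants_pos
  define N where "N = 1 / \<rho>"
  have N0: "0 < N" using \<rho> by (simp add: N_def)
  have N: "1 / (r + 2 * l) \<le> N" unfolding N_def using \<rho> r l by (intro divide_left_mono) auto
  have A5: "0 < A5 N" unfolding A5_def K5_def using p N0
    by (intro add_pos_pos mult_pos_pos divide_pos_pos) auto
  have M6: "0 \<le> M6 N" using A5 p by (simp add: M6_def)
  have O6: "0 \<le> O6 N" using p N0 by (simp add: O6_def)
  define g where "g = (\<lambda>t. exp (- (l * t)) * (l1 (n 0) + \<epsilon>))"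
  have g: "0 \<le> g t" for t using l1_nonneg[of "n 0"] \<epsilon> by (simp add: g_def)
  have e: "\<epsilon> * exp (- (l * t)) \<le> g t" for t
    using l1_nonneg[of "n 0"] by (simp add: g_def algebra_simps)
  have m: "l1 (n t) \<le> M6 N * g t" if t: "0 \<le> t" for t
  proof (rule power2_le_imp_le)
    have "(l1 (n t))\<^sup>2 \<le> A5 N / \<delta> * (g t)\<^sup>2"
      using density_decay[OF cp r l \<epsilon> N t] p by (simp add: g_def field_simps)
    then show "(l1 (n t))\<^sup>2 \<le> (M6 N * g t)\<^sup>2" using A5 p by (simp add: power_mult_distrib M6_def)
  qed (use M6 g in simp)
  have o: "osc (w t) \<le> O6 N * g t" if t: "0 \<le> t" for t
  proof (rule power2_le_imp_le)
    have "(osc (w t))\<^sup>2 \<le> C2 * (l1 (n t))\<^sup>2 + C3 * N * (\<epsilon> * exp (- (l * t)))\<^sup>2"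
      by (rule pointwise_estimates(1)[OF cp r(1) l(1) \<epsilon> N t])
    also have "\<dots> \<le> C2 * (M6 N * g t)\<^sup>2 + C3 * N * (g t)\<^sup>2"
      using p N0 e m[OF t] l1_nonneg \<epsilon> by (intro add_mono mult_left_mono power_mono) auto
    also have "\<dots> = (O6 N * g t)\<^sup>2" using p N0 by (simp add: O6_def power_mult_distrib algebra_simps)
    finally show "(osc (w t))\<^sup>2 \<le> (O6 N * g t)\<^sup>2" .
  qed (use O6 g in simp)
  define Q where "Q = au * real CARD('n) * O6 N + L * M6 N + 1"
  have Q0: "0 \<le> Q" using O6 M6 al au L by (simp add: Q_def)
  \<comment> \<open>A generator annihilates constants, so it acts on \<open>w\<close> with a strength proportional to
    the oscillation.\<close>
  have wx: "\<bar>w t $ x\<bar> \<le> Q / \<rho> * g t"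
  proof -
    obtain B where B: "\<And>t x. 0 \<le> t \<Longrightarrow> \<bar>w t $ x\<bar> \<le> B"
      using coupled_pairD(1)[OF cp] by blast
    have "\<exists>h. ((\<lambda>s. w s $ x) has_rate (r * w t $ x - h)) t \<and> \<bar>h\<bar> \<le> Q * g t"
      if t: "0 \<le> t" for t
    proof -
      obtain M \<phi> where M: "generator al au M" and \<phi>: "\<And>x. \<bar>\<phi> x\<bar> \<le> L * l1 (n t) + \<epsilon> * exp (- (l * t))"
        and D: "\<And>x. ((\<lambda>s. w s $ x) has_rate (r * w t $ x - (\<Sum>z\<in>UNIV. M x z * w t $ z) - \<phi> x)) t"
        using coupled_pairD(3)[OF cp t] unfolding backward_drift_def by blast
      have "\<bar>(\<Sum>z\<in>UNIV. M x z * w t $ z) + \<phi> x\<bar> \<le> au * real CARD('n) * osc (w t) + (L * l1 (n t) + \<epsilon> * exp (- (l * t)))"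
        using generator_apply_bound[OF M, of x "w t"] \<phi>[of x] al by linarith
      also have "\<dots> \<le> au * real CARD('n) * (O6 N * g t) + (L * (M6 N * g t) + g t)"
        using o[OF t] m[OF t] e L al au by (intro add_mono mult_left_mono) auto
      also have "\<dots> = Q * g t" by (simp add: Q_def algebra_simps)
      finally show ?thesis using D[of x] by (intro exI[of _ "(\<Sum>z\<in>UNIV. M x z * w t $ z) + \<phi> x"]) (simp add: algebra_simps)
    qed
    then obtain h where h: "\<And>t. 0 \<le> t \<Longrightarrow> ((\<lambda>s. w s $ x) has_rate (r * w t $ x - h t)) t"
      and hb: "\<And>t. 0 \<le> t \<Longrightarrow> \<bar>h t\<bar> \<le> Q * g t" by metis
    have "\<bar>w t $ x\<bar> \<le> (Q * (l1 (n 0) + \<epsilon>)) * exp (- (l * t)) / (r + l)"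
    proof (rule bounded_ode_decay[OF h _ _ r(1) l(1) t])
      show "\<bar>h s\<bar> \<le> Q * (l1 (n 0) + \<epsilon>) * exp (- (l * s))" if "0 \<le> s" for s
        using hb[OF that] by (simp add: g_def mult_ac)
    qed (use B in auto)
    also have "\<dots> = Q * g t / (r + l)" by (simp add: g_def mult_ac)
    also have "\<dots> \<le> Q * g t / \<rho>" using Q0 g \<rho> r l by (intro divide_left_mono) auto
    finally show ?thesis by simp
  qed
  have K: "decay_constant \<rho> = M6 N + O6 N + Q / \<rho>" by (simp add: decay_constant_def N_def Q_def)
  have QR: "0 \<le> Q / \<rho>" using Q0 \<rho> by simp
  have "M6 N * g t \<le> decay_constant \<rho> * g t" "O6 N * g t \<le> decay_constant \<rho> * g t" "Q / \<rho> * g t \<le> decay_constant \<rho> * g t"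
    unfolding K using g[of t] M6 O6 QR by (intro mult_right_mono; simp)+
  then show "l1 (n t) \<le> decay_constant \<rho> * (exp (- (l * t)) * (l1 (n 0) + \<epsilon>))"
    "osc (w t) \<le> decay_constant \<rho> * (exp (- (l * t)) * (l1 (n 0) + \<epsilon>))"
    "\<bar>w t $ x\<bar> \<le> decay_constant \<rho> * (exp (- (l * t)) * (l1 (n 0) + \<epsilon>))"
    using m[OF t] o[OF t] wx unfolding g_def by linarith+
  show "0 \<le> decay_constant \<rho>" unfolding K using M6 O6 QR by simp
qed

end

section \<open>Differential calculus on the simplex\<close>

lemma simplex_nonneg: "\<eta> \<in> prob_simplex \<Longrightarrow> 0 \<le> \<eta> $ x"
  by (simp add: prob_simplex_def)

lemma simplex_sum: "\<eta> \<in> prob_simplex \<Longrightarrow> (\<Sum>x\<in>UNIV. \<eta> $ x) = 1"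
  by (simp add: prob_simplex_def)

lemma simplex_le1: "\<eta> \<in> prob_simplex \<Longrightarrow> \<eta> $ x \<le> 1"
  using member_le_sum[of x UNIV "($) \<eta>"] by (simp add: prob_simplex_def)

lemma simplex_l1: "\<eta> \<in> prob_simplex \<Longrightarrow> l1 \<eta> = 1"
  by (simp add: l1_def prob_simplex_def)

lemma simplex_norm: "\<eta> \<in> prob_simplex \<Longrightarrow> norm \<eta> \<le> 1"
  using norm_le_l1[of \<eta>] simplex_l1[of \<eta>] by simp

lemma vertex_in_simplex: "axis x 1 \<in> prob_simplex"
  by (simp add: prob_simplex_def axis_def)

lemma convex_simplex: "convex (prob_simplex :: (real ^ 'n::finite) set)"
proof (rule convexI)
  fix x y :: "real ^ 'n" and u v :: real
  assume a: "x \<in> prob_simplex" "y \<in> prob_simplex" "0 \<le> u" "0 \<le> v" "u + v = 1"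
  have "(\<Sum>i\<in>UNIV. (u *\<^sub>R x + v *\<^sub>R y) $ i) = u * (\<Sum>i\<in>UNIV. x $ i) + v * (\<Sum>i\<in>UNIV. y $ i)"
    by (simp add: sum.distrib sum_distrib_left)
  also have "\<dots> = 1" using a by (simp add: simplex_sum)
  finally show "u *\<^sub>R x + v *\<^sub>R y \<in> prob_simplex"
    using a by (simp add: prob_simplex_def)
qed

lemma closed_simplex: "closed (prob_simplex :: (real ^ 'n::finite) set)"
proof -
  have "prob_simplex = (\<Inter>x. {\<eta> :: real ^ 'n. 0 \<le> \<eta> $ x}) \<inter> {\<eta>. (\<Sum>x\<in>UNIV. \<eta> $ x) = 1}"
    by (auto simp: prob_simplex_def)
  moreover have "closed {\<eta> :: real ^ 'n. 0 \<le> \<eta> $ x}" for x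
    by (intro closed_Collect_le continuous_intros)
  moreover have "closed {\<eta> :: real ^ 'n. (\<Sum>x\<in>UNIV. \<eta> $ x) = 1}"
    by (intro closed_Collect_eq continuous_intros)
  ultimately show ?thesis by (metis closed_INT closed_Int)
qed

lemma compact_simplex: "compact (prob_simplex :: (real ^ 'n::finite) set)"
  unfolding compact_eq_bounded_closed
  using closed_simplex simplex_norm by (auto simp: bounded_iff)

lemma transfer_nth: "transfer y z $ v = (if v = z then 1 else 0) - (if v = y then 1 else 0)"
  by (simp add: transfer_def axis_def)

lemma transfer_same [simp]: "transfer y y = 0"
  by (simp add: transfer_def)

lemma transfer_swap: "transfer z y = - transfer y z"
  by (simp add: transfer_def)

lemma move_in_simplex:
  assumes "\<eta> \<in> prob_simplex" "0 \<le> h" "h \<le> \<eta> $ y"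
  shows "\<eta> + h *\<^sub>R transfer y z \<in> prob_simplex"
proof -
  have "0 \<le> (\<eta> + h *\<^sub>R transfer y z) $ x" for x
    using assms simplex_nonneg[OF assms(1), of x] by (cases "y = z") (auto simp: transfer_nth)
  moreover have "(\<Sum>x\<in>UNIV. h * transfer y z $ x) = 0"
    by (simp add: transfer_nth sum_subtractf flip: sum_distrib_left)
  then have "(\<Sum>x\<in>UNIV. (\<eta> + h *\<^sub>R transfer y z) $ x) = 1"
    using simplex_sum[OF assms(1)] by (simp add: sum.distrib)
  ultimately show ?thesis by (simp add: prob_simplex_def)
qed

lemma stays_in_simplex_iff:
  assumes "\<eta> \<in> prob_simplex"
  shows "stays_in_simplex y z \<eta> \<longleftrightarrow> y = z \<or> 0 < \<eta> $ y"
proof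
  assume s: "stays_in_simplex y z \<eta>"
  show "y = z \<or> 0 < \<eta> $ y"
  proof (rule ccontr)
    assume "\<not> (y = z \<or> 0 < \<eta> $ y)"
    then have y: "y \<noteq> z" "\<eta> $ y \<le> 0" by auto
    have "eventually (\<lambda>h::real. 0 < h) (at_right 0)" by (rule eventually_at_right_less)
    with s have "eventually (\<lambda>h::real. False) (at_right 0)"
      unfolding stays_in_simplex_def
    proof eventually_elim
      case (elim h)
      then have "0 \<le> (\<eta> + h *\<^sub>R transfer y z) $ y" by (intro simplex_nonneg)
      then show ?case using y elim by (simp add: transfer_nth)
    qed
    then show False by simp
  qed
next
  assume "y = z \<or> 0 < \<eta> $ y"
  then show "stays_in_simplex y z \<eta>"
  proof
    assume "y = z" then show ?thesis using assms by (simp add: stays_in_simplex_def)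
  next
    assume y: "0 < \<eta> $ y"
    then have "eventually (\<lambda>h. h \<in> {0<..<\<eta> $ y}) (at_right 0)" by (rule eventually_at_right_real)
    then show ?thesis unfolding stays_in_simplex_def
    proof eventually_elim
      case (elim h)
      then show ?case by (intro move_in_simplex[OF assms]) auto
    qed
  qed
qed

text \<open>From a relative interior point the segment from a vertex can be prolonged beyond it, which would make a
  vanishing component negative.\<close>

lemma rel_interior_simplex_pos:
  assumes "\<eta> \<in> rel_interior prob_simplex"
  shows "0 < \<eta> $ x"
proof (rule ccontr)
  assume "\<not> 0 < \<eta> $ x"
  have \<eta>: "\<eta> \<in> prob_simplex" using assms rel_interior_subset by blast
  with \<open>\<not> 0 < \<eta> $ x\<close> have 0: "\<eta> $ x = 0" using simplex_nonneg[of \<eta> x] by simp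
  obtain e where e: "e > 1" "(1 - e) *\<^sub>R axis x 1 + e *\<^sub>R \<eta> \<in> prob_simplex"
    using convex_rel_interior_if[OF convex_simplex assms, rule_format, OF hull_inc[OF vertex_in_simplex[of x]]]
    by blast
  have "0 \<le> ((1 - e) *\<^sub>R axis x 1 + e *\<^sub>R \<eta>) $ x" by (rule simplex_nonneg[OF e(2)])
  then show False using e(1) 0 by simp
qed

text \<open>The limits that define derivatives at boundary points are taken along a nontrivial filter, so they are
  unique.\<close>

lemma simplex_limit_of_interior:
  assumes "\<eta> \<in> prob_simplex" "\<eta> $ x = 0"
  shows "at \<eta> within rel_interior prob_simplex \<noteq> bot"
proof -
  have "\<eta> \<notin> rel_interior prob_simplex" using rel_interior_simplex_pos[of \<eta> x] assms(2) by auto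
  moreover have "\<eta> \<in> closure (rel_interior prob_simplex)"
    using convex_closure_rel_interior[OF convex_simplex] assms(1) closure_subset by blast
  ultimately have "\<eta> islimpt rel_interior prob_simplex" by (simp add: closure_def)
  then show ?thesis by (simp add: trivial_limit_within)
qed

lemma has_simplex_deriv_unique:
  assumes "\<eta> \<in> prob_simplex" "has_simplex_deriv K y z \<eta> D" "has_simplex_deriv K y z \<eta> E"
  shows "D = E"
proof (cases "stays_in_simplex y z \<eta>")
  case True
  then have "(diff_quotient K y z \<eta> \<longlongrightarrow> D) (at_right 0)" "(diff_quotient K y z \<eta> \<longlongrightarrow> E) (at_right 0)"
    using assms(2,3) by (simp_all add: has_simplex_deriv_def)
  then show ?thesis by (rule tendsto_unique[OF trivial_limit_at_right_real])
next
  case False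
  then have "\<eta> $ y = 0" using stays_in_simplex_iff[OF assms(1)] simplex_nonneg[OF assms(1), of y] by fastforce
  from simplex_limit_of_interior[OF assms(1) this] show ?thesis
  proof (rule tendsto_unique)
    show "((\<lambda>\<theta>. Lim (at_right 0) (diff_quotient K y z \<theta>)) \<longlongrightarrow> D) (at \<eta> within rel_interior prob_simplex)"
      using False assms(2) by (simp add: has_simplex_deriv_def)
    show "((\<lambda>\<theta>. Lim (at_right 0) (diff_quotient K y z \<theta>)) \<longlongrightarrow> E) (at \<eta> within rel_interior prob_simplex)"
      using False assms(3) by (simp add: has_simplex_deriv_def)
  qed
qed

lemma simplex_deriv_eq:
  assumes "\<eta> \<in> prob_simplex" "has_simplex_deriv K y z \<eta> D"
  shows "simplex_deriv K y z \<eta> = D"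
  unfolding simplex_deriv_def
  by (rule the_equality[where P = "has_simplex_deriv K y z \<eta>", OF assms(2)]) (rule has_simplex_deriv_unique[OF assms(1) _ assms(2)])

text \<open>An ordinary derivative relative to the simplex, represented by a vector that is determined up to adding a
  constant to all components. Its existence is equivalent to \<open>simplex_C1\<close> by
  \<open>simplex_C1_of_gradient\<close> and \<open>gradient_of_simplex_C1\<close>, and the chain rule and Taylor
  estimates apply to it.\<close>

definition simplex_gradient :: "(real ^ 'n::finite \<Rightarrow> real) \<Rightarrow> (real ^ 'n \<Rightarrow> real ^ 'n) \<Rightarrow> bool" where
  "simplex_gradient K G \<longleftrightarrow> continuous_on prob_simplex G \<and>
     (\<forall>\<eta>\<in>prob_simplex. (K has_derivative (\<lambda>v. G \<eta> \<bullet> v)) (at \<eta> within prob_simplex))"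

lemma one_sided_deriv_of_gradient:
  assumes K: "(K has_derivative (\<lambda>v. g \<bullet> v)) (at \<eta> within prob_simplex)"
    and \<eta>: "\<eta> \<in> prob_simplex" and y: "0 < \<eta> $ y \<or> y = z"
  shows "(diff_quotient K y z \<eta> \<longlongrightarrow> g \<bullet> transfer y z) (at_right 0)"
proof (cases "y = z")
  case True
  then show ?thesis by (simp add: diff_quotient_def[abs_def])
next
  case False
  let ?I = "{0<..<\<eta> $ y}"
  let ?p = "\<lambda>h. \<eta> + h *\<^sub>R transfer y z"
  have yp: "0 < \<eta> $ y" using False y by simp
  have p: "(?p has_derivative (\<lambda>h. h *\<^sub>R transfer y z)) (at 0 within ?I)"
    by (auto intro!: derivative_eq_intros)
  have sub: "?p ` ?I \<subseteq> prob_simplex" using \<eta> by (auto intro!: move_in_simplex)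
  have "(K has_derivative (\<lambda>v. g \<bullet> v)) (at (?p 0) within ?p ` ?I)"
    using has_derivative_subset[OF K sub] by simp
  from has_derivative_in_compose[OF p this]
  have "((\<lambda>h. K (?p h)) has_derivative (\<lambda>h. h * (g \<bullet> transfer y z))) (at 0 within ?I)" by simp
  then have "((\<lambda>h. K (?p h)) has_real_derivative (g \<bullet> transfer y z)) (at 0 within ?I)"
    by (simp add: has_field_derivative_def mult_commute_abs)
  then have "((\<lambda>h. (K (?p h) - K \<eta>) / h) \<longlongrightarrow> g \<bullet> transfer y z) (at 0 within ?I)"
    by (simp add: has_field_derivative_iff)
  moreover have "at 0 within ?I = at_right 0" using yp by (intro at_within_nhd[of 0 "{..<\<eta> $ y}"]) auto
  ultimately show ?thesis by (simp add: diff_quotient_def[abs_def])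
qed

text \<open>At points without mass in the donor state the derivative is a limit of interior derivatives, and
  continuity of \<open>G\<close> identifies it.\<close>

lemma has_simplex_deriv_of_gradient:
  assumes G: "simplex_gradient K G" and \<eta>: "\<eta> \<in> prob_simplex"
  shows "has_simplex_deriv K y z \<eta> (G \<eta> \<bullet> transfer y z)"
proof (cases "stays_in_simplex y z \<eta>")
  case True
  then have "0 < \<eta> $ y \<or> y = z" using stays_in_simplex_iff[OF \<eta>] by blast
  moreover have "(K has_derivative (\<lambda>v. G \<eta> \<bullet> v)) (at \<eta> within prob_simplex)"
    using G \<eta> by (auto simp: simplex_gradient_def)
  ultimately show ?thesis using one_sided_deriv_of_gradient[OF _ \<eta>] True
    by (auto simp: has_simplex_deriv_def)
next
  case False
  have L: "Lim (at_right 0) (diff_quotient K y z \<theta>) = G \<theta> \<bullet> transfer y z" if "\<theta> \<in> rel_interior prob_simplex" for \<theta>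
  proof (rule tendsto_Lim)
    have \<theta>: "\<theta> \<in> prob_simplex" using that rel_interior_subset by blast
    have "(K has_derivative (\<lambda>v. G \<theta> \<bullet> v)) (at \<theta> within prob_simplex)"
      using G \<theta> by (auto simp: simplex_gradient_def)
    from one_sided_deriv_of_gradient[OF this \<theta>] rel_interior_simplex_pos[OF that, of y]
    show "(diff_quotient K y z \<theta> \<longlongrightarrow> G \<theta> \<bullet> transfer y z) (at_right 0)" by blast
  qed simp
  have "(G \<longlongrightarrow> G \<eta>) (at \<eta> within prob_simplex)"
    using G \<eta> by (auto simp: simplex_gradient_def continuous_on_def)
  then have "(G \<longlongrightarrow> G \<eta>) (at \<eta> within rel_interior prob_simplex)"
    using tendsto_within_subset rel_interior_subset by blast
  then have "((\<lambda>\<theta>. G \<theta> \<bullet> transfer y z) \<longlongrightarrow> G \<eta> \<bullet> transfer y z) (at \<eta> within rel_interior prob_simplex)"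
    by (intro tendsto_intros)
  then have "((\<lambda>\<theta>. Lim (at_right 0) (diff_quotient K y z \<theta>)) \<longlongrightarrow> G \<eta> \<bullet> transfer y z)
      (at \<eta> within rel_interior prob_simplex)"
    by (rule Lim_transform_eventually) (auto simp: eventually_at_filter L)
  with False show ?thesis by (simp add: has_simplex_deriv_def)
qed

lemma simplex_deriv_of_gradient:
  assumes "simplex_gradient K G" "\<eta> \<in> prob_simplex"
  shows "simplex_deriv K y z \<eta> = G \<eta> $ z - G \<eta> $ y"
proof -
  have "simplex_deriv K y z \<eta> = G \<eta> \<bullet> transfer y z"
    by (rule simplex_deriv_eq[OF assms(2) has_simplex_deriv_of_gradient[OF assms]])
  then show ?thesis by (simp add: transfer_def inner_diff_right inner_axis)
qed

lemma simplex_C1_of_gradient: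
  assumes "simplex_gradient K G"
  shows "simplex_C1 K"
proof -
  have "continuous_on prob_simplex (\<lambda>\<eta>. \<chi> y z. G \<eta> $ z - G \<eta> $ y)"
    using assms by (intro continuous_on_vec_lambda continuous_intros) (auto simp: simplex_gradient_def)
  then have "continuous_on prob_simplex (simplex_jac K)"
    by (rule continuous_on_eq) (simp add: simplex_jac_def simplex_deriv_of_gradient[OF assms] vec_eq_iff)
  then show ?thesis using has_simplex_deriv_of_gradient[OF assms]
    by (auto simp: simplex_C1_def simplex_differentiable_def)
qed

text \<open>Only right derivatives are known, so the mean value theorem is not available. Instead, the last time up to
  which \<open>k t - k 0 \<le> (M + e) * t\<close> holds cannot lie before \<open>h\<close>.\<close>

lemma right_derivative_bound:
  fixes k :: "real \<Rightarrow> real"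
  assumes cont: "continuous_on {0..h} k" and h: "0 \<le> h"
    and der: "\<And>s. 0 \<le> s \<Longrightarrow> s < h \<Longrightarrow> \<exists>D\<le>M. ((\<lambda>\<delta>. (k (s + \<delta>) - k s) / \<delta>) \<longlongrightarrow> D) (at_right 0)"
  shows "k h - k 0 \<le> M * h"
proof (rule field_le_epsilon)
  fix e0 :: real assume e0: "0 < e0"
  define e where "e = e0 / (h + 1)"
  have e: "0 < e" "e * h \<le> e0" using e0 h by (auto simp: e_def field_simps)
  define A where "A = {t \<in> {0..h}. k t - k 0 \<le> (M + e) * t}"
  have A: "A = {0..h} \<inter> (\<lambda>t. k t - k 0 - (M + e) * t) -` {..0}" by (auto simp: A_def)
  have "closed A" unfolding A
    by (rule continuous_closed_preimage) (auto intro!: continuous_intros cont)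
  moreover have "bounded A" unfolding A by (rule bounded_subset[OF bounded_closed_interval]) auto
  ultimately have "compact A" by (simp add: compact_eq_bounded_closed)
  moreover have "0 \<in> A" using h by (simp add: A_def)
  ultimately obtain t where t: "t \<in> A" "\<And>s. s \<in> A \<Longrightarrow> s \<le> t" using compact_attains_sup[of A] by blast
  have "t = h"
  proof (rule ccontr)
    assume "t \<noteq> h"
    then have th: "0 \<le> t" "t < h" using t(1) by (auto simp: A_def)
    obtain D where D: "D \<le> M" "((\<lambda>\<delta>. (k (t + \<delta>) - k t) / \<delta>) \<longlongrightarrow> D) (at_right 0)" using der[OF th] by blast
    then have "eventually (\<lambda>\<delta>. (k (t + \<delta>) - k t) / \<delta> < M + e) (at_right 0)"
      using e by (intro order_tendstoD(2)[OF D(2)]) simp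
    moreover have "eventually (\<lambda>\<delta>. \<delta> \<in> {0<..<h - t}) (at_right 0)" using th by (intro eventually_at_right_real) simp
    ultimately have "eventually (\<lambda>\<delta>. (k (t + \<delta>) - k t) / \<delta> < M + e \<and> \<delta> \<in> {0<..<h - t}) (at_right 0)"
      by eventually_elim simp
    then obtain \<delta> where \<delta>: "(k (t + \<delta>) - k t) / \<delta> < M + e" "0 < \<delta>" "\<delta> < h - t"
      using eventually_happens'[of "at_right (0::real)"] by fastforce
    then have "k (t + \<delta>) - k t \<le> (M + e) * \<delta>" by (simp add: field_simps)
    then have "t + \<delta> \<in> A" using t(1) \<delta> by (auto simp: A_def algebra_simps)
    then show False using t(2) \<delta> by fastforce
  qed
  then show "k h - k 0 \<le> M * h + e0" using t(1) e by (auto simp: A_def algebra_simps)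
qed

lemma simplex_C1_has_deriv:
  assumes "simplex_C1 K" "\<eta> \<in> prob_simplex" "0 < \<eta> $ y"
  shows "((\<lambda>h. (K (\<eta> + h *\<^sub>R transfer y z) - K \<eta>) / h) \<longlongrightarrow> simplex_deriv K y z \<eta>) (at_right 0)"
proof -
  obtain D where D: "has_simplex_deriv K y z \<eta> D"
    using assms(1,2) unfolding simplex_C1_def simplex_differentiable_def by blast
  then have "simplex_deriv K y z \<eta> = D" by (rule simplex_deriv_eq[OF assms(2)])
  with D show ?thesis using stays_in_simplex_iff[OF assms(2), of y z] assms(3)
    by (simp add: has_simplex_deriv_def diff_quotient_def[abs_def])
qed

lemma tendsto_of_diff_quotient:
  fixes k :: "real \<Rightarrow> real"
  assumes "((\<lambda>h. (k h - k 0) / h) \<longlongrightarrow> D) (at_right 0)"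
  shows "(k \<longlongrightarrow> k 0) (at_right 0)"
proof -
  have "((\<lambda>h. h * ((k h - k 0) / h) + k 0) \<longlongrightarrow> 0 * D + k 0) (at_right 0)"
    by (intro tendsto_intros assms tendsto_ident_at)
  then have "((\<lambda>h. h * ((k h - k 0) / h) + k 0) \<longlongrightarrow> k 0) (at_right 0)" by simp
  then show ?thesis
    by (rule Lim_transform_eventually) (auto simp: eventually_at_filter)
qed

text \<open>Along a segment of transfers from \<open>y\<close> to \<open>w\<close> the derivative is known only
  one-sidedly. Continuity from the right comes from the transfer \<open>y\<close> to \<open>w\<close>, continuity from
  the left from the reverse transfer; both states carry mass in the interior of the segment.\<close>

lemma segment_estimate:
  assumes K: "simplex_C1 K" and \<eta>: "\<eta> \<in> prob_simplex" and h: "0 \<le> h" "h \<le> \<eta> $ y"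
    and close: "\<And>s. 0 \<le> s \<Longrightarrow> s < h \<Longrightarrow> \<bar>simplex_deriv K y w (\<eta> + s *\<^sub>R transfer y w) - c\<bar> \<le> \<epsilon>"
  shows "\<bar>K (\<eta> + h *\<^sub>R transfer y w) - K \<eta> - h * c\<bar> \<le> \<epsilon> * h"
proof (cases "h = 0 \<or> y = w")
  case True
  then show ?thesis
  proof
    assume yw: "y = w"
    have "simplex_deriv K y y \<eta> = 0"
      by (rule simplex_deriv_eq[OF \<eta>]) (simp add: has_simplex_deriv_def stays_in_simplex_iff[OF \<eta>] diff_quotient_def[abs_def])
    then show ?thesis using close[of 0] h yw by (cases "h = 0") (auto simp: abs_mult)
  qed simp
next
  case False
  then have hp: "0 < h" and yw: "y \<noteq> w" using h by auto
  define k where "k = (\<lambda>s. K (\<eta> + s *\<^sub>R transfer y w))"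
  let ?\<theta> = "\<lambda>s. \<eta> + s *\<^sub>R transfer y w"
  have \<theta>: "?\<theta> s \<in> prob_simplex" if "0 \<le> s" "s \<le> h" for s using that h \<eta> by (intro move_in_simplex) auto
  have fwd: "((\<lambda>\<delta>. (k (s + \<delta>) - k s) / \<delta>) \<longlongrightarrow> simplex_deriv K y w (?\<theta> s)) (at_right 0)" if "0 \<le> s" "s < h" for s
  proof -
    have "0 < ?\<theta> s $ y" using that h yw by (simp add: transfer_nth)
    from simplex_C1_has_deriv[OF K \<theta> this] that show ?thesis by (simp add: k_def algebra_simps)
  qed
  have bwd: "((\<lambda>\<delta>. (k (s - \<delta>) - k s) / \<delta>) \<longlongrightarrow> simplex_deriv K w y (?\<theta> s)) (at_right 0)" if "0 < s" "s \<le> h" for s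
  proof -
    have "0 < ?\<theta> s $ w" using that simplex_nonneg[OF \<eta>, of w] yw by (simp add: transfer_nth add_nonneg_pos)
    from simplex_C1_has_deriv[OF K \<theta> this, of y] that show ?thesis
      by (simp add: k_def transfer_swap[of w y] algebra_simps)
  qed
  have right: "(k \<longlongrightarrow> k s) (at_right s)" if "0 \<le> s" "s < h" for s
    using tendsto_of_diff_quotient[of "\<lambda>\<delta>. k (s + \<delta>)"] fwd[OF that]
    by (simp add: filterlim_at_right_to_0[of k _ s] add.commute)
  have left: "(k \<longlongrightarrow> k s) (at_left s)" if "0 < s" "s \<le> h" for s
  proof -
    have "((\<lambda>\<delta>. k (s - \<delta>)) \<longlongrightarrow> k s) (at_right 0)"
      using tendsto_of_diff_quotient[of "\<lambda>\<delta>. k (s - \<delta>)"] bwd[OF that] by simp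
    then show ?thesis
      by (simp add: filterlim_at_left_to_right filterlim_at_right_to_0[of _ _ "- s"])
  qed
  have cont: "continuous_on {0..h} k"
    by (rule continuous_on_IccI) (use right left hp in \<open>auto simp: filterlim_split_at\<close>)
  have "k h - k 0 \<le> (c + \<epsilon>) * h"
  proof (rule right_derivative_bound[OF cont h(1)])
    fix s assume s: "0 \<le> s" "s < h"
    then show "\<exists>D\<le>c + \<epsilon>. ((\<lambda>\<delta>. (k (s + \<delta>) - k s) / \<delta>) \<longlongrightarrow> D) (at_right 0)"
      using fwd[OF s] close[OF s] by (intro exI[of _ "simplex_deriv K y w (?\<theta> s)"]) (simp add: abs_le_iff)
  qed
  moreover have "- k h - - k 0 \<le> (\<epsilon> - c) * h"
  proof (rule right_derivative_bound[of h "\<lambda>s. - k s"])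
    fix s assume s: "0 \<le> s" "s < h"
    have "((\<lambda>\<delta>. - ((k (s + \<delta>) - k s) / \<delta>)) \<longlongrightarrow> - simplex_deriv K y w (?\<theta> s)) (at_right 0)"
      by (intro tendsto_minus fwd s)
    moreover have "- ((k (s + \<delta>) - k s) / \<delta>) = (- k (s + \<delta>) - - k s) / \<delta>" for \<delta> by (simp add: minus_divide_left)
    ultimately show "\<exists>D\<le>\<epsilon> - c. ((\<lambda>\<delta>. (- k (s + \<delta>) - - k s) / \<delta>) \<longlongrightarrow> D) (at_right 0)"
      using close[OF s] by (intro exI[of _ "- simplex_deriv K y w (?\<theta> s)"]) (simp add: abs_le_iff)
  qed (auto intro!: continuous_intros cont h)
  ultimately show ?thesis unfolding k_def by (simp add: abs_le_iff algebra_simps)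
qed

text \<open>The state \<open>w\<close> serves as a hub: the mass \<open>h z\<close> of every state \<open>z\<close> is
  moved to it. Two probability vectors have a common descendant of this form, and the moves are made one state at a
  time inside the simplex, always along a transfer whose donor carries mass. Boundary points therefore need no
  separate treatment.\<close>

definition dump :: "'n::finite \<Rightarrow> ('n \<Rightarrow> real) \<Rightarrow> real ^ 'n \<Rightarrow> real ^ 'n" where
  "dump w h \<eta> = (\<chi> v. \<eta> $ v - h v + (if v = w then (\<Sum>z\<in>UNIV. h z) else 0))"

lemma dump_in_simplex:
  assumes "\<eta> \<in> prob_simplex" "\<And>z. 0 \<le> h z" "\<And>z. h z \<le> \<eta> $ z"
  shows "dump w h \<eta> \<in> prob_simplex"
  using assms by (auto simp: prob_simplex_def dump_def sum.distrib sum_subtractf intro!: add_nonneg_nonneg sum_nonneg)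

lemma dump_dist:
  assumes "\<And>z. 0 \<le> h z"
  shows "norm (dump w h \<eta> - \<eta>) \<le> 2 * (\<Sum>z\<in>UNIV. h z)"
proof -
  have s: "0 \<le> (\<Sum>z\<in>UNIV. h z)" using assms by (simp add: sum_nonneg)
  have "norm (dump w h \<eta> - \<eta>) \<le> (\<Sum>v\<in>UNIV. \<bar>(dump w h \<eta> - \<eta>) $ v\<bar>)" by (rule norm_le_l1_cart)
  also have "\<dots> \<le> (\<Sum>v\<in>UNIV. h v + (if v = w then (\<Sum>z\<in>UNIV. h z) else 0))"
    using assms s by (intro sum_mono) (auto simp: dump_def abs_le_iff add_increasing)
  also have "\<dots> = 2 * (\<Sum>z\<in>UNIV. h z)" by (simp add: sum.distrib)
  finally show ?thesis .
qed

text \<open>One segment for every donor state, in any order; the intermediate points stay close to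
  \<open>\<eta>\<close>.\<close>

lemma dump_estimate:
  assumes K: "simplex_C1 K" and \<eta>: "\<eta> \<in> prob_simplex"
    and h: "\<And>z. 0 \<le> h z" "\<And>z. h z \<le> \<eta> $ z"
    and close: "\<And>\<theta> z. \<theta> \<in> prob_simplex \<Longrightarrow> norm (\<theta> - \<eta>) \<le> 2 * (\<Sum>z\<in>UNIV. h z) \<Longrightarrow> \<bar>simplex_deriv K z w \<theta> - c z\<bar> \<le> \<epsilon>"
  shows "\<bar>K (dump w h \<eta>) - K \<eta> - (\<Sum>z\<in>UNIV. h z * c z)\<bar> \<le> \<epsilon> * (\<Sum>z\<in>UNIV. h z)"
proof -
  define hS where "hS = (\<lambda>S z. if z \<in> S then h z else 0)"
  have "\<bar>K (dump w (hS S) \<eta>) - K \<eta> - (\<Sum>z\<in>S. h z * c z)\<bar> \<le> \<epsilon> * (\<Sum>z\<in>S. h z)" for S :: "'a set"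
  proof (induction S rule: finite_induct[OF finite])
    case 1
    have "dump w (hS {}) \<eta> = \<eta>" by (simp add: dump_def hS_def vec_eq_iff)
    then show ?case by simp
  next
    case (2 y S)
    have hS: "0 \<le> hS S z" "hS S z \<le> \<eta> $ z" for z using h simplex_nonneg[OF \<eta>] by (auto simp: hS_def)
    have P: "dump w (hS S) \<eta> \<in> prob_simplex" by (rule dump_in_simplex[OF \<eta> hS])
    have step: "dump w (hS S) \<eta> + s *\<^sub>R transfer y w = dump w ((hS S)(y := s)) \<eta>" for s
    proof -
      have "(\<Sum>z\<in>UNIV. ((hS S)(y := s)) z) = (\<Sum>z\<in>UNIV. hS S z + (if z = y then s else 0))"
        using 2 by (intro sum.cong) (auto simp: hS_def)
      then show ?thesis using 2 by (auto simp: vec_eq_iff dump_def transfer_nth sum.distrib hS_def)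
    qed
    have seg: "\<bar>K (dump w (hS S) \<eta> + h y *\<^sub>R transfer y w) - K (dump w (hS S) \<eta>) - h y * c y\<bar> \<le> \<epsilon> * h y"
    proof (rule segment_estimate[OF K P h(1)])
      show "h y \<le> dump w (hS S) \<eta> $ y" using h 2 hS by (auto simp: dump_def hS_def sum_nonneg add_increasing2)
      fix s assume s: "0 \<le> s" "s < h y"
      let ?g = "(hS S)(y := s)"
      have g: "0 \<le> ?g z" "?g z \<le> h z" "?g z \<le> \<eta> $ z" for z
        using s h order_trans[OF less_imp_le[OF s(2)] h(2)] simplex_nonneg[OF \<eta>] by (auto simp: hS_def)
      have "norm (dump w ?g \<eta> - \<eta>) \<le> 2 * (\<Sum>z\<in>UNIV. ?g z)" by (rule dump_dist[OF g(1)])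
      also have "\<dots> \<le> 2 * (\<Sum>z\<in>UNIV. h z)" using g(2) by (intro mult_left_mono sum_mono) auto
      finally show "\<bar>simplex_deriv K y w (dump w (hS S) \<eta> + s *\<^sub>R transfer y w) - c y\<bar> \<le> \<epsilon>"
        unfolding step by (intro close dump_in_simplex[OF \<eta> g(1) g(3)])
    qed
    have "(hS S)(y := h y) = hS (insert y S)" using 2 by (auto simp: hS_def)
    with seg step[of "h y"] 2 show ?case by (simp add: distrib_left abs_le_iff)
  qed
  from this[of UNIV] show ?thesis by (simp add: hS_def)
qed

text \<open>As \<open>D\<^sub>z\<^sub>w = G\<^sub>w - G\<^sub>z\<close> and \<open>G\<close> matters only up to
  constants, it is normalised by \<open>G\<^sub>w = 0\<close>. To compare \<open>K\<close> at \<open>\<eta>\<close>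
  and \<open>\<zeta>\<close>, both are joined to the point obtained by dumping the excess of either over the other
  into \<open>w\<close>.\<close>

lemma gradient_of_simplex_C1:
  fixes K :: "real ^ 'n::finite \<Rightarrow> real"
  assumes K: "simplex_C1 K"
  shows "simplex_gradient K (\<lambda>\<eta>. \<chi> z. - simplex_deriv K z w \<eta>)"
proof -
  define G where "G = (\<lambda>\<eta>. \<chi> z. - simplex_deriv K z w \<eta>)"
  have J: "continuous_on prob_simplex (simplex_jac K)" using K by (simp add: simplex_C1_def)
  have Gj: "G \<eta> = (\<chi> z. - (simplex_jac K \<eta> $ z $ w))" for \<eta> by (simp add: G_def simplex_jac_def)
  have cG: "continuous_on prob_simplex G" unfolding Gj
    by (intro continuous_on_vec_lambda continuous_intros J)
  have "(K has_derivative (\<lambda>v. G \<eta> \<bullet> v)) (at \<eta> within prob_simplex)" if \<eta>: "\<eta> \<in> prob_simplex" for \<eta>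
    unfolding has_derivative_within_alt
  proof (intro conjI allI impI)
    show "bounded_linear (\<lambda>v. G \<eta> \<bullet> v)" by (rule bounded_linear_inner_right)
    fix e :: real assume e: "0 < e"
    define d where "d = real CARD('n)"
    have d: "1 \<le> d" by (simp add: d_def Suc_leI)
    define \<epsilon> where "\<epsilon> = e / d"
    have \<epsilon>: "0 < \<epsilon>" using e d by (simp add: \<epsilon>_def)
    obtain \<rho> where \<rho>: "0 < \<rho>" "\<And>\<theta>. \<theta> \<in> prob_simplex \<Longrightarrow> dist \<theta> \<eta> < \<rho> \<Longrightarrow> dist (G \<theta>) (G \<eta>) < \<epsilon>"
      using cG \<eta> \<epsilon> unfolding continuous_on_iff by metis
    have close: "\<bar>simplex_deriv K z w \<theta> - simplex_deriv K z w \<eta>\<bar> \<le> \<epsilon>"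
      if "\<theta> \<in> prob_simplex" "norm (\<theta> - \<eta>) < \<rho>" for \<theta> z
    proof -
      have "\<bar>(G \<theta> - G \<eta>) $ z\<bar> \<le> norm (G \<theta> - G \<eta>)" by (rule component_le_norm_cart)
      also have "\<dots> < \<epsilon>" using \<rho>(2)[OF that(1)] that(2) by (simp add: dist_norm)
      finally show ?thesis by (simp add: G_def abs_minus_commute)
    qed
    show "\<exists>\<delta>>0. \<forall>\<zeta>\<in>prob_simplex. norm (\<zeta> - \<eta>) < \<delta> \<longrightarrow>
        norm (K \<zeta> - K \<eta> - G \<eta> \<bullet> (\<zeta> - \<eta>)) \<le> e * norm (\<zeta> - \<eta>)"
    proof (intro exI[of _ "\<rho> / (1 + 2 * d)"] conjI ballI impI)
      show "0 < \<rho> / (1 + 2 * d)" using \<rho> d by simp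
      fix \<zeta> assume \<zeta>: "\<zeta> \<in> prob_simplex" and near: "norm (\<zeta> - \<eta>) < \<rho> / (1 + 2 * d)"
      define h where "h = (\<lambda>z. max 0 (\<eta> $ z - \<zeta> $ z))"
      define k where "k = (\<lambda>z. max 0 (\<zeta> $ z - \<eta> $ z))"
      have h: "0 \<le> h z" "h z \<le> \<eta> $ z" and k: "0 \<le> k z" "k z \<le> \<zeta> $ z" for z
        using simplex_nonneg[OF \<eta>] simplex_nonneg[OF \<zeta>] by (auto simp: h_def k_def)
      have hk: "h z - k z = \<eta> $ z - \<zeta> $ z" for z by (simp add: h_def k_def max_def)
      have "(\<Sum>z\<in>UNIV. h z) - (\<Sum>z\<in>UNIV. k z) = 0"
        by (simp add: sum_subtractf[symmetric] hk) (simp add: sum_subtractf simplex_sum \<eta> \<zeta>)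
      then have shk: "(\<Sum>z\<in>UNIV. h z) = (\<Sum>z\<in>UNIV. k z)" by simp
      have sum_l1: "(\<Sum>z\<in>UNIV. h z) + (\<Sum>z\<in>UNIV. k z) = l1 (\<zeta> - \<eta>)"
        unfolding l1_def sum.distrib[symmetric] by (intro sum.cong) (auto simp: h_def k_def)
      have l1d: "l1 (\<zeta> - \<eta>) \<le> d * norm (\<zeta> - \<eta>)" unfolding d_def by (rule l1_le_norm)
      \<comment> \<open>Both are the componentwise minimum of \<open>\<eta>\<close> and \<open>\<zeta>\<close> with
        the missing mass placed at \<open>w\<close>.\<close>
      have mid: "dump w h \<eta> = dump w k \<zeta>"
        unfolding dump_def shk using hk by (simp add: vec_eq_iff algebra_simps)
      have small: "(1 + 2 * d) * norm (\<zeta> - \<eta>) < \<rho>" using near d by (simp add: field_simps)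
      have s2: "2 * (\<Sum>z\<in>UNIV. h z) \<le> 2 * d * norm (\<zeta> - \<eta>)" "2 * (\<Sum>z\<in>UNIV. k z) \<le> 2 * d * norm (\<zeta> - \<eta>)"
        using sum_l1 l1d shk sum_nonneg[of UNIV h] h norm_ge_zero[of "\<zeta> - \<eta>"] by auto
      let ?c = "\<lambda>z. simplex_deriv K z w \<eta>"
      have A: "\<bar>K (dump w h \<eta>) - K \<eta> - (\<Sum>z\<in>UNIV. h z * ?c z)\<bar> \<le> \<epsilon> * (\<Sum>z\<in>UNIV. h z)"
      proof (rule dump_estimate[OF K \<eta> h])
        fix \<theta> z assume \<theta>: "\<theta> \<in> prob_simplex" "norm (\<theta> - \<eta>) \<le> 2 * (\<Sum>z\<in>UNIV. h z)"
        have "norm (\<theta> - \<eta>) \<le> 2 * d * norm (\<zeta> - \<eta>)" using \<theta>(2) s2(1) by linarith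
        also have "\<dots> \<le> (1 + 2 * d) * norm (\<zeta> - \<eta>)" by (intro mult_right_mono) auto
        finally have "norm (\<theta> - \<eta>) < \<rho>" using small by linarith
        then show "\<bar>simplex_deriv K z w \<theta> - ?c z\<bar> \<le> \<epsilon>" by (rule close[OF \<theta>(1)])
      qed
      have B: "\<bar>K (dump w k \<zeta>) - K \<zeta> - (\<Sum>z\<in>UNIV. k z * ?c z)\<bar> \<le> \<epsilon> * (\<Sum>z\<in>UNIV. k z)"
      proof (rule dump_estimate[OF K \<zeta> k])
        fix \<theta> z assume \<theta>: "\<theta> \<in> prob_simplex" "norm (\<theta> - \<zeta>) \<le> 2 * (\<Sum>z\<in>UNIV. k z)"
        have "norm (\<theta> - \<eta>) \<le> norm (\<theta> - \<zeta>) + norm (\<zeta> - \<eta>)" by norm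
        also have "\<dots> < \<rho>" using \<theta>(2) s2 small by (simp add: distrib_right)
        finally show "\<bar>simplex_deriv K z w \<theta> - ?c z\<bar> \<le> \<epsilon>" by (rule close[OF \<theta>(1)])
      qed
      have "G \<eta> \<bullet> (\<zeta> - \<eta>) = (\<Sum>z\<in>UNIV. (h z - k z) * ?c z)"
        by (simp add: inner_vec_def G_def hk) (simp add: algebra_simps)
      also have "\<dots> = (\<Sum>z\<in>UNIV. h z * ?c z) - (\<Sum>z\<in>UNIV. k z * ?c z)"
        by (simp add: left_diff_distrib sum_subtractf)
      finally have "\<bar>K \<zeta> - K \<eta> - G \<eta> \<bullet> (\<zeta> - \<eta>)\<bar> \<le> \<epsilon> * (\<Sum>z\<in>UNIV. h z) + \<epsilon> * (\<Sum>z\<in>UNIV. k z)"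
        using A B mid by (simp add: abs_le_iff)
      also have "\<dots> = \<epsilon> * l1 (\<zeta> - \<eta>)" by (simp add: sum_l1[symmetric] distrib_left)
      also have "\<dots> \<le> \<epsilon> * (d * norm (\<zeta> - \<eta>))" using \<epsilon> l1d by (intro mult_left_mono) auto
      also have "\<dots> = e * norm (\<zeta> - \<eta>)" using d by (simp add: \<epsilon>_def)
      finally show "norm (K \<zeta> - K \<eta> - G \<eta> \<bullet> (\<zeta> - \<eta>)) \<le> e * norm (\<zeta> - \<eta>)" by simp
    qed
  qed
  then show ?thesis using cG unfolding simplex_gradient_def G_def by blast
qed

lemma lipschitz_of_gradient:
  fixes K :: "real ^ 'n::finite \<Rightarrow> real"
  assumes "simplex_gradient K G"
  shows "\<exists>L\<ge>0. \<forall>\<eta>\<in>prob_simplex. \<forall>\<zeta>\<in>prob_simplex. \<bar>K \<zeta> - K \<eta>\<bar> \<le> L * norm (\<zeta> - \<eta>)"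
proof -
  have "bounded (G ` prob_simplex)"
    using assms compact_simplex by (auto simp: simplex_gradient_def intro!: compact_imp_bounded compact_continuous_image)
  then obtain L where L: "0 < L" "\<And>\<eta>. \<eta> \<in> prob_simplex \<Longrightarrow> norm (G \<eta>) \<le> L"
    unfolding bounded_pos by blast
  have "norm (K \<zeta> - K \<eta>) \<le> L * norm (\<zeta> - \<eta>)" if "\<eta> \<in> prob_simplex" "\<zeta> \<in> prob_simplex" for \<eta> \<zeta>
  proof (rule differentiable_bound[OF convex_simplex _ _ that(2,1)])
    show "(K has_derivative (\<lambda>v. G x \<bullet> v)) (at x within prob_simplex)" if "x \<in> prob_simplex" for x
      using assms that by (simp add: simplex_gradient_def)
    show "onorm (\<lambda>v. G x \<bullet> v) \<le> L" if "x \<in> prob_simplex" for x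
    proof (rule onorm_le)
      fix v
      have "norm (G x \<bullet> v) \<le> norm (G x) * norm v" using Cauchy_Schwarz_ineq2 by auto
      also have "\<dots> \<le> L * norm v" by (intro mult_right_mono L that) auto
      finally show "norm (G x \<bullet> v) \<le> L * norm v" .
    qed
  qed
  then show ?thesis using L(1) by (intro exI[of _ L]) auto
qed

section \<open>Second differences and gradients\<close>

text \<open>A function that is additive up to \<open>O(s t)\<close> has a linear part with quadratic error. Iterating
  the defect shows that the quotients \<open>k s / s\<close> along \<open>s = 1 / 2 ^ j\<close> form a Cauchy
  sequence; integer multiples of small \<open>s\<close> reach every \<open>t\<close> up to a remainder of size
  \<open>B s\<close>.\<close>

lemma second_difference_quotient_limit:
  fixes k :: "real \<Rightarrow> real"
  assumes add: "\<And>s t. 0 \<le> s \<Longrightarrow> 0 \<le> t \<Longrightarrow> s + t \<le> 1 \<Longrightarrow> \<bar>k (s + t) - k s - k t\<bar> \<le> 2 * A * (s * t)"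
    and lip: "\<And>s. 0 \<le> s \<Longrightarrow> s \<le> 1 \<Longrightarrow> \<bar>k s\<bar> \<le> B * s"
    and A: "0 \<le> A" and B: "0 \<le> B"
  shows "\<exists>D. \<forall>t. 0 \<le> t \<and> t \<le> 1 \<longrightarrow> \<bar>k t - t * D\<bar> \<le> 3 * A * t\<^sup>2"
proof -
  have mult: "\<bar>k (real n * s) - real n * k s\<bar> \<le> A * (real n * s)\<^sup>2" if "0 \<le> s" "real n * s \<le> 1" for n s
    using that(2)
  proof (induction n)
    case 0
    then show ?case using lip[of 0] by simp
  next
    case (Suc n)
    have e: "real (Suc n) * s = real n * s + s" by (simp add: algebra_simps)
    have le: "real n * s + s \<le> 1" using Suc.prems unfolding e .
    have "\<bar>k (real n * s + s) - k (real n * s) - k s\<bar> \<le> 2 * A * ((real n * s) * s)"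
      using that(1) le by (intro add) auto
    moreover have "\<bar>k (real n * s) - real n * k s\<bar> \<le> A * (real n * s)\<^sup>2" using Suc.IH le that(1) by simp
    moreover have "2 * A * ((real n * s) * s) + A * (real n * s)\<^sup>2 + A * s\<^sup>2 = A * (real n * s + s)\<^sup>2"
      by (simp add: power2_eq_square algebra_simps)
    moreover have "0 \<le> A * s\<^sup>2" using A by simp
    ultimately show ?case unfolding e by (simp add: algebra_simps abs_le_iff)
  qed
  have quot: "\<bar>k t / t - k s / s\<bar> \<le> 3 * A * t + 2 * B * s / t" if st: "0 < s" "s \<le> t" "t \<le> 1" for s t
  proof -
    \<comment> \<open>The largest multiple of \<open>s\<close> below \<open>t\<close>.\<close>
    define n where "n = nat \<lfloor>t / s\<rfloor>"
    have "0 \<le> \<lfloor>t / s\<rfloor>" using st by simp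
    then have n: "real n \<le> t / s" "t / s < real n + 1" unfolding n_def by linarith+
    have ns: "real n * s \<le> t" "t - real n * s < s" using n st by (simp_all add: field_simps)
    have sq: "(real n * s)\<^sup>2 \<le> t\<^sup>2" using ns st by (intro power_mono) auto
    have 1: "\<bar>k (real n * s) - real n * k s\<bar> \<le> A * t\<^sup>2"
      using mult[of s n] mult_left_mono[OF sq A] ns st by linarith
    have 2: "\<bar>k t - k (real n * s) - k (t - real n * s)\<bar> \<le> 2 * A * t\<^sup>2"
    proof -
      have "\<bar>k (real n * s + (t - real n * s)) - k (real n * s) - k (t - real n * s)\<bar> \<le> 2 * A * ((real n * s) * (t - real n * s))"
        using ns st by (intro add) auto
      also have "\<dots> \<le> 2 * A * (t * t)" using ns st A by (intro mult_left_mono mult_mono) auto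
      finally show ?thesis by (simp add: power2_eq_square)
    qed
    have 3: "\<bar>k (t - real n * s)\<bar> \<le> B * s"
      using lip[of "t - real n * s"] mult_left_mono[of "t - real n * s" s B] ns st B by linarith
    have 4: "\<bar>real n * k s - t / s * k s\<bar> \<le> B * s"
    proof -
      have "\<bar>real n * k s - t / s * k s\<bar> = \<bar>real n - t / s\<bar> * \<bar>k s\<bar>"
        by (simp add: left_diff_distrib[symmetric] abs_mult del: times_divide_eq_left)
      also have "\<dots> \<le> 1 * (B * s)" using n lip[of s] st by (intro mult_mono) auto
      finally show ?thesis by simp
    qed
    have "\<bar>k t - t / s * k s\<bar> \<le> 3 * (A * t\<^sup>2) + 2 * (B * s)"
    proof -
      define a b u v x y where "a = A * t\<^sup>2" and "b = B * s" and "u = k t" and "v = k (real n * s)"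
        and "x = real n * k s" and "y = t / s * k s"
      have "\<bar>v - x\<bar> \<le> a" "\<bar>u - v - k (t - real n * s)\<bar> \<le> 2 * a" "\<bar>k (t - real n * s)\<bar> \<le> b" "\<bar>x - y\<bar> \<le> b"
        using 1 2 3 4 unfolding a_def b_def u_def v_def x_def y_def by (simp_all add: mult.assoc)
      then have "\<bar>u - y\<bar> \<le> 3 * a + 2 * b" by linarith
      then show ?thesis unfolding a_def b_def u_def y_def .
    qed
    then have "\<bar>k t - t / s * k s\<bar> / t \<le> (3 * (A * t\<^sup>2) + 2 * (B * s)) / t" using st by (intro divide_right_mono) auto
    moreover have "\<bar>k t - t / s * k s\<bar> / t = \<bar>k t / t - k s / s\<bar>"
    proof -
      have "k t / t - k s / s = (k t - t / s * k s) / t" using st by (simp add: field_simps)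
      then show ?thesis using st by (simp add: abs_divide)
    qed
    ultimately show ?thesis using st by (simp add: add_divide_distrib power2_eq_square)
  qed
  define q where "q = (\<lambda>j::nat. k (1 / 2 ^ j) / (1 / 2 ^ j))"
  have half: "((\<lambda>j::nat. 1 / 2 ^ j :: real) \<longlongrightarrow> 0) sequentially"
    using LIMSEQ_power_zero[of "1/2 :: real"] by (simp add: power_divide)
  have "((\<lambda>j::nat. A * (1 / 2 ^ j)) \<longlongrightarrow> A * 0) sequentially" by (intro tendsto_intros half)
  then have "(\<lambda>j::nat. A * (1 / 2 ^ j)) \<longlonglongrightarrow> 0" by simp
  then have "Cauchy q"
  proof (rule Cauchy_of_tail_bound[rotated])
    fix i j :: nat assume that: "i \<le> j"
    have "(2::real) ^ (j - i) * (1 / 2 ^ j) = 1 / 2 ^ i"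
      using that by (simp add: power_diff field_simps)
    then have eq: "real (2 ^ (j - i)) * (1 / 2 ^ j) = 1 / 2 ^ i" by simp
    have "\<bar>k (1 / 2 ^ i) - real (2 ^ (j - i)) * k (1 / 2 ^ j)\<bar> \<le> A * (1 / 2 ^ i)\<^sup>2"
      using mult[of "1 / 2 ^ j" "2 ^ (j - i)"] unfolding eq by simp
    then have "\<bar>k (1 / 2 ^ i) - real (2 ^ (j - i)) * k (1 / 2 ^ j)\<bar> * 2 ^ i \<le> A * (1 / 2 ^ i)\<^sup>2 * 2 ^ i"
      by (intro mult_right_mono) auto
    moreover have "A * (1 / 2 ^ i)\<^sup>2 * 2 ^ i = A * (1 / 2 ^ i)" by (simp add: power2_eq_square)
    moreover have "\<bar>k (1 / 2 ^ i) - real (2 ^ (j - i)) * k (1 / 2 ^ j)\<bar> * 2 ^ i = \<bar>q i - q j\<bar>"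
    proof -
      have "q i - q j = (k (1 / 2 ^ i) - real (2 ^ (j - i)) * k (1 / 2 ^ j)) * 2 ^ i"
        using that by (simp add: q_def left_diff_distrib power_add[symmetric])
      then show ?thesis by (simp add: abs_mult)
    qed
    ultimately show "dist (q i) (q j) \<le> A * (1 / 2 ^ i)" by (simp add: dist_real_def)
  qed
  then obtain D where D: "q \<longlonglongrightarrow> D" using Cauchy_convergent convergent_def by blast
  show ?thesis
  proof (intro exI[of _ D] allI impI)
    fix t :: real assume t: "0 \<le> t \<and> t \<le> 1"
    show "\<bar>k t - t * D\<bar> \<le> 3 * A * t\<^sup>2"
    proof (cases "t = 0")
      case True
      then show ?thesis using lip[of 0] by simp
    next
      case False
      then have t: "0 < t" "t \<le> 1" using t by auto
      have "((\<lambda>j. \<bar>k t / t - q j\<bar>) \<longlongrightarrow> \<bar>k t / t - D\<bar>) sequentially" by (intro tendsto_intros D)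
      moreover have "((\<lambda>j. 3 * A * t + 2 * B * (1 / 2 ^ j) / t) \<longlongrightarrow> 3 * A * t + 2 * B * 0 / t) sequentially"
        using t by (intro tendsto_intros half) auto
      moreover have "eventually (\<lambda>j. \<bar>k t / t - q j\<bar> \<le> 3 * A * t + 2 * B * (1 / 2 ^ j) / t) sequentially"
      proof -
        have "eventually (\<lambda>j::nat. (1 / 2 ^ j :: real) < t) sequentially" using half t by (auto simp: order_tendsto_iff)
        then show ?thesis
        proof eventually_elim
          case (elim j)
          then show ?case unfolding q_def using quot[of "1 / 2 ^ j" t] t by simp
        qed
      qed
      ultimately have "\<bar>k t / t - D\<bar> \<le> 3 * A * t + 2 * B * 0 / t"
        by (intro tendsto_le[OF sequentially_bot]) auto
      then have "\<bar>k t / t - D\<bar> * t \<le> 3 * A * t * t" using t by (intro mult_right_mono) auto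
      moreover have "\<bar>k t / t - D\<bar> * t = \<bar>k t - t * D\<bar>"
      proof -
        have "k t - t * D = (k t / t - D) * t" using t by (simp add: field_simps)
        then show ?thesis using t by (simp add: abs_mult)
      qed
      ultimately show ?thesis by (simp add: power2_eq_square mult.assoc)
    qed
  qed
qed

lemma le_of_quadratic_error:
  fixes x y M :: real
  assumes "\<And>s. 0 < s \<Longrightarrow> s \<le> 1 \<Longrightarrow> s * x \<le> s * y + M * s\<^sup>2"
  shows "x \<le> y"
proof (rule field_le_epsilon)
  fix e :: real assume e: "0 < e"
  define s where "s = min 1 (e / (\<bar>M\<bar> + 1))"
  have s: "0 < s" "s \<le> 1" using e by (auto simp: s_def)
  have "s * x \<le> s * (y + M * s)" using assms[OF s] by (simp add: algebra_simps power2_eq_square)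
  then have "x \<le> y + M * s" using s by simp
  also have "M * s \<le> (\<bar>M\<bar> + 1) * (e / (\<bar>M\<bar> + 1))"
    using s by (intro mult_mono) (auto simp: s_def)
  also have "\<dots> = e" by simp
  finally show "x \<le> y + e" by simp
qed

lemma simplex_diff_norm: "\<eta> \<in> prob_simplex \<Longrightarrow> \<zeta> \<in> prob_simplex \<Longrightarrow> norm (\<eta> - \<zeta>) \<le> 2"
  using norm_triangle_ineq4[of \<eta> \<zeta>] simplex_norm[of \<eta>] simplex_norm[of \<zeta>] by simp

lemma simplex_segment:
  assumes "\<eta> \<in> prob_simplex" "\<zeta> \<in> prob_simplex" "0 \<le> s" "s \<le> 1"
  shows "\<eta> + s *\<^sub>R (\<zeta> - \<eta>) \<in> prob_simplex"
proof -
  have "(1 - s) *\<^sub>R \<eta> + s *\<^sub>R \<zeta> \<in> prob_simplex"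
    using convexD_alt[OF convex_simplex assms(1,2,3,4)] .
  then show ?thesis by (simp add: algebra_simps)
qed

text \<open>The partial sums interpolate between \<open>\<eta>\<close> and \<open>\<zeta>\<close> by adding the
  directions towards the vertices one after another.\<close>

lemma simplex_partial_mixture:
  fixes \<eta> \<zeta> :: "real ^ 'n::finite"
  assumes \<eta>: "\<eta> \<in> prob_simplex" and \<zeta>: "\<zeta> \<in> prob_simplex" and s: "0 \<le> s" "s \<le> 1"
  shows "\<eta> + s *\<^sub>R (\<Sum>z\<in>S. \<zeta> $ z *\<^sub>R (axis z 1 - \<eta>)) \<in> prob_simplex"
    and "norm (\<Sum>z\<in>S. \<zeta> $ z *\<^sub>R (axis z 1 - \<eta>)) \<le> 2"
proof -
  define m where "m = (\<Sum>z\<in>S. \<zeta> $ z)"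
  have "m \<le> (\<Sum>z\<in>UNIV. \<zeta> $ z)" unfolding m_def
    by (rule sum_mono2) (auto simp: simplex_nonneg[OF \<zeta>])
  then have m: "0 \<le> m" "m \<le> 1" using simplex_sum[OF \<zeta>] simplex_nonneg[OF \<zeta>] by (auto simp: m_def sum_nonneg)
  have "s * m \<le> 1 * 1" using s m by (intro mult_mono) auto
  then have sm: "s * m \<le> 1" by simp
  have nth: "(\<eta> + s *\<^sub>R (\<Sum>z\<in>S. \<zeta> $ z *\<^sub>R (axis z 1 - \<eta>))) $ v
      = (1 - s * m) * \<eta> $ v + s * (if v \<in> S then \<zeta> $ v else 0)" for v
  proof -
    have "(\<Sum>z\<in>S. \<zeta> $ z * axis z 1 $ v) = (\<Sum>z\<in>S. if z = v then \<zeta> $ z else 0)"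
      by (intro sum.cong) (auto simp: axis_def)
    also have "\<dots> = (if v \<in> S then \<zeta> $ v else 0)" by simp
    finally show ?thesis
      by (simp add: right_diff_distrib sum_subtractf m_def sum_distrib_right sum_distrib_left algebra_simps)
  qed
  have "(\<Sum>v\<in>UNIV. (1 - s * m) * \<eta> $ v + s * (if v \<in> S then \<zeta> $ v else 0)) = (1 - s * m) * 1 + s * m"
  proof -
    have "(\<Sum>v\<in>UNIV. if v \<in> S then \<zeta> $ v else 0) = m" by (simp add: m_def sum.If_cases)
    then show ?thesis using simplex_sum[OF \<eta>] by (simp add: sum.distrib flip: sum_distrib_left)
  qed
  then show "\<eta> + s *\<^sub>R (\<Sum>z\<in>S. \<zeta> $ z *\<^sub>R (axis z 1 - \<eta>)) \<in> prob_simplex"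
    unfolding prob_simplex_def nth mem_Collect_eq
    using sm s simplex_nonneg[OF \<eta>] simplex_nonneg[OF \<zeta>] by auto
  have "norm (\<Sum>z\<in>S. \<zeta> $ z *\<^sub>R (axis z 1 - \<eta>)) \<le> (\<Sum>z\<in>S. \<zeta> $ z * 2)"
    by (intro sum_norm_le) (auto intro!: mult_left_mono simplex_diff_norm vertex_in_simplex \<eta> simp: simplex_nonneg[OF \<zeta>])
  also have "\<dots> = m * 2" by (simp add: m_def sum_distrib_right)
  finally show "norm (\<Sum>z\<in>S. \<zeta> $ z *\<^sub>R (axis z 1 - \<eta>)) \<le> 2" using m by simp
qed

text \<open>A bound on all four-point differences, quadratic in the side lengths and linear in the defect of
  \<open>a, b, c, d\<close> from being a parallelogram, makes \<open>K\<close> differentiable with a Lipschitz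
  gradient. Along a segment it gives directional derivatives with quadratic error. Over the partial mixtures it shows
  that the derivative towards \<open>\<zeta>\<close> is the \<open>\<zeta>\<close>-average of the derivatives towards
  the vertices, hence linear. Applied to two short segments towards the same vertex it gives the Lipschitz
  bound.\<close>

lemma gradient_of_second_differences:
  fixes K :: "real ^ 'n::finite \<Rightarrow> real"
  assumes C: "0 \<le> C"
    and lip: "\<And>a b. a \<in> prob_simplex \<Longrightarrow> b \<in> prob_simplex \<Longrightarrow> \<bar>K a - K b\<bar> \<le> C * norm (a - b)"
    and sec: "\<And>a b c d. a \<in> prob_simplex \<Longrightarrow> b \<in> prob_simplex \<Longrightarrow> c \<in> prob_simplex \<Longrightarrow> d \<in> prob_simplex \<Longrightarrow>
        \<bar>K a - K b - K c + K d\<bar> \<le> C * (norm (a - b - c + d)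
           + (norm (a - b) + norm (c - d)) * (norm (a - c) + norm (b - d)))"
  shows "\<exists>G. simplex_gradient K G \<and> (\<forall>\<eta>\<in>prob_simplex. norm (G \<eta>) \<le> 2 * real CARD('n) * C) \<and>
     (\<forall>\<eta>\<in>prob_simplex. \<forall>\<zeta>\<in>prob_simplex. norm (G \<eta> - G \<zeta>) \<le> 9 * real CARD('n) * C * norm (\<eta> - \<zeta>))"
proof -
  have "\<exists>D. \<forall>t. 0 \<le> t \<and> t \<le> 1 \<longrightarrow>
      \<bar>K (\<eta> + t *\<^sub>R (\<zeta> - \<eta>)) - K \<eta> - t * D\<bar> \<le> 6 * C * (norm (\<zeta> - \<eta>))\<^sup>2 * t\<^sup>2"
    if \<eta>: "\<eta> \<in> prob_simplex" and \<zeta>: "\<zeta> \<in> prob_simplex" for \<eta> \<zeta>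
  proof -
    define N where "N = norm (\<zeta> - \<eta>)"
    have N: "0 \<le> N" by (simp add: N_def)
    define k where "k = (\<lambda>s. K (\<eta> + s *\<^sub>R (\<zeta> - \<eta>)) - K \<eta>)"
    have "\<exists>D. \<forall>t. 0 \<le> t \<and> t \<le> 1 \<longrightarrow> \<bar>k t - t * D\<bar> \<le> 3 * (2 * C * N\<^sup>2) * t\<^sup>2"
    proof (rule second_difference_quotient_limit)
      fix s t :: real assume st: "0 \<le> s" "0 \<le> t" "s + t \<le> 1"
      let ?a = "\<eta> + (s + t) *\<^sub>R (\<zeta> - \<eta>)" and ?b = "\<eta> + s *\<^sub>R (\<zeta> - \<eta>)" and ?c = "\<eta> + t *\<^sub>R (\<zeta> - \<eta>)"
      have "\<bar>K ?a - K ?b - K ?c + K \<eta>\<bar> \<le> C * (norm (?a - ?b - ?c + \<eta>)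
           + (norm (?a - ?b) + norm (?c - \<eta>)) * (norm (?a - ?c) + norm (?b - \<eta>)))"
        using st by (intro sec simplex_segment \<eta> \<zeta>) auto
      moreover have e0: "?a - ?b - ?c + \<eta> = 0" and "?a - ?b = t *\<^sub>R (\<zeta> - \<eta>)" "?c - \<eta> = t *\<^sub>R (\<zeta> - \<eta>)"
        "?a - ?c = s *\<^sub>R (\<zeta> - \<eta>)" "?b - \<eta> = s *\<^sub>R (\<zeta> - \<eta>)"
        by (simp_all add: algebra_simps)
      then have "norm (?a - ?b - ?c + \<eta>) = 0" "norm (?a - ?b) = t * N" "norm (?c - \<eta>) = t * N"
        "norm (?a - ?c) = s * N" "norm (?b - \<eta>) = s * N" using st by (simp_all only: N_def norm_scaleR norm_zero abs_of_nonneg)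
      ultimately have "\<bar>K ?a - K ?b - K ?c + K \<eta>\<bar> \<le> C * (0 + (t * N + t * N) * (s * N + s * N))" by (simp only:)
      also have "\<dots> = 2 * (2 * C * N\<^sup>2) * (s * t)" by (simp add: power2_eq_square)
      finally show "\<bar>k (s + t) - k s - k t\<bar> \<le> 2 * (2 * C * N\<^sup>2) * (s * t)" by (simp add: k_def)
    next
      fix s :: real assume s: "0 \<le> s" "s \<le> 1"
      have "\<bar>k s\<bar> \<le> C * norm (\<eta> + s *\<^sub>R (\<zeta> - \<eta>) - \<eta>)" unfolding k_def
        by (intro lip simplex_segment \<eta> \<zeta> s)
      then show "\<bar>k s\<bar> \<le> (C * N) * s" using s by (simp add: N_def mult_ac)
    qed (use C N in auto)
    then show ?thesis unfolding k_def N_def by (simp add: mult.assoc)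
  qed
  then obtain D where D: "\<And>\<eta> \<zeta> t. \<eta> \<in> prob_simplex \<Longrightarrow> \<zeta> \<in> prob_simplex \<Longrightarrow> 0 \<le> t \<Longrightarrow> t \<le> 1 \<Longrightarrow>
      \<bar>K (\<eta> + t *\<^sub>R (\<zeta> - \<eta>)) - K \<eta> - t * D \<eta> \<zeta>\<bar> \<le> 6 * C * (norm (\<zeta> - \<eta>))\<^sup>2 * t\<^sup>2"
    by metis
  have D24: "\<bar>K (\<eta> + t *\<^sub>R (\<zeta> - \<eta>)) - K \<eta> - t * D \<eta> \<zeta>\<bar> \<le> 24 * C * t\<^sup>2"
    if "\<eta> \<in> prob_simplex" "\<zeta> \<in> prob_simplex" "0 \<le> t" "t \<le> 1" for \<eta> \<zeta> t
  proof -
    have "(norm (\<zeta> - \<eta>))\<^sup>2 \<le> 2\<^sup>2" using that by (intro power_mono simplex_diff_norm) auto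
    then have "6 * C * (norm (\<zeta> - \<eta>))\<^sup>2 * t\<^sup>2 \<le> 6 * C * 2\<^sup>2 * t\<^sup>2" using C by (intro mult_right_mono mult_left_mono) auto
    also have "6 * C * 2\<^sup>2 * t\<^sup>2 = 24 * C * t\<^sup>2" by simp
    finally show ?thesis using D[OF that] by linarith
  qed
  define G where "G = (\<lambda>\<eta>. \<chi> z. D \<eta> (axis z 1))"
  \<comment> \<open>Compare the two sides along a mixture of length \<open>s\<close>: they agree up to
    \<open>O(s ^ 2)\<close>, while both are homogeneous in \<open>s\<close>.\<close>
  have lin: "D \<eta> \<zeta> = G \<eta> \<bullet> \<zeta>" if \<eta>: "\<eta> \<in> prob_simplex" and \<zeta>: "\<zeta> \<in> prob_simplex" for \<eta> \<zeta>
  proof -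
    define M where "M = 24 * C + (24 * C + 16 * C) * real CARD('n)"
    have est: "\<bar>s * D \<eta> \<zeta> - s * (G \<eta> \<bullet> \<zeta>)\<bar> \<le> M * s\<^sup>2" if s: "0 < s" "s \<le> 1" for s
    proof -
      let ?V = "\<lambda>S. \<Sum>z\<in>S. \<zeta> $ z *\<^sub>R (axis z 1 - \<eta>)"
      let ?k = "\<lambda>z. K (\<eta> + (s * \<zeta> $ z) *\<^sub>R (axis z 1 - \<eta>)) - K \<eta>"
      have sz: "0 \<le> s * \<zeta> $ z" "s * \<zeta> $ z \<le> s" for z
        using s simplex_nonneg[OF \<zeta>, of z] simplex_le1[OF \<zeta>, of z] mult_left_mono[of "\<zeta> $ z" 1 s] by auto
      have sz1: "s * \<zeta> $ z \<le> 1" for z using sz(2)[of z] s(2) by linarith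
      have part: "\<bar>K (\<eta> + s *\<^sub>R ?V S) - K \<eta> - (\<Sum>z\<in>S. ?k z)\<bar> \<le> 16 * C * s\<^sup>2 * real (card S)" for S :: "'n set"
      proof (induction S rule: finite_induct[OF finite])
        case 1
        then show ?case by simp
      next
        case (2 z S)
        let ?v = "\<zeta> $ z *\<^sub>R (axis z 1 - \<eta>)"
        let ?a = "\<eta> + s *\<^sub>R ?V (insert z S)" and ?b = "\<eta> + s *\<^sub>R ?V S" and ?c = "\<eta> + (s * \<zeta> $ z) *\<^sub>R (axis z 1 - \<eta>)"
        have a: "?a = \<eta> + s *\<^sub>R ?v + s *\<^sub>R ?V S" using 2 by (simp add: algebra_simps)
        have "\<bar>K ?a - K ?b - K ?c + K \<eta>\<bar> \<le> C * (norm (?a - ?b - ?c + \<eta>)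
           + (norm (?a - ?b) + norm (?c - \<eta>)) * (norm (?a - ?c) + norm (?b - \<eta>)))"
          using s sz sz1 by (intro sec simplex_partial_mixture simplex_segment \<eta> \<zeta> vertex_in_simplex) auto
        also have "\<dots> \<le> C * (0 + (2 * s + 2 * s) * (2 * s + 2 * s))"
        proof (intro mult_left_mono add_mono mult_mono)
          have nv: "norm (s *\<^sub>R ?v) \<le> 2 * s"
          proof -
            have "norm (s *\<^sub>R ?v) = (s * \<zeta> $ z) * norm (axis z 1 - \<eta>)" using s simplex_nonneg[OF \<zeta>, of z] by simp
            also have "\<dots> \<le> s * 2" using sz s by (intro mult_mono simplex_diff_norm vertex_in_simplex \<eta>) auto
            finally show ?thesis by simp
          qed
          have nV: "norm (s *\<^sub>R ?V S) \<le> 2 * s"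
            using simplex_partial_mixture(2)[OF \<eta> \<zeta>, of 1 S] s by (simp add: mult.commute)
          show "norm (?a - ?b - ?c + \<eta>) \<le> 0" unfolding a by simp
          show "norm (?a - ?b) \<le> 2 * s" unfolding a using nv by simp
          show "norm (?c - \<eta>) \<le> 2 * s" using nv by simp
          show "norm (?a - ?c) \<le> 2 * s" unfolding a using nV by simp
          show "norm (?b - \<eta>) \<le> 2 * s" using nV by simp
        qed (use s C in auto)
        also have "\<dots> = 16 * C * s\<^sup>2" by (simp add: power2_eq_square)
        finally have st: "\<bar>K ?a - K ?b - ?k z\<bar> \<le> 16 * C * s\<^sup>2" by (simp add: abs_le_iff)
        have "real (card (insert z S)) = real (card S) + 1" using 2 by simp
        then have "16 * C * s\<^sup>2 * real (card (insert z S)) = 16 * C * s\<^sup>2 * real (card S) + 16 * C * s\<^sup>2"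
          by (simp add: distrib_left)
        moreover have "(\<Sum>z\<in>insert z S. ?k z) = ?k z + (\<Sum>z\<in>S. ?k z)" using 2 by simp
        ultimately show ?case using st 2(3) by linarith
      qed
      have V: "?V UNIV = \<zeta> - \<eta>"
      proof -
        have "?V UNIV = (\<Sum>z\<in>UNIV. \<zeta> $ z *\<^sub>R axis z 1) - (\<Sum>z\<in>UNIV. \<zeta> $ z) *\<^sub>R \<eta>"
          by (simp add: scaleR_diff_right sum_subtractf scaleR_sum_left)
        also have "(\<Sum>z\<in>UNIV. \<zeta> $ z *\<^sub>R axis z 1) = \<zeta>"
          by (simp add: vec_eq_iff axis_def if_distrib cong: if_cong)
        finally show ?thesis using simplex_sum[OF \<zeta>] by simp
      qed
      have A: "\<bar>K (\<eta> + s *\<^sub>R (\<zeta> - \<eta>)) - K \<eta> - (\<Sum>z\<in>UNIV. ?k z)\<bar> \<le> 16 * C * s\<^sup>2 * real CARD('n)"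
        using part[of UNIV] unfolding V by simp
      have B: "\<bar>K (\<eta> + s *\<^sub>R (\<zeta> - \<eta>)) - K \<eta> - s * D \<eta> \<zeta>\<bar> \<le> 24 * C * s\<^sup>2"
        using D24[OF \<eta> \<zeta>, of s] s by simp
      have "\<bar>(\<Sum>z\<in>UNIV. ?k z) - s * (G \<eta> \<bullet> \<zeta>)\<bar> \<le> (\<Sum>z\<in>(UNIV::'n set). 24 * C * s\<^sup>2)"
      proof -
        have "s * (G \<eta> \<bullet> \<zeta>) = (\<Sum>z\<in>UNIV. (s * \<zeta> $ z) * D \<eta> (axis z 1))"
          by (simp add: G_def inner_vec_def sum_distrib_left mult_ac)
        then have "\<bar>(\<Sum>z\<in>UNIV. ?k z) - s * (G \<eta> \<bullet> \<zeta>)\<bar> \<le> (\<Sum>z\<in>UNIV. \<bar>?k z - (s * \<zeta> $ z) * D \<eta> (axis z 1)\<bar>)"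
          by (simp add: sum_subtractf[symmetric])
        also have "\<dots> \<le> (\<Sum>z\<in>(UNIV::'n set). 24 * C * s\<^sup>2)"
        proof (rule sum_mono)
          fix z
          have "\<bar>?k z - (s * \<zeta> $ z) * D \<eta> (axis z 1)\<bar> \<le> 24 * C * (s * \<zeta> $ z)\<^sup>2"
            by (intro D24 \<eta> vertex_in_simplex sz sz1)
          also have "\<dots> \<le> 24 * C * s\<^sup>2" using C sz by (intro mult_left_mono power_mono) auto
          finally show "\<bar>?k z - (s * \<zeta> $ z) * D \<eta> (axis z 1)\<bar> \<le> 24 * C * s\<^sup>2" .
        qed
        finally show ?thesis .
      qed
      also have "\<dots> = 24 * C * s\<^sup>2 * real CARD('n)" by simp
      finally have E: "\<bar>(\<Sum>z\<in>UNIV. ?k z) - s * (G \<eta> \<bullet> \<zeta>)\<bar> \<le> 24 * C * s\<^sup>2 * real CARD('n)" .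
      have "M * s\<^sup>2 = 24 * C * s\<^sup>2 + 24 * C * s\<^sup>2 * real CARD('n) + 16 * C * s\<^sup>2 * real CARD('n)"
        by (simp add: M_def algebra_simps)
      with A B E show ?thesis by linarith
    qed
    show ?thesis
    proof (rule antisym)
      show "D \<eta> \<zeta> \<le> G \<eta> \<bullet> \<zeta>"
      proof (rule le_of_quadratic_error)
        show "s * D \<eta> \<zeta> \<le> s * (G \<eta> \<bullet> \<zeta>) + M * s\<^sup>2" if "0 < s" "s \<le> 1" for s
          using est[OF that] by linarith
      qed
      show "G \<eta> \<bullet> \<zeta> \<le> D \<eta> \<zeta>"
      proof (rule le_of_quadratic_error)
        show "s * (G \<eta> \<bullet> \<zeta>) \<le> s * D \<eta> \<zeta> + M * s\<^sup>2" if "0 < s" "s \<le> 1" for s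
          using est[OF that] by linarith
      qed
    qed
  qed
  have taylor: "\<bar>K \<zeta> - K \<eta> - G \<eta> \<bullet> (\<zeta> - \<eta>)\<bar> \<le> 6 * C * (norm (\<zeta> - \<eta>))\<^sup>2"
    if \<eta>: "\<eta> \<in> prob_simplex" and \<zeta>: "\<zeta> \<in> prob_simplex" for \<eta> \<zeta>
  proof -
    have "D \<eta> \<eta> = 0" using D[OF \<eta> \<eta>, of 1] by simp
    then have "G \<eta> \<bullet> (\<zeta> - \<eta>) = D \<eta> \<zeta>" using lin[OF \<eta> \<zeta>] lin[OF \<eta> \<eta>] by (simp add: inner_diff_right)
    then show ?thesis using D[OF \<eta> \<zeta>, of 1] by simp
  qed
  have Gz: "\<bar>G \<eta> $ z\<bar> \<le> 2 * C" if \<eta>: "\<eta> \<in> prob_simplex" for \<eta> z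
  proof (rule le_of_quadratic_error[of _ _ "24 * C"])
    fix s :: real assume s: "0 < s" "s \<le> 1"
    let ?e = "axis z 1 - \<eta>"
    have "\<bar>K (\<eta> + s *\<^sub>R ?e) - K \<eta>\<bar> \<le> C * norm (\<eta> + s *\<^sub>R ?e - \<eta>)"
      using s by (intro lip simplex_segment vertex_in_simplex \<eta>) auto
    also have "\<dots> = C * (s * norm ?e)" using s by simp
    also have "\<dots> \<le> C * (s * 2)" using C s by (intro mult_left_mono simplex_diff_norm vertex_in_simplex \<eta>) auto
    finally have "\<bar>K (\<eta> + s *\<^sub>R ?e) - K \<eta>\<bar> \<le> s * (2 * C)" by (simp only: mult_ac)
    moreover have "\<bar>K (\<eta> + s *\<^sub>R ?e) - K \<eta> - s * G \<eta> $ z\<bar> \<le> 24 * C * s\<^sup>2"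
      using D24[OF \<eta> vertex_in_simplex, of s z] s by (simp add: G_def)
    ultimately have "\<bar>s * G \<eta> $ z\<bar> \<le> s * (2 * C) + 24 * C * s\<^sup>2" by linarith
    then show "s * \<bar>G \<eta> $ z\<bar> \<le> s * (2 * C) + 24 * C * s\<^sup>2" using s by (simp add: abs_mult)
  qed
  \<comment> \<open>The four points \<open>\<eta>\<close>, \<open>\<zeta>\<close> and their displacements by
    \<open>s\<close> towards the vertex \<open>z\<close> form a trapezoid with defect
    \<open>s * norm (\<eta> - \<zeta>)\<close>.\<close>
  have GG: "\<bar>G \<eta> $ z - G \<zeta> $ z\<bar> \<le> 9 * C * norm (\<eta> - \<zeta>)" if \<eta>: "\<eta> \<in> prob_simplex" and \<zeta>: "\<zeta> \<in> prob_simplex" for \<eta> \<zeta> z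
  proof (rule le_of_quadratic_error[of _ _ "48 * C"])
    fix s :: real assume s: "0 < s" "s \<le> 1"
    let ?a = "\<eta> + s *\<^sub>R (axis z 1 - \<eta>)" and ?c = "\<zeta> + s *\<^sub>R (axis z 1 - \<zeta>)"
    let ?N = "norm (\<eta> - \<zeta>)"
    have "\<bar>K ?a - K \<eta> - K ?c + K \<zeta>\<bar> \<le> C * (norm (?a - \<eta> - ?c + \<zeta>)
           + (norm (?a - \<eta>) + norm (?c - \<zeta>)) * (norm (?a - ?c) + norm (\<eta> - \<zeta>)))"
      using s by (intro sec simplex_segment vertex_in_simplex \<eta> \<zeta>) auto
    also have "\<dots> \<le> C * (s * ?N + (2 * s + 2 * s) * (?N + ?N))"
    proof (intro mult_left_mono add_mono mult_mono)
      have "?a - \<eta> - ?c + \<zeta> = (- s) *\<^sub>R (\<eta> - \<zeta>)" by (simp add: algebra_simps)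
      then show "norm (?a - \<eta> - ?c + \<zeta>) \<le> s * ?N" using s by (simp only: norm_scaleR)
      show "norm (?a - \<eta>) \<le> 2 * s" using mult_left_mono[OF simplex_diff_norm[OF vertex_in_simplex \<eta>, of z], of s] s by simp
      show "norm (?c - \<zeta>) \<le> 2 * s" using mult_left_mono[OF simplex_diff_norm[OF vertex_in_simplex \<zeta>, of z], of s] s by simp
      have "?a - ?c = (1 - s) *\<^sub>R (\<eta> - \<zeta>)" by (simp add: algebra_simps)
      then have "norm (?a - ?c) = (1 - s) * ?N" using s by (simp only: norm_scaleR)
      also have "\<dots> \<le> 1 * ?N" using s by (intro mult_right_mono) auto
      finally show "norm (?a - ?c) \<le> ?N" by simp
    qed (use s C in auto)
    also have "\<dots> = s * (9 * C * ?N)" by (simp add: algebra_simps)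
    finally have 1: "\<bar>K ?a - K \<eta> - K ?c + K \<zeta>\<bar> \<le> s * (9 * C * ?N)" .
    have 2: "\<bar>K ?a - K \<eta> - s * G \<eta> $ z\<bar> \<le> 24 * C * s\<^sup>2"
      using D24[OF \<eta> vertex_in_simplex, of s z] s by (simp add: G_def)
    have 3: "\<bar>K ?c - K \<zeta> - s * G \<zeta> $ z\<bar> \<le> 24 * C * s\<^sup>2"
      using D24[OF \<zeta> vertex_in_simplex, of s z] s by (simp add: G_def)
    define X where "X = 24 * C * s\<^sup>2"
    have "\<bar>s * G \<eta> $ z - s * G \<zeta> $ z\<bar> \<le> s * (9 * C * ?N) + 2 * X" using 1 2 3 unfolding X_def[symmetric] by linarith
    then have "\<bar>s * (G \<eta> $ z - G \<zeta> $ z)\<bar> \<le> s * (9 * C * ?N) + 48 * C * s\<^sup>2" by (simp add: right_diff_distrib X_def)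
    then show "s * \<bar>G \<eta> $ z - G \<zeta> $ z\<bar> \<le> s * (9 * C * ?N) + 48 * C * s\<^sup>2" using s by (simp add: abs_mult)
  qed
  have nG: "norm (G \<eta>) \<le> 2 * real CARD('n) * C" if "\<eta> \<in> prob_simplex" for \<eta>
    using norm_le_card_bound[OF Gz[OF that]] by simp
  have nGG: "norm (G \<eta> - G \<zeta>) \<le> 9 * real CARD('n) * C * norm (\<eta> - \<zeta>)"
    if "\<eta> \<in> prob_simplex" "\<zeta> \<in> prob_simplex" for \<eta> \<zeta>
    using norm_le_card_bound[of "G \<eta> - G \<zeta>" "9 * C * norm (\<eta> - \<zeta>)"] GG[OF that] by (simp add: mult_ac)
  have "continuous_on prob_simplex G"
    by (rule lipschitz_on_continuous_on[of "9 * real CARD('n) * C"], rule lipschitz_onI)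
      (use nGG C in \<open>auto simp: dist_norm\<close>)
  moreover have "(K has_derivative (\<lambda>v. G \<eta> \<bullet> v)) (at \<eta> within prob_simplex)" if \<eta>: "\<eta> \<in> prob_simplex" for \<eta>
    unfolding has_derivative_within_alt
  proof (intro conjI allI impI)
    show "bounded_linear (\<lambda>v. G \<eta> \<bullet> v)" by (rule bounded_linear_inner_right)
    fix e :: real assume e: "0 < e"
    show "\<exists>\<delta>>0. \<forall>\<zeta>\<in>prob_simplex. norm (\<zeta> - \<eta>) < \<delta> \<longrightarrow>
        norm (K \<zeta> - K \<eta> - G \<eta> \<bullet> (\<zeta> - \<eta>)) \<le> e * norm (\<zeta> - \<eta>)"
    proof (intro exI[of _ "e / (6 * C + 1)"] conjI ballI impI)
      show "0 < e / (6 * C + 1)" using e C by simp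
      fix \<zeta> assume \<zeta>: "\<zeta> \<in> prob_simplex" and near: "norm (\<zeta> - \<eta>) < e / (6 * C + 1)"
      have "(6 * C + 1) * norm (\<zeta> - \<eta>) \<le> e" using near C by (simp add: field_simps)
      then have "6 * C * norm (\<zeta> - \<eta>) \<le> e" by (simp add: algebra_simps) (smt (verit) norm_ge_zero)
      then have "6 * C * norm (\<zeta> - \<eta>) * norm (\<zeta> - \<eta>) \<le> e * norm (\<zeta> - \<eta>)" by (intro mult_right_mono) auto
      then show "norm (K \<zeta> - K \<eta> - G \<eta> \<bullet> (\<zeta> - \<eta>)) \<le> e * norm (\<zeta> - \<eta>)"
        using taylor[OF \<eta> \<zeta>] by (simp add: power2_eq_square mult.assoc)
    qed
  qed
  ultimately show ?thesis using nG nGG unfolding simplex_gradient_def by (intro exI[of _ G]) simp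
qed

text \<open>The difference of \<open>h\<close> along the segments from \<open>b\<close> to \<open>a\<close> and from
  \<open>d\<close> to \<open>c\<close> is differentiated in the common parameter; the derivative differs from its
  linear part by products of two first differences, one in each direction of the quadrilateral.\<close>

lemma second_difference_bound:
  fixes h :: "'a::real_normed_vector \<Rightarrow> 'b::real_normed_vector"
  assumes S: "convex S" and L: "0 \<le> L"
    and h: "\<And>x. x \<in> S \<Longrightarrow> (h has_derivative h' x) (at x within S)"
    and h': "\<And>x y v. x \<in> S \<Longrightarrow> y \<in> S \<Longrightarrow> norm (h' x v - h' y v) \<le> L * norm (x - y) * norm v"
    and abcd: "a \<in> S" "b \<in> S" "c \<in> S" "d \<in> S"
  shows "norm (h a - h b - h c + h d - h' a (a - b - c + d))
    \<le> 3 * L * (norm (a - b) + norm (c - d)) * (norm (a - c) + norm (b - d))"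
proof -
  define w where "w = a - b - c + d"
  define X where "X = norm (a - b) + norm (c - d)"
  define Y where "Y = norm (a - c) + norm (b - d)"
  have X: "0 \<le> X" and Y: "0 \<le> Y" by (auto simp: X_def Y_def)
  have wX: "norm w \<le> X" using norm_triangle_ineq4[of "a - b" "c - d"] by (simp add: w_def X_def algebra_simps)
  have wY: "norm w \<le> Y" using norm_triangle_ineq4[of "a - c" "b - d"] by (simp add: w_def Y_def algebra_simps)
  let ?p = "\<lambda>s::real. b + s *\<^sub>R (a - b)" and ?q = "\<lambda>s::real. d + s *\<^sub>R (c - d)"
  have seg: "x + s *\<^sub>R (y - x) \<in> S" if "x \<in> S" "y \<in> S" "s \<in> {0..1}" for x y and s :: real
  proof -
    have "(1 - s) *\<^sub>R x + s *\<^sub>R y \<in> S" using that by (intro convexD_alt[OF S]) auto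
    then show ?thesis by (simp add: algebra_simps)
  qed
  have lin: "linear (h' x)" if "x \<in> S" for x using h[OF that] has_derivative_linear by blast
  define D where "D = (\<lambda>s. h' (?p s) (a - b) - h' (?q s) (c - d) - h' a w)"
  define \<psi> where "\<psi> = (\<lambda>s. h (?p s) - h (?q s) - s *\<^sub>R h' a w)"
  have hp: "((\<lambda>s. h (x + s *\<^sub>R (y - x))) has_derivative (\<lambda>t. t *\<^sub>R h' (x + s *\<^sub>R (y - x)) (y - x))) (at s within {0..1})"
    if xy: "x \<in> S" "y \<in> S" and s: "s \<in> {0..1}" for x y and s :: real
  proof -
    have p: "((\<lambda>s. x + s *\<^sub>R (y - x)) has_derivative (\<lambda>t. t *\<^sub>R (y - x))) (at s within {0..1})"
      by (auto intro!: derivative_eq_intros)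
    have "(h has_derivative h' (x + s *\<^sub>R (y - x))) (at (x + s *\<^sub>R (y - x)) within (\<lambda>s. x + s *\<^sub>R (y - x)) ` {0..1})"
      by (rule has_derivative_subset[OF h[OF seg[OF xy s]]]) (use seg[OF xy] in auto)
    from has_derivative_in_compose[OF p this]
    show ?thesis by (simp add: linear_scale[OF lin[OF seg[OF xy s]]])
  qed
  have "norm (\<psi> 1 - \<psi> 0) \<le> (3 * L * X * Y) * norm (1 - 0 :: real)"
  proof (rule differentiable_bound[of "{0..1::real}"])
    fix s :: real assume s: "s \<in> {0..1}"
    have "(\<psi> has_derivative (\<lambda>t. t *\<^sub>R h' (?p s) (a - b) - t *\<^sub>R h' (?q s) (c - d) - t *\<^sub>R h' a w)) (at s within {0..1})"
      unfolding \<psi>_def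
      by (intro has_derivative_diff hp s abcd has_derivative_scaleR_left has_derivative_ident)
    then show "(\<psi> has_derivative (\<lambda>t. t *\<^sub>R D s)) (at s within {0..1})"
      by (simp add: D_def scaleR_diff_right)
    have ps: "?p s \<in> S" and qs: "?q s \<in> S" using seg[OF _ _ s] abcd by auto
    have cd: "h' (?q s) (c - d) = h' (?q s) (a - b) - h' (?q s) w"
      by (simp add: linear_diff[OF lin[OF qs], symmetric] w_def)
    have "D s = (h' (?p s) (a - b) - h' (?q s) (a - b)) + (h' (?q s) w - h' a w)"
      unfolding D_def cd by simp
    then have "norm (D s) \<le> L * norm (?p s - ?q s) * norm (a - b) + L * norm (?q s - a) * norm w"
      by (simp only:) (intro norm_triangle_le add_mono h' ps qs abcd)
    also have "\<dots> \<le> L * Y * X + (L * X * Y + L * Y * X)"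
    proof (rule add_mono)
      have "?p s - ?q s = (1 - s) *\<^sub>R (b - d) + s *\<^sub>R (a - c)" by (simp add: algebra_simps)
      then have "norm (?p s - ?q s) \<le> (1 - s) * norm (b - d) + s * norm (a - c)"
        using norm_triangle_ineq[of "(1 - s) *\<^sub>R (b - d)" "s *\<^sub>R (a - c)"] s by simp
      also have "\<dots> \<le> 1 * norm (b - d) + 1 * norm (a - c)" using s by (intro add_mono mult_right_mono) auto
      finally have pq: "norm (?p s - ?q s) \<le> Y" by (simp add: Y_def)
      show "L * norm (?p s - ?q s) * norm (a - b) \<le> L * Y * X"
        by (intro mult_mono mult_nonneg_nonneg pq L Y) (auto simp: X_def)
      have "?q s - a = (1 - s) *\<^sub>R (d - a) + s *\<^sub>R (c - a)" by (simp add: algebra_simps)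
      then have "norm (?q s - a) \<le> (1 - s) * norm (d - a) + s * norm (c - a)"
        using norm_triangle_ineq[of "(1 - s) *\<^sub>R (d - a)" "s *\<^sub>R (c - a)"] s by simp
      also have "\<dots> \<le> 1 * norm (d - a) + 1 * norm (c - a)" using s by (intro add_mono mult_right_mono) auto
      also have "norm (d - a) \<le> norm (a - b) + norm (b - d)" using norm_triangle_ineq[of "a - b" "b - d"] by (simp add: norm_minus_commute)
      finally have "norm (?q s - a) \<le> norm (a - b) + norm (b - d) + norm (a - c)" by (simp add: norm_minus_commute)
      then have qa: "norm (?q s - a) \<le> X + Y"
        using norm_ge_zero[of "c - d"] unfolding X_def Y_def by linarith
      have "L * norm (?q s - a) * norm w \<le> L * (X + Y) * norm w"
        by (intro mult_right_mono mult_left_mono qa L) auto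
      also have "\<dots> = L * X * norm w + L * Y * norm w" by (simp add: algebra_simps)
      also have "\<dots> \<le> L * X * Y + L * Y * X" using wX wY L X Y by (intro add_mono mult_left_mono) auto
      finally show "L * norm (?q s - a) * norm w \<le> L * X * Y + L * Y * X" .
    qed
    also have "\<dots> = 3 * L * X * Y" by simp
    finally show "onorm (\<lambda>t. t *\<^sub>R D s) \<le> 3 * L * X * Y"
      by (intro onorm_le) (simp add: mult.commute[of "norm (D s)"] mult_left_mono mult.commute[of _ "\<bar>_\<bar>"])
  qed auto
  moreover have "\<psi> 1 - \<psi> 0 = h a - h b - h c + h d - h' a w" by (simp add: \<psi>_def)
  ultimately show ?thesis by (simp add: w_def X_def Y_def)
qed

section \<open>The Hamiltonian and the optimal rates\<close>

lemma norm_matrix_vector_le: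
  fixes A :: "real ^ 'n::finite ^ 'm::finite"
  shows "norm (A *v v) \<le> real CARD('m) * norm A * norm v"
proof -
  have "\<bar>(A *v v) $ i\<bar> \<le> norm A * norm v" for i
  proof -
    have "\<bar>(A *v v) $ i\<bar> \<le> norm (A $ i) * norm v"
      unfolding matrix_vector_mul_component by (rule Cauchy_Schwarz_ineq2)
    also have "\<dots> \<le> norm A * norm v" by (intro mult_right_mono Finite_Cartesian_Product.norm_nth_le) auto
    finally show ?thesis .
  qed
  from norm_le_card_bound[OF this] show ?thesis by (simp add: mult.assoc)
qed

lemma Delta_nth [simp]: "Delta x w $ y = w $ y - w $ x"
  by (simp add: Delta_def)

lemma Delta_diff: "Delta x (v - w) = Delta x v - Delta x w"
  by (simp add: vec_eq_iff)

lemma Delta_add: "Delta x (v + w) = Delta x v + Delta x w"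
  by (simp add: vec_eq_iff)

lemma norm_Delta_le: "norm (Delta x (w :: real ^ 'n::finite)) \<le> real CARD('n) * osc w"
  by (rule norm_le_card_bound) (simp add: osc_abs)

text \<open>The differences from \<open>x\<close> of the two states that realise the oscillation already account for
  it.\<close>

lemma osc_le_Delta: "(osc w)\<^sup>2 \<le> 2 * (norm (Delta x (w :: real ^ 'n::finite)))\<^sup>2"
proof -
  obtain a b where ab: "osc w = w $ a - w $ b" using osc_attained by blast
  show ?thesis
  proof (cases "a = b")
    case True
    then show ?thesis using ab by simp
  next
    case False
    have "(w $ a - w $ x)\<^sup>2 + (w $ b - w $ x)\<^sup>2 = (\<Sum>y\<in>{a, b}. (Delta x w $ y)\<^sup>2)" using False by simp
    also have "\<dots> \<le> (\<Sum>y\<in>UNIV. (Delta x w $ y)\<^sup>2)" by (rule sum_mono2) auto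
    also have "\<dots> = (norm (Delta x w))\<^sup>2" by (simp add: norm_eq_sqrt_inner inner_vec_def power2_eq_square sum_nonneg)
    finally have "(w $ a - w $ x)\<^sup>2 + (w $ b - w $ x)\<^sup>2 \<le> (norm (Delta x w))\<^sup>2" .
    moreover have "(osc w)\<^sup>2 \<le> 2 * ((w $ a - w $ x)\<^sup>2 + (w $ b - w $ x)\<^sup>2)"
    proof -
      define p q where "p = w $ a - w $ x" and "q = w $ b - w $ x"
      have "osc w = p - q" by (simp add: ab p_def q_def)
      moreover have "2 * (p\<^sup>2 + q\<^sup>2) - (p - q)\<^sup>2 = (p + q)\<^sup>2" by (simp add: power2_eq_square algebra_simps)
      moreover have "0 \<le> (p + q)\<^sup>2" by simp
      ultimately show ?thesis unfolding p_def[symmetric] q_def[symmetric] by (simp only:)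
    qed
    ultimately show ?thesis by (meson order_trans mult_left_mono zero_le_numeral)
  qed
qed

locale mean_field_game =
  fixes al au :: real
    and f :: "'n::finite \<Rightarrow> real ^ 'n \<Rightarrow> real"
    and F :: "'n \<Rightarrow> real ^ 'n \<Rightarrow> real"
    and H :: "'n \<Rightarrow> real ^ 'n \<Rightarrow> real"
    and g :: "'n \<Rightarrow> real ^ 'n \<Rightarrow> real ^ 'n"
  assumes H_def: "H = hamiltonian al au f"
    and g_def: "g = opt_rate al au f"
    and A1: "0 < al" "al < au"
    and A2: "\<And>x p. \<exists>!a. minimizing_rate al au f x p a"
    and A3: "\<And>x. simplex_C1 (F x)" "\<And>x. \<exists>L. L-lipschitz_on prob_simplex (simplex_jac (F x))"
    and A4: "lasry_lions_monotone F"
    and A5: "\<And>x. regular_concave_at x (H x)"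
begin

lemma optimal: "minimizing_rate al au f x p (g x p)"
  unfolding g_def opt_rate_def by (rule theI'[OF A2])

lemma rate_sum: "(\<Sum>z\<in>UNIV. g x p $ z) = 0"
  using optimal[of x p] by (simp add: minimizing_rate_def rate_vectors_def sum.remove[of UNIV x])

lemma rate_generator: "generator al au (\<lambda>y z. g y (p y) $ z)"
  unfolding generator_def
proof (intro conjI allI impI)
  fix x y :: 'n assume "x \<noteq> y"
  then have "g x (p x) $ y \<in> {al..au}" using optimal[of x "p x"]
    unfolding minimizing_rate_def rate_vectors_def off_diagonal_rates_def by auto
  then show "al \<le> g x (p x) $ y" "g x (p x) $ y \<le> au" by auto
qed (rule rate_sum)

lemma H_eq: "H x p = f x (g x p) + g x p \<bullet> p"
  unfolding H_def hamiltonian_def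
  using optimal[of x p] by (intro cInf_eq_minimum) (auto simp: minimizing_rate_def)

text \<open>As an infimum of affine functions the Hamiltonian is concave, with the optimal rate as a
  supergradient.\<close>

lemma H_concave: "H x q \<le> H x p + g x p \<bullet> (q - p)"
proof -
  have "f x (g x q) + g x q \<bullet> q \<le> f x (g x p) + g x p \<bullet> q"
    using optimal[of x q] optimal[of x p] by (auto simp: minimizing_rate_def)
  then show ?thesis unfolding H_eq by (simp add: inner_diff_right)
qed

text \<open>A choice of the second derivative of the Hamiltonian; it can be specified through \<open>g\<close> because
  the first derivative is the optimal rate.\<close>

definition Hess :: "'n \<Rightarrow> real ^ 'n \<Rightarrow> real ^ 'n ^ 'n" where
  "Hess x = (SOME Q. (\<forall>p. (g x has_derivative (\<lambda>q. Q p *v q)) (at p)) \<and>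
     (\<forall>S. compact S \<longrightarrow> (\<exists>L. L-lipschitz_on S Q) \<and>
        (\<exists>c>0. \<forall>p\<in>S. \<forall>q. q $ x = 0 \<longrightarrow> q \<bullet> (Q p *v q) \<le> - c * (norm q)\<^sup>2)))"

lemma H_gradient_and_Hess:
  shows H_gradient: "(H x has_derivative (\<lambda>v. g x p \<bullet> v)) (at p)"
    and Hess: "(\<forall>p. (g x has_derivative (\<lambda>q. Hess x p *v q)) (at p)) \<and>
     (\<forall>S. compact S \<longrightarrow> (\<exists>L. L-lipschitz_on S (Hess x)) \<and>
        (\<exists>c>0. \<forall>p\<in>S. \<forall>q. q $ x = 0 \<longrightarrow> q \<bullet> (Hess x p *v q) \<le> - c * (norm q)\<^sup>2))"
proof -
  obtain G and Q :: "real ^ 'n \<Rightarrow> real ^ 'n ^ 'n" where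
    GQ: "\<forall>p. GDERIV (H x) p :> G p" "\<forall>p. (G has_derivative (\<lambda>q. Q p *v q)) (at p)"
      "\<forall>S. compact S \<longrightarrow> (\<exists>L. L-lipschitz_on S G) \<and> (\<exists>L. L-lipschitz_on S Q) \<and>
           (\<exists>c>0. \<forall>p\<in>S. \<forall>q. q $ x = 0 \<longrightarrow> q \<bullet> (Q p *v q) \<le> - c * (norm q)\<^sup>2)"
    using A5[of x] unfolding regular_concave_at_def by blast
  \<comment> \<open>The function \<open>H x q - g x p \<bullet> (q - p)\<close> is maximal at \<open>q = p\<close>, so
    its gradient vanishes there.\<close>
  have Gg: "G p = g x p" for p
  proof -
    have "((\<lambda>q. H x q - g x p \<bullet> (q - p)) has_derivative (\<lambda>v. v \<bullet> G p - g x p \<bullet> v)) (at p)"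
      using GQ(1) by (auto intro!: derivative_eq_intros simp: gderiv_def)
    then have "(\<lambda>v. v \<bullet> G p - g x p \<bullet> v) = (\<lambda>v. 0)"
      by (rule differential_zero_maxmin[OF UNIV_I open_UNIV]) (use H_concave in \<open>auto simp: algebra_simps\<close>)
    then have "(G p - g x p) \<bullet> (G p - g x p) = 0"
      by (metis inner_commute inner_diff_left)
    then show ?thesis by simp
  qed
  then have G: "G = g x" by blast
  show "(H x has_derivative (\<lambda>v. g x p \<bullet> v)) (at p)" for p
    using GQ(1) unfolding G gderiv_def by (simp add: inner_commute)
  have "\<exists>Q. (\<forall>p. (g x has_derivative (\<lambda>q. Q p *v q)) (at p)) \<and>
     (\<forall>S. compact S \<longrightarrow> (\<exists>L. L-lipschitz_on S Q) \<and>
        (\<exists>c>0. \<forall>p\<in>S. \<forall>q. q $ x = 0 \<longrightarrow> q \<bullet> (Q p *v q) \<le> - c * (norm q)\<^sup>2))"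
    using GQ(2,3) unfolding G by (intro exI[of _ Q]) simp
  from someI_ex[OF this] show "(\<forall>p. (g x has_derivative (\<lambda>q. Hess x p *v q)) (at p)) \<and>
     (\<forall>S. compact S \<longrightarrow> (\<exists>L. L-lipschitz_on S (Hess x)) \<and>
        (\<exists>c>0. \<forall>p\<in>S. \<forall>q. q $ x = 0 \<longrightarrow> q \<bullet> (Hess x p *v q) \<le> - c * (norm q)\<^sup>2))"
    unfolding Hess_def .
qed

lemma g_deriv: "(g x has_derivative (\<lambda>q. Hess x p *v q)) (at p)"
  using Hess[of x] by blast

lemma g_continuous: "continuous_on S (g x)"
  using g_deriv[of x] has_derivative_continuous continuous_at_imp_continuous_on by blast

lemma H_continuous: "continuous_on S (H x)"
  using H_gradient[of x] has_derivative_continuous continuous_at_imp_continuous_on by blast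

lemma local_constants:
  "\<exists>L>0. \<exists>c>0. \<forall>x. \<forall>p\<in>cball 0 R. (\<forall>v. norm (Hess x p *v v) \<le> L * norm v) \<and>
     (\<forall>q\<in>cball 0 R. \<forall>v. norm (Hess x p *v v - Hess x q *v v) \<le> L * norm (p - q) * norm v) \<and>
     (\<forall>q. q $ x = 0 \<longrightarrow> q \<bullet> (Hess x p *v q) \<le> - c * (norm q)\<^sup>2)"
proof -
  let ?S = "cball (0 :: real ^ 'n) R"
  have "\<exists>L. L-lipschitz_on ?S (Hess x)" for x using Hess[of x] compact_cball by blast
  then obtain L1 where L1: "\<And>x. (L1 x)-lipschitz_on ?S (Hess x)" by metis
  have "\<exists>c>0. \<forall>p\<in>?S. \<forall>q. q $ x = 0 \<longrightarrow> q \<bullet> (Hess x p *v q) \<le> - c * (norm q)\<^sup>2" for x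
    using Hess[of x] compact_cball by blast
  then obtain c1 where c1: "\<And>x. 0 < c1 x" "\<And>x p q. p \<in> ?S \<Longrightarrow> q $ x = 0 \<Longrightarrow> q \<bullet> (Hess x p *v q) \<le> - c1 x * (norm q)\<^sup>2"
    by metis
  have "bounded (Hess x ` ?S)" for x
    by (intro compact_imp_bounded compact_continuous_image lipschitz_on_continuous_on[OF L1] compact_cball)
  then have "\<exists>B. \<forall>p\<in>?S. norm (Hess x p) \<le> B" for x by (auto simp: bounded_iff)
  then obtain B1 where B1: "\<And>x p. p \<in> ?S \<Longrightarrow> norm (Hess x p) \<le> B1 x" by metis
  define d where "d = real CARD('n)"
  have d: "0 < d" by (simp add: d_def)
  define L where "L = d * (1 + (\<Sum>x\<in>UNIV. \<bar>L1 x\<bar>) + (\<Sum>x\<in>UNIV. \<bar>B1 x\<bar>))"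
  define c where "c = Min (range c1)"
  have s0: "0 \<le> (\<Sum>x\<in>UNIV. \<bar>L1 x\<bar>)" "0 \<le> (\<Sum>x\<in>UNIV. \<bar>B1 x\<bar>)" by (auto intro: sum_nonneg)
  then have "0 < 1 + (\<Sum>x\<in>UNIV. \<bar>L1 x\<bar>) + (\<Sum>x\<in>UNIV. \<bar>B1 x\<bar>)" by linarith
  then have L: "0 < L" unfolding L_def using d by (rule mult_pos_pos[rotated])
  have c: "0 < c" unfolding c_def using c1(1) by (simp add: Min_gr_iff)
  have "\<bar>L1 x\<bar> \<le> (\<Sum>x\<in>UNIV. \<bar>L1 x\<bar>)" "\<bar>B1 x\<bar> \<le> (\<Sum>x\<in>UNIV. \<bar>B1 x\<bar>)" for x
    by (rule member_le_sum; simp)+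
  then have "L1 x \<le> 1 + (\<Sum>x\<in>UNIV. \<bar>L1 x\<bar>) + (\<Sum>x\<in>UNIV. \<bar>B1 x\<bar>)"
    "B1 x \<le> 1 + (\<Sum>x\<in>UNIV. \<bar>L1 x\<bar>) + (\<Sum>x\<in>UNIV. \<bar>B1 x\<bar>)" for x
    using s0 by (simp_all add: abs_le_iff algebra_simps) (smt (verit))+
  then have LB: "d * L1 x \<le> L" "d * B1 x \<le> L" for x unfolding L_def using d
    by (simp_all add: mult_left_mono)
  have 1: "norm (Hess x p *v v) \<le> L * norm v" if "p \<in> ?S" for x p v
  proof -
    have "norm (Hess x p *v v) \<le> d * norm (Hess x p) * norm v" unfolding d_def by (rule norm_matrix_vector_le)
    also have "\<dots> \<le> d * B1 x * norm v" using B1[OF that] d by (intro mult_right_mono mult_left_mono) auto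
    also have "\<dots> \<le> L * norm v" by (intro mult_right_mono LB) auto
    finally show ?thesis .
  qed
  have 2: "norm (Hess x p *v v - Hess x q *v v) \<le> L * norm (p - q) * norm v" if "p \<in> ?S" "q \<in> ?S" for x p q v
  proof -
    have "norm (Hess x p *v v - Hess x q *v v) \<le> d * norm (Hess x p - Hess x q) * norm v"
      unfolding d_def matrix_vector_mult_diff_rdistrib[symmetric] by (rule norm_matrix_vector_le)
    also have "\<dots> \<le> d * (L1 x * norm (p - q)) * norm v"
      using lipschitz_onD[OF L1 that] d by (intro mult_right_mono mult_left_mono) (auto simp: dist_norm)
    also have "\<dots> = (d * L1 x) * norm (p - q) * norm v" by simp
    also have "\<dots> \<le> L * norm (p - q) * norm v" by (intro mult_right_mono LB) auto
    finally show ?thesis .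
  qed
  have 3: "q \<bullet> (Hess x p *v q) \<le> - c * (norm q)\<^sup>2" if "p \<in> ?S" "q $ x = 0" for x p q
  proof -
    have "c \<le> c1 x" unfolding c_def by simp
    then have "c * (norm q)\<^sup>2 \<le> c1 x * (norm q)\<^sup>2" by (intro mult_right_mono) auto
    then show ?thesis using c1(2)[OF that] by linarith
  qed
  show ?thesis
    by (rule exI[of _ L], rule conjI[OF L], rule exI[of _ c], rule conjI[OF c]) (intro allI ballI conjI impI 1 2 3)
qed

lemma g_lipschitz:
  assumes L: "\<And>p v. p \<in> cball 0 R \<Longrightarrow> norm (Hess x p *v v) \<le> L * norm v"
    and "p \<in> cball 0 R" "q \<in> cball 0 R"
  shows "norm (g x p - g x q) \<le> L * norm (p - q)"
proof (rule differentiable_bound[OF convex_cball _ _ assms(2,3)])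
  show "(g x has_derivative (\<lambda>v. Hess x p *v v)) (at p within cball 0 R)" for p
    by (rule has_derivative_at_withinI[OF g_deriv])
  show "onorm (\<lambda>v. Hess x p *v v) \<le> L" if "p \<in> cball 0 R" for p by (rule onorm_le[OF L[OF that]])
qed

text \<open>The strong concavity of the Hessian is available only in directions without \<open>x\<close>-component;
  differences of vectors \<open>Delta x\<close> are of this kind.\<close>

lemma H_strongly_concave:
  assumes c: "\<And>p q. p \<in> cball 0 R \<Longrightarrow> q $ x = 0 \<Longrightarrow> q \<bullet> (Hess x p *v q) \<le> - c * (norm q)\<^sup>2"
    and p: "p \<in> cball 0 R" and q: "q \<in> cball 0 R" and x: "(q - p) $ x = 0"
  shows "H x q \<le> H x p + g x p \<bullet> (q - p) - c / 2 * (norm (q - p))\<^sup>2"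
proof -
  define v where "v = q - p"
  have inS: "p + s *\<^sub>R v \<in> cball 0 R" if "0 \<le> s" "s \<le> 1" for s
  proof -
    have "(1 - s) *\<^sub>R p + s *\<^sub>R q \<in> cball 0 R" using that p q by (intro convexD_alt[OF convex_cball]) auto
    then show ?thesis by (simp add: v_def algebra_simps)
  qed
  have line: "((\<lambda>s. p + s *\<^sub>R v) has_derivative (\<lambda>t. t *\<^sub>R v)) (at s)" for s
    by (auto intro!: derivative_eq_intros)
  have slope: "(g x (p + s *\<^sub>R v) - g x p) \<bullet> v \<le> - c * s * (norm v)\<^sup>2" if s: "0 \<le> s" "s \<le> 1" for s
  proof -
    define k where "k = (\<lambda>s. g x (p + s *\<^sub>R v) \<bullet> v + c * s * (norm v)\<^sup>2)"
    have "k s \<le> k 0"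
    proof (rule DERIV_nonpos_imp_nonincreasing[OF s(1)])
      fix t assume t: "0 \<le> t" "t \<le> s"
      have "((\<lambda>s. g x (p + s *\<^sub>R v)) has_derivative (\<lambda>h. Hess x (p + t *\<^sub>R v) *v (h *\<^sub>R v))) (at t)"
        using has_derivative_compose[OF line g_deriv] .
      then have "((\<lambda>s. g x (p + s *\<^sub>R v) \<bullet> v) has_derivative (\<lambda>h. (Hess x (p + t *\<^sub>R v) *v (h *\<^sub>R v)) \<bullet> v)) (at t)"
        by (rule has_derivative_inner_left)
      moreover have "(\<lambda>h. (Hess x (p + t *\<^sub>R v) *v (h *\<^sub>R v)) \<bullet> v) = (*) (v \<bullet> (Hess x (p + t *\<^sub>R v) *v v))"
        by (simp add: fun_eq_iff matrix_vector_mult_scaleR inner_commute)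
      ultimately have "((\<lambda>s. g x (p + s *\<^sub>R v) \<bullet> v) has_real_derivative (v \<bullet> (Hess x (p + t *\<^sub>R v) *v v))) (at t)"
        by (simp add: has_field_derivative_def)
      then have "(k has_real_derivative (v \<bullet> (Hess x (p + t *\<^sub>R v) *v v) + c * (norm v)\<^sup>2)) (at t)"
        unfolding k_def by (auto intro!: derivative_eq_intros)
      moreover have "v \<bullet> (Hess x (p + t *\<^sub>R v) *v v) + c * (norm v)\<^sup>2 \<le> 0"
        using c[OF inS, of t v] t s x by (simp add: v_def)
      ultimately show "\<exists>y. (k has_real_derivative y) (at t) \<and> y \<le> 0" by blast
    qed
    then show ?thesis by (simp add: k_def inner_diff_left)
  qed
  define \<psi> where "\<psi> = (\<lambda>s. H x (p + s *\<^sub>R v) - s * (g x p \<bullet> v) + c / 2 * s\<^sup>2 * (norm v)\<^sup>2)"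
  have "\<psi> 1 \<le> \<psi> 0"
  proof (rule DERIV_nonpos_imp_nonincreasing[of 0 1 \<psi>])
    fix s :: real assume s: "0 \<le> s" "s \<le> 1"
    have "((\<lambda>s. H x (p + s *\<^sub>R v)) has_derivative (\<lambda>h. g x (p + s *\<^sub>R v) \<bullet> (h *\<^sub>R v))) (at s)"
      using has_derivative_compose[OF line H_gradient] .
    then have "((\<lambda>s. H x (p + s *\<^sub>R v)) has_real_derivative (g x (p + s *\<^sub>R v) \<bullet> v)) (at s)"
      by (simp add: has_field_derivative_def mult_commute_abs)
    then have "(\<psi> has_real_derivative (g x (p + s *\<^sub>R v) \<bullet> v - g x p \<bullet> v + c * s * (norm v)\<^sup>2)) (at s)"
      unfolding \<psi>_def by (auto intro!: derivative_eq_intros)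
    moreover have "g x (p + s *\<^sub>R v) \<bullet> v - g x p \<bullet> v + c * s * (norm v)\<^sup>2 \<le> 0"
      using slope[OF s] by (simp add: inner_diff_left)
    ultimately show "\<exists>y. (\<psi> has_real_derivative y) (at s) \<and> y \<le> 0" by blast
  qed simp
  then show ?thesis by (simp add: \<psi>_def v_def)
qed

text \<open>Rates sum to \<open>0\<close>, so subtracting the reference value of \<open>w\<close> changes
  nothing.\<close>

lemma inner_Delta: "g y p \<bullet> Delta x w = (\<Sum>z\<in>UNIV. g y p $ z * w $ z)"
  using rate_sum[of y p] by (simp add: inner_vec_def right_diff_distrib sum_subtractf flip: sum_distrib_right)

text \<open>By concavity the increment of \<open>H x\<close> lies between its linearisations at the two end points, so
  it is realised exactly by a convex combination of two optimal rate vectors. Such combinations are again generators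
  with rates between \<open>al\<close> and \<open>au\<close>: without any smallness the difference of two solutions
  solves a linear backward equation to which the contraction applies.\<close>

lemma H_difference:
  "\<exists>M. generator al au M \<and> (\<forall>x. H x (Delta x u) - H x (Delta x v) = (\<Sum>z\<in>UNIV. M x z * (u - v) $ z))"
proof -
  have "\<exists>s. 0 \<le> s \<and> s \<le> 1 \<and> H x (Delta x u) - H x (Delta x v)
      = ((1 - s) *\<^sub>R g x (Delta x v) + s *\<^sub>R g x (Delta x u)) \<bullet> Delta x (u - v)" for x
  proof -
    define A B D where "A = g x (Delta x v) \<bullet> Delta x (u - v)" and "B = g x (Delta x u) \<bullet> Delta x (u - v)"
      and "D = H x (Delta x u) - H x (Delta x v)"
    have D: "B \<le> D" "D \<le> A"
      using H_concave[of x "Delta x u" "Delta x v"] H_concave[of x "Delta x v" "Delta x u"]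
      by (simp_all add: A_def B_def D_def Delta_diff inner_diff_right)
    have "\<exists>s. 0 \<le> s \<and> s \<le> 1 \<and> D = (1 - s) * A + s * B"
    proof (cases "A = B")
      case True
      then show ?thesis using D by (intro exI[of _ 0]) auto
    next
      case False
      then have "B < A" using D by simp
      define s where "s = (A - D) / (A - B)"
      have "s * (A - B) = A - D" using False by (simp add: s_def)
      then have "D = (1 - s) * A + s * B" by (simp add: algebra_simps)
      moreover have "0 \<le> s" "s \<le> 1" using D \<open>B < A\<close> by (simp_all add: s_def)
      ultimately show ?thesis by blast
    qed
    then show ?thesis by (simp add: A_def B_def D_def inner_add_left)
  qed
  then obtain s where s: "\<And>x. 0 \<le> s x" "\<And>x. s x \<le> 1" and eq: "\<And>x. H x (Delta x u) - H x (Delta x v)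
      = ((1 - s x) *\<^sub>R g x (Delta x v) + s x *\<^sub>R g x (Delta x u)) \<bullet> Delta x (u - v)" by metis
  define M where "M = (\<lambda>x z. (1 - s x) * g x (Delta x v) $ z + s x * g x (Delta x u) $ z)"
  have "generator al au M" unfolding generator_def
  proof (intro conjI allI impI)
    fix x y :: 'n assume xy: "x \<noteq> y"
    have b: "al \<le> g x p $ y" "g x p $ y \<le> au" for p
      using rate_generator[of "\<lambda>_. p"] xy by (auto simp: generator_def)
    have "(1 - s x) * al + s x * al \<le> M x y" "M x y \<le> (1 - s x) * au + s x * au" unfolding M_def
      using s[of x] b by (intro add_mono mult_left_mono; simp)+
    then show "al \<le> M x y" "M x y \<le> au" by (simp_all add: algebra_simps)
  next
    fix x
    show "(\<Sum>y\<in>UNIV. M x y) = 0" unfolding M_def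
      by (simp add: sum.distrib rate_sum flip: sum_distrib_left)
  qed
  moreover have "H x (Delta x u) - H x (Delta x v) = (\<Sum>z\<in>UNIV. M x z * (u - v) $ z)" for x
    unfolding eq[of x] inner_add_left inner_scaleR_left inner_Delta M_def
    by (simp add: sum_distrib_left sum.distrib[symmetric] algebra_simps)
  ultimately show ?thesis by blast
qed

end

section \<open>Fixed points in spaces of paths\<close>

lemma geometric_steps_converge:
  fixes a :: "nat \<Rightarrow> real"
  assumes step: "\<And>k. \<bar>a (Suc k) - a k\<bar> \<le> C * q ^ k" and q: "0 \<le> q" "q < 1"
  shows "\<exists>l. a \<longlonglongrightarrow> l \<and> (\<forall>k. \<bar>a k - l\<bar> \<le> C / (1 - q) * q ^ k)"
proof -
  have "C \<ge> 0" using step[of 0] by simp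
  have tail: "\<bar>a (k + j) - a k\<bar> \<le> C / (1 - q) * q ^ k * (1 - q ^ j)" for k j
  proof (induction j)
    case 0
    then show ?case by simp
  next
    case (Suc j)
    have "C / (1 - q) * q ^ k * (1 - q ^ j) + C * q ^ (k + j) = C / (1 - q) * q ^ k * (1 - q ^ Suc j)"
      using q by (simp add: field_simps power_add)
    moreover have "\<bar>a (k + Suc j) - a (k + j)\<bar> \<le> C * q ^ (k + j)" using step[of "k + j"] by simp
    ultimately show ?case using Suc by linarith
  qed
  have tail': "\<bar>a (k + j) - a k\<bar> \<le> C / (1 - q) * q ^ k" for k j
  proof -
    have "C / (1 - q) * q ^ k * (1 - q ^ j) \<le> C / (1 - q) * q ^ k * 1"
      using q \<open>C \<ge> 0\<close> by (intro mult_left_mono) auto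
    then show ?thesis using tail[of k j] by simp
  qed
  have "((\<lambda>k. C / (1 - q) * q ^ k) \<longlongrightarrow> C / (1 - q) * 0) sequentially"
    using q by (intro tendsto_mult tendsto_const LIMSEQ_power_zero) auto
  then have lim0: "(\<lambda>k. C / (1 - q) * q ^ k) \<longlonglongrightarrow> 0" by simp
  from lim0 have "Cauchy a"
  proof (rule Cauchy_of_tail_bound[rotated])
    show "dist (a i) (a j) \<le> C / (1 - q) * q ^ i" if "i \<le> j" for i j
      using tail'[of i "j - i"] that by (simp add: dist_real_def abs_minus_commute)
  qed
  then obtain l where l: "a \<longlonglongrightarrow> l" using Cauchy_convergent convergent_def by blast
  have "\<bar>a k - l\<bar> \<le> C / (1 - q) * q ^ k" for k
  proof -
    have "((\<lambda>j. \<bar>a (j + k) - a k\<bar>) \<longlongrightarrow> \<bar>l - a k\<bar>) sequentially"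
      by (intro tendsto_intros LIMSEQ_ignore_initial_segment l)
    then have "\<bar>l - a k\<bar> \<le> C / (1 - q) * q ^ k"
      by (rule tendsto_upperbound) (use tail'[of k] in \<open>auto simp: add.commute\<close>)
    then show ?thesis by (simp add: abs_minus_commute)
  qed
  with l show ?thesis by blast
qed

text \<open>Paths matter only for nonnegative times; the exponential weight makes Picard iteration contract on the
  whole half line.\<close>

definition path_close :: "real \<Rightarrow> real \<Rightarrow> (real \<Rightarrow> real ^ 'n) \<Rightarrow> (real \<Rightarrow> real ^ 'n) \<Rightarrow> bool" where
  "path_close \<rho> D f h \<longleftrightarrow> (\<forall>t\<ge>0. \<forall>x. \<bar>f t $ x - h t $ x\<bar> \<le> D * exp (\<rho> * t))"

lemma path_closeD: "path_close \<rho> D f h \<Longrightarrow> 0 \<le> t \<Longrightarrow> \<bar>f t $ x - h t $ x\<bar> \<le> D * exp (\<rho> * t)"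
  by (simp add: path_close_def)

text \<open>The contraction principle for paths. The class \<open>P\<close> is required to be closed only under
  geometrically fast convergence, which is what the iteration produces.\<close>

lemma weighted_fixpoint:
  fixes T :: "(real \<Rightarrow> real ^ 'n::finite) \<Rightarrow> (real \<Rightarrow> real ^ 'n)"
  assumes f0: "P f0" and T: "\<And>f. P f \<Longrightarrow> P (T f)"
    and closed: "\<And>F f D. (\<And>k. P (F k)) \<Longrightarrow> (\<And>k. path_close \<rho> (D * q ^ k) (F k) f) \<Longrightarrow> P f"
    and contr: "\<And>f h D. P f \<Longrightarrow> P h \<Longrightarrow> 0 \<le> D \<Longrightarrow> path_close \<rho> D f h \<Longrightarrow> path_close \<rho> (q * D) (T f) (T h)"
    and init: "path_close \<rho> B (T f0) f0" and q: "0 \<le> q" "q < 1"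
  shows "\<exists>f. P f \<and> (\<forall>t\<ge>0. T f t = f t)"
proof -
  have B: "0 \<le> B" using path_closeD[OF init order_refl, of undefined] abs_ge_zero[of "T f0 0 $ undefined - f0 0 $ undefined"] by simp
  define F where "F = (\<lambda>k. (T ^^ k) f0)"
  have PF: "P (F k)" for k by (induction k) (auto simp: F_def f0 T)
  have FS: "F (Suc k) = T (F k)" for k by (simp add: F_def)
  have step: "path_close \<rho> (B * q ^ k) (F (Suc k)) (F k)" for k
  proof (induction k)
    case 0
    then show ?case using init by (simp add: F_def)
  next
    case (Suc k)
    then show ?case using contr[OF PF PF _ Suc] B q by (simp add: FS mult_ac)
  qed
  have "\<exists>l. (\<lambda>k. F k t $ x) \<longlonglongrightarrow> l \<and> (\<forall>k. \<bar>F k t $ x - l\<bar> \<le> (B * exp (\<rho> * t)) / (1 - q) * q ^ k)" if "0 \<le> t" for t x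
    using path_closeD[OF step that] q by (intro geometric_steps_converge) (auto simp: mult_ac)
  then obtain l where l: "\<And>t x. 0 \<le> t \<Longrightarrow> (\<lambda>k. F k t $ x) \<longlonglongrightarrow> l t x"
    and lb: "\<And>t x k. 0 \<le> t \<Longrightarrow> \<bar>F k t $ x - l t x\<bar> \<le> (B * exp (\<rho> * t)) / (1 - q) * q ^ k" by metis
  define f where "f = (\<lambda>t. \<chi> x. l t x)"
  define D where "D = B / (1 - q)"
  have D: "0 \<le> D" using B q by (simp add: D_def)
  have Ff: "path_close \<rho> (D * q ^ k) (F k) f" for k
    unfolding path_close_def f_def D_def using lb by (simp add: mult_ac)
  have Pf: "P f" by (rule closed[OF PF Ff])
  have "T f t = f t" if t: "0 \<le> t" for t
  proof -
    have "T f t $ x = f t $ x" for x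
    proof -
      have "path_close \<rho> (q * (D * q ^ k)) (T (F k)) (T f)" for k
        by (rule contr[OF PF Pf _ Ff]) (use D q in simp)
      then have bound: "\<bar>F (Suc k) t $ x - T f t $ x\<bar> \<le> q * (D * q ^ k) * exp (\<rho> * t)" for k
        using path_closeD[OF _ t] unfolding FS by blast
      have "((\<lambda>k. q * (D * q ^ k) * exp (\<rho> * t)) \<longlongrightarrow> q * (D * 0) * exp (\<rho> * t)) sequentially"
        using q by (intro tendsto_intros LIMSEQ_power_zero) auto
      then have "((\<lambda>k. q * (D * q ^ k) * exp (\<rho> * t)) \<longlongrightarrow> 0) sequentially" by simp
      then have "((\<lambda>k. F (Suc k) t $ x - T f t $ x) \<longlongrightarrow> 0) sequentially"
        by (rule Lim_null_comparison[rotated]) (use bound in auto)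
      then have "(\<lambda>k. F (Suc k) t $ x) \<longlonglongrightarrow> T f t $ x" by (simp add: LIM_zero_iff)
      moreover have "(\<lambda>k. F (Suc k) t $ x) \<longlonglongrightarrow> l t x" by (intro LIMSEQ_Suc l t)
      ultimately show ?thesis using LIMSEQ_unique by (auto simp: f_def)
    qed
    then show ?thesis by (simp add: vec_eq_iff)
  qed
  with Pf show ?thesis by blast
qed

lemma continuous_path_limit:
  fixes F :: "nat \<Rightarrow> real \<Rightarrow> real ^ 'n::finite"
  assumes "\<And>k. continuous_on {0..} (F k)" "\<And>k. path_close \<rho> (D * q ^ k) (F k) f" "0 \<le> q" "q < 1"
  shows "continuous_on {0..} f"
    and "0 \<le> t \<Longrightarrow> (\<lambda>k. F k t) \<longlonglongrightarrow> f t"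
proof -
  have dq: "(\<lambda>k. D * q ^ k) \<longlonglongrightarrow> 0"
  proof -
    have "(\<lambda>k. D * q ^ k) \<longlonglongrightarrow> D * 0" using assms(3,4) by (intro tendsto_intros LIMSEQ_power_zero) auto
    then show ?thesis by simp
  qed
  have scaled: "continuous_on {0..} (\<lambda>t. exp (- (\<rho> * t)) * f t $ x)" for x
  proof (rule uniform_limit_theorem[of _ "\<lambda>k t. exp (- (\<rho> * t)) * F k t $ x" sequentially])
    show "\<forall>\<^sub>F k in sequentially. continuous_on {0..} (\<lambda>t. exp (- (\<rho> * t)) * F k t $ x)"
      by (intro always_eventually allI continuous_intros assms(1))
    show "uniform_limit {0..} (\<lambda>k t. exp (- (\<rho> * t)) * F k t $ x) (\<lambda>t. exp (- (\<rho> * t)) * f t $ x) sequentially"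
    proof (rule uniform_limitI)
      fix e :: real assume "0 < e"
      then have "eventually (\<lambda>k. D * q ^ k < e) sequentially" using dq by (auto simp: order_tendsto_iff)
      then show "\<forall>\<^sub>F k in sequentially. \<forall>t\<in>{0..}. dist (exp (- (\<rho> * t)) * F k t $ x) (exp (- (\<rho> * t)) * f t $ x) < e"
      proof eventually_elim
        case (elim k)
        show ?case
        proof
          fix t :: real assume "t \<in> {0..}"
          then have t: "0 \<le> t" by simp
          have "dist (exp (- (\<rho> * t)) * F k t $ x) (exp (- (\<rho> * t)) * f t $ x) = exp (- (\<rho> * t)) * \<bar>F k t $ x - f t $ x\<bar>"
            by (simp add: dist_real_def right_diff_distrib[symmetric] abs_mult)
          also have "\<dots> \<le> exp (- (\<rho> * t)) * (D * q ^ k * exp (\<rho> * t))"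
            by (intro mult_left_mono path_closeD[OF assms(2) t]) auto
          also have "\<dots> = D * q ^ k" by (simp add: exp_minus)
          finally show "dist (exp (- (\<rho> * t)) * F k t $ x) (exp (- (\<rho> * t)) * f t $ x) < e" using elim by simp
        qed
      qed
    qed
  qed simp
  have "continuous_on {0..} (\<lambda>t. exp (\<rho> * t) * (exp (- (\<rho> * t)) * f t $ x))" for x
    by (rule continuous_on_mult[OF _ scaled]) (intro continuous_intros)
  then have "continuous_on {0..} (\<lambda>t. f t $ x)" for x
    by (rule continuous_on_eq) (simp flip: mult.assoc exp_add)
  then have "continuous_on {0..} (\<lambda>t. \<chi> x. f t $ x)" by (intro continuous_on_vec_lambda)
  then show "continuous_on {0..} f" by simp
  assume t: "0 \<le> t"
  show "(\<lambda>k. F k t) \<longlonglongrightarrow> f t"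
  proof (rule vec_tendstoI)
    fix x
    have "((\<lambda>k. D * q ^ k * exp (\<rho> * t)) \<longlongrightarrow> 0 * exp (\<rho> * t)) sequentially" by (intro tendsto_intros dq)
    then have "((\<lambda>k. D * q ^ k * exp (\<rho> * t)) \<longlongrightarrow> 0) sequentially" by simp
    then have "((\<lambda>k. F k t $ x - f t $ x) \<longlongrightarrow> 0) sequentially"
      by (rule Lim_null_comparison[rotated]) (use path_closeD[OF assms(2) t] in auto)
    then show "(\<lambda>k. F k t $ x) \<longlonglongrightarrow> f t $ x" by (simp add: LIM_zero_iff)
  qed
qed

definition simplex_path :: "(real \<Rightarrow> real ^ 'n::finite) \<Rightarrow> bool" where
  "simplex_path \<nu> \<longleftrightarrow> continuous_on {0..} \<nu> \<and> (\<forall>t\<ge>0. \<nu> t \<in> prob_simplex)"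

lemma simplex_pathD:
  assumes "simplex_path \<nu>"
  shows "continuous_on {0..} \<nu>" "0 \<le> t \<Longrightarrow> \<nu> t \<in> prob_simplex"
  using assms by (auto simp: simplex_path_def)

lemma simplex_path_limit:
  assumes F: "\<And>k. simplex_path (F k)" and close: "\<And>k. path_close \<rho> (D * q ^ k) (F k) f" and q: "0 \<le> q" "q < 1"
  shows "simplex_path f"
  unfolding simplex_path_def
proof (intro conjI allI impI)
  note lim = continuous_path_limit[OF simplex_pathD(1)[OF F] close q]
  show "continuous_on {0..} f" by (rule lim(1))
  fix t :: real assume t: "0 \<le> t"
  show "f t \<in> prob_simplex"
    by (rule closed_sequentially[OF closed_simplex _ lim(2)[OF t]]) (rule simplex_pathD(2)[OF F t])
qed

lemma simplex_path_bounded_step: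
  assumes "simplex_path \<nu>" "\<mu>0 \<in> prob_simplex" "0 \<le> \<rho>"
  shows "path_close \<rho> 1 \<nu> (\<lambda>_. \<mu>0)"
  unfolding path_close_def
proof (intro allI impI)
  fix t :: real and x assume t: "0 \<le> t"
  note \<nu> = simplex_pathD(2)[OF assms(1) t]
  have "\<bar>\<nu> t $ x - \<mu>0 $ x\<bar> \<le> 1"
    using simplex_nonneg[OF \<nu>, of x] simplex_le1[OF \<nu>, of x] simplex_nonneg[OF assms(2), of x] simplex_le1[OF assms(2), of x] by simp
  also have "1 \<le> 1 * exp (\<rho> * t)" using t assms(3) by simp
  finally show "\<bar>\<nu> t $ x - \<mu>0 $ x\<bar> \<le> 1 * exp (\<rho> * t)" .
qed

text \<open>The multiple \<open>K / (a + \<rho>) * exp (\<rho> t)\<close> of the weight is a supersolution.\<close>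

lemma damped_comparison:
  fixes y h :: "real \<Rightarrow> real"
  assumes y: "\<And>t. 0 \<le> t \<Longrightarrow> (y has_rate (h t - a * y t)) t"
    and h: "\<And>t. 0 \<le> t \<Longrightarrow> \<bar>h t\<bar> \<le> K * exp (\<rho> * t)" and y0: "y 0 = 0" and a: "0 < a + \<rho>" and t: "0 \<le> t"
  shows "\<bar>y t\<bar> \<le> K / (a + \<rho>) * exp (\<rho> * t)"
proof -
  have K: "0 \<le> K" using h[of 0] by simp
  define k where "k = K / (a + \<rho>)"
  have k: "0 \<le> k" and Kk: "K = (a + \<rho>) * k" using K a by (auto simp: k_def)
  have one_side: "s * y t \<le> k * exp (\<rho> * t)" if s: "s = 1 \<or> s = -1" for s :: real
  proof -
    define f where "f = (\<lambda>t. exp (a * t) * (s * y t - k * exp (\<rho> * t)))"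
    have "f t \<le> f 0"
    proof (rule antimono_half_line[OF _ _ t])
      fix u :: real assume u: "0 \<le> u"
      have "(f has_rate (exp (a * u) * a * (s * y u - k * exp (\<rho> * u))
          + exp (a * u) * (s * (h u - a * y u) - k * (exp (\<rho> * u) * \<rho>)))) u"
        unfolding f_def by (auto intro!: derivative_eq_intros y u)
      then have "(f has_rate (exp (a * u) * (s * h u - K * exp (\<rho> * u)))) u"
        by (rule DERIV_cong) (simp add: Kk algebra_simps)
      moreover have "exp (a * u) * (s * h u - K * exp (\<rho> * u)) \<le> 0"
        using h[OF u] s by (intro mult_nonneg_nonpos) (auto simp: abs_le_iff)
      ultimately show "\<exists>D\<le>0. (f has_rate D) u" by blast
    qed simp
    also have "f 0 \<le> 0" using k by (simp add: f_def y0)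
    finally show ?thesis by (simp add: f_def mult_le_0_iff)
  qed
  show ?thesis using one_side[of 1] one_side[of "-1"] by (auto simp: abs_le_iff k_def)
qed

lemma damped_exists:
  fixes h :: "real \<Rightarrow> real"
  assumes "continuous_on {0..} h"
  shows "\<exists>y. y 0 = y0 \<and> (\<forall>t\<ge>0. (y has_rate (h t - a * y t)) t)"
proof -
  have "continuous_on {0..} (\<lambda>t. exp (a * t) * h t)" by (intro continuous_intros assms)
  then obtain Q where Q: "Q 0 = 0" "\<And>t. 0 \<le> t \<Longrightarrow> (Q has_rate (exp (a * t) * h t)) t"
    using antiderivative_half_line by blast
  define y where "y = (\<lambda>t. exp (- (a * t)) * (y0 + Q t))"
  have "(y has_rate (h t - a * y t)) t" if t: "0 \<le> t" for t
  proof -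
    have "(y has_rate (exp (- (a * t)) * (- a) * (y0 + Q t) + exp (- (a * t)) * (exp (a * t) * h t))) t"
      unfolding y_def by (auto intro!: derivative_eq_intros Q t)
    then show ?thesis by (rule DERIV_cong) (simp add: y_def exp_minus algebra_simps)
  qed
  moreover have "y 0 = y0" by (simp add: y_def Q)
  ultimately show ?thesis by blast
qed

text \<open>Existence of the forward equation in the simplex, when the rates depend on time and on the current
  distribution. Writing the right-hand side as \<open>drive - \<Lambda> * \<mu>\<close> with \<open>\<Lambda>\<close>
  equal to \<open>au\<close> times the number of states makes the drive nonnegative with total
  \<open>\<Lambda>\<close>, so that every Picard iterate stays a path of probability vectors; boundary points cause no
  difficulty.\<close>

lemma forward_flow:
  fixes R :: "real \<Rightarrow> real ^ 'n::finite \<Rightarrow> 'n \<Rightarrow> 'n \<Rightarrow> real"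
  assumes gen: "\<And>t \<mu>. 0 \<le> t \<Longrightarrow> \<mu> \<in> prob_simplex \<Longrightarrow> generator al au (R t \<mu>)" and al: "0 \<le> al" and au: "0 < au"
    and cont: "\<And>\<nu> y x. continuous_on {0..} \<nu> \<Longrightarrow> (\<And>t. 0 \<le> t \<Longrightarrow> \<nu> t \<in> prob_simplex) \<Longrightarrow> continuous_on {0..} (\<lambda>t. R t (\<nu> t) y x)"
    and lip: "\<And>t \<mu> \<nu> D x. 0 \<le> t \<Longrightarrow> \<mu> \<in> prob_simplex \<Longrightarrow> \<nu> \<in> prob_simplex \<Longrightarrow> (\<And>y. \<bar>\<mu> $ y - \<nu> $ y\<bar> \<le> D) \<Longrightarrow>
        \<bar>(\<Sum>y\<in>UNIV. \<mu> $ y * R t \<mu> y x) - (\<Sum>y\<in>UNIV. \<nu> $ y * R t \<nu> y x)\<bar> \<le> lip_const * D" and lip_const: "0 \<le> lip_const"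
    and \<mu>0: "\<mu>0 \<in> prob_simplex"
  shows "\<exists>\<mu>. \<mu> 0 = \<mu>0 \<and> (\<forall>t\<ge>0. \<mu> t \<in> prob_simplex) \<and>
     (\<forall>t\<ge>0. \<forall>x. ((\<lambda>s. \<mu> s $ x) has_rate (\<Sum>y\<in>UNIV. \<mu> t $ y * R t (\<mu> t) y x)) t)"
proof -
  define \<Lambda> where "\<Lambda> = au * real CARD('n)"
  have \<Lambda>: "0 < \<Lambda>" using au by (simp add: \<Lambda>_def)
  define P :: "(real \<Rightarrow> real ^ 'n) \<Rightarrow> bool" where "P = simplex_path"
  define drive where "drive = (\<lambda>\<nu> :: real \<Rightarrow> real ^ 'n. \<lambda>t x. \<Lambda> * \<nu> t $ x + (\<Sum>y\<in>UNIV. \<nu> t $ y * R t (\<nu> t) y x))"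
  define sol where "sol = (\<lambda>\<nu> z :: real \<Rightarrow> real ^ 'n. z 0 = \<mu>0 \<and>
      (\<forall>t\<ge>0. \<forall>x. ((\<lambda>s. z s $ x) has_rate (drive \<nu> t x - \<Lambda> * z t $ x)) t))"
  define T where "T = (\<lambda>\<nu>. SOME z. sol \<nu> z)"
  have T: "sol \<nu> (T \<nu>)" if P: "P \<nu>" for \<nu>
  proof -
    have "continuous_on {0..} (\<lambda>t. drive \<nu> t x)" for x
      unfolding drive_def using P by (intro continuous_intros cont) (auto simp: P_def simplex_path_def)
    then have "\<exists>y. y 0 = \<mu>0 $ x \<and> (\<forall>t\<ge>0. (y has_rate (drive \<nu> t x - \<Lambda> * y t)) t)" for x
      by (intro damped_exists)
    then obtain y where y: "\<And>x. y x 0 = \<mu>0 $ x" "\<And>x t. 0 \<le> t \<Longrightarrow> (y x has_rate (drive \<nu> t x - \<Lambda> * y x t)) t"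
      by metis
    have "sol \<nu> (\<lambda>t. \<chi> x. y x t)" unfolding sol_def using y by (simp add: vec_eq_iff)
    then show ?thesis unfolding T_def by (rule someI[of "sol \<nu>"])
  qed
  have drive_nonneg: "0 \<le> drive \<nu> t x" if "P \<nu>" "0 \<le> t" for \<nu> t x
  proof -
    have \<nu>: "\<nu> t \<in> prob_simplex" using that by (simp add: P_def simplex_path_def)
    have g: "generator al au (R t (\<nu> t))" by (rule gen[OF that(2) \<nu>])
    have "(\<Sum>y\<in>UNIV. \<nu> t $ y * R t (\<nu> t) y x) = \<nu> t $ x * R t (\<nu> t) x x + (\<Sum>y\<in>UNIV - {x}. \<nu> t $ y * R t (\<nu> t) y x)"
      by (rule sum.remove) auto
    moreover have "0 \<le> (\<Sum>y\<in>UNIV - {x}. \<nu> t $ y * R t (\<nu> t) y x)"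
      using g al simplex_nonneg[OF \<nu>] by (intro sum_nonneg mult_nonneg_nonneg) (auto simp: generator_def intro: order_trans)
    moreover have "0 \<le> \<nu> t $ x * (R t (\<nu> t) x x + \<Lambda>)"
      using generator_diag[OF g, of x] au simplex_nonneg[OF \<nu>] by (intro mult_nonneg_nonneg) (auto simp: \<Lambda>_def)
    ultimately show ?thesis by (simp add: drive_def algebra_simps)
  qed
  have drive_sum: "(\<Sum>x\<in>UNIV. drive \<nu> t x) = \<Lambda>" if "P \<nu>" "0 \<le> t" for \<nu> t
  proof -
    have \<nu>: "\<nu> t \<in> prob_simplex" using that by (simp add: P_def simplex_path_def)
    have g: "generator al au (R t (\<nu> t))" by (rule gen[OF that(2) \<nu>])
    have "(\<Sum>x\<in>UNIV. \<Sum>y\<in>UNIV. \<nu> t $ y * R t (\<nu> t) y x) = (\<Sum>y\<in>UNIV. \<nu> t $ y * (\<Sum>x\<in>UNIV. R t (\<nu> t) y x))"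
      by (subst sum.swap) (simp add: sum_distrib_left)
    also have "\<dots> = 0" using g by (simp add: generator_def)
    finally show ?thesis using simplex_sum[OF \<nu>] by (simp add: drive_def sum.distrib flip: sum_distrib_left)
  qed
  have PT: "P (T \<nu>)" if P: "P \<nu>" for \<nu>
  proof -
    have z0: "T \<nu> 0 = \<mu>0" and dz: "\<And>t x. 0 \<le> t \<Longrightarrow> ((\<lambda>s. T \<nu> s $ x) has_rate (drive \<nu> t x - \<Lambda> * T \<nu> t $ x)) t"
      using T[OF P] by (auto simp: sol_def)
    have pos: "0 \<le> T \<nu> t $ x" if t: "0 \<le> t" for t x
    proof -
      have "exp (\<Lambda> * 0) * T \<nu> 0 $ x \<le> exp (\<Lambda> * t) * T \<nu> t $ x"
      proof (rule mono_half_line[OF _ _ t])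
        fix s :: real assume s: "0 \<le> s"
        have "((\<lambda>t. exp (\<Lambda> * t) * T \<nu> t $ x) has_rate (exp (\<Lambda> * s) * \<Lambda> * T \<nu> s $ x + exp (\<Lambda> * s) * (drive \<nu> s x - \<Lambda> * T \<nu> s $ x))) s"
          by (auto intro!: derivative_eq_intros dz s)
        then have "((\<lambda>t. exp (\<Lambda> * t) * T \<nu> t $ x) has_rate (exp (\<Lambda> * s) * drive \<nu> s x)) s"
          by (rule DERIV_cong) (simp add: algebra_simps)
        moreover have "0 \<le> exp (\<Lambda> * s) * drive \<nu> s x" using drive_nonneg[OF P s] by simp
        ultimately show "\<exists>D\<ge>0. ((\<lambda>t. exp (\<Lambda> * t) * T \<nu> t $ x) has_rate D) s" by blast
      qed simp
      moreover have "0 \<le> T \<nu> 0 $ x" using simplex_nonneg[OF \<mu>0] by (simp add: z0)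
      ultimately have "0 \<le> exp (\<Lambda> * t) * T \<nu> t $ x" by simp
      then show ?thesis by (simp add: zero_le_mult_iff)
    qed
    have sum: "(\<Sum>x\<in>UNIV. T \<nu> t $ x) = 1" if t: "0 \<le> t" for t
    proof -
      have "\<bar>(\<Sum>x\<in>UNIV. T \<nu> t $ x) - 1\<bar> \<le> 0 / (\<Lambda> + 0) * exp (0 * t)"
      proof (rule damped_comparison[where h = "\<lambda>_. 0", OF _ _ _ _ t])
        fix s :: real assume s: "0 \<le> s"
        have "((\<lambda>t. (\<Sum>x\<in>UNIV. T \<nu> t $ x) - 1) has_rate ((\<Sum>x\<in>UNIV. drive \<nu> s x - \<Lambda> * T \<nu> s $ x) - 0)) s"
          by (intro DERIV_diff DERIV_sum dz s DERIV_const)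
        then show "((\<lambda>t. (\<Sum>x\<in>UNIV. T \<nu> t $ x) - 1) has_rate (0 - \<Lambda> * ((\<Sum>x\<in>UNIV. T \<nu> s $ x) - 1))) s"
          by (rule DERIV_cong) (simp add: sum_subtractf drive_sum[OF P s] sum_distrib_left[symmetric] algebra_simps)
      qed (use \<Lambda> simplex_sum[OF \<mu>0] z0 in auto)
      then show ?thesis by simp
    qed
    have "continuous_on {0..} (T \<nu>)" using dz by (intro half_line_continuous_vec) blast
    then show ?thesis using pos sum by (simp add: P_def simplex_path_def prob_simplex_def)
  qed
  \<comment> \<open>With this weight the contraction factor
    \<open>(\<Lambda> + lip_const) / (\<Lambda> + \<rho>)\<close> is \<open>1 / 2\<close>.\<close>
  define \<rho> where "\<rho> = \<Lambda> + 2 * lip_const"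
  have "\<exists>\<mu>. P \<mu> \<and> (\<forall>t\<ge>0. T \<mu> t = \<mu> t)"
  proof (rule weighted_fixpoint[where P = P and \<rho> = \<rho> and q = "1/2" and B = 1])
    show "P (\<lambda>_. \<mu>0)" using \<mu>0 by (simp add: P_def simplex_path_def)
    show "P f" if "\<And>k. P (F k)" "\<And>k. path_close \<rho> (D * (1/2) ^ k) (F k) f" for F f D
      using simplex_path_limit[OF _ that(2)] that(1) by (simp add: P_def)
    show "path_close \<rho> 1 (T (\<lambda>_. \<mu>0)) (\<lambda>_. \<mu>0)"
      using PT[OF \<open>P (\<lambda>_. \<mu>0)\<close>] \<mu>0 \<Lambda> lip_const by (intro simplex_path_bounded_step) (auto simp: P_def \<rho>_def)
    show "path_close \<rho> (1 / 2 * D) (T f) (T h)" if Pf: "P f" and Ph: "P h" and D: "0 \<le> D" and fh: "path_close \<rho> D f h" for f h D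
      unfolding path_close_def
    proof (intro allI impI)
      fix t :: real and x assume t: "0 \<le> t"
      have "\<bar>T f t $ x - T h t $ x\<bar> \<le> ((\<Lambda> + lip_const) * D) / (\<Lambda> + \<rho>) * exp (\<rho> * t)"
      proof (rule damped_comparison[where h = "\<lambda>s. drive f s x - drive h s x", OF _ _ _ _ t])
        fix s :: real assume s: "0 \<le> s"
        have "((\<lambda>s. T f s $ x - T h s $ x) has_rate ((drive f s x - \<Lambda> * T f s $ x) - (drive h s x - \<Lambda> * T h s $ x))) s"
          using T[OF Pf] T[OF Ph] s by (intro DERIV_diff) (auto simp: sol_def)
        then show "((\<lambda>s. T f s $ x - T h s $ x) has_rate (drive f s x - drive h s x - \<Lambda> * (T f s $ x - T h s $ x))) s"
          by (rule DERIV_cong) (simp add: algebra_simps)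
        have c: "\<bar>f s $ y - h s $ y\<bar> \<le> D * exp (\<rho> * s)" for y by (rule path_closeD[OF fh s])
        have "\<bar>(\<Sum>y\<in>UNIV. f s $ y * R s (f s) y x) - (\<Sum>y\<in>UNIV. h s $ y * R s (h s) y x)\<bar> \<le> lip_const * (D * exp (\<rho> * s))"
          using Pf Ph s c by (intro lip) (auto simp: P_def simplex_path_def)
        moreover have "\<bar>\<Lambda> * f s $ x - \<Lambda> * h s $ x\<bar> \<le> \<Lambda> * (D * exp (\<rho> * s))"
          using mult_left_mono[OF c[of x], of \<Lambda>] \<Lambda> by (simp add: right_diff_distrib[symmetric] abs_mult)
        ultimately have "\<bar>drive f s x - drive h s x\<bar> \<le> \<Lambda> * (D * exp (\<rho> * s)) + lip_const * (D * exp (\<rho> * s))"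
          unfolding drive_def by linarith
        then show "\<bar>drive f s x - drive h s x\<bar> \<le> (\<Lambda> + lip_const) * D * exp (\<rho> * s)" by (simp add: algebra_simps)
      qed (use T[OF Pf] T[OF Ph] \<Lambda> lip_const in \<open>auto simp: sol_def \<rho>_def\<close>)
      also have "((\<Lambda> + lip_const) * D) / (\<Lambda> + \<rho>) = 1 / 2 * D"
      proof -
        have "\<Lambda> + \<rho> = 2 * (\<Lambda> + lip_const)" by (simp add: \<rho>_def)
        moreover have "\<Lambda> + lip_const \<noteq> 0" using \<Lambda> lip_const by linarith
        ultimately show ?thesis by (simp only:) (simp add: field_simps del: distrib_left_numeral)
      qed
      finally show "\<bar>T f t $ x - T h t $ x\<bar> \<le> 1 / 2 * D * exp (\<rho> * t)" .
    qed
  qed (use PT in auto)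
  then obtain \<mu> where P\<mu>: "P \<mu>" and fixed: "\<And>t. 0 \<le> t \<Longrightarrow> T \<mu> t = \<mu> t" by blast
  have "T \<mu> 0 = \<mu>0" using T[OF P\<mu>] by (simp add: sol_def)
  moreover have "((\<lambda>s. T \<mu> s $ x) has_rate (\<Sum>y\<in>UNIV. T \<mu> t $ y * R t (T \<mu> t) y x)) t" if t: "0 \<le> t" for t x
  proof -
    have "((\<lambda>s. T \<mu> s $ x) has_rate (drive \<mu> t x - \<Lambda> * T \<mu> t $ x)) t"
      using T[OF P\<mu>] t by (simp add: sol_def)
    then show ?thesis by (rule DERIV_cong) (simp add: drive_def fixed[OF t])
  qed
  moreover have "T \<mu> t \<in> prob_simplex" if "0 \<le> t" for t using PT[OF P\<mu>] that by (simp add: P_def simplex_path_def)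
  ultimately show ?thesis by (intro exI[of _ "T \<mu>"]) simp
qed

section \<open>The discounted system and its monotonicity\<close>

text \<open>With \<open>d\<close> the number of states, the radius in the Hessian bounds is \<open>d\<close> times
  \<open>2 * (B0 + BF) / (al * d)\<close>, the bound for the oscillation of every bounded solution
  (\<open>system_osc\<close>). It depends neither on the discount nor on the solution, so the regularity of the
  Hamiltonian on this ball is all that matters.\<close>

locale mfg_constants = mean_field_game al au f F H g
  for al au :: real
    and f :: "'n::finite \<Rightarrow> real ^ 'n \<Rightarrow> real"
    and F :: "'n \<Rightarrow> real ^ 'n \<Rightarrow> real"
    and H :: "'n \<Rightarrow> real ^ 'n \<Rightarrow> real"
    and g :: "'n \<Rightarrow> real ^ 'n \<Rightarrow> real ^ 'n" +
  fixes BF B0 Lg c LF :: real and GF :: "'n \<Rightarrow> real ^ 'n \<Rightarrow> real ^ 'n"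
  assumes BF: "\<And>x \<eta>. \<eta> \<in> prob_simplex \<Longrightarrow> \<bar>F x \<eta>\<bar> \<le> BF"
    and B0: "\<And>x. \<bar>H x 0\<bar> \<le> B0"
    and pos: "0 < Lg" "0 < c" "0 < LF"
    and Hess_bound: "\<And>x p v. p \<in> cball 0 (real CARD('n) * (2 * (B0 + BF) / (al * real CARD('n)))) \<Longrightarrow>
          norm (Hess x p *v v) \<le> Lg * norm v"
    and Hess_lipschitz: "\<And>x p q v. p \<in> cball 0 (real CARD('n) * (2 * (B0 + BF) / (al * real CARD('n)))) \<Longrightarrow>
          q \<in> cball 0 (real CARD('n) * (2 * (B0 + BF) / (al * real CARD('n)))) \<Longrightarrow>
          norm (Hess x p *v v - Hess x q *v v) \<le> Lg * norm (p - q) * norm v"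
    and Hess_concave: "\<And>x p q. p \<in> cball 0 (real CARD('n) * (2 * (B0 + BF) / (al * real CARD('n)))) \<Longrightarrow> q $ x = 0 \<Longrightarrow>
          q \<bullet> (Hess x p *v q) \<le> - c * (norm q)\<^sup>2"
    and GF: "\<And>x. simplex_gradient (F x) (GF x)"
    and GF_bound: "\<And>x \<eta>. \<eta> \<in> prob_simplex \<Longrightarrow> norm (GF x \<eta>) \<le> LF"
    and GF_lipschitz: "\<And>x \<eta> \<zeta>. \<eta> \<in> prob_simplex \<Longrightarrow> \<zeta> \<in> prob_simplex \<Longrightarrow> norm (GF x \<eta> - GF x \<zeta>) \<le> LF * norm (\<eta> - \<zeta>)"

lemma (in mean_field_game) constants_exist:
  "\<exists>BF B0 Lg c LF GF. mfg_constants al au f F H g BF B0 Lg c LF GF"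
proof -
  have G: "simplex_gradient (F x) (\<lambda>\<eta>. \<chi> z. - simplex_deriv (F x) z w \<eta>)" for x w
    by (rule gradient_of_simplex_C1[OF A3(1)])
  obtain w :: 'n where True by simp
  define GF where "GF = (\<lambda>x \<eta>. \<chi> z. - simplex_deriv (F x) z w \<eta>)"
  have GF: "simplex_gradient (F x) (GF x)" for x using G[of x w] by (simp add: GF_def)
  obtain L1 where L1: "\<And>x. (L1 x)-lipschitz_on prob_simplex (simplex_jac (F x))" using A3(2) by metis
  have GFL: "norm (GF x \<eta> - GF x \<zeta>) \<le> real CARD('n) * L1 x * norm (\<eta> - \<zeta>)"
    if "\<eta> \<in> prob_simplex" "\<zeta> \<in> prob_simplex" for x \<eta> \<zeta>
  proof -
    have "\<bar>(GF x \<eta> - GF x \<zeta>) $ z\<bar> \<le> L1 x * norm (\<eta> - \<zeta>)" for z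
    proof -
      have "(GF x \<eta> - GF x \<zeta>) $ z = - ((simplex_jac (F x) \<eta> - simplex_jac (F x) \<zeta>) $ z $ w)"
        by (simp add: GF_def simplex_jac_def)
      then have "\<bar>(GF x \<eta> - GF x \<zeta>) $ z\<bar> \<le> norm ((simplex_jac (F x) \<eta> - simplex_jac (F x) \<zeta>) $ z)"
        using component_le_norm_cart[of "(simplex_jac (F x) \<eta> - simplex_jac (F x) \<zeta>) $ z" w] by simp
      also have "\<dots> \<le> norm (simplex_jac (F x) \<eta> - simplex_jac (F x) \<zeta>)" by (rule Finite_Cartesian_Product.norm_nth_le)
      also have "\<dots> \<le> L1 x * norm (\<eta> - \<zeta>)" using lipschitz_onD[OF L1 that] by (simp add: dist_norm)
      finally show ?thesis .
    qed
    from norm_le_card_bound[OF this] show ?thesis by (simp add: mult.assoc)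
  qed
  have "bounded (GF x ` prob_simplex)" for x
    using GF[of x] compact_simplex by (auto simp: simplex_gradient_def intro!: compact_imp_bounded compact_continuous_image)
  then have "\<exists>B. \<forall>\<eta>\<in>prob_simplex. norm (GF x \<eta>) \<le> B" for x by (auto simp: bounded_iff)
  then obtain B1 where B1: "\<And>x \<eta>. \<eta> \<in> prob_simplex \<Longrightarrow> norm (GF x \<eta>) \<le> B1 x" by metis
  define LF where "LF = 1 + (\<Sum>x\<in>UNIV. \<bar>real CARD('n) * L1 x\<bar>) + (\<Sum>x\<in>UNIV. \<bar>B1 x\<bar>)"
  have s0: "0 \<le> (\<Sum>x\<in>UNIV. \<bar>real CARD('n) * L1 x\<bar>)" "0 \<le> (\<Sum>x\<in>UNIV. \<bar>B1 x\<bar>)" by (auto intro: sum_nonneg)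
  have m: "\<bar>real CARD('n) * L1 x\<bar> \<le> (\<Sum>x\<in>UNIV. \<bar>real CARD('n) * L1 x\<bar>)" "\<bar>B1 x\<bar> \<le> (\<Sum>x\<in>UNIV. \<bar>B1 x\<bar>)" for x
    by (rule member_le_sum; simp)+
  have LF: "0 < LF" "real CARD('n) * L1 x \<le> LF" "B1 x \<le> LF" for x
    unfolding LF_def using s0 m[of x] by linarith+
  have "\<exists>B. \<forall>\<eta>\<in>prob_simplex. \<bar>F x \<eta>\<bar> \<le> B" for x
  proof -
    obtain L where L: "\<forall>\<eta>\<in>prob_simplex. \<forall>\<zeta>\<in>prob_simplex. \<bar>F x \<zeta> - F x \<eta>\<bar> \<le> L * norm (\<zeta> - \<eta>)" "0 \<le> L"
      using lipschitz_of_gradient[OF GF[of x]] by blast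
    have "\<bar>F x \<eta>\<bar> \<le> \<bar>F x (axis w 1)\<bar> + L * 2" if \<eta>: "\<eta> \<in> prob_simplex" for \<eta>
    proof -
      have "\<bar>F x \<eta> - F x (axis w 1)\<bar> \<le> L * norm (\<eta> - axis w 1)" using L \<eta> vertex_in_simplex[of w] by blast
      also have "\<dots> \<le> L * 2" using L by (intro mult_left_mono simplex_diff_norm \<eta> vertex_in_simplex) auto
      finally show ?thesis by linarith
    qed
    then show ?thesis by blast
  qed
  then obtain b where b: "\<And>x \<eta>. \<eta> \<in> prob_simplex \<Longrightarrow> \<bar>F x \<eta>\<bar> \<le> b x" by metis
  have BF: "\<bar>F x \<eta>\<bar> \<le> Max (range b)" if "\<eta> \<in> prob_simplex" for x \<eta>
    using b[OF that, of x] by (rule order_trans) simp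
  have B0: "\<bar>H x 0\<bar> \<le> Max (range (\<lambda>x. \<bar>H x 0\<bar>))" for x by simp
  obtain Lg c where Lg: "0 < Lg" "0 < c" and HL: "\<forall>x. \<forall>p\<in>cball 0 (real CARD('n) * (2 * (Max (range (\<lambda>x. \<bar>H x 0\<bar>)) + Max (range b)) / (al * real CARD('n)))).
     (\<forall>v. norm (Hess x p *v v) \<le> Lg * norm v) \<and>
     (\<forall>q\<in>cball 0 (real CARD('n) * (2 * (Max (range (\<lambda>x. \<bar>H x 0\<bar>)) + Max (range b)) / (al * real CARD('n)))).
         \<forall>v. norm (Hess x p *v v - Hess x q *v v) \<le> Lg * norm (p - q) * norm v) \<and>
     (\<forall>q. q $ x = 0 \<longrightarrow> q \<bullet> (Hess x p *v q) \<le> - c * (norm q)\<^sup>2)"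
    using local_constants by blast
  have "mfg_constants al au f F H g (Max (range b)) (Max (range (\<lambda>x. \<bar>H x 0\<bar>))) Lg c LF GF"
  proof (intro mfg_constants.intro mfg_constants_axioms.intro)
    show "mean_field_game al au f F H g" by (rule mean_field_game_axioms)
    show "norm (GF x \<eta>) \<le> LF" if "\<eta> \<in> prob_simplex" for x \<eta> using B1[OF that, of x] LF(3)[of x] by linarith
    show "norm (GF x \<eta> - GF x \<zeta>) \<le> LF * norm (\<eta> - \<zeta>)" if "\<eta> \<in> prob_simplex" "\<zeta> \<in> prob_simplex" for x \<eta> \<zeta>
      using GFL[OF that, of x] mult_right_mono[OF LF(2)[of x] norm_ge_zero[of "\<eta> - \<zeta>"]] by linarith
  qed (use BF B0 Lg LF(1) GF HL in blast)+
  then show ?thesis by blast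
qed

context mfg_constants
begin

definition "d = real CARD('n)"
text \<open>\<open>K\<close> bounds the oscillation of all solutions, \<open>R\<close> the resulting differences
  \<open>Delta x u\<close>, and \<open>LL\<close> the strength of the mutual coupling.\<close>

definition "K = 2 * (B0 + BF) / (al * real CARD('n))"
definition "R = real CARD('n) * K"
definition "LL = LF + d * (Lg * d)"

lemma d_pos: "1 \<le> d" by (simp add: d_def Suc_leI)

lemma LL_pos: "0 < LL"
  unfolding LL_def using pos d_pos by (intro add_pos_nonneg mult_nonneg_nonneg) auto

lemma B_nonneg: "0 \<le> BF" "0 \<le> B0"
  using BF[OF vertex_in_simplex, of undefined undefined] B0[of undefined] by linarith+

sublocale coupling: coupling_constants al au LL "c / 2" "TYPE('n)"
  by unfold_locales (use A1 LL_pos pos in auto)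

lemma Hess_bound_R: "p \<in> cball 0 R \<Longrightarrow> norm (Hess x p *v v) \<le> Lg * norm v"
  unfolding R_def K_def by (rule Hess_bound)

lemma g_lipschitz_R: "p \<in> cball 0 R \<Longrightarrow> q \<in> cball 0 R \<Longrightarrow> norm (g x p - g x q) \<le> Lg * norm (p - q)"
  by (rule g_lipschitz[OF Hess_bound_R])

lemma F_lipschitz:
  assumes "\<eta> \<in> prob_simplex" "\<zeta> \<in> prob_simplex"
  shows "\<bar>F x \<eta> - F x \<zeta>\<bar> \<le> LF * norm (\<eta> - \<zeta>)"
proof -
  have "norm (F x \<eta> - F x \<zeta>) \<le> LF * norm (\<eta> - \<zeta>)"
  proof (rule differentiable_bound[OF convex_simplex _ _ assms])
    show "(F x has_derivative (\<lambda>v. GF x \<theta> \<bullet> v)) (at \<theta> within prob_simplex)" if "\<theta> \<in> prob_simplex" for \<theta>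
      using GF that by (simp add: simplex_gradient_def)
    show "onorm (\<lambda>v. GF x \<theta> \<bullet> v) \<le> LF" if "\<theta> \<in> prob_simplex" for \<theta>
    proof (rule onorm_le)
      fix v
      have "norm (GF x \<theta> \<bullet> v) \<le> norm (GF x \<theta>) * norm v" using Cauchy_Schwarz_ineq2 by auto
      also have "\<dots> \<le> LF * norm v" by (intro mult_right_mono GF_bound that) auto
      finally show "norm (GF x \<theta> \<bullet> v) \<le> LF * norm v" .
    qed
  qed
  then show ?thesis by simp
qed

text \<open>The mean field game system with the coupling cost switched down by the factor \<open>\<theta>\<close> and
  with an additional source \<open>\<phi>\<close>. It interpolates between a decoupled pair of equations
  (\<open>\<theta> = 0\<close>) and the system of interest (\<open>\<theta> = 1\<close>,
  \<open>\<phi> = 0\<close>).\<close>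

definition system ::
    "real \<Rightarrow> real \<Rightarrow> (real \<Rightarrow> real ^ 'n) \<Rightarrow> real ^ 'n \<Rightarrow> (real \<Rightarrow> real ^ 'n) \<Rightarrow> (real \<Rightarrow> real ^ 'n) \<Rightarrow> bool" where
  "system r \<theta> \<phi> \<mu>0 u \<mu> \<longleftrightarrow>
     (\<exists>B. \<forall>t\<ge>0. \<forall>x. \<bar>u t $ x\<bar> \<le> B) \<and> (\<forall>t\<ge>0. \<mu> t \<in> prob_simplex) \<and> \<mu> 0 = \<mu>0 \<and>
     (\<forall>t\<ge>0. \<forall>x.
        ((\<lambda>s. u s $ x) has_rate (r * u t $ x - H x (Delta x (u t)) - \<theta> * F x (\<mu> t) - \<phi> t $ x)) t) \<and>
     (\<forall>t\<ge>0. \<forall>x.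
        ((\<lambda>s. \<mu> s $ x) has_rate (\<Sum>y\<in>UNIV. \<mu> t $ y * g y (Delta y (u t)) $ x)) t)"

lemma systemD:
  assumes "system r \<theta> \<phi> \<mu>0 u \<mu>"
  shows "\<exists>B. \<forall>t\<ge>0. \<forall>x. \<bar>u t $ x\<bar> \<le> B"
    and "0 \<le> t \<Longrightarrow> \<mu> t \<in> prob_simplex" and "\<mu> 0 = \<mu>0"
    and "0 \<le> t \<Longrightarrow> ((\<lambda>s. u s $ x) has_rate (r * u t $ x - H x (Delta x (u t)) - \<theta> * F x (\<mu> t) - \<phi> t $ x)) t"
    and "0 \<le> t \<Longrightarrow> ((\<lambda>s. \<mu> s $ x) has_rate (\<Sum>y\<in>UNIV. \<mu> t $ y * g y (Delta y (u t)) $ x)) t"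
  using assms unfolding system_def by simp_all

lemma system_continuous:
  assumes "system r \<theta> \<phi> \<mu>0 u \<mu>"
  shows "continuous_on {0..} u" "continuous_on {0..} \<mu>"
  using systemD(4,5)[OF assms] by (intro half_line_continuous_vec; blast)+

text \<open>The source may use up the part of the cost that \<open>\<theta>\<close> has switched off; the total cost
  is then bounded by \<open>BF\<close>, and the a priori bounds do not depend on \<open>\<theta>\<close>.\<close>

definition small_source :: "real \<Rightarrow> (real \<Rightarrow> real ^ 'n) \<Rightarrow> bool" where
  "small_source \<theta> \<phi> \<longleftrightarrow> 0 \<le> \<theta> \<and> \<theta> \<le> 1 \<and> (\<forall>t\<ge>0. \<forall>x. \<bar>\<phi> t $ x\<bar> \<le> (1 - \<theta>) * BF)"

lemma system_linear:
  assumes sys: "system r \<theta> \<phi> \<mu>0 u \<mu>" and src: "small_source \<theta> \<phi>" and t: "0 \<le> t"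
  shows "backward_drift al au r u t (B0 + BF)"
proof -
  have D0: "Delta x (0 :: real ^ 'n) = 0" for x by (simp add: vec_eq_iff)
  obtain M where M: "generator al au M"
    and eq: "\<And>x. H x (Delta x (u t)) - H x 0 = (\<Sum>z\<in>UNIV. M x z * u t $ z)"
    using H_difference[of "u t" 0] by (auto simp: D0)
  let ?\<psi> = "\<lambda>x. H x 0 + \<theta> * F x (\<mu> t) + \<phi> t $ x"
  have "\<bar>?\<psi> x\<bar> \<le> B0 + BF" for x
  proof -
    have \<theta>: "0 \<le> \<theta>" "\<bar>\<phi> t $ x\<bar> \<le> (1 - \<theta>) * BF" using src t by (auto simp: small_source_def)
    have "\<bar>\<theta> * F x (\<mu> t)\<bar> \<le> \<theta> * BF"
      using \<theta> BF[OF systemD(2)[OF sys t], of x] by (simp add: abs_mult mult_left_mono)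
    moreover have "(1 - \<theta>) * BF = BF - \<theta> * BF" by (simp add: algebra_simps)
    ultimately show ?thesis using \<theta>(2) B0[of x] by linarith
  qed
  moreover have "((\<lambda>s. u s $ x) has_rate (r * u t $ x - (\<Sum>z\<in>UNIV. M x z * u t $ z) - ?\<psi> x)) t" for x
    by (rule DERIV_cong[OF systemD(4)[OF sys t]]) (simp add: eq[symmetric])
  ultimately show ?thesis unfolding backward_drift_def using M by (intro exI[of _ M] exI[of _ ?\<psi>]) simp
qed

text \<open>The oscillation contracts backwards in time at rate \<open>\<kappa> = al * d\<close> against a source of
  size \<open>2 * (B0 + BF)\<close>, and the unknown oscillation at a remote time \<open>T\<close> is damped
  away.\<close>

lemma system_osc:
  assumes sys: "system r \<theta> \<phi> \<mu>0 u \<mu>" and src: "small_source \<theta> \<phi>" and r: "0 < r" and t: "0 \<le> t"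
  shows "osc (u t) \<le> K"
proof -
  define \<kappa> where "\<kappa> = al * real CARD('n)"
  have \<kappa>: "0 < \<kappa>" using A1 by (simp add: \<kappa>_def)
  have \<kappa>K: "\<kappa> * K = 2 * (B0 + BF)" using A1 by (simp add: K_def \<kappa>_def)
  obtain B where B: "\<And>t x. 0 \<le> t \<Longrightarrow> \<bar>u t $ x\<bar> \<le> B" using systemD(1)[OF sys] by blast
  have bound: "exp (- (\<kappa> * t)) * (osc (u t) - K) \<le> (2 * B + \<bar>K\<bar>) * exp (- (\<kappa> * T))" if T: "t \<le> T" for T
  proof -
    have T0: "0 \<le> T" using T t by simp
    have "\<exists>y y'. y T = osc (u T) \<and> (\<forall>s. 0 \<le> s \<and> s \<le> T \<longrightarrow> osc (u s) \<le> y s \<and>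
        (y has_rate y' s) s \<and> y' s \<ge> (al * real CARD('n) + r) * y s - 2 * (B0 + BF))"
      using A1 by (intro backward_majorant[OF _ T0 system_linear[OF sys src] continuous_on_const]) auto
    then obtain y y' where yT: "y T = osc (u T)" and y: "\<And>s. 0 \<le> s \<Longrightarrow> s \<le> T \<Longrightarrow> osc (u s) \<le> y s \<and>
        (y has_rate y' s) s \<and> y' s \<ge> (al * real CARD('n) + r) * y s - 2 * (B0 + BF)" by blast
    have "exp (- (\<kappa> * t)) * (y t - K) \<le> exp (- (\<kappa> * T)) * (y T - K)"
    proof (rule mono_half_line[OF _ t T])
      fix s assume "t \<le> s" "s \<le> T"
      then have s: "0 \<le> s" "s \<le> T" using t by auto
      note y = y[OF s]
      have y0: "0 \<le> y s" using y osc_nonneg[of "u s"] by linarith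
      have "((\<lambda>t. exp (- (\<kappa> * t)) * (y t - K)) has_rate (exp (- (\<kappa> * s)) * (- \<kappa>) * (y s - K) + exp (- (\<kappa> * s)) * y' s)) s"
        using y by (auto intro!: derivative_eq_intros)
      then have "((\<lambda>t. exp (- (\<kappa> * t)) * (y t - K)) has_rate (exp (- (\<kappa> * s)) * (y' s - \<kappa> * y s + \<kappa> * K))) s"
        by (rule DERIV_cong) (simp add: algebra_simps)
      moreover have "0 \<le> y' s - \<kappa> * y s + \<kappa> * K"
      proof -
        have "0 \<le> r * y s" using y0 r by simp
        moreover have "y' s \<ge> (\<kappa> + r) * y s - 2 * (B0 + BF)" using y by (simp add: \<kappa>_def)
        ultimately show ?thesis unfolding \<kappa>K by (simp add: algebra_simps)
      qed
      ultimately show "\<exists>D\<ge>0. ((\<lambda>t. exp (- (\<kappa> * t)) * (y t - K)) has_rate D) s"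
        by (meson exp_ge_zero mult_nonneg_nonneg)
    qed
    moreover have "osc (u t) \<le> y t" using y[OF t T] by blast
    then have "exp (- (\<kappa> * t)) * (osc (u t) - K) \<le> exp (- (\<kappa> * t)) * (y t - K)" by (intro mult_left_mono) auto
    moreover have "y T \<le> 2 * B" unfolding yT
    proof (rule osc_least)
      fix x z show "u T $ x - u T $ z \<le> 2 * B" using B[OF T0, of x] B[OF T0, of z] by (simp add: abs_le_iff)
    qed
    then have "exp (- (\<kappa> * T)) * (y T - K) \<le> exp (- (\<kappa> * T)) * (2 * B + \<bar>K\<bar>)" by (intro mult_left_mono) auto
    ultimately show ?thesis unfolding mult.commute[of "2 * B + \<bar>K\<bar>"] by linarith
  qed
  then have "exp (- (\<kappa> * t)) * (osc (u t) - K) \<le> 0" by (rule nonpos_of_decaying_bound[OF \<kappa>])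
  then show ?thesis by (simp add: mult_le_0_iff)
qed

lemma system_scaled_bound:
  assumes sys: "system r \<theta> \<phi> \<mu>0 u \<mu>" and src: "small_source \<theta> \<phi>" and r: "0 < r" and t: "0 \<le> t"
  shows "\<bar>r * u t $ x\<bar> \<le> au * d * K + (B0 + BF)"
proof -
  obtain B where B: "\<And>t x. 0 \<le> t \<Longrightarrow> \<bar>u t $ x\<bar> \<le> B" using systemD(1)[OF sys] by blast
  have "\<exists>h. ((\<lambda>s. u s $ x) has_rate (r * u t $ x - h)) t \<and> \<bar>h\<bar> \<le> au * d * K + (B0 + BF)"
    if t: "0 \<le> t" for t
  proof -
    obtain M \<psi> where M: "generator al au M" and \<psi>: "\<And>x. \<bar>\<psi> x\<bar> \<le> B0 + BF" and
      D: "\<And>x. ((\<lambda>s. u s $ x) has_rate (r * u t $ x - (\<Sum>z\<in>UNIV. M x z * u t $ z) - \<psi> x)) t"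
      using system_linear[OF sys src t] unfolding backward_drift_def by blast
    have "\<bar>\<Sum>z\<in>UNIV. M x z * u t $ z\<bar> \<le> au * d * osc (u t)"
      unfolding d_def by (rule generator_apply_bound[OF M]) (use A1 in simp)
    also have "\<dots> \<le> au * d * K" using A1 d_pos by (intro mult_left_mono system_osc[OF sys src r t]) auto
    finally have "\<bar>(\<Sum>z\<in>UNIV. M x z * u t $ z) + \<psi> x\<bar> \<le> au * d * K + (B0 + BF)" using \<psi>[of x] by linarith
    then show ?thesis using D[of x] by (intro exI[of _ "(\<Sum>z\<in>UNIV. M x z * u t $ z) + \<psi> x"]) (simp add: algebra_simps)
  qed
  then obtain h where h: "\<And>t. 0 \<le> t \<Longrightarrow> ((\<lambda>s. u s $ x) has_rate (r * u t $ x - h t)) t"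
    and hb: "\<And>t. 0 \<le> t \<Longrightarrow> \<bar>h t\<bar> \<le> au * d * K + (B0 + BF)" by metis
  have "\<bar>u t $ x\<bar> \<le> (au * d * K + (B0 + BF)) * exp (- (0 * t)) / (r + 0)"
    by (rule bounded_ode_decay[OF h _ _ r order_refl t]) (use hb B in auto)
  then have "r * \<bar>u t $ x\<bar> \<le> au * d * K + (B0 + BF)" using r by (simp add: field_simps)
  then show ?thesis using r by (simp add: abs_mult)
qed

lemma Delta_in_ball: "osc (v :: real ^ 'n) \<le> K \<Longrightarrow> Delta x v \<in> cball 0 R"
  using order_trans[OF norm_Delta_le[of x v] mult_left_mono[of "osc v" K "real CARD('n)"]] by (simp add: R_def)

text \<open>Whatever the distribution, differences from an average state see half of the squared oscillation; the
  dissipation therefore controls the full oscillation even where the distribution vanishes.\<close>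

lemma weighted_Delta_lower:
  fixes w :: "real ^ 'n"
  assumes "\<mu> \<in> prob_simplex"
  shows "(osc w)\<^sup>2 / 2 \<le> (\<Sum>y\<in>UNIV. \<mu> $ y * (norm (Delta y w))\<^sup>2)"
proof -
  have "(osc w)\<^sup>2 / 2 = (\<Sum>y\<in>UNIV. \<mu> $ y * ((osc w)\<^sup>2 / 2))"
    using simplex_sum[OF assms] by (simp flip: sum_distrib_right sum_divide_distrib)
  also have "\<dots> \<le> (\<Sum>y\<in>UNIV. \<mu> $ y * (norm (Delta y w))\<^sup>2)"
    using osc_le_Delta[of w] simplex_nonneg[OF assms] by (intro sum_mono mult_left_mono) (auto simp: field_simps)
  finally show ?thesis .
qed

text \<open>Strong concavity, written as the gap between the increment of the Hamiltonian and its linearisation at the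
  first point.\<close>

lemma H_gap:
  assumes "osc u \<le> K" "osc v \<le> K"
  shows "g y (Delta y u) \<bullet> Delta y (u - v) - (H y (Delta y u) - H y (Delta y v)) \<le> - (c / 2) * (norm (Delta y (u - v)))\<^sup>2"
proof -
  have "H y (Delta y v) \<le> H y (Delta y u) + g y (Delta y u) \<bullet> (Delta y v - Delta y u) - c / 2 * (norm (Delta y v - Delta y u))\<^sup>2"
    by (rule H_strongly_concave[where R = R]) (use Delta_in_ball assms Hess_concave in \<open>auto simp: R_def K_def\<close>)
  moreover have "norm (Delta y v - Delta y u) = norm (Delta y (u - v))" by (simp add: Delta_diff norm_minus_commute)
  ultimately show ?thesis by (simp add: Delta_diff inner_diff_right)
qed

lemma rate_difference_l1:
  assumes "\<mu> \<in> prob_simplex" and b: "\<And>y. norm (v y) \<le> B"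
  shows "(\<Sum>x\<in>UNIV. \<bar>\<Sum>y\<in>UNIV. \<mu> $ y * (v y :: real ^ 'n) $ x\<bar>) \<le> d * B"
proof -
  have "(\<Sum>x\<in>UNIV. \<bar>\<Sum>y\<in>UNIV. \<mu> $ y * v y $ x\<bar>) \<le> (\<Sum>x\<in>UNIV. \<Sum>y\<in>UNIV. \<mu> $ y * \<bar>v y $ x\<bar>)"
    by (intro sum_mono order_trans[OF sum_abs]) (simp add: abs_mult simplex_nonneg[OF assms(1)])
  also have "\<dots> = (\<Sum>y\<in>UNIV. \<mu> $ y * l1 (v y))" by (subst sum.swap) (simp add: l1_def sum_distrib_left)
  also have "\<dots> \<le> (\<Sum>y\<in>UNIV. \<mu> $ y * (d * B))"
  proof (intro sum_mono mult_left_mono simplex_nonneg[OF assms(1)])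
    fix y
    have "l1 (v y) \<le> d * norm (v y)" unfolding d_def by (rule l1_le_norm)
    also have "\<dots> \<le> d * B" using b d_pos by (intro mult_left_mono) auto
    finally show "l1 (v y) \<le> d * B" .
  qed
  also have "\<dots> = d * B" using simplex_sum[OF assms(1)] by (simp flip: sum_distrib_right)
  finally show ?thesis .
qed

text \<open>The Lasry--Lions computation. In the derivative of the pairing the terms of the Hamiltonian combine into
  concavity gaps weighted by the two distributions, each at most \<open>- c / 4 * osc w ^ 2\<close>, and monotonicity
  removes the coupling cost; only the difference of the sources remains as an error.\<close>

lemma system_pair_coupled:
  assumes s1: "system r \<theta> \<phi>1 \<mu>1 u1 m1" and s2: "system r \<theta> \<phi>2 \<mu>2 u2 m2"
    and src: "small_source \<theta> \<phi>1" "small_source \<theta> \<phi>2" and r: "0 < r"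
    and close: "\<And>t x. 0 \<le> t \<Longrightarrow> \<bar>\<phi>1 t $ x - \<phi>2 t $ x\<bar> \<le> \<epsilon> * exp (- (l * t))"
  shows "coupled_pair al au LL (c / 2) r \<epsilon> l (\<lambda>t. u1 t - u2 t) (\<lambda>t. m1 t - m2 t)"
  unfolding coupled_pair_def
proof (intro conjI allI impI)
  obtain B1 B2 where B: "\<And>t x. 0 \<le> t \<Longrightarrow> \<bar>u1 t $ x\<bar> \<le> B1" "\<And>t x. 0 \<le> t \<Longrightarrow> \<bar>u2 t $ x\<bar> \<le> B2"
    using systemD(1)[OF s1] systemD(1)[OF s2] by blast
  have "\<bar>(u1 t - u2 t) $ x\<bar> \<le> B1 + B2 + 1 \<and> \<bar>(m1 t - m2 t) $ x\<bar> \<le> B1 + B2 + 1" if t: "0 \<le> t" for t x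
  proof -
    note simplex_nonneg[OF systemD(2)[OF s1 t], of x] simplex_le1[OF systemD(2)[OF s1 t], of x]
      simplex_nonneg[OF systemD(2)[OF s2 t], of x] simplex_le1[OF systemD(2)[OF s2 t], of x]
      B(1)[OF t, of x] B(2)[OF t, of x]
    then show ?thesis by simp linarith
  qed
  then show "\<exists>B. \<forall>t\<ge>0. \<forall>x. \<bar>(u1 t - u2 t) $ x\<bar> \<le> B \<and> \<bar>(m1 t - m2 t) $ x\<bar> \<le> B" by blast
next
  fix t :: real assume t: "0 \<le> t"
  define w where "w = u1 t - u2 t"
  define n where "n = m1 t - m2 t"
  define e where "e = \<epsilon> * exp (- (l * t))"
  note M1 = systemD(2)[OF s1 t] and M2 = systemD(2)[OF s2 t]
  have o1: "osc (u1 t) \<le> K" and o2: "osc (u2 t) \<le> K" using system_osc[OF s1 src(1) r t] system_osc[OF s2 src(2) r t] .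
  have e: "\<bar>\<phi>1 t $ x - \<phi>2 t $ x\<bar> \<le> e" for x using close[OF t] by (simp add: e_def)
  have \<theta>: "0 \<le> \<theta>" "\<theta> \<le> 1" using src by (auto simp: small_source_def)
  show n0: "(\<Sum>x\<in>UNIV. (m1 t - m2 t) $ x) = 0" using simplex_sum[OF M1] simplex_sum[OF M2] by (simp add: sum_subtractf)
  define \<phi> where "\<phi> = (\<lambda>x. \<theta> * (F x (m1 t) - F x (m2 t)) + (\<phi>1 t $ x - \<phi>2 t $ x))"
  have \<phi>: "\<bar>\<phi> x\<bar> \<le> LL * l1 n + e" for x
  proof -
    have "\<bar>\<theta> * (F x (m1 t) - F x (m2 t))\<bar> \<le> 1 * (LF * norm n)"
      unfolding abs_mult n_def using \<theta> by (intro mult_mono F_lipschitz M1 M2) auto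
    also have "\<dots> \<le> LL * l1 n" unfolding mult_1
      using norm_le_l1[of n] pos d_pos by (intro mult_mono) (auto simp: LL_def)
    finally show ?thesis unfolding \<phi>_def using e[of x] by linarith
  qed
  have dw: "((\<lambda>s. (u1 s - u2 s) $ x) has_rate (r * w $ x - (H x (Delta x (u1 t)) - H x (Delta x (u2 t))) - \<phi> x)) t" for x
    using DERIV_diff[OF systemD(4)[OF s1 t] systemD(4)[OF s2 t]]
    by (simp, rule DERIV_cong) (simp add: \<phi>_def w_def algebra_simps)
  obtain M where M: "generator al au M" and Meq: "\<And>x. H x (Delta x (u1 t)) - H x (Delta x (u2 t)) = (\<Sum>z\<in>UNIV. M x z * w $ z)"
    using H_difference[of "u1 t" "u2 t"] unfolding w_def by blast
  show "backward_drift al au r (\<lambda>t. u1 t - u2 t) t (LL * l1 (m1 t - m2 t) + \<epsilon> * exp (- (l * t)))"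
    unfolding backward_drift_def w_def[symmetric] n_def[symmetric] e_def[symmetric]
    using M \<phi> dw unfolding Meq by (intro exI[of _ M] exI[of _ \<phi>]) simp
  define N where "N = (\<lambda>y z. g y (Delta y (u1 t)) $ z)"
  have N: "generator al au N" unfolding N_def by (rule rate_generator)
  \<comment> \<open>The difference of the fluxes is split into the first flux acting on the difference of the
    densities and the change of the rates seen by the second density.\<close>
  define \<psi> where "\<psi> = (\<lambda>x. \<Sum>y\<in>UNIV. m2 t $ y * (g y (Delta y (u1 t)) - g y (Delta y (u2 t))) $ x)"
  have \<psi>: "(\<Sum>x\<in>UNIV. \<bar>\<psi> x\<bar>) \<le> LL * osc w + e"
  proof -
    have "(\<Sum>x\<in>UNIV. \<bar>\<psi> x\<bar>) \<le> d * (Lg * (d * osc w))" unfolding \<psi>_def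
    proof (rule rate_difference_l1[OF M2])
      fix y
      have "norm (g y (Delta y (u1 t)) - g y (Delta y (u2 t))) \<le> Lg * norm (Delta y (u1 t) - Delta y (u2 t))"
        by (intro g_lipschitz_R Delta_in_ball o1 o2)
      also have "\<dots> \<le> Lg * (d * osc w)"
        using norm_Delta_le[of y w] pos by (intro mult_left_mono) (auto simp: w_def Delta_diff d_def)
      finally show "norm (g y (Delta y (u1 t)) - g y (Delta y (u2 t))) \<le> Lg * (d * osc w)" .
    qed
    also have "\<dots> \<le> LL * osc w" unfolding LL_def using pos osc_nonneg[of w] by (simp add: algebra_simps)
    also have "\<dots> \<le> LL * osc w + e" using e[of undefined] by simp
    finally show ?thesis .
  qed
  have dn: "((\<lambda>s. (m1 s - m2 s) $ x) has_rate ((\<Sum>y\<in>UNIV. N y x * n $ y) + \<psi> x)) t" for x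
  proof -
    have "(\<Sum>y\<in>UNIV. m1 t $ y * g y (Delta y (u1 t)) $ x) - (\<Sum>y\<in>UNIV. m2 t $ y * g y (Delta y (u2 t)) $ x)
       = (\<Sum>y\<in>UNIV. N y x * n $ y) + \<psi> x"
      unfolding \<psi>_def N_def n_def sum.distrib[symmetric] sum_subtractf[symmetric]
      by (intro sum.cong) (auto simp: algebra_simps)
    then show ?thesis using DERIV_diff[OF systemD(5)[OF s1 t, of x] systemD(5)[OF s2 t, of x]] by simp
  qed
  show "forward_drift al au (\<lambda>t. m1 t - m2 t) t (LL * osc (u1 t - u2 t) + \<epsilon> * exp (- (l * t)))"
    unfolding forward_drift_def w_def[symmetric] n_def[symmetric] e_def[symmetric]
    using N \<psi> dn by (intro exI[of _ N] exI[of _ \<psi>]) simp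
  define D where "D = (\<Sum>x\<in>UNIV. (r * w $ x - (H x (Delta x (u1 t)) - H x (Delta x (u2 t))) - \<phi> x) * n $ x
      + w $ x * ((\<Sum>y\<in>UNIV. m1 t $ y * g y (Delta y (u1 t)) $ x) - (\<Sum>y\<in>UNIV. m2 t $ y * g y (Delta y (u2 t)) $ x)))"
  have "((\<lambda>s. (u1 s - u2 s) \<bullet> (m1 s - m2 s)) has_rate D) t"
    unfolding inner_vec_def inner_real_def D_def
  proof (rule DERIV_sum)
    fix x
    have "((\<lambda>s. (m1 s - m2 s) $ x) has_rate ((\<Sum>y\<in>UNIV. m1 t $ y * g y (Delta y (u1 t)) $ x) - (\<Sum>y\<in>UNIV. m2 t $ y * g y (Delta y (u2 t)) $ x))) t"
      using DERIV_diff[OF systemD(5)[OF s1 t, of x] systemD(5)[OF s2 t, of x]] by simp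
    from DERIV_mult[OF dw this]
    show "((\<lambda>s. (u1 s - u2 s) $ x * (m1 s - m2 s) $ x) has_rate ((r * w $ x - (H x (Delta x (u1 t)) - H x (Delta x (u2 t))) - \<phi> x) * n $ x
      + w $ x * ((\<Sum>y\<in>UNIV. m1 t $ y * g y (Delta y (u1 t)) $ x) - (\<Sum>y\<in>UNIV. m2 t $ y * g y (Delta y (u2 t)) $ x)))) t"
      by (rule DERIV_cong) (simp add: w_def n_def algebra_simps)
  qed
  moreover have "D \<le> r * (w \<bullet> n) - c / 2 * (osc w)\<^sup>2 + e * (l1 n + osc w)"
  proof -
    define h where "h = (\<lambda>y. H y (Delta y (u1 t)) - H y (Delta y (u2 t)))"
    have swap: "(\<Sum>x\<in>UNIV. w $ x * (\<Sum>y\<in>UNIV. m $ y * g y (Delta y v) $ x)) = (\<Sum>y\<in>UNIV. m $ y * (g y (Delta y v) \<bullet> Delta y w))" for m v :: "real ^ 'n"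
    proof -
      have "(\<Sum>x\<in>UNIV. w $ x * (\<Sum>y\<in>UNIV. m $ y * g y (Delta y v) $ x)) = (\<Sum>x\<in>UNIV. \<Sum>y\<in>UNIV. m $ y * (g y (Delta y v) $ x * w $ x))"
        by (simp add: sum_distrib_left mult_ac)
      also have "\<dots> = (\<Sum>y\<in>UNIV. m $ y * (g y (Delta y v) \<bullet> Delta y w))"
        by (subst sum.swap) (simp add: inner_Delta sum_distrib_left)
      finally show ?thesis .
    qed
    have split: "(\<Sum>x\<in>UNIV. (r * w $ x - h x - \<phi> x) * n $ x + w $ x * (a x - b x))
        = (\<Sum>x\<in>UNIV. r * (w $ x * n $ x)) - (\<Sum>x\<in>UNIV. h x * n $ x) - (\<Sum>x\<in>UNIV. \<phi> x * n $ x)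
        + (\<Sum>x\<in>UNIV. w $ x * a x) - (\<Sum>x\<in>UNIV. w $ x * b x)" for a b
      by (simp add: sum.distrib sum_subtractf algebra_simps)
    have "D = (\<Sum>x\<in>UNIV. r * (w $ x * n $ x)) - (\<Sum>x\<in>UNIV. h x * n $ x) - (\<Sum>x\<in>UNIV. \<phi> x * n $ x)
        + (\<Sum>x\<in>UNIV. w $ x * (\<Sum>y\<in>UNIV. m1 t $ y * g y (Delta y (u1 t)) $ x))
        - (\<Sum>x\<in>UNIV. w $ x * (\<Sum>y\<in>UNIV. m2 t $ y * g y (Delta y (u2 t)) $ x))"
      unfolding D_def split[symmetric] by (simp add: h_def)
    also have "(\<Sum>x\<in>UNIV. r * (w $ x * n $ x)) = r * (w \<bullet> n)" by (simp add: inner_vec_def sum_distrib_left)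
    also have "(\<Sum>x\<in>UNIV. h x * n $ x) = (\<Sum>x\<in>UNIV. m1 t $ x * h x) - (\<Sum>x\<in>UNIV. m2 t $ x * h x)"
      unfolding sum_subtractf[symmetric] by (intro sum.cong) (auto simp: n_def algebra_simps)
    \<comment> \<open>The first and the second bracket are the concavity gaps at the first and at the second
      value.\<close>
    finally have D: "D = r * (w \<bullet> n) - (\<Sum>x\<in>UNIV. \<phi> x * n $ x)
        + (\<Sum>y\<in>UNIV. m1 t $ y * (g y (Delta y (u1 t)) \<bullet> Delta y w - h y))
        + (\<Sum>y\<in>UNIV. m2 t $ y * (h y - g y (Delta y (u2 t)) \<bullet> Delta y w))"
      unfolding swap by (simp add: right_diff_distrib sum_subtractf)
    have g1: "(\<Sum>y\<in>UNIV. m1 t $ y * (g y (Delta y (u1 t)) \<bullet> Delta y w - h y)) \<le> - (c / 4) * (osc w)\<^sup>2"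
    proof -
      have "(\<Sum>y\<in>UNIV. m1 t $ y * (g y (Delta y (u1 t)) \<bullet> Delta y w - h y)) \<le> (\<Sum>y\<in>UNIV. m1 t $ y * (- (c / 2) * (norm (Delta y w))\<^sup>2))"
        unfolding h_def w_def by (intro sum_mono mult_left_mono H_gap o1 o2 simplex_nonneg[OF M1])
      also have "\<dots> = - (c / 2) * (\<Sum>y\<in>UNIV. m1 t $ y * (norm (Delta y w))\<^sup>2)" by (simp add: sum_distrib_left mult_ac sum_negf)
      also have "\<dots> \<le> - (c / 2) * ((osc w)\<^sup>2 / 2)" using weighted_Delta_lower[OF M1] pos by (intro mult_left_mono_neg) auto
      finally show ?thesis by simp
    qed
    have g2: "(\<Sum>y\<in>UNIV. m2 t $ y * (h y - g y (Delta y (u2 t)) \<bullet> Delta y w)) \<le> - (c / 4) * (osc w)\<^sup>2"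
    proof -
      have "h y - g y (Delta y (u2 t)) \<bullet> Delta y w \<le> - (c / 2) * (norm (Delta y w))\<^sup>2" for y
      proof -
        have "Delta y (u2 t - u1 t) = - Delta y w" by (simp add: w_def Delta_diff)
        then show ?thesis using H_gap[OF o2 o1, of y] by (simp add: h_def)
      qed
      then have "(\<Sum>y\<in>UNIV. m2 t $ y * (h y - g y (Delta y (u2 t)) \<bullet> Delta y w)) \<le> (\<Sum>y\<in>UNIV. m2 t $ y * (- (c / 2) * (norm (Delta y w))\<^sup>2))"
        by (intro sum_mono mult_left_mono simplex_nonneg[OF M2])
      also have "\<dots> = - (c / 2) * (\<Sum>y\<in>UNIV. m2 t $ y * (norm (Delta y w))\<^sup>2)" by (simp add: sum_distrib_left mult_ac sum_negf)
      also have "\<dots> \<le> - (c / 2) * ((osc w)\<^sup>2 / 2)" using weighted_Delta_lower[OF M2] pos by (intro mult_left_mono_neg) auto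
      finally show ?thesis by simp
    qed
    have "- (\<Sum>x\<in>UNIV. \<phi> x * n $ x) \<le> e * l1 n"
    proof -
      have "0 \<le> (\<Sum>x\<in>UNIV. (F x (m1 t) - F x (m2 t)) * n $ x)"
        using A4 M1 M2 by (simp add: lasry_lions_monotone_def n_def)
      then have "0 \<le> \<theta> * (\<Sum>x\<in>UNIV. (F x (m1 t) - F x (m2 t)) * n $ x)" using \<theta> by simp
      moreover have "(\<Sum>x\<in>UNIV. \<phi> x * n $ x) = \<theta> * (\<Sum>x\<in>UNIV. (F x (m1 t) - F x (m2 t)) * n $ x) + (\<Sum>x\<in>UNIV. (\<phi>1 t $ x - \<phi>2 t $ x) * n $ x)"
        by (simp add: \<phi>_def distrib_right sum.distrib sum_distrib_left mult.assoc)
      moreover have "- (\<Sum>x\<in>UNIV. (\<phi>1 t $ x - \<phi>2 t $ x) * n $ x) \<le> (\<Sum>x\<in>UNIV. e * \<bar>n $ x\<bar>)"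
        unfolding sum_negf[symmetric]
      proof (rule sum_mono)
        fix x
        have "- ((\<phi>1 t $ x - \<phi>2 t $ x) * n $ x) \<le> \<bar>\<phi>1 t $ x - \<phi>2 t $ x\<bar> * \<bar>n $ x\<bar>" by (metis abs_ge_minus_self abs_mult)
        also have "\<dots> \<le> e * \<bar>n $ x\<bar>" by (intro mult_right_mono e) auto
        finally show "- ((\<phi>1 t $ x - \<phi>2 t $ x) * n $ x) \<le> e * \<bar>n $ x\<bar>" .
      qed
      moreover have "(\<Sum>x\<in>UNIV. e * \<bar>n $ x\<bar>) = e * l1 n" by (simp add: l1_def sum_distrib_left)
      ultimately show ?thesis by linarith
    qed
    moreover have "0 \<le> e * osc w" using e[of undefined] osc_nonneg[of w] by (intro mult_nonneg_nonneg) linarith+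
    ultimately show ?thesis using D g1 g2 by (simp add: distrib_left)
  qed
  ultimately show "\<exists>D. ((\<lambda>s. (u1 s - u2 s) \<bullet> (m1 s - m2 s)) has_rate D) t \<and>
        D \<le> r * ((u1 t - u2 t) \<bullet> (m1 t - m2 t)) - c / 2 * (osc (u1 t - u2 t))\<^sup>2
          + \<epsilon> * exp (- (l * t)) * (l1 (m1 t - m2 t) + osc (u1 t - u2 t))"
    unfolding w_def[symmetric] n_def[symmetric] e_def[symmetric] by blast
qed

end

section \<open>Existence of equilibria by continuation in the coupling\<close>

context mfg_constants
begin

definition "\<Lambda> = au * d"

lemma \<Lambda>_pos: "0 < \<Lambda>" using A1 d_pos by (simp add: \<Lambda>_def)

lemma rate_abs_bound: "\<bar>g y p $ x\<bar> \<le> \<Lambda>"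
proof -
  have g: "generator al au (\<lambda>y z. g y ((\<lambda>_. p) y) $ z)" by (rule rate_generator)
  have aud: "au \<le> \<Lambda>" using A1 d_pos by (simp add: \<Lambda>_def)
  show ?thesis
  proof (cases "x = y")
    case False
    then have "al \<le> g y p $ x" "g y p $ x \<le> au" using g by (auto simp: generator_def)
    then show ?thesis using A1 aud by linarith
  next
    case True
    have "0 = g y p $ y + (\<Sum>z\<in>UNIV - {y}. g y p $ z)"
      using rate_sum[of y p] by (simp add: sum.remove[of UNIV y])
    moreover have "0 \<le> (\<Sum>z\<in>UNIV - {y}. g y p $ z)"
    proof (rule sum_nonneg)
      fix z assume "z \<in> UNIV - {y}"
      then have "al \<le> g y p $ z" using g by (auto simp: generator_def)
      then show "0 \<le> g y p $ z" using A1 by simp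
    qed
    moreover have "g y p $ y + \<Lambda> \<ge> au" using generator_diag[OF g, of y] by (simp add: \<Lambda>_def d_def)
    ultimately show ?thesis using True A1 by simp
  qed
qed

text \<open>With \<open>\<Lambda>\<close> added on the diagonal, the generator that represents the increment of the
  Hamiltonian becomes a nonnegative matrix of row sum \<open>\<Lambda>\<close>. The Lipschitz constant in the maximum
  norm is therefore not larger than the shift itself, which is what the fixed point argument below needs.\<close>

lemma H_shift_bound:
  assumes D: "\<And>z. \<bar>u $ z - v $ z\<bar> \<le> D"
  shows "\<bar>(H x (Delta x u) + \<Lambda> * u $ x) - (H x (Delta x v) + \<Lambda> * v $ x)\<bar> \<le> \<Lambda> * D"
proof -
  obtain M where M: "generator al au M" and eq: "H x (Delta x u) - H x (Delta x v) = (\<Sum>z\<in>UNIV. M x z * (u - v) $ z)"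
    using H_difference[of u v] by blast
  have M0: "generator 0 au M" unfolding generator_def
  proof (intro conjI allI impI)
    show "0 \<le> M x y" "M x y \<le> au" if "x \<noteq> y" for x y
    proof -
      have "al \<le> M x y" "M x y \<le> au" using M that by (auto simp: generator_def)
      then show "0 \<le> M x y" "M x y \<le> au" using A1 by linarith+
    qed
    show "(\<Sum>y\<in>UNIV. M x y) = 0" for x using M by (simp add: generator_def)
  qed
  let ?E = "excess_rate 0 au M x"
  have "(H x (Delta x u) + \<Lambda> * u $ x) - (H x (Delta x v) + \<Lambda> * v $ x) = (\<Sum>z\<in>UNIV. ?E z * (u - v) $ z)"
  proof -
    have "?E z * (u - v) $ z = M x z * (u - v) $ z + (if z = x then \<Lambda> * (u - v) $ z else 0)" for z
      by (simp add: excess_rate_def \<Lambda>_def d_def algebra_simps)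
    then have "(\<Sum>z\<in>UNIV. ?E z * (u - v) $ z) = (\<Sum>z\<in>UNIV. M x z * (u - v) $ z) + \<Lambda> * (u - v) $ x"
      by (simp add: sum.distrib)
    then show ?thesis using eq by (simp add: algebra_simps)
  qed
  also have "\<bar>\<dots>\<bar> \<le> (\<Sum>z\<in>UNIV. ?E z * D)"
  proof (rule order_trans[OF sum_abs], rule sum_mono)
    fix z
    show "\<bar>?E z * (u - v) $ z\<bar> \<le> ?E z * D"
      unfolding abs_mult using excess_rate_nonneg[OF M0, of x z] A1 D[of z] by (simp add: mult_left_mono)
  qed
  also have "\<dots> = \<Lambda> * D" by (simp add: sum_distrib_right[symmetric] excess_rate_sum[OF M0] \<Lambda>_def d_def)
  finally show ?thesis .
qed

lemma continuous_on_Delta: "continuous_on S u \<Longrightarrow> continuous_on S (\<lambda>t. Delta y (u t))"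
  unfolding Delta_def by (intro continuous_on_vec_lambda continuous_intros)

text \<open>Moving \<open>\<Lambda> * u\<close> to the other side raises the discount to \<open>r + \<Lambda>\<close>
  while the nonlinearity has Lipschitz constant \<open>\<Lambda>\<close>. Picard iteration then contracts by
  \<open>\<Lambda> / (r + \<Lambda>)\<close> in the unweighted norm, for every positive discount.\<close>

lemma decoupled_value_exists:
  assumes \<phi>: "continuous_on {0..} \<phi>" and src: "small_source 0 \<phi>" and r: "0 < r"
  shows "\<exists>u. (\<exists>B. \<forall>t\<ge>0. \<forall>x. \<bar>u t $ x\<bar> \<le> B) \<and>
    (\<forall>t\<ge>0. \<forall>x. ((\<lambda>s. u s $ x) has_rate (r * u t $ x - H x (Delta x (u t)) - \<phi> t $ x)) t)"
proof -
  define Bu where "Bu = (B0 + BF) / r"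
  have rBu: "r * Bu = B0 + BF" using r by (simp add: Bu_def)
  have Bu: "0 \<le> Bu" using B_nonneg r by (simp add: Bu_def)
  define P where "P = (\<lambda>v :: real \<Rightarrow> real ^ 'n. continuous_on {0..} v \<and> (\<forall>t\<ge>0. \<forall>x. \<bar>v t $ x\<bar> \<le> Bu))"
  define h where "h = (\<lambda>v :: real \<Rightarrow> real ^ 'n. \<lambda>t x. H x (Delta x (v t)) + \<Lambda> * v t $ x + \<phi> t $ x)"
  define sol where "sol = (\<lambda>v z :: real \<Rightarrow> real ^ 'n.
      (\<forall>t\<ge>0. \<forall>x. ((\<lambda>s. z s $ x) has_rate ((r + \<Lambda>) * z t $ x - h v t x)) t)
      \<and> (\<forall>t\<ge>0. \<forall>x. \<bar>z t $ x\<bar> \<le> Bu))"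
  define T where "T = (\<lambda>v. SOME z. sol v z)"
  have T: "sol v (T v)" if P: "P v" for v
  proof -
    have hb: "\<bar>h v t x\<bar> \<le> (r + \<Lambda>) * Bu" if t: "0 \<le> t" for t x
    proof -
      have D0: "Delta x (0 :: real ^ 'n) = 0" by (simp add: vec_eq_iff)
      have "\<bar>(H x (Delta x (v t)) + \<Lambda> * v t $ x) - (H x (Delta x 0) + \<Lambda> * (0 :: real ^ 'n) $ x)\<bar> \<le> \<Lambda> * Bu"
        by (rule H_shift_bound) (use P t in \<open>simp add: P_def\<close>)
      moreover have "\<bar>\<phi> t $ x\<bar> \<le> BF" using src t by (simp add: small_source_def)
      ultimately show ?thesis using B0[of x] rBu unfolding h_def D0 by (simp add: distrib_right)
    qed
    have "continuous_on {0..} (\<lambda>t. h v t x)" for x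
      unfolding h_def using P
      by (intro continuous_intros \<phi> continuous_on_compose2[OF H_continuous[of UNIV] continuous_on_Delta]) (auto simp: P_def)
    then have "\<exists>y. (\<forall>t\<ge>0. (y has_rate ((r + \<Lambda>) * y t - h v t x)) t) \<and> (\<forall>t\<ge>0. \<bar>y t\<bar> \<le> (r + \<Lambda>) * Bu / (r + \<Lambda>))" for x
      using r \<Lambda>_pos by (intro bounded_ode_exists hb) auto
    then obtain y where y: "\<And>x t. 0 \<le> t \<Longrightarrow> (y x has_rate ((r + \<Lambda>) * y x t - h v t x)) t"
      "\<And>x t. 0 \<le> t \<Longrightarrow> \<bar>y x t\<bar> \<le> (r + \<Lambda>) * Bu / (r + \<Lambda>)" by metis
    have "(r + \<Lambda>) * Bu / (r + \<Lambda>) = Bu" using r \<Lambda>_pos by simp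
    then have "sol v (\<lambda>t. \<chi> x. y x t)" unfolding sol_def using y by simp
    then show ?thesis unfolding T_def by (rule someI[of "sol v"])
  qed
  have PT: "P (T v)" if "P v" for v
  proof -
    have "continuous_on {0..} (T v)" using T[OF that] by (intro half_line_continuous_vec) (auto simp: sol_def)
    then show ?thesis using T[OF that] by (simp add: P_def sol_def)
  qed
  have "\<exists>v. P v \<and> (\<forall>t\<ge>0. T v t = v t)"
  proof (rule weighted_fixpoint[where P = P and \<rho> = 0 and q = "\<Lambda> / (r + \<Lambda>)" and B = Bu])
    show P0: "P (\<lambda>_. 0)" using Bu by (simp add: P_def)
    show "path_close 0 Bu (T (\<lambda>_. 0)) (\<lambda>_. 0)" using PT[OF P0] by (simp add: P_def path_close_def)
    show q: "0 \<le> \<Lambda> / (r + \<Lambda>)" "\<Lambda> / (r + \<Lambda>) < 1" using r \<Lambda>_pos by simp_all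
    show "P f" if "\<And>k. P (F k)" "\<And>k. path_close 0 (D * (\<Lambda> / (r + \<Lambda>)) ^ k) (F k) f" for F f D
      unfolding P_def
    proof (intro conjI allI impI)
      show "continuous_on {0..} f"
        by (rule continuous_path_limit(1)[OF _ that(2) q]) (use that(1) in \<open>auto simp: P_def\<close>)
      fix t :: real and x assume t: "0 \<le> t"
      have "(\<lambda>k. F k t) \<longlonglongrightarrow> f t"
        by (rule continuous_path_limit(2)[OF _ that(2) q t]) (use that(1) in \<open>auto simp: P_def\<close>)
      then have "(\<lambda>k. \<bar>F k t $ x\<bar>) \<longlonglongrightarrow> \<bar>f t $ x\<bar>" by (intro tendsto_intros)
      then show "\<bar>f t $ x\<bar> \<le> Bu"
        by (rule tendsto_upperbound) (use that(1) t in \<open>auto simp: P_def\<close>)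
    qed
    show "path_close 0 (\<Lambda> / (r + \<Lambda>) * D) (T v) (T v')" if P: "P v" "P v'" and D: "0 \<le> D" and close: "path_close 0 D v v'" for v v' D
      unfolding path_close_def
    proof (intro allI impI)
      fix t :: real and x assume t: "0 \<le> t"
      have "\<bar>T v t $ x - T v' t $ x\<bar> \<le> (\<Lambda> * D) * exp (- (0 * t)) / ((r + \<Lambda>) + 0)"
      proof (rule bounded_ode_decay[where h = "\<lambda>s. h v s x - h v' s x" and B = "2 * Bu", OF _ _ _ _ order_refl t])
        fix s :: real assume s: "0 \<le> s"
        have "((\<lambda>s. T v s $ x - T v' s $ x) has_rate (((r + \<Lambda>) * T v s $ x - h v s x) - ((r + \<Lambda>) * T v' s $ x - h v' s x))) s"
          using T[OF P(1)] T[OF P(2)] s by (intro DERIV_diff) (auto simp: sol_def)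
        then show "((\<lambda>s. T v s $ x - T v' s $ x) has_rate ((r + \<Lambda>) * (T v s $ x - T v' s $ x) - (h v s x - h v' s x))) s"
          by (rule DERIV_cong) (simp add: algebra_simps)
        have "\<bar>(H x (Delta x (v s)) + \<Lambda> * v s $ x) - (H x (Delta x (v' s)) + \<Lambda> * v' s $ x)\<bar> \<le> \<Lambda> * D"
          by (rule H_shift_bound) (use path_closeD[OF close s] in simp)
        then show "\<bar>h v s x - h v' s x\<bar> \<le> \<Lambda> * D * exp (- (0 * s))" by (simp add: h_def algebra_simps)
        have "\<bar>T v s $ x\<bar> \<le> Bu" "\<bar>T v' s $ x\<bar> \<le> Bu" using T[OF P(1)] T[OF P(2)] s by (auto simp: sol_def)
        then show "\<bar>T v s $ x - T v' s $ x\<bar> \<le> 2 * Bu" by linarith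
      qed (use r \<Lambda>_pos in simp)
      then show "\<bar>T v t $ x - T v' t $ x\<bar> \<le> \<Lambda> / (r + \<Lambda>) * D * exp (0 * t)" by simp
    qed
  qed (use PT in auto)
  then obtain v where Pv: "P v" and fixed: "\<And>t. 0 \<le> t \<Longrightarrow> T v t = v t" by blast
  have "((\<lambda>s. T v s $ x) has_rate (r * T v t $ x - H x (Delta x (T v t)) - \<phi> t $ x)) t"
    if t: "0 \<le> t" for t x
  proof -
    have "((\<lambda>s. T v s $ x) has_rate ((r + \<Lambda>) * T v t $ x - h v t x)) t"
      using T[OF Pv] t by (simp add: sol_def)
    then show ?thesis by (rule DERIV_cong) (simp add: h_def fixed[OF t] algebra_simps)
  qed
  moreover have "\<bar>T v t $ x\<bar> \<le> Bu" if "0 \<le> t" for t x using T[OF Pv] that by (simp add: sol_def)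
  ultimately show ?thesis by (intro exI[of _ "T v"]) blast
qed

lemma density_flow_exists:
  assumes u: "continuous_on {0..} u" and \<mu>0: "\<mu>0 \<in> prob_simplex"
  shows "\<exists>\<mu>. \<mu> 0 = \<mu>0 \<and> (\<forall>t\<ge>0. \<mu> t \<in> prob_simplex) \<and>
     (\<forall>t\<ge>0. \<forall>x. ((\<lambda>s. \<mu> s $ x) has_rate (\<Sum>y\<in>UNIV. \<mu> t $ y * g y (Delta y (u t)) $ x)) t)"
proof (rule forward_flow[where R = "\<lambda>t _ y x. g y (Delta y (u t)) $ x" and al = al and au = au and lip_const = "d * \<Lambda>"])
  show "continuous_on {0..} (\<lambda>t. g y (Delta y (u t)) $ x)" for y x
    by (intro continuous_intros continuous_on_compose2[OF g_continuous[of UNIV] continuous_on_Delta[OF u]]) auto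
  show "\<bar>(\<Sum>y\<in>UNIV. \<mu> $ y * g y (Delta y (u t)) $ x) - (\<Sum>y\<in>UNIV. \<nu> $ y * g y (Delta y (u t)) $ x)\<bar> \<le> d * \<Lambda> * D"
    if D: "\<And>y. \<bar>\<mu> $ y - \<nu> $ y\<bar> \<le> D" for t \<mu> \<nu> D x
  proof -
    have D0: "0 \<le> D" using D[of undefined] by (rule order_trans[OF abs_ge_zero])
    have "\<bar>(\<Sum>y\<in>UNIV. \<mu> $ y * g y (Delta y (u t)) $ x) - (\<Sum>y\<in>UNIV. \<nu> $ y * g y (Delta y (u t)) $ x)\<bar>
        \<le> (\<Sum>y\<in>UNIV. \<bar>\<mu> $ y - \<nu> $ y\<bar> * \<bar>g y (Delta y (u t)) $ x\<bar>)"
      unfolding sum_subtractf[symmetric] left_diff_distrib[symmetric] abs_mult[symmetric] by (rule sum_abs)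
    also have "\<dots> \<le> (\<Sum>y\<in>(UNIV :: 'n set). D * \<Lambda>)"
      by (intro sum_mono mult_mono D rate_abs_bound) (use D0 in auto)
    finally show ?thesis by (simp add: d_def mult_ac)
  qed
qed (use rate_generator A1 \<mu>0 d_pos \<Lambda>_pos in auto)

definition solvable :: "real \<Rightarrow> real \<Rightarrow> bool" where
  "solvable r \<theta> \<longleftrightarrow> (\<forall>\<phi> \<mu>0. continuous_on {0..} \<phi> \<longrightarrow> small_source \<theta> \<phi> \<longrightarrow> \<mu>0 \<in> prob_simplex \<longrightarrow>
      (\<exists>u \<mu>. system r \<theta> \<phi> \<mu>0 u \<mu>))"

lemma solvable_decoupled:
  assumes "0 < r" shows "solvable r 0"
  unfolding solvable_def
proof (intro allI impI)
  fix \<phi> :: "real \<Rightarrow> real ^ 'n" and \<mu>0 :: "real ^ 'n"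
  assume \<phi>: "continuous_on {0..} \<phi>" "small_source 0 \<phi>" and \<mu>0: "\<mu>0 \<in> prob_simplex"
  obtain u where u: "\<exists>B. \<forall>t\<ge>0. \<forall>x. \<bar>u t $ x\<bar> \<le> B"
    "\<And>t x. 0 \<le> t \<Longrightarrow> ((\<lambda>s. u s $ x) has_rate (r * u t $ x - H x (Delta x (u t)) - \<phi> t $ x)) t"
    using decoupled_value_exists[OF \<phi> assms] by blast
  have cu: "continuous_on {0..} u" using u(2) by (intro half_line_continuous_vec) blast
  obtain \<mu> where \<mu>: "\<mu> 0 = \<mu>0 \<and> (\<forall>t\<ge>0. \<mu> t \<in> prob_simplex) \<and>
     (\<forall>t\<ge>0. \<forall>x. ((\<lambda>s. \<mu> s $ x) has_rate (\<Sum>y\<in>UNIV. \<mu> t $ y * g y (Delta y (u t)) $ x)) t)"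
    using density_flow_exists[OF cu \<mu>0] by (elim exE)
  have "system r 0 \<phi> \<mu>0 u \<mu>" unfolding system_def
    by (intro conjI u(1) \<mu>[THEN conjunct1] \<mu>[THEN conjunct2, THEN conjunct1] \<mu>[THEN conjunct2, THEN conjunct2])
      (use u(2) in simp)
  then show "\<exists>u \<mu>. system r 0 \<phi> \<mu>0 u \<mu>" by blast
qed

text \<open>A further portion \<open>e\<close> of the coupling is frozen along a guessed path of distributions and
  treated as a source. By \<open>coupled_pair_decay\<close> with \<open>l = 0\<close>, the resulting distribution
  depends on the guess with a Lipschitz constant proportional to \<open>e\<close>, and the admissible \<open>e\<close>
  is the same at every \<open>\<theta>\<close>.\<close>

lemma solvable_step:
  assumes r: "0 < r" "r < coupling.r0" and sol: "solvable r \<theta>" and \<theta>: "0 \<le> \<theta>" "0 \<le> e" "\<theta> + e \<le> 1"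
    and small: "coupling.decay_constant r * (e * LF * d) \<le> 1 / 2"
  shows "solvable r (\<theta> + e)"
  unfolding solvable_def
proof (intro allI impI)
  fix \<phi> :: "real \<Rightarrow> real ^ 'n" and \<mu>0 :: "real ^ 'n"
  assume \<phi>: "continuous_on {0..} \<phi>" and src: "small_source (\<theta> + e) \<phi>" and \<mu>0: "\<mu>0 \<in> prob_simplex"
  define P :: "(real \<Rightarrow> real ^ 'n) \<Rightarrow> bool" where "P = simplex_path"
  define S where "S = (\<lambda>\<nu> :: real \<Rightarrow> real ^ 'n. \<lambda>t. \<chi> x. \<phi> t $ x + e * F x (\<nu> t))"
  define T where "T = (\<lambda>\<nu>. SOME m. \<exists>u. system r \<theta> (S \<nu>) \<mu>0 u m)"
  have F_cont: "continuous_on prob_simplex (F x)" for x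
    by (rule lipschitz_on_continuous_on[of LF], rule lipschitz_onI) (use F_lipschitz pos in \<open>auto simp: dist_norm\<close>)
  have S: "small_source \<theta> (S \<nu>)" if "P \<nu>" for \<nu>
    unfolding small_source_def
  proof (intro conjI allI impI)
    show "0 \<le> \<theta>" "\<theta> \<le> 1" using \<theta> by auto
    fix t :: real and x assume t: "0 \<le> t"
    have "\<bar>e * F x (\<nu> t)\<bar> \<le> e * BF" using \<theta> that t BF by (simp add: abs_mult P_def simplex_path_def mult_left_mono)
    moreover have "\<bar>\<phi> t $ x\<bar> \<le> (1 - (\<theta> + e)) * BF" using src t by (simp add: small_source_def)
    moreover have "(1 - (\<theta> + e)) * BF + e * BF = (1 - \<theta>) * BF" by (simp add: algebra_simps)
    ultimately show "\<bar>S \<nu> t $ x\<bar> \<le> (1 - \<theta>) * BF" by (simp add: S_def)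
  qed
  have T: "\<exists>u. system r \<theta> (S \<nu>) \<mu>0 u (T \<nu>)" if P: "P \<nu>" for \<nu>
  proof -
    have "continuous_on {0..} (S \<nu>)" unfolding S_def using P
      by (intro continuous_on_vec_lambda continuous_intros \<phi> continuous_on_compose2[OF F_cont]) (auto simp: P_def simplex_path_def)
    then have "\<exists>m. \<exists>u. system r \<theta> (S \<nu>) \<mu>0 u m" using sol S[OF P] \<mu>0 unfolding solvable_def by blast
    then show ?thesis unfolding T_def by (rule someI_ex)
  qed
  have PT: "P (T \<nu>)" if P: "P \<nu>" for \<nu>
    using T[OF P] system_continuous(2) systemD(2) unfolding P_def simplex_path_def by blast
  have "\<exists>\<mu>. P \<mu> \<and> (\<forall>t\<ge>0. T \<mu> t = \<mu> t)"
  proof (rule weighted_fixpoint[where P = P and \<rho> = 0 and q = "1/2" and B = 1])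
    show P0: "P (\<lambda>_. \<mu>0)" using \<mu>0 by (simp add: P_def simplex_path_def)
    show "P f" if "\<And>k. P (F k)" "\<And>k. path_close 0 (D * (1/2) ^ k) (F k) f" for F f D
      using simplex_path_limit[OF _ that(2)] that(1) by (simp add: P_def)
    show "path_close 0 1 (T (\<lambda>_. \<mu>0)) (\<lambda>_. \<mu>0)"
      using PT[OF P0] \<mu>0 by (intro simplex_path_bounded_step) (auto simp: P_def)
    show "path_close 0 (1 / 2 * D) (T \<nu>) (T \<nu>')" if P: "P \<nu>" "P \<nu>'" and D: "0 \<le> D" and close: "path_close 0 D \<nu> \<nu>'" for \<nu> \<nu>' D
      unfolding path_close_def
    proof (intro allI impI)
      fix t :: real and x assume t: "0 \<le> t"
      obtain u u' where u: "system r \<theta> (S \<nu>) \<mu>0 u (T \<nu>)" "system r \<theta> (S \<nu>') \<mu>0 u' (T \<nu>')" using T[OF P(1)] T[OF P(2)] by blast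
      define \<epsilon> where "\<epsilon> = e * LF * d * D"
      have \<epsilon>: "0 \<le> \<epsilon>" using \<theta> pos d_pos D by (simp add: \<epsilon>_def)
      have cp: "coupled_pair al au LL (c / 2) r \<epsilon> 0 (\<lambda>t. u t - u' t) (\<lambda>t. T \<nu> t - T \<nu>' t)"
      proof (rule system_pair_coupled[OF u S[OF P(1)] S[OF P(2)] r(1)])
        fix s :: real and x assume s: "0 \<le> s"
        have "norm (\<nu> s - \<nu>' s) \<le> d * D" unfolding d_def
          by (rule norm_le_card_bound) (use path_closeD[OF close s] in simp)
        then have "LF * norm (\<nu> s - \<nu>' s) \<le> LF * (d * D)" using pos by (intro mult_left_mono) auto
        moreover have "\<bar>F x (\<nu> s) - F x (\<nu>' s)\<bar> \<le> LF * norm (\<nu> s - \<nu>' s)" using P s by (intro F_lipschitz) (auto simp: P_def simplex_path_def)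
        ultimately have "\<bar>F x (\<nu> s) - F x (\<nu>' s)\<bar> \<le> LF * (d * D)" by linarith
        then have "e * \<bar>F x (\<nu> s) - F x (\<nu>' s)\<bar> \<le> e * (LF * (d * D))" using \<theta> by (intro mult_left_mono) auto
        moreover have "\<bar>S \<nu> s $ x - S \<nu>' s $ x\<bar> = e * \<bar>F x (\<nu> s) - F x (\<nu>' s)\<bar>"
          using \<theta> by (simp add: S_def right_diff_distrib[symmetric] abs_mult)
        ultimately show "\<bar>S \<nu> s $ x - S \<nu>' s $ x\<bar> \<le> \<epsilon> * exp (- (0 * s))" by (simp add: \<epsilon>_def mult_ac)
      qed
      have "l1 (T \<nu> t - T \<nu>' t) \<le> coupling.decay_constant r * (exp (- (0 * t)) * (l1 (T \<nu> 0 - T \<nu>' 0) + \<epsilon>))"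
        by (rule coupling.coupled_pair_decay(1)[OF cp r _ _ \<epsilon> r(1) _ t]) (use coupling.constants_pos(9) in auto)
      also have "l1 (T \<nu> 0 - T \<nu>' 0) = 0" using systemD(3)[OF u(1)] systemD(3)[OF u(2)] by (simp add: l1_def)
      finally have "l1 (T \<nu> t - T \<nu>' t) \<le> coupling.decay_constant r * (e * LF * d) * D" by (simp add: \<epsilon>_def mult_ac)
      also have "\<dots> \<le> 1 / 2 * D" by (intro mult_right_mono small D)
      finally show "\<bar>T \<nu> t $ x - T \<nu>' t $ x\<bar> \<le> 1 / 2 * D * exp (0 * t)"
        using l1_component[of "T \<nu> t - T \<nu>' t" x] by simp
    qed
  qed (use PT in auto)
  then obtain \<nu> where P\<nu>: "P \<nu>" and fixed: "\<And>t. 0 \<le> t \<Longrightarrow> T \<nu> t = \<nu> t" by blast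
  obtain u where u: "system r \<theta> (S \<nu>) \<mu>0 u (T \<nu>)" using T[OF P\<nu>] by blast
  have "system r (\<theta> + e) \<phi> \<mu>0 u (T \<nu>)"
    unfolding system_def
  proof (intro conjI allI impI)
    show "\<exists>B. \<forall>t\<ge>0. \<forall>x. \<bar>u t $ x\<bar> \<le> B" "T \<nu> 0 = \<mu>0" by (rule systemD[OF u])+
    fix t :: real assume t: "0 \<le> t"
    show "T \<nu> t \<in> prob_simplex" by (rule systemD(2)[OF u t])
    fix x
    show "((\<lambda>s. u s $ x) has_rate (r * u t $ x - H x (Delta x (u t)) - (\<theta> + e) * F x (T \<nu> t) - \<phi> t $ x)) t"
      by (rule DERIV_cong[OF systemD(4)[OF u t]]) (simp add: S_def fixed[OF t] algebra_simps)
    show "((\<lambda>s. T \<nu> s $ x) has_rate (\<Sum>y\<in>UNIV. T \<nu> t $ y * g y (Delta y (u t)) $ x)) t"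
      by (rule systemD(5)[OF u t])
  qed
  then show "\<exists>u \<mu>. system r (\<theta> + e) \<phi> \<mu>0 u \<mu>" by blast
qed

text \<open>Finitely many steps of equal length lead from the decoupled system to the full one; their length is
  dictated by the decay constant alone.\<close>

theorem system_exists:
  assumes r: "0 < r" "r < coupling.r0" and \<mu>0: "\<mu>0 \<in> prob_simplex"
  shows "\<exists>u \<mu>. system r 1 (\<lambda>_. 0) \<mu>0 u \<mu>"
proof -
  define k where "k = coupling.decay_constant r * LF * d"
  obtain N :: nat where N: "2 * k + 1 \<le> real N" using real_arch_simple by blast
  \<comment> \<open>The sign is read off from the decay estimate for the trivial pair, a solution minus
    itself.\<close>
  have k0: "0 \<le> coupling.decay_constant r"
  proof -
    have "\<exists>w n :: real \<Rightarrow> real ^ 'n. coupled_pair al au LL (c / 2) r 0 0 w n"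
    proof -
      have s: "small_source 0 (\<lambda>_. 0)" using B_nonneg by (simp add: small_source_def)
      then obtain u \<mu> where u: "system r 0 (\<lambda>_. 0) \<mu>0 u \<mu>"
        using solvable_decoupled[OF r(1)] \<mu>0 continuous_on_const unfolding solvable_def by blast
      show ?thesis using system_pair_coupled[OF u u s s r(1), of 0 0] by auto
    qed
    then show ?thesis using coupling.coupled_pair_decay(4)[OF _ r, of 0 0] r coupling.constants_pos(9) by force
  qed
  then have k: "0 \<le> k" using pos d_pos by (simp add: k_def)
  then have N0: "0 < real N" using N by linarith
  have small: "coupling.decay_constant r * (1 / real N * LF * d) \<le> 1 / 2"
  proof -
    have "coupling.decay_constant r * (1 / real N * LF * d) = k / real N" by (simp add: k_def mult_ac)
    also have "\<dots> \<le> 1 / 2" using N N0 k by (simp add: field_simps)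
    finally show ?thesis .
  qed
  have "j \<le> N \<Longrightarrow> solvable r (real j / real N)" for j
  proof (induction j)
    case 0
    then show ?case using solvable_decoupled[OF r(1)] by simp
  next
    case (Suc j)
    have e: "real (Suc j) / real N = real j / real N + 1 / real N" by (simp add: add_divide_distrib)
    have "real j / real N + 1 / real N \<le> 1" using Suc.prems N0 unfolding e[symmetric] by simp
    then show ?case unfolding e using Suc small by (intro solvable_step[OF r]) auto
  qed
  from this[of N] have "solvable r 1" using N0 by simp
  moreover have "small_source 1 (\<lambda>_. 0)" by (simp add: small_source_def)
  ultimately show ?thesis using \<mu>0 continuous_on_const unfolding solvable_def by blast
qed

end

section \<open>First and second differences of equilibria\<close>

context mfg_constants
begin

lemma Hess_sum: "(\<Sum>x\<in>UNIV. (Hess y p *v q) $ x) = 0"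
proof -
  have "((\<lambda>p. \<Sum>x\<in>UNIV. g y p $ x) has_derivative (\<lambda>q. \<Sum>x\<in>UNIV. (Hess y p *v q) $ x)) (at p)"
    by (intro has_derivative_sum bounded_linear.has_derivative[OF bounded_linear_vec_nth] g_deriv)
  moreover have "((\<lambda>p. \<Sum>x\<in>UNIV. g y p $ x) has_derivative (\<lambda>q. 0)) (at p)"
    unfolding rate_sum by simp
  ultimately have "(\<lambda>q. \<Sum>x\<in>UNIV. (Hess y p *v q) $ x) = (\<lambda>q. 0)" by (rule has_derivative_unique)
  then show ?thesis by meson
qed

lemma inner_Delta_sum_zero:
  fixes v w :: "real ^ 'n"
  assumes "(\<Sum>x\<in>UNIV. v $ x) = 0"
  shows "v \<bullet> Delta y w = v \<bullet> w"
  using assms by (simp add: inner_vec_def right_diff_distrib sum_subtractf flip: sum_distrib_right)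

text \<open>The infinitesimal form of monotonicity, from difference quotients along \<open>n\<close>; every direction
  of mass \<open>0\<close> stays in the simplex for a short time.\<close>

lemma GF_monotone_interior:
  fixes n :: "real ^ 'n"
  assumes \<eta>: "\<eta> \<in> prob_simplex" and int: "\<And>x. 0 < \<eta> $ x" and n: "(\<Sum>x\<in>UNIV. n $ x) = 0"
  shows "0 \<le> (\<Sum>x\<in>UNIV. (GF x \<eta> \<bullet> n) * n $ x)"
proof -
  define m where "m = Min (range (($) \<eta>))"
  have m: "0 < m" "\<And>x. m \<le> \<eta> $ x" using int by (auto simp: m_def Min_gr_iff)
  define \<sigma> where "\<sigma> = m / (norm n + 1)"
  have \<sigma>: "0 < \<sigma>" using m by (simp add: \<sigma>_def add_nonneg_pos)
  have inS: "\<eta> + s *\<^sub>R n \<in> prob_simplex" if s: "0 \<le> s" "s \<le> \<sigma>" for s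
  proof -
    have "0 \<le> \<eta> $ x + s * n $ x" for x
    proof -
      have "\<bar>s * n $ x\<bar> \<le> \<sigma> * (norm n + 1)"
        unfolding abs_mult using s component_le_norm_cart[of n x] by (intro mult_mono) auto
      also have "\<dots> = m" using norm_ge_zero[of n] unfolding \<sigma>_def by (simp add: add_nonneg_eq_0_iff)
      finally show ?thesis using m(2)[of x] by linarith
    qed
    then show ?thesis using simplex_sum[OF \<eta>] n by (simp add: prob_simplex_def sum.distrib flip: sum_distrib_left)
  qed
  have "((\<lambda>s. (F x (\<eta> + s *\<^sub>R n) - F x \<eta>) / s) \<longlongrightarrow> GF x \<eta> \<bullet> n) (at_right 0)" for x
  proof -
    let ?I = "{0<..<\<sigma>}"
    have p: "((\<lambda>s. \<eta> + s *\<^sub>R n) has_derivative (\<lambda>s. s *\<^sub>R n)) (at 0 within ?I)"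
      by (auto intro!: derivative_eq_intros)
    have "(F x has_derivative (\<lambda>v. GF x \<eta> \<bullet> v)) (at \<eta> within prob_simplex)"
      using GF[of x] \<eta> by (simp add: simplex_gradient_def)
    then have "(F x has_derivative (\<lambda>v. GF x \<eta> \<bullet> v)) (at (\<eta> + 0 *\<^sub>R n) within (\<lambda>s. \<eta> + s *\<^sub>R n) ` ?I)"
      using inS by (auto intro: has_derivative_subset)
    from has_derivative_in_compose[OF p this]
    have "((\<lambda>s. F x (\<eta> + s *\<^sub>R n)) has_real_derivative (GF x \<eta> \<bullet> n)) (at 0 within ?I)"
      by (simp add: has_field_derivative_def mult_commute_abs)
    then have "((\<lambda>s. (F x (\<eta> + s *\<^sub>R n) - F x \<eta>) / s) \<longlongrightarrow> GF x \<eta> \<bullet> n) (at 0 within ?I)"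
      by (simp add: has_field_derivative_iff)
    moreover have "at 0 within ?I = at_right 0" using \<sigma> by (intro at_within_nhd[of 0 "{..<\<sigma>}"]) auto
    ultimately show ?thesis by simp
  qed
  then have "((\<lambda>s. \<Sum>x\<in>UNIV. (F x (\<eta> + s *\<^sub>R n) - F x \<eta>) / s * n $ x) \<longlongrightarrow> (\<Sum>x\<in>UNIV. (GF x \<eta> \<bullet> n) * n $ x)) (at_right 0)"
    by (intro tendsto_intros)
  moreover have "eventually (\<lambda>s. 0 \<le> (\<Sum>x\<in>UNIV. (F x (\<eta> + s *\<^sub>R n) - F x \<eta>) / s * n $ x)) (at_right 0)"
    using eventually_at_right_real[OF \<sigma>]
  proof eventually_elim
    case (elim s)
    then have s: "0 < s" "s < \<sigma>" by auto
    have "0 \<le> (\<Sum>x\<in>UNIV. (F x (\<eta> + s *\<^sub>R n) - F x \<eta>) * ((\<eta> + s *\<^sub>R n) $ x - \<eta> $ x))"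
      using A4[unfolded lasry_lions_monotone_def, rule_format, OF inS[of s] \<eta>] s by simp
    also have "\<dots> = s\<^sup>2 * (\<Sum>x\<in>UNIV. (F x (\<eta> + s *\<^sub>R n) - F x \<eta>) / s * n $ x)"
      using s by (simp add: sum_distrib_left power2_eq_square mult_ac)
    finally show ?case using s by (simp add: zero_le_mult_iff)
  qed
  ultimately show ?thesis by (rule tendsto_lowerbound) simp
qed

text \<open>Boundary points are approached along the segment from the barycentre \<open>b\<close>.\<close>

lemma GF_monotone:
  fixes n :: "real ^ 'n"
  assumes \<eta>: "\<eta> \<in> prob_simplex" and n: "(\<Sum>x\<in>UNIV. n $ x) = 0"
  shows "0 \<le> (\<Sum>x\<in>UNIV. (GF x \<eta> \<bullet> n) * n $ x)"
proof -
  define b :: "real ^ 'n" where "b = (\<chi> x. 1 / d)"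
  have b: "b \<in> prob_simplex" using d_pos by (simp add: prob_simplex_def b_def d_def)
  define \<theta> where "\<theta> = (\<lambda>k::nat. \<eta> + (1 / real (Suc k)) *\<^sub>R (b - \<eta>))"
  have \<theta>S: "\<theta> k \<in> prob_simplex" for k unfolding \<theta>_def by (intro simplex_segment \<eta> b) auto
  have \<theta>pos: "0 < \<theta> k $ x" for k x
  proof -
    have "\<theta> k $ x = (1 - 1 / real (Suc k)) * \<eta> $ x + (1 / real (Suc k)) * (1 / d)"
      by (simp add: \<theta>_def b_def algebra_simps)
    moreover have "0 \<le> (1 - 1 / real (Suc k)) * \<eta> $ x" using simplex_nonneg[OF \<eta>] by (intro mult_nonneg_nonneg) auto
    moreover have "0 < (1 / real (Suc k)) * (1 / d)" using d_pos by (intro mult_pos_pos divide_pos_pos) auto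
    ultimately show ?thesis by linarith
  qed
  have inv: "(\<lambda>k. 1 / real (Suc k)) \<longlonglongrightarrow> 0" using LIMSEQ_inverse_real_of_nat by (simp add: inverse_eq_divide)
  have "\<theta> \<longlonglongrightarrow> \<eta> + 0 *\<^sub>R (b - \<eta>)" unfolding \<theta>_def by (intro tendsto_intros inv)
  then have \<theta>lim: "\<theta> \<longlonglongrightarrow> \<eta>" by simp
  have "(\<lambda>k. GF x (\<theta> k)) \<longlonglongrightarrow> GF x \<eta>" for x
  proof -
    have "continuous_on prob_simplex (GF x)" using GF[of x] by (simp add: simplex_gradient_def)
    from continuous_on_tendsto_compose[OF this \<theta>lim \<eta>] \<theta>S show ?thesis by simp
  qed
  then have "(\<lambda>k. \<Sum>x\<in>UNIV. (GF x (\<theta> k) \<bullet> n) * n $ x) \<longlonglongrightarrow> (\<Sum>x\<in>UNIV. (GF x \<eta> \<bullet> n) * n $ x)"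
    by (intro tendsto_intros)
  then show ?thesis
    by (rule tendsto_lowerbound) (auto intro!: always_eventually GF_monotone_interior \<theta>S \<theta>pos n)
qed

abbreviation equilibrium :: "real \<Rightarrow> real ^ 'n \<Rightarrow> (real \<Rightarrow> real ^ 'n) \<Rightarrow> (real \<Rightarrow> real ^ 'n) \<Rightarrow> bool" where
  "equilibrium r \<equiv> system r 1 (\<lambda>_. 0)"

lemma small_source_zero: "small_source 1 (\<lambda>_. 0)"
  by (simp add: small_source_def)

text \<open>The largest rate that \<open>coupled_pair_decay\<close> admits, with the constant that belongs to it;
  neither depends on the discount.\<close>

definition "lam = coupling.c5 / 4"
definition "C0 = coupling.decay_constant lam"

lemma lam_pos: "0 < lam" using coupling.constants_pos(9) by (simp add: lam_def)

lemma equilibrium_pair_coupled: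
  assumes "equilibrium r \<mu>1 u1 m1" "equilibrium r \<mu>2 u2 m2" "0 < r"
  shows "coupled_pair al au LL (c / 2) r 0 l (\<lambda>t. u1 t - u2 t) (\<lambda>t. m1 t - m2 t)"
  by (rule system_pair_coupled[OF assms(1,2) small_source_zero small_source_zero assms(3)]) simp

lemma equilibrium_pair_decay:
  assumes e: "equilibrium r \<mu>1 u1 m1" "equilibrium r \<mu>2 u2 m2" and r: "0 < r" "r < coupling.r0" and t: "0 \<le> t"
  shows "l1 (m1 t - m2 t) \<le> C0 * exp (- (lam * t)) * l1 (\<mu>1 - \<mu>2)"
    and "osc (u1 t - u2 t) \<le> C0 * exp (- (lam * t)) * l1 (\<mu>1 - \<mu>2)"
    and "\<bar>u1 t $ x - u2 t $ x\<bar> \<le> C0 * exp (- (lam * t)) * l1 (\<mu>1 - \<mu>2)"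
    and "0 \<le> C0"
proof -
  note cp = equilibrium_pair_coupled[OF e r(1), of lam]
  note D = coupling.coupled_pair_decay[OF cp r less_imp_le[OF lam_pos] _ order_refl lam_pos _ t]
  have l: "lam \<le> coupling.c5 / 4" "lam \<le> r + lam" using r by (simp_all add: lam_def)
  show "l1 (m1 t - m2 t) \<le> C0 * exp (- (lam * t)) * l1 (\<mu>1 - \<mu>2)"
    using D(1)[OF l] systemD(3)[OF e(1)] systemD(3)[OF e(2)] by (simp add: C0_def mult.assoc)
  show "osc (u1 t - u2 t) \<le> C0 * exp (- (lam * t)) * l1 (\<mu>1 - \<mu>2)"
    using D(2)[OF l] systemD(3)[OF e(1)] systemD(3)[OF e(2)] by (simp add: C0_def mult.assoc)
  show "\<bar>u1 t $ x - u2 t $ x\<bar> \<le> C0 * exp (- (lam * t)) * l1 (\<mu>1 - \<mu>2)"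
    using D(3)[OF l] systemD(3)[OF e(1)] systemD(3)[OF e(2)] by (simp add: C0_def mult.assoc)
  show "0 \<le> C0" using D(4)[OF l] by (simp add: C0_def)
qed

text \<open>A discrete product rule: the leading terms carry the second difference of one factor and the value of the
  other at \<open>a\<close>; each remaining term contains a first difference of both factors, in different directions,
  or a first difference of one and the second difference of the other.\<close>

lemma product_second_difference:
  fixes sa sb sc sd :: real and ga gb gc gd :: "'a::real_vector"
  shows "sa *\<^sub>R ga - sb *\<^sub>R gb - sc *\<^sub>R gc + sd *\<^sub>R gd
    = (sa - sb - sc + sd) *\<^sub>R ga + sa *\<^sub>R (ga - gb - gc + gd)
      + ((sa - sb) *\<^sub>R (gb - gd) + (sb - sd) *\<^sub>R (ga - gb) - (sa - sb - sc + sd) *\<^sub>R (ga - gc)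
         - (sb - sd) *\<^sub>R (ga - gb - gc + gd))"
  by (simp add: algebra_simps)

definition "second_order_constant = (3 * Lg + 3 * LF + 7 * (d * d) * Lg) * (d * C0)\<^sup>2"

text \<open>The second difference of four equilibria solves the system linearised at the equilibrium \<open>a\<close>,
  up to products of two first differences. Each first difference decays like \<open>exp (- lam t)\<close>, so the
  error inherits decay with a factor \<open>h1 * h2\<close>. The linearised system is again a coupled pair: the rates
  of \<open>a\<close> are a generator, the Hessian yields the dissipation, and the gradient of the coupling cost is
  monotone. This is the discrete counterpart of differentiating the system twice in the initial distribution.\<close>

lemma second_difference_coupled:
  assumes ea: "equilibrium r \<mu>a ua ma" and eb: "equilibrium r \<mu>b ub mb"
    and ec: "equilibrium r \<mu>c uc mc" and ed: "equilibrium r \<mu>d ud md"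
    and r: "0 < r" "r < coupling.r0"
  shows "coupled_pair al au LL (c / 2) r
      (second_order_constant * ((l1 (\<mu>a - \<mu>b) + l1 (\<mu>c - \<mu>d)) * (l1 (\<mu>a - \<mu>c) + l1 (\<mu>b - \<mu>d)))) lam
      (\<lambda>t. ua t - ub t - uc t + ud t) (\<lambda>t. ma t - mb t - mc t + md t)"
  unfolding coupled_pair_def
proof (intro conjI allI impI)
  obtain Ba Bb Bc Bd where B: "\<And>t x. 0 \<le> t \<Longrightarrow> \<bar>ua t $ x\<bar> \<le> Ba" "\<And>t x. 0 \<le> t \<Longrightarrow> \<bar>ub t $ x\<bar> \<le> Bb"
    "\<And>t x. 0 \<le> t \<Longrightarrow> \<bar>uc t $ x\<bar> \<le> Bc" "\<And>t x. 0 \<le> t \<Longrightarrow> \<bar>ud t $ x\<bar> \<le> Bd"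
    using systemD(1)[OF ea] systemD(1)[OF eb] systemD(1)[OF ec] systemD(1)[OF ed] by metis
  have "\<bar>(ua t - ub t - uc t + ud t) $ x\<bar> \<le> Ba + Bb + Bc + Bd + 2 \<and> \<bar>(ma t - mb t - mc t + md t) $ x\<bar> \<le> Ba + Bb + Bc + Bd + 2"
    if t: "0 \<le> t" for t x
  proof -
    note simplex_nonneg[OF systemD(2)[OF ea t], of x] simplex_le1[OF systemD(2)[OF ea t], of x]
      simplex_nonneg[OF systemD(2)[OF eb t], of x] simplex_le1[OF systemD(2)[OF eb t], of x]
      simplex_nonneg[OF systemD(2)[OF ec t], of x] simplex_le1[OF systemD(2)[OF ec t], of x]
      simplex_nonneg[OF systemD(2)[OF ed t], of x] simplex_le1[OF systemD(2)[OF ed t], of x]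
      B(1)[OF t, of x] B(2)[OF t, of x] B(3)[OF t, of x] B(4)[OF t, of x]
    then show ?thesis by simp linarith
  qed
  then show "\<exists>B. \<forall>t\<ge>0. \<forall>x. \<bar>(ua t - ub t - uc t + ud t) $ x\<bar> \<le> B \<and> \<bar>(ma t - mb t - mc t + md t) $ x\<bar> \<le> B" by blast
next
  fix t :: real assume t: "0 \<le> t"
  define w where "w = ua t - ub t - uc t + ud t"
  define n where "n = ma t - mb t - mc t + md t"
  define h1 where "h1 = l1 (\<mu>a - \<mu>b) + l1 (\<mu>c - \<mu>d)"
  define h2 where "h2 = l1 (\<mu>a - \<mu>c) + l1 (\<mu>b - \<mu>d)"
  define e where "e = second_order_constant * (h1 * h2) * exp (- (lam * t))"
  define E where "E = exp (- (lam * t))"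
  \<comment> \<open>\<open>X1\<close> and \<open>X2\<close> bound the first differences at time \<open>t\<close> in
    the two directions of the quadrilateral.\<close>
  define X1 where "X1 = d * (C0 * E * h1)"
  define X2 where "X2 = d * (C0 * E * h2)"
  have h: "0 \<le> h1" "0 \<le> h2" by (auto simp: h1_def h2_def l1_nonneg)
  have C0: "0 \<le> C0" by (rule equilibrium_pair_decay(4)[OF ea eb r t])
  have E: "0 \<le> E" "E \<le> 1" using lam_pos t by (auto simp: E_def)
  have X: "0 \<le> X1" "0 \<le> X2" using h C0 E d_pos by (auto simp: X1_def X2_def)
  \<comment> \<open>A product of two first differences decays at twice the rate; one of the two exponentials is
    dropped.\<close>
  have X12: "(3 * Lg + 3 * LF + 7 * (d * d) * Lg) * (X1 * X2) \<le> e"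
  proof -
    have "(3 * Lg + 3 * LF + 7 * (d * d) * Lg) * (X1 * X2) = second_order_constant * (h1 * h2) * E * E"
      by (simp add: second_order_constant_def X1_def X2_def power2_eq_square mult_ac)
    also have "\<dots> \<le> second_order_constant * (h1 * h2) * E * 1"
      using E h pos d_pos by (intro mult_left_mono mult_nonneg_nonneg) (auto simp: second_order_constant_def)
    finally show ?thesis by (simp add: e_def E_def)
  qed
  define k where "k = X1 * X2"
  have k: "0 \<le> k" using X by (simp add: k_def)
  have parts: "3 * Lg * k + 3 * LF * k + 7 * (d * d) * Lg * k \<le> e"
    using X12 by (simp add: k_def algebra_simps)
  have parts_pos: "0 \<le> 3 * Lg * k" "0 \<le> 3 * LF * k" "0 \<le> 7 * (d * d) * Lg * k" using k pos d_pos by simp_all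
  note Sa = systemD(2)[OF ea t] and Sb = systemD(2)[OF eb t] and Sc = systemD(2)[OF ec t] and Sd = systemD(2)[OF ed t]
  note src = small_source_zero
  have oa: "osc (ua t) \<le> K" and ob: "osc (ub t) \<le> K" and oc: "osc (uc t) \<le> K" and od: "osc (ud t) \<le> K"
    using system_osc[OF ea src r(1) t] system_osc[OF eb src r(1) t] system_osc[OF ec src r(1) t] system_osc[OF ed src r(1) t] .
  have dl: "x \<le> d * x" if "0 \<le> x" for x using mult_right_mono[OF d_pos that] by simp
  have du: "norm (Delta y (v1 t) - Delta y (v2 t)) \<le> d * (C0 * E * l1 (\<nu>1 - \<nu>2))"
    and dm: "norm (m1 t - m2 t) \<le> d * (C0 * E * l1 (\<nu>1 - \<nu>2))"
    if e: "equilibrium r \<nu>1 v1 m1" "equilibrium r \<nu>2 v2 m2" for y v1 v2 m1 m2 \<nu>1 \<nu>2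
  proof -
    have "norm (Delta y (v1 t - v2 t)) \<le> d * osc (v1 t - v2 t)" unfolding d_def by (rule norm_Delta_le)
    also have "\<dots> \<le> d * (C0 * E * l1 (\<nu>1 - \<nu>2))"
      using equilibrium_pair_decay(2)[OF e r t] d_pos by (intro mult_left_mono) (auto simp: E_def)
    finally show "norm (Delta y (v1 t) - Delta y (v2 t)) \<le> d * (C0 * E * l1 (\<nu>1 - \<nu>2))" by (simp add: Delta_diff)
    have "norm (m1 t - m2 t) \<le> l1 (m1 t - m2 t)" by (rule norm_le_l1)
    also have "\<dots> \<le> C0 * E * l1 (\<nu>1 - \<nu>2)" using equilibrium_pair_decay(1)[OF e r t] by (simp add: E_def)
    also have "\<dots> \<le> d * (C0 * E * l1 (\<nu>1 - \<nu>2))" using C0 E l1_nonneg by (intro dl mult_nonneg_nonneg) auto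
    finally show "norm (m1 t - m2 t) \<le> d * (C0 * E * l1 (\<nu>1 - \<nu>2))" .
  qed
  have X1s: "d * (C0 * E * l1 (\<mu>a - \<mu>b)) + d * (C0 * E * l1 (\<mu>c - \<mu>d)) = X1"
    and X2s: "d * (C0 * E * l1 (\<mu>a - \<mu>c)) + d * (C0 * E * l1 (\<mu>b - \<mu>d)) = X2"
    by (simp_all add: X1_def X2_def h1_def h2_def algebra_simps)
  have XX: "0 \<le> d * (C0 * E * l1 v)" for v :: "real ^ 'n" using C0 E d_pos l1_nonneg by (intro mult_nonneg_nonneg) auto
  define pa pb pc pd where "pa = (\<lambda>y. Delta y (ua t))" and "pb = (\<lambda>y. Delta y (ub t))"
    and "pc = (\<lambda>y. Delta y (uc t))" and "pd = (\<lambda>y. Delta y (ud t))"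
  have ball: "pa y \<in> cball 0 R" "pb y \<in> cball 0 R" "pc y \<in> cball 0 R" "pd y \<in> cball 0 R" for y
    unfolding pa_def pb_def pc_def pd_def by (intro Delta_in_ball oa ob oc od)+
  have P1: "norm (pa y - pb y) + norm (pc y - pd y) \<le> X1" and P2: "norm (pa y - pc y) + norm (pb y - pd y) \<le> X2" for y
    unfolding pa_def pb_def pc_def pd_def X1s[symmetric] X2s[symmetric]
    by (intro add_mono du[OF ea eb] du[OF ec ed] du[OF ea ec] du[OF eb ed])+
  have N1: "norm (ma t - mb t) + norm (mc t - md t) \<le> X1" and N2: "norm (ma t - mc t) + norm (mb t - md t) \<le> X2"
    unfolding X1s[symmetric] X2s[symmetric]
    by (intro add_mono dm[OF ea eb] dm[OF ec ed] dm[OF ea ec] dm[OF eb ed])+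
  have Dw: "pa y - pb y - pc y + pd y = Delta y w" for y
    by (simp add: pa_def pb_def pc_def pd_def w_def Delta_diff Delta_add)
  have prod: "A * B \<le> k" if "0 \<le> A" "A \<le> X1" "0 \<le> B" "B \<le> X2" for A B
    unfolding k_def using that X by (intro mult_mono) auto
  have n0: "(\<Sum>x\<in>UNIV. n $ x) = 0" using simplex_sum[OF Sa] simplex_sum[OF Sb] simplex_sum[OF Sc] simplex_sum[OF Sd]
    by (simp add: n_def sum_subtractf sum.distrib)
  then show "(\<Sum>x\<in>UNIV. (ma t - mb t - mc t + md t) $ x) = 0" by (simp add: n_def)
  \<comment> \<open>\<open>Hr\<close> and \<open>Fr\<close> are the Taylor remainders of the Hamiltonian and of the
    coupling cost at \<open>a\<close>.\<close>
  define Hr where "Hr = (\<lambda>x. H x (pa x) - H x (pb x) - H x (pc x) + H x (pd x) - g x (pa x) \<bullet> Delta x w)"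
  define Fr where "Fr = (\<lambda>x. F x (ma t) - F x (mb t) - F x (mc t) + F x (md t) - GF x (ma t) \<bullet> n)"
  have Hr: "\<bar>Hr x\<bar> \<le> 3 * Lg * k" for x
  proof -
    have "norm (H x (pa x) - H x (pb x) - H x (pc x) + H x (pd x) - g x (pa x) \<bullet> (pa x - pb x - pc x + pd x))
      \<le> 3 * Lg * (norm (pa x - pb x) + norm (pc x - pd x)) * (norm (pa x - pc x) + norm (pb x - pd x))"
    proof (rule second_difference_bound[OF convex_cball less_imp_le[OF pos(1)] _ _ ball])
      show "(H x has_derivative (\<lambda>v. g x p \<bullet> v)) (at p within cball 0 R)" for p
        by (rule has_derivative_at_withinI[OF H_gradient])
      show "norm (g x p \<bullet> v - g x q \<bullet> v) \<le> Lg * norm (p - q) * norm v" if "p \<in> cball 0 R" "q \<in> cball 0 R" for p q v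
      proof -
        have "norm (g x p \<bullet> v - g x q \<bullet> v) = \<bar>(g x p - g x q) \<bullet> v\<bar>" by (simp add: inner_diff_left)
        also have "\<dots> \<le> norm (g x p - g x q) * norm v" by (rule Cauchy_Schwarz_ineq2)
        also have "\<dots> \<le> Lg * norm (p - q) * norm v" by (intro mult_right_mono g_lipschitz_R that) auto
        finally show ?thesis .
      qed
    qed
    also have "\<dots> = 3 * Lg * ((norm (pa x - pb x) + norm (pc x - pd x)) * (norm (pa x - pc x) + norm (pb x - pd x)))"
      by (simp add: mult.assoc)
    also have "\<dots> \<le> 3 * Lg * k" using pos by (intro mult_left_mono prod P1 P2) auto
    finally show ?thesis by (simp add: Hr_def Dw)
  qed
  have Fr: "\<bar>Fr x\<bar> \<le> 3 * LF * k" for x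
  proof -
    have "norm (F x (ma t) - F x (mb t) - F x (mc t) + F x (md t) - GF x (ma t) \<bullet> (ma t - mb t - mc t + md t))
      \<le> 3 * LF * (norm (ma t - mb t) + norm (mc t - md t)) * (norm (ma t - mc t) + norm (mb t - md t))"
    proof (rule second_difference_bound[OF convex_simplex less_imp_le[OF pos(3)] _ _ Sa Sb Sc Sd])
      show "(F x has_derivative (\<lambda>v. GF x p \<bullet> v)) (at p within prob_simplex)" if "p \<in> prob_simplex" for p
        using GF[of x] that by (simp add: simplex_gradient_def)
      show "norm (GF x p \<bullet> v - GF x q \<bullet> v) \<le> LF * norm (p - q) * norm v" if "p \<in> prob_simplex" "q \<in> prob_simplex" for p q v
      proof -
        have "norm (GF x p \<bullet> v - GF x q \<bullet> v) = \<bar>(GF x p - GF x q) \<bullet> v\<bar>" by (simp add: inner_diff_left)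
        also have "\<dots> \<le> norm (GF x p - GF x q) * norm v" by (rule Cauchy_Schwarz_ineq2)
        also have "\<dots> \<le> LF * norm (p - q) * norm v" by (intro mult_right_mono GF_lipschitz that) auto
        finally show ?thesis .
      qed
    qed
    also have "\<dots> = 3 * LF * ((norm (ma t - mb t) + norm (mc t - md t)) * (norm (ma t - mc t) + norm (mb t - md t)))"
      by (simp add: mult.assoc)
    also have "\<dots> \<le> 3 * LF * k" using pos by (intro mult_left_mono prod N1 N2) auto
    finally show ?thesis by (simp add: Fr_def n_def)
  qed
  define \<phi> where "\<phi> = (\<lambda>x. GF x (ma t) \<bullet> n + (Hr x + Fr x))"
  have rem\<phi>: "\<bar>Hr x + Fr x\<bar> \<le> e" for x using Hr[of x] Fr[of x] parts parts_pos by linarith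
  have \<phi>: "\<bar>\<phi> x\<bar> \<le> LL * l1 n + e" for x
  proof -
    have "\<bar>GF x (ma t) \<bullet> n\<bar> \<le> norm (GF x (ma t)) * norm n" by (rule Cauchy_Schwarz_ineq2)
    also have "\<dots> \<le> LL * l1 n" using GF_bound[OF Sa, of x] norm_le_l1[of n] pos d_pos
      by (intro mult_mono) (auto simp: LL_def intro: order_trans)
    finally show ?thesis unfolding \<phi>_def using rem\<phi>[of x] by linarith
  qed
  define N where "N = (\<lambda>y z. g y (pa y) $ z)"
  have N: "generator al au N" unfolding N_def by (rule rate_generator)
  have gN: "g x (pa x) \<bullet> Delta x w = (\<Sum>z\<in>UNIV. N x z * w $ z)" for x by (simp add: N_def inner_Delta)
  have dw: "((\<lambda>s. (ua s - ub s - uc s + ud s) $ x) has_rate (r * w $ x - (\<Sum>z\<in>UNIV. N x z * w $ z) - \<phi> x)) t" for x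
    using DERIV_add[OF DERIV_diff[OF DERIV_diff[OF systemD(4)[OF ea t, of x] systemD(4)[OF eb t, of x]] systemD(4)[OF ec t, of x]] systemD(4)[OF ed t, of x]]
    unfolding gN[symmetric]
    by (simp, rule_tac DERIV_cong) (auto simp: \<phi>_def Hr_def Fr_def w_def pa_def pb_def pc_def pd_def algebra_simps)
  show "backward_drift al au r (\<lambda>t. ua t - ub t - uc t + ud t) t (LL * l1 (ma t - mb t - mc t + md t)
      + second_order_constant * ((l1 (\<mu>a - \<mu>b) + l1 (\<mu>c - \<mu>d)) * (l1 (\<mu>a - \<mu>c) + l1 (\<mu>b - \<mu>d))) * exp (- (lam * t)))"
    unfolding backward_drift_def w_def[symmetric] n_def[symmetric] h1_def[symmetric] h2_def[symmetric] e_def[symmetric]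
    using N \<phi> dw by (intro exI[of _ N] exI[of _ \<phi>]) simp
  \<comment> \<open>\<open>\<Gamma>\<close> is the second difference of the rates, \<open>Q\<close> its linear part;
    \<open>rest\<close> collects the mixed terms of the discrete product rule for density times rate.\<close>
  define \<Gamma> where "\<Gamma> = (\<lambda>y. g y (pa y) - g y (pb y) - g y (pc y) + g y (pd y))"
  define Q where "Q = (\<lambda>y. Hess y (pa y) *v Delta y w)"
  define rest where "rest = (\<lambda>y. (ma t $ y - mb t $ y) *\<^sub>R (g y (pb y) - g y (pd y)) + (mb t $ y - md t $ y) *\<^sub>R (g y (pa y) - g y (pb y))
      - n $ y *\<^sub>R (g y (pa y) - g y (pc y)) - (mb t $ y - md t $ y) *\<^sub>R \<Gamma> y)"
  define err where "err = (\<Sum>y\<in>UNIV. ma t $ y *\<^sub>R (\<Gamma> y - Q y) + rest y)"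
  have gl: "norm (g y p - g y q) \<le> Lg * norm (p - q)" if "p \<in> cball 0 R" "q \<in> cball 0 R" for y p q
    by (rule g_lipschitz_R[OF that])
  have \<Gamma>Q: "norm (\<Gamma> y - Q y) \<le> 3 * Lg * k" for y
  proof -
    have "norm (g y (pa y) - g y (pb y) - g y (pc y) + g y (pd y) - Hess y (pa y) *v (pa y - pb y - pc y + pd y))
      \<le> 3 * Lg * (norm (pa y - pb y) + norm (pc y - pd y)) * (norm (pa y - pc y) + norm (pb y - pd y))"
    proof (rule second_difference_bound[OF convex_cball less_imp_le[OF pos(1)] _ _ ball])
      show "(g y has_derivative (\<lambda>v. Hess y p *v v)) (at p within cball 0 R)" for p
        by (rule has_derivative_at_withinI[OF g_deriv])
      show "norm (Hess y p *v v - Hess y q *v v) \<le> Lg * norm (p - q) * norm v" if "p \<in> cball 0 R" "q \<in> cball 0 R" for p q v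
        using Hess_lipschitz that unfolding R_def K_def by blast
    qed
    also have "\<dots> = 3 * Lg * ((norm (pa y - pb y) + norm (pc y - pd y)) * (norm (pa y - pc y) + norm (pb y - pd y)))"
      by (simp add: mult.assoc)
    also have "\<dots> \<le> 3 * Lg * k" using pos by (intro mult_left_mono prod P1 P2) auto
    finally show ?thesis by (simp add: \<Gamma>_def Q_def Dw)
  qed
  have rest: "norm (rest y) \<le> 4 * (Lg * k)" for y
  proof -
    have P1': "norm (pa y - pb y) \<le> X1" "norm (pc y - pd y) \<le> X1" and P2': "norm (pa y - pc y) \<le> X2" "norm (pb y - pd y) \<le> X2"
      using P1[of y] P2[of y] norm_ge_zero[of "pa y - pb y"] norm_ge_zero[of "pc y - pd y"]
        norm_ge_zero[of "pa y - pc y"] norm_ge_zero[of "pb y - pd y"] by linarith+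
    have cm: "\<bar>v $ y\<bar> \<le> norm v" for v :: "real ^ 'n" by (rule component_le_norm_cart)
    have N1': "\<bar>ma t $ y - mb t $ y\<bar> \<le> X1" "\<bar>mb t $ y - md t $ y\<bar> \<le> X2"
      using N1 N2 cm[of "ma t - mb t"] cm[of "mb t - md t"] norm_ge_zero[of "mc t - md t"] norm_ge_zero[of "ma t - mc t"]
      unfolding vector_minus_component by linarith+
    have nX: "\<bar>n $ y\<bar> \<le> X1"
    proof -
      have "\<bar>n $ y\<bar> \<le> \<bar>(ma t - mb t) $ y\<bar> + \<bar>(mc t - md t) $ y\<bar>" by (simp add: n_def)
      then show ?thesis using N1 cm[of "ma t - mb t"] cm[of "mc t - md t"] by linarith
    qed
    have \<Gamma>X: "norm (\<Gamma> y) \<le> Lg * X1"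
    proof -
      have "norm (\<Gamma> y) \<le> norm (g y (pa y) - g y (pb y)) + norm (g y (pc y) - g y (pd y))"
        using norm_triangle_ineq4[of "g y (pa y) - g y (pb y)" "g y (pc y) - g y (pd y)"] by (simp add: \<Gamma>_def algebra_simps)
      also have "\<dots> \<le> Lg * norm (pa y - pb y) + Lg * norm (pc y - pd y)" by (intro add_mono gl ball)
      also have "\<dots> = Lg * (norm (pa y - pb y) + norm (pc y - pd y))" by (simp add: distrib_left)
      also have "\<dots> \<le> Lg * X1" using P1 pos by (intro mult_left_mono) auto
      finally show ?thesis .
    qed
    have gX: "norm (g y (pb y) - g y (pd y)) \<le> Lg * X2" "norm (g y (pa y) - g y (pb y)) \<le> Lg * X1" "norm (g y (pa y) - g y (pc y)) \<le> Lg * X2"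
      using order_trans[OF gl[OF ball(2) ball(4), of y] mult_left_mono[OF P2'(2) less_imp_le[OF pos(1)]]]
        order_trans[OF gl[OF ball(1) ball(2), of y] mult_left_mono[OF P1'(1) less_imp_le[OF pos(1)]]]
        order_trans[OF gl[OF ball(1) ball(3), of y] mult_left_mono[OF P2'(1) less_imp_le[OF pos(1)]]] by auto
    have LgX: "0 \<le> Lg * X1" "0 \<le> Lg * X2" using pos X by auto
    have t1: "norm ((ma t $ y - mb t $ y) *\<^sub>R (g y (pb y) - g y (pd y))) \<le> X1 * (Lg * X2)"
      unfolding norm_scaleR using N1'(1) gX(1) X by (intro mult_mono) auto
    have t2: "norm ((mb t $ y - md t $ y) *\<^sub>R (g y (pa y) - g y (pb y))) \<le> X2 * (Lg * X1)"
      unfolding norm_scaleR using N1'(2) gX(2) X by (intro mult_mono) auto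
    have t3: "norm (n $ y *\<^sub>R (g y (pa y) - g y (pc y))) \<le> X1 * (Lg * X2)"
      unfolding norm_scaleR using nX gX(3) X by (intro mult_mono) auto
    have t4: "norm ((mb t $ y - md t $ y) *\<^sub>R \<Gamma> y) \<le> X2 * (Lg * X1)"
      unfolding norm_scaleR using N1'(2) \<Gamma>X X by (intro mult_mono) auto
    have "norm (rest y) \<le> X1 * (Lg * X2) + X2 * (Lg * X1) + X1 * (Lg * X2) + X2 * (Lg * X1)"
      unfolding rest_def
      by (intro order_trans[OF norm_triangle_ineq4] order_trans[OF norm_triangle_ineq] add_mono t1 t2 t3 t4)
    also have "\<dots> = 4 * (Lg * k)" by (simp add: k_def)
    finally show ?thesis .
  qed
  have l1err: "l1 err \<le> e"
  proof -
    have "norm (ma t $ y *\<^sub>R (\<Gamma> y - Q y) + rest y) \<le> 7 * (Lg * k)" for y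
    proof -
      have "norm (ma t $ y *\<^sub>R (\<Gamma> y - Q y)) \<le> 1 * (3 * Lg * k)"
        unfolding norm_scaleR using simplex_nonneg[OF Sa, of y] simplex_le1[OF Sa, of y] \<Gamma>Q[of y] by (intro mult_mono) auto
      then show ?thesis using rest[of y] norm_triangle_ineq[of "ma t $ y *\<^sub>R (\<Gamma> y - Q y)" "rest y"] by simp
    qed
    then have "norm err \<le> (\<Sum>y\<in>(UNIV :: 'n set). 7 * (Lg * k))" unfolding err_def by (intro sum_norm_le) auto
    also have "\<dots> = d * (7 * (Lg * k))" by (simp add: d_def)
    finally have "d * norm err \<le> d * (d * (7 * (Lg * k)))" using d_pos by (intro mult_left_mono) auto
    moreover have "l1 err \<le> d * norm err" unfolding d_def by (rule l1_le_norm)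
    moreover have "d * (d * (7 * (Lg * k))) = 7 * (d * d) * Lg * k" by simp
    ultimately show ?thesis using parts parts_pos by linarith
  qed
  have gsum: "(\<Sum>x\<in>UNIV. (g y p - g y q) $ x) = 0" for y p q by (simp add: sum_subtractf rate_sum)
  \<comment> \<open>The error has no total mass, so that its pairing with \<open>w\<close> involves only the
    oscillation of \<open>w\<close>.\<close>
  have err0: "(\<Sum>x\<in>UNIV. err $ x) = 0"
  proof -
    have r0: "(\<Sum>x\<in>UNIV. rest y $ x) = 0" for y
      unfolding rest_def \<Gamma>_def
      by (simp add: sum.distrib sum_subtractf sum_negf right_diff_distrib distrib_left rate_sum flip: sum_distrib_left)
    have G0: "(\<Sum>x\<in>UNIV. (\<Gamma> y - Q y) $ x) = 0" for y
      unfolding \<Gamma>_def Q_def by (simp add: sum.distrib sum_subtractf rate_sum Hess_sum)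
    have "(\<Sum>x\<in>UNIV. err $ x) = (\<Sum>y\<in>UNIV. \<Sum>x\<in>UNIV. (ma t $ y *\<^sub>R (\<Gamma> y - Q y) + rest y) $ x)"
      unfolding err_def sum_component by (rule sum.swap)
    also have "\<dots> = (\<Sum>y\<in>UNIV. ma t $ y * (\<Sum>x\<in>UNIV. (\<Gamma> y - Q y) $ x) + (\<Sum>x\<in>UNIV. rest y $ x))"
      by (simp only: vector_add_component vector_scaleR_component real_scaleR_def sum.distrib sum_distrib_left)
    also have "\<dots> = 0" by (simp only: r0 G0) simp
    finally show ?thesis .
  qed
  define \<psi> where "\<psi> = (\<lambda>x. (\<Sum>y\<in>UNIV. ma t $ y * Q y $ x) + err $ x)"
  have \<psi>: "(\<Sum>x\<in>UNIV. \<bar>\<psi> x\<bar>) \<le> LL * osc w + e"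
  proof -
    have "(\<Sum>x\<in>UNIV. \<bar>\<Sum>y\<in>UNIV. ma t $ y * Q y $ x\<bar>) \<le> d * (Lg * (d * osc w))"
    proof (rule rate_difference_l1[OF Sa])
      fix y
      have "norm (Q y) \<le> Lg * norm (Delta y w)" unfolding Q_def by (rule Hess_bound_R[OF ball(1)])
      also have "\<dots> \<le> Lg * (d * osc w)" using norm_Delta_le[of y w] pos by (intro mult_left_mono) (auto simp: d_def)
      finally show "norm (Q y) \<le> Lg * (d * osc w)" .
    qed
    also have "\<dots> \<le> LL * osc w" unfolding LL_def using pos osc_nonneg[of w] by (simp add: algebra_simps)
    finally have 1: "(\<Sum>x\<in>UNIV. \<bar>\<Sum>y\<in>UNIV. ma t $ y * Q y $ x\<bar>) \<le> LL * osc w" .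
    have "(\<Sum>x\<in>UNIV. \<bar>\<psi> x\<bar>) \<le> (\<Sum>x\<in>UNIV. \<bar>\<Sum>y\<in>UNIV. ma t $ y * Q y $ x\<bar> + \<bar>err $ x\<bar>)"
      unfolding \<psi>_def by (intro sum_mono abs_triangle_ineq)
    also have "\<dots> = (\<Sum>x\<in>UNIV. \<bar>\<Sum>y\<in>UNIV. ma t $ y * Q y $ x\<bar>) + l1 err" by (simp add: sum.distrib l1_def)
    finally show ?thesis using 1 l1err by linarith
  qed
  have dn: "((\<lambda>s. (ma s - mb s - mc s + md s) $ x) has_rate ((\<Sum>y\<in>UNIV. N y x * n $ y) + \<psi> x)) t" for x
  proof -
    have pw: "ma t $ y * g y (pa y) $ x - mb t $ y * g y (pb y) $ x - mc t $ y * g y (pc y) $ x + md t $ y * g y (pd y) $ x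
       = N y x * n $ y + (ma t $ y * Q y $ x + (ma t $ y *\<^sub>R (\<Gamma> y - Q y) + rest y) $ x)" for y
    proof -
      have "(ma t $ y *\<^sub>R g y (pa y) - mb t $ y *\<^sub>R g y (pb y) - mc t $ y *\<^sub>R g y (pc y) + md t $ y *\<^sub>R g y (pd y)) $ x
        = (n $ y *\<^sub>R g y (pa y) + ma t $ y *\<^sub>R \<Gamma> y + rest y) $ x"
        unfolding product_second_difference rest_def \<Gamma>_def n_def by simp
      then show ?thesis by (simp add: N_def algebra_simps)
    qed
    have "(\<Sum>y\<in>UNIV. ma t $ y * g y (pa y) $ x) - (\<Sum>y\<in>UNIV. mb t $ y * g y (pb y) $ x)
        - (\<Sum>y\<in>UNIV. mc t $ y * g y (pc y) $ x) + (\<Sum>y\<in>UNIV. md t $ y * g y (pd y) $ x)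
       = (\<Sum>y\<in>UNIV. N y x * n $ y) + \<psi> x"
      unfolding \<psi>_def err_def sum_component sum.distrib[symmetric] sum_subtractf[symmetric] pw ..
    then show ?thesis
      using DERIV_add[OF DERIV_diff[OF DERIV_diff[OF systemD(5)[OF ea t, of x] systemD(5)[OF eb t, of x]] systemD(5)[OF ec t, of x]] systemD(5)[OF ed t, of x]]
      by (simp add: pa_def pb_def pc_def pd_def)
  qed
  show "forward_drift al au (\<lambda>t. ma t - mb t - mc t + md t) t (LL * osc (ua t - ub t - uc t + ud t)
      + second_order_constant * ((l1 (\<mu>a - \<mu>b) + l1 (\<mu>c - \<mu>d)) * (l1 (\<mu>a - \<mu>c) + l1 (\<mu>b - \<mu>d))) * exp (- (lam * t)))"
    unfolding forward_drift_def w_def[symmetric] n_def[symmetric] h1_def[symmetric] h2_def[symmetric] e_def[symmetric]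
    using N \<psi> dn by (intro exI[of _ N] exI[of _ \<psi>]) simp
  \<comment> \<open>In the pairing the generator cancels between the two equations.\<close>
  define D where "D = (\<Sum>x\<in>UNIV. (r * w $ x - (\<Sum>z\<in>UNIV. N x z * w $ z) - \<phi> x) * n $ x + w $ x * ((\<Sum>y\<in>UNIV. N y x * n $ y) + \<psi> x))"
  have "((\<lambda>s. (ua s - ub s - uc s + ud s) \<bullet> (ma s - mb s - mc s + md s)) has_rate D) t"
    unfolding inner_vec_def inner_real_def D_def
  proof (rule DERIV_sum)
    fix x
    show "((\<lambda>s. (ua s - ub s - uc s + ud s) $ x * (ma s - mb s - mc s + md s) $ x) has_rate ((r * w $ x - (\<Sum>z\<in>UNIV. N x z * w $ z) - \<phi> x) * n $ x + w $ x * ((\<Sum>y\<in>UNIV. N y x * n $ y) + \<psi> x))) t"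
      by (rule DERIV_cong[OF DERIV_mult[OF dw dn]]) (simp add: w_def n_def algebra_simps)
  qed
  moreover have "D \<le> r * (w \<bullet> n) - c / 2 * (osc w)\<^sup>2 + e * (l1 n + osc w)"
  proof -
    have D1: "D = r * (w \<bullet> n) - (\<Sum>x\<in>UNIV. \<phi> x * n $ x) + (\<Sum>x\<in>UNIV. w $ x * \<psi> x)"
    proof -
      have swap: "(\<Sum>x\<in>UNIV. (\<Sum>z\<in>UNIV. N x z * w $ z) * n $ x) = (\<Sum>x\<in>UNIV. w $ x * (\<Sum>y\<in>UNIV. N y x * n $ y))"
        unfolding sum_distrib_left sum_distrib_right by (subst sum.swap) (simp add: mult_ac)
      have split: "(\<Sum>x\<in>UNIV. (r * w $ x - a x - \<phi> x) * n $ x + w $ x * (b x + \<psi> x))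
        = (\<Sum>x\<in>UNIV. r * (w $ x * n $ x)) - (\<Sum>x\<in>UNIV. a x * n $ x) - (\<Sum>x\<in>UNIV. \<phi> x * n $ x)
          + (\<Sum>x\<in>UNIV. w $ x * b x) + (\<Sum>x\<in>UNIV. w $ x * \<psi> x)" for a b
        by (simp add: sum.distrib sum_subtractf algebra_simps)
      have "(\<Sum>x\<in>UNIV. r * (w $ x * n $ x)) = r * (w \<bullet> n)" by (simp add: inner_vec_def sum_distrib_left)
      then show ?thesis unfolding D_def split swap by simp
    qed
    have m1: "- (\<Sum>x\<in>UNIV. \<phi> x * n $ x) \<le> e * l1 n"
    proof -
      have "(\<Sum>x\<in>UNIV. \<phi> x * n $ x) = (\<Sum>x\<in>UNIV. (GF x (ma t) \<bullet> n) * n $ x) + (\<Sum>x\<in>UNIV. (Hr x + Fr x) * n $ x)"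
        by (simp add: \<phi>_def distrib_right sum.distrib)
      moreover have "0 \<le> (\<Sum>x\<in>UNIV. (GF x (ma t) \<bullet> n) * n $ x)" by (rule GF_monotone[OF Sa n0])
      moreover have "- (\<Sum>x\<in>UNIV. (Hr x + Fr x) * n $ x) \<le> (\<Sum>x\<in>UNIV. e * \<bar>n $ x\<bar>)"
        unfolding sum_negf[symmetric]
      proof (rule sum_mono)
        fix x
        have "- ((Hr x + Fr x) * n $ x) \<le> \<bar>Hr x + Fr x\<bar> * \<bar>n $ x\<bar>" by (metis abs_ge_minus_self abs_mult)
        also have "\<dots> \<le> e * \<bar>n $ x\<bar>" by (intro mult_right_mono rem\<phi>) auto
        finally show "- ((Hr x + Fr x) * n $ x) \<le> e * \<bar>n $ x\<bar>" .
      qed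
      moreover have "(\<Sum>x\<in>UNIV. e * \<bar>n $ x\<bar>) = e * l1 n" by (simp add: l1_def sum_distrib_left)
      ultimately show ?thesis by linarith
    qed
    have m2: "(\<Sum>x\<in>UNIV. w $ x * \<psi> x) \<le> - (c / 2) * (osc w)\<^sup>2 + e * osc w"
    proof -
      have "(\<Sum>x\<in>UNIV. w $ x * \<psi> x) = (\<Sum>x\<in>UNIV. \<Sum>y\<in>UNIV. ma t $ y * (Q y $ x * w $ x)) + w \<bullet> err"
        by (simp add: \<psi>_def distrib_left sum.distrib sum_distrib_left inner_vec_def mult_ac)
      also have "(\<Sum>x\<in>UNIV. \<Sum>y\<in>UNIV. ma t $ y * (Q y $ x * w $ x)) = (\<Sum>y\<in>UNIV. ma t $ y * (Q y \<bullet> w))"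
        by (subst sum.swap) (simp add: inner_vec_def sum_distrib_left)
      also have "\<dots> \<le> (\<Sum>y\<in>UNIV. ma t $ y * (- c * (norm (Delta y w))\<^sup>2))"
      proof (intro sum_mono mult_left_mono simplex_nonneg[OF Sa])
        fix y
        have "Q y \<bullet> w = Q y \<bullet> Delta y w" unfolding Q_def by (rule inner_Delta_sum_zero[OF Hess_sum, symmetric])
        also have "\<dots> = Delta y w \<bullet> (Hess y (pa y) *v Delta y w)" by (simp add: Q_def inner_commute)
        also have "\<dots> \<le> - c * (norm (Delta y w))\<^sup>2"
          using Hess_concave[of "pa y" "Delta y w" y] ball(1)[of y] by (simp add: R_def K_def)
        finally show "Q y \<bullet> w \<le> - c * (norm (Delta y w))\<^sup>2" .
      qed
      also have "\<dots> = - c * (\<Sum>y\<in>UNIV. ma t $ y * (norm (Delta y w))\<^sup>2)" by (simp add: sum_distrib_left mult_ac sum_negf)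
      also have "\<dots> \<le> - c * ((osc w)\<^sup>2 / 2)" using weighted_Delta_lower[OF Sa] pos by (intro mult_left_mono_neg) auto
      finally have "(\<Sum>x\<in>UNIV. w $ x * \<psi> x) \<le> - c * ((osc w)\<^sup>2 / 2) + w \<bullet> err" by simp
      moreover have "w \<bullet> err \<le> e * osc w"
      proof -
        have "w \<bullet> err \<le> osc w * l1 err" using inner_le_osc_l1[OF err0, of w] by (simp add: abs_le_iff)
        also have "\<dots> \<le> osc w * e" by (intro mult_left_mono l1err osc_nonneg)
        finally show ?thesis by (simp add: mult.commute)
      qed
      ultimately show ?thesis by simp
    qed
    show ?thesis using D1 m1 m2 by (simp add: distrib_left)
  qed
  ultimately show "\<exists>D. ((\<lambda>s. (ua s - ub s - uc s + ud s) \<bullet> (ma s - mb s - mc s + md s)) has_rate D) t \<and>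
        D \<le> r * ((ua t - ub t - uc t + ud t) \<bullet> (ma t - mb t - mc t + md t)) - c / 2 * (osc (ua t - ub t - uc t + ud t))\<^sup>2
          + second_order_constant * ((l1 (\<mu>a - \<mu>b) + l1 (\<mu>c - \<mu>d)) * (l1 (\<mu>a - \<mu>c) + l1 (\<mu>b - \<mu>d))) * exp (- (lam * t))
            * (l1 (ma t - mb t - mc t + md t) + osc (ua t - ub t - uc t + ud t))"
    unfolding w_def[symmetric] n_def[symmetric] h1_def[symmetric] h2_def[symmetric] e_def[symmetric] by blast
qed

end

section \<open>The value function and the master equation\<close>

lemma half_line_deriv_unique:
  fixes f :: "real \<Rightarrow> real"
  assumes "(f has_rate D) 0" "(f has_rate E) 0"
  shows "D = E"
proof -
  have sub: "{0<..} \<subseteq> {0 :: real..}" by auto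
  have "((\<lambda>y. (f y - f 0) / (y - 0)) \<longlongrightarrow> D) (at_right 0)" "((\<lambda>y. (f y - f 0) / (y - 0)) \<longlongrightarrow> E) (at_right 0)"
    using DERIV_subset[OF assms(1) sub] DERIV_subset[OF assms(2) sub] by (simp_all add: has_field_derivative_iff)
  then show ?thesis by (rule tendsto_unique[OF trivial_limit_at_right_real])
qed

lemma half_line_transform:
  fixes f h :: "real \<Rightarrow> real"
  assumes "(f has_rate D) t" "0 \<le> t" "\<And>s. 0 \<le> s \<Longrightarrow> f s = h s"
  shows "(h has_rate D) t"
  by (rule has_field_derivative_transform_within[OF assms(1), of 1]) (use assms in auto)

lemma chain_rule_simplex:
  fixes m :: "real \<Rightarrow> real ^ 'n::finite"
  assumes K: "simplex_gradient K G" and mS: "\<And>s. 0 \<le> s \<Longrightarrow> m s \<in> prob_simplex" and t: "0 \<le> t"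
    and m': "\<And>x. ((\<lambda>s. m s $ x) has_rate v $ x) t"
  shows "((\<lambda>s. K (m s)) has_rate (G (m t) \<bullet> v)) t"
proof -
  have m: "(m has_derivative (\<lambda>h. h *\<^sub>R v)) (at t within {0..})"
    unfolding has_derivative_componentwise_within[of m]
    using m' by (auto simp: Basis_vec_def inner_axis has_field_derivative_def mult_commute_abs)
  have "(K has_derivative (\<lambda>w. G (m t) \<bullet> w)) (at (m t) within prob_simplex)"
    using K mS[OF t] by (simp add: simplex_gradient_def)
  then have "(K has_derivative (\<lambda>w. G (m t) \<bullet> w)) (at (m t) within m ` {0..})"
    by (rule has_derivative_subset) (use mS in auto)
  from has_derivative_in_compose[OF m this] show ?thesis
    by (simp add: has_field_derivative_def mult_commute_abs)
qed

text \<open>For rates that sum to \<open>0\<close> the transport term of the master equation is the derivative in the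
  direction of the forward drift.\<close>

lemma transport_identity:
  fixes \<eta> G :: "real ^ 'n::finite" and v :: "'n \<Rightarrow> real ^ 'n"
  assumes "\<And>y. (\<Sum>z\<in>UNIV. v y $ z) = 0"
  shows "(\<Sum>y\<in>UNIV. \<Sum>z\<in>UNIV. \<eta> $ y * (G $ z - G $ y) * v y $ z) = G \<bullet> (\<chi> x. \<Sum>y\<in>UNIV. \<eta> $ y * v y $ x)"
proof -
  have "(\<Sum>z\<in>UNIV. \<eta> $ y * (G $ z - G $ y) * v y $ z) = (\<Sum>z\<in>UNIV. \<eta> $ y * G $ z * v y $ z)" for y
  proof -
    have "(\<Sum>z\<in>UNIV. \<eta> $ y * G $ y * v y $ z) = \<eta> $ y * G $ y * (\<Sum>z\<in>UNIV. v y $ z)" by (simp add: sum_distrib_left)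
    then show ?thesis using assms by (simp add: right_diff_distrib left_diff_distrib sum_subtractf)
  qed
  then have "(\<Sum>y\<in>UNIV. \<Sum>z\<in>UNIV. \<eta> $ y * (G $ z - G $ y) * v y $ z) = (\<Sum>y\<in>UNIV. \<Sum>z\<in>UNIV. \<eta> $ y * G $ z * v y $ z)"
    by simp
  also have "\<dots> = (\<Sum>z\<in>UNIV. \<Sum>y\<in>UNIV. \<eta> $ y * G $ z * v y $ z)" by (rule sum.swap)
  also have "\<dots> = G \<bullet> (\<chi> x. \<Sum>y\<in>UNIV. \<eta> $ y * v y $ x)" by (simp add: inner_vec_def sum_distrib_left mult_ac)
  finally show ?thesis .
qed

lemma simplex_gradient_cong:
  assumes "simplex_gradient K G" "\<And>\<eta>. \<eta> \<in> prob_simplex \<Longrightarrow> K' \<eta> = K \<eta>"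
  shows "simplex_gradient K' G"
  using assms unfolding simplex_gradient_def by (auto intro: has_derivative_transform)

context mfg_constants
begin

lemma C0_nonneg: "0 \<le> C0"
proof -
  have r: "0 < coupling.r0 / 2" "coupling.r0 / 2 < coupling.r0" using coupling.constants_pos(10) by simp_all
  obtain u \<mu> where e: "equilibrium (coupling.r0 / 2) (axis undefined 1) u \<mu>"
    using system_exists[OF r vertex_in_simplex] by blast
  show ?thesis by (rule equilibrium_pair_decay(4)[OF e e r order_refl])
qed

lemma equilibrium_unique:
  assumes e: "equilibrium r \<mu>0 u m" "equilibrium r \<mu>0 u' m'" and r: "0 < r" "r < coupling.r0" and t: "0 \<le> t"
  shows "u t = u' t" "m t = m' t"
proof -
  have z: "l1 (\<mu>0 - \<mu>0) = 0" by (simp add: l1_def)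
  have "u t $ x = u' t $ x" for x using equilibrium_pair_decay(3)[OF e r t, of x] unfolding z by simp
  then show "u t = u' t" by (simp add: vec_eq_iff)
  have "norm (m t - m' t) \<le> 0" using equilibrium_pair_decay(1)[OF e r t] norm_le_l1[of "m t - m' t"] unfolding z mult_zero_right by linarith
  then show "m t = m' t" by simp
qed

text \<open>The candidate solution of the master equation: the initial value of the equilibrium that starts at the
  given distribution.\<close>

definition "value" :: "real \<Rightarrow> real ^ 'n \<Rightarrow> real ^ 'n" where
  "value r \<mu>0 = (SOME u0. \<exists>u m. equilibrium r \<mu>0 u m \<and> u 0 = u0)"

lemma value_eq:
  assumes e: "equilibrium r \<mu>0 u m" and r: "0 < r" "r < coupling.r0"
  shows "value r \<mu>0 = u 0"
proof -
  have "\<exists>u0 u m. equilibrium r \<mu>0 u m \<and> u 0 = u0" using e by blast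
  from someI_ex[OF this] obtain u' m' where u': "equilibrium r \<mu>0 u' m'" "u' 0 = value r \<mu>0"
    unfolding value_def by blast
  show ?thesis using equilibrium_unique(1)[OF u'(1) e r order_refl] u'(2) by simp
qed

lemma equilibrium_shift:
  assumes e: "equilibrium r \<mu>0 u m" and \<tau>: "0 \<le> \<tau>"
  shows "equilibrium r (m \<tau>) (\<lambda>t. u (\<tau> + t)) (\<lambda>t. m (\<tau> + t))"
  unfolding system_def
proof (intro conjI allI impI)
  show "\<exists>B. \<forall>t\<ge>0. \<forall>x. \<bar>u (\<tau> + t) $ x\<bar> \<le> B" using systemD(1)[OF e] \<tau> by (metis add_nonneg_nonneg)
  fix t :: real and x assume "0 \<le> t"
  then have t: "0 \<le> \<tau> + t" using \<tau> by simp
  show "m (\<tau> + t) \<in> prob_simplex" by (rule systemD(2)[OF e t])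
  show "((\<lambda>s. u (\<tau> + s) $ x) has_rate (r * u (\<tau> + t) $ x - H x (Delta x (u (\<tau> + t))) - 1 * F x (m (\<tau> + t)) - 0 $ x)) t"
    by (rule half_line_shift[OF systemD(4)[OF e t] \<tau>])
  show "((\<lambda>s. m (\<tau> + s) $ x) has_rate (\<Sum>y\<in>UNIV. m (\<tau> + t) $ y * g y (Delta y (u (\<tau> + t))) $ x)) t"
    by (rule half_line_shift[OF systemD(5)[OF e t] \<tau>])
qed simp

text \<open>Restarting an equilibrium at a later time gives an equilibrium, so by uniqueness the value follows the
  density: the characteristics of the master equation are the equilibria.\<close>

lemma value_along:
  assumes e: "equilibrium r \<mu>0 u m" and r: "0 < r" "r < coupling.r0" and t: "0 \<le> t"
  shows "value r (m t) = u t"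
  using value_eq[OF equilibrium_shift[OF e t] r] by simp

text \<open>Covers both the Lipschitz constant and the bound on second differences; the two factors \<open>d\<close>
  in the second summand convert mass norms into Euclidean norms.\<close>

definition "Cv = C0 * d + C0 * second_order_constant * (d * d)"

lemma second_order_constant_nonneg: "0 \<le> second_order_constant"
  unfolding second_order_constant_def using pos d_pos by (intro mult_nonneg_nonneg add_nonneg_nonneg) auto

lemma Cv_nonneg: "0 \<le> Cv"
  unfolding Cv_def using C0_nonneg d_pos second_order_constant_nonneg by simp

lemma value_lipschitz:
  assumes a: "a \<in> prob_simplex" and b: "b \<in> prob_simplex" and r: "0 < r" "r < coupling.r0"
  shows "\<bar>value r a $ x - value r b $ x\<bar> \<le> Cv * norm (a - b)"
proof -
  obtain u m where e1: "equilibrium r a u m" using system_exists[OF r a] by blast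
  obtain u' m' where e2: "equilibrium r b u' m'" using system_exists[OF r b] by blast
  have "\<bar>u 0 $ x - u' 0 $ x\<bar> \<le> C0 * l1 (a - b)"
    using equilibrium_pair_decay(3)[OF e1 e2 r order_refl, of x] by simp
  also have "\<dots> \<le> C0 * (d * norm (a - b))" unfolding d_def by (intro mult_left_mono l1_le_norm C0_nonneg)
  also have "\<dots> \<le> Cv * norm (a - b)" unfolding Cv_def
    using C0_nonneg d_pos second_order_constant_nonneg by (simp add: algebra_simps)
  finally show ?thesis by (simp add: value_eq[OF e1 r] value_eq[OF e2 r])
qed

lemma value_second_difference:
  assumes S: "a \<in> prob_simplex" "b \<in> prob_simplex" "c' \<in> prob_simplex" "d' \<in> prob_simplex"
    and r: "0 < r" "r < coupling.r0"
  shows "\<bar>value r a $ x - value r b $ x - value r c' $ x + value r d' $ x\<bar>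
    \<le> Cv * (norm (a - b - c' + d') + (norm (a - b) + norm (c' - d')) * (norm (a - c') + norm (b - d')))"
proof -
  obtain ua ma where ea: "equilibrium r a ua ma" using system_exists[OF r S(1)] by blast
  obtain ub mb where eb: "equilibrium r b ub mb" using system_exists[OF r S(2)] by blast
  obtain uc mc where ec: "equilibrium r c' uc mc" using system_exists[OF r S(3)] by blast
  obtain ud md where ed: "equilibrium r d' ud md" using system_exists[OF r S(4)] by blast
  define h1 where "h1 = l1 (a - b) + l1 (c' - d')"
  define h2 where "h2 = l1 (a - c') + l1 (b - d')"
  define N1 where "N1 = norm (a - b) + norm (c' - d')"
  define N2 where "N2 = norm (a - c') + norm (b - d')"
  have h: "0 \<le> h1" "0 \<le> h2" by (auto simp: h1_def h2_def l1_nonneg)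
  have hN: "h1 \<le> d * N1" "h2 \<le> d * N2" unfolding h1_def h2_def N1_def N2_def d_def distrib_left
    by (intro add_mono l1_le_norm)+
  have eps: "0 \<le> second_order_constant * (h1 * h2)" using h second_order_constant_nonneg by simp
  note cp = second_difference_coupled[OF ea eb ec ed r, folded h1_def h2_def]
  have l: "lam \<le> coupling.c5 / 4" "lam \<le> r + lam" using r by (simp_all add: lam_def)
  have "\<bar>(ua 0 - ub 0 - uc 0 + ud 0) $ x\<bar> \<le> C0 * (exp (- (lam * 0)) * (l1 (ma 0 - mb 0 - mc 0 + md 0) + second_order_constant * (h1 * h2)))"
    unfolding C0_def
    by (rule coupling.coupled_pair_decay(3)[OF cp r less_imp_le[OF lam_pos] l(1) eps lam_pos l(2) order_refl])
  also have "\<dots> = C0 * (l1 (a - b - c' + d') + second_order_constant * (h1 * h2))"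
    using systemD(3)[OF ea] systemD(3)[OF eb] systemD(3)[OF ec] systemD(3)[OF ed] by simp
  also have "\<dots> \<le> C0 * (d * norm (a - b - c' + d') + second_order_constant * ((d * N1) * (d * N2)))"
    using h hN C0_nonneg second_order_constant_nonneg l1_le_norm[of "a - b - c' + d'"]
    by (intro mult_left_mono add_mono mult_mono) (auto simp: d_def)
  also have "\<dots> = C0 * d * norm (a - b - c' + d') + C0 * second_order_constant * (d * d) * (N1 * N2)"
    by (simp add: algebra_simps)
  also have "\<dots> \<le> Cv * norm (a - b - c' + d') + Cv * (N1 * N2)"
    using C0_nonneg d_pos second_order_constant_nonneg
    by (intro add_mono mult_right_mono) (auto simp: Cv_def N1_def N2_def)
  finally show ?thesis
    by (simp add: value_eq[OF ea r] value_eq[OF eb r] value_eq[OF ec r] value_eq[OF ed r] N1_def N2_def distrib_left)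
qed

lemma value_gradient:
  assumes r: "0 < r" "r < coupling.r0"
  shows "\<exists>G. simplex_gradient (\<lambda>\<eta>. value r \<eta> $ x) G \<and> (\<forall>\<eta>\<in>prob_simplex. norm (G \<eta>) \<le> 2 * d * Cv) \<and>
     (\<forall>\<eta>\<in>prob_simplex. \<forall>\<zeta>\<in>prob_simplex. norm (G \<eta> - G \<zeta>) \<le> 9 * d * Cv * norm (\<eta> - \<zeta>))"
  unfolding d_def
  by (rule gradient_of_second_differences[OF Cv_nonneg])
    (intro value_lipschitz value_second_difference r; assumption)+

text \<open>Differentiating \<open>value r (m s) = u s\<close> at \<open>s = 0\<close> along the equilibrium started
  at \<open>\<eta>\<close> in two ways: by the chain rule and by the equation for \<open>u\<close>.\<close>

lemma value_master:
  assumes r: "0 < r" "r < coupling.r0"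
  shows "master_solution H g F r (\<lambda>x \<eta>. value r \<eta> $ x)"
  unfolding master_solution_def
proof (intro conjI allI ballI)
  show "simplex_C1 (\<lambda>\<eta>. value r \<eta> $ x)" for x using value_gradient[OF r] simplex_C1_of_gradient by blast
  fix x and \<eta> :: "real ^ 'n" assume \<eta>: "\<eta> \<in> prob_simplex"
  obtain G where G: "simplex_gradient (\<lambda>\<eta>. value r \<eta> $ x) G" using value_gradient[OF r] by blast
  obtain u m where e: "equilibrium r \<eta> u m" using system_exists[OF r \<eta>] by blast
  have m0: "m 0 = \<eta>" and u0: "u 0 = value r \<eta>" using systemD(3)[OF e] value_eq[OF e r] by auto
  define v where "v = (\<chi> z. \<Sum>y\<in>UNIV. \<eta> $ y * g y (Delta y (value r \<eta>)) $ z)"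
  have "((\<lambda>s. value r (m s) $ x) has_rate (G (m 0) \<bullet> v)) 0"
    by (rule chain_rule_simplex[OF G systemD(2)[OF e] order_refl])
      (use systemD(5)[OF e order_refl] in \<open>simp_all add: v_def m0 u0\<close>)
  then have "((\<lambda>s. u s $ x) has_rate (G \<eta> \<bullet> v)) 0"
    unfolding m0 by (rule half_line_transform) (auto simp: value_along[OF e r])
  from half_line_deriv_unique[OF systemD(4)[OF e order_refl, of x] this]
  have "r * value r \<eta> $ x - H x (Delta x (value r \<eta>)) - F x \<eta> = G \<eta> \<bullet> v" by (simp add: m0 u0)
  moreover have "(\<Sum>y\<in>UNIV. \<Sum>z\<in>UNIV. \<eta> $ y * simplex_deriv (\<lambda>\<eta>. value r \<eta> $ x) y z \<eta> * g y (Delta y (value r \<eta>)) $ z) = G \<eta> \<bullet> v"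
    unfolding simplex_deriv_of_gradient[OF G \<eta>] v_def by (rule transport_identity[OF rate_sum])
  ultimately show "r * value r \<eta> $ x = H x (Delta x (\<chi> w. value r \<eta> $ w))
      + (\<Sum>y\<in>UNIV. \<Sum>z\<in>UNIV. \<eta> $ y * simplex_deriv (\<lambda>\<eta>. value r \<eta> $ x) y z \<eta> * g y (Delta y (\<chi> w. value r \<eta> $ w)) $ z) + F x \<eta>"
    by simp
qed

text \<open>Conversely, any solution \<open>V\<close> defines a feedback. The flow of distributions under the optimal
  rates for \<open>V\<close> exists because \<open>V\<close> is Lipschitz, and along it \<open>V\<close> solves the
  value equation by the chain rule. Uniqueness of the master equation thus reduces to that of equilibria.\<close>

lemma master_equilibrium:
  assumes V: "master_solution H g F r V" and \<mu>0: "\<mu>0 \<in> prob_simplex"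
  shows "\<exists>m. equilibrium r \<mu>0 (\<lambda>t. \<chi> w. V w (m t)) m"
proof -
  have "\<exists>G. simplex_gradient (V w) G" for w
    using V gradient_of_simplex_C1[of "V w"] unfolding master_solution_def by blast
  then obtain G where G: "\<And>w. simplex_gradient (V w) (G w)" by metis
  define Vv where "Vv = (\<lambda>\<eta>. \<chi> w. V w \<eta>)"
  obtain L1 where L1: "\<And>w. 0 \<le> L1 w" "\<And>w \<eta> \<zeta>. \<eta> \<in> prob_simplex \<Longrightarrow> \<zeta> \<in> prob_simplex \<Longrightarrow> \<bar>V w \<zeta> - V w \<eta>\<bar> \<le> L1 w * norm (\<zeta> - \<eta>)"
    using lipschitz_of_gradient[OF G] by metis
  define L2 where "L2 = (\<Sum>w\<in>UNIV. L1 w)"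
  have L2: "0 \<le> L2" using L1(1) by (simp add: L2_def sum_nonneg)
  have Vlip: "norm (Vv \<zeta> - Vv \<eta>) \<le> L2 * norm (\<zeta> - \<eta>)" if "\<eta> \<in> prob_simplex" "\<zeta> \<in> prob_simplex" for \<eta> \<zeta>
  proof -
    have "norm (Vv \<zeta> - Vv \<eta>) \<le> (\<Sum>w\<in>UNIV. \<bar>(Vv \<zeta> - Vv \<eta>) $ w\<bar>)" by (rule norm_le_l1_cart)
    also have "\<dots> \<le> (\<Sum>w\<in>UNIV. L1 w * norm (\<zeta> - \<eta>))" using L1(2)[OF that] by (intro sum_mono) (simp add: Vv_def)
    finally show ?thesis by (simp add: L2_def sum_distrib_right)
  qed
  have Vcont: "continuous_on prob_simplex Vv"
    by (rule lipschitz_on_continuous_on[of L2], rule lipschitz_onI) (use Vlip L2 in \<open>auto simp: dist_norm\<close>)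
  then have "bounded (Vv ` prob_simplex)" using compact_simplex compact_continuous_image compact_imp_bounded by blast
  then obtain B where B: "\<And>\<eta>. \<eta> \<in> prob_simplex \<Longrightarrow> norm (Vv \<eta>) \<le> B" by (auto simp: bounded_iff)
  define RV where "RV = d * (2 * B)"
  have ball: "Delta y (Vv \<eta>) \<in> cball 0 RV" if "\<eta> \<in> prob_simplex" for y \<eta>
  proof -
    have "norm (Delta y (Vv \<eta>)) \<le> d * osc (Vv \<eta>)" unfolding d_def by (rule norm_Delta_le)
    also have "\<dots> \<le> d * (2 * norm (Vv \<eta>))" using d_pos by (intro mult_left_mono osc_norm) auto
    also have "\<dots> \<le> RV" unfolding RV_def using B[OF that] d_pos by (intro mult_left_mono) auto
    finally show ?thesis by simp
  qed
  obtain L3 where L3: "0 < L3" "\<And>x p v. p \<in> cball 0 RV \<Longrightarrow> norm (Hess x p *v v) \<le> L3 * norm v"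
    using local_constants[of RV] by blast
  have glip: "\<bar>g y (Delta y (Vv \<mu>)) $ x - g y (Delta y (Vv \<nu>)) $ x\<bar> \<le> 2 * L3 * d * L2 * d * D"
    if S: "\<mu> \<in> prob_simplex" "\<nu> \<in> prob_simplex" and D: "\<And>y. \<bar>\<mu> $ y - \<nu> $ y\<bar> \<le> D" for y x \<mu> \<nu> D
  proof -
    have "\<bar>(g y (Delta y (Vv \<mu>)) - g y (Delta y (Vv \<nu>))) $ x\<bar> \<le> norm (g y (Delta y (Vv \<mu>)) - g y (Delta y (Vv \<nu>)))" by (rule component_le_norm_cart)
    also have "\<dots> \<le> L3 * norm (Delta y (Vv \<mu>) - Delta y (Vv \<nu>))" by (rule g_lipschitz[OF L3(2) ball[OF S(1)] ball[OF S(2)]])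
    also have "\<dots> \<le> L3 * (d * (2 * (L2 * (d * D))))"
    proof (rule mult_left_mono)
      have "norm (\<mu> - \<nu>) \<le> d * D" unfolding d_def by (rule norm_le_card_bound) (simp add: D)
      then have "L2 * norm (\<mu> - \<nu>) \<le> L2 * (d * D)" using L2 by (intro mult_left_mono)
      then have "osc (Vv \<mu> - Vv \<nu>) \<le> 2 * (L2 * (d * D))"
        using osc_norm[of "Vv \<mu> - Vv \<nu>"] Vlip[OF S(2,1)] by linarith
      then have "d * osc (Vv \<mu> - Vv \<nu>) \<le> d * (2 * (L2 * (d * D)))" using d_pos by (intro mult_left_mono) auto
      moreover have "norm (Delta y (Vv \<mu> - Vv \<nu>)) \<le> d * osc (Vv \<mu> - Vv \<nu>)" unfolding d_def by (rule norm_Delta_le)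
      ultimately show "norm (Delta y (Vv \<mu>) - Delta y (Vv \<nu>)) \<le> d * (2 * (L2 * (d * D)))" unfolding Delta_diff by linarith
    qed (use L3(1) in simp)
    finally show ?thesis by (simp add: mult_ac)
  qed
  have "\<exists>m. m 0 = \<mu>0 \<and> (\<forall>t\<ge>0. m t \<in> prob_simplex) \<and>
     (\<forall>t\<ge>0. \<forall>x. ((\<lambda>s. m s $ x) has_rate (\<Sum>y\<in>UNIV. m t $ y * g y (Delta y (Vv (m t))) $ x)) t)"
  proof (rule forward_flow[where R = "\<lambda>t \<mu> y x. g y (Delta y (Vv \<mu>)) $ x" and al = al and au = au and lip_const = "d * \<Lambda> + 2 * L3 * d * L2 * d"])
    show "continuous_on {0..} (\<lambda>t. g y (Delta y (Vv (\<nu> t))) $ x)"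
      if "continuous_on {0..} \<nu>" "\<And>t. 0 \<le> t \<Longrightarrow> \<nu> t \<in> prob_simplex" for \<nu> :: "real \<Rightarrow> real ^ 'n" and y x
    proof -
      have "continuous_on {0..} (\<lambda>t. Vv (\<nu> t))" by (rule continuous_on_compose2[OF Vcont that(1)]) (use that(2) in auto)
      then show ?thesis by (intro continuous_intros continuous_on_compose2[OF g_continuous[of UNIV] continuous_on_Delta]) auto
    qed
    show "\<bar>(\<Sum>y\<in>UNIV. \<mu> $ y * g y (Delta y (Vv \<mu>)) $ x) - (\<Sum>y\<in>UNIV. \<nu> $ y * g y (Delta y (Vv \<nu>)) $ x)\<bar>
        \<le> (d * \<Lambda> + 2 * L3 * d * L2 * d) * D"
      if S: "\<mu> \<in> prob_simplex" "\<nu> \<in> prob_simplex" and D: "\<And>y. \<bar>\<mu> $ y - \<nu> $ y\<bar> \<le> D" for t \<mu> \<nu> D x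
    proof -
      let ?a = "\<lambda>y. g y (Delta y (Vv \<mu>)) $ x" and ?b = "\<lambda>y. g y (Delta y (Vv \<nu>)) $ x"
      have D0: "0 \<le> D" using D[of undefined] by (rule order_trans[OF abs_ge_zero])
      have "(\<Sum>y\<in>UNIV. \<mu> $ y * ?a y) - (\<Sum>y\<in>UNIV. \<nu> $ y * ?b y) = (\<Sum>y\<in>UNIV. (\<mu> $ y - \<nu> $ y) * ?a y) + (\<Sum>y\<in>UNIV. \<nu> $ y * (?a y - ?b y))"
        unfolding sum.distrib[symmetric] sum_subtractf[symmetric] by (intro sum.cong) (auto simp: algebra_simps)
      moreover have "\<bar>\<Sum>y\<in>UNIV. (\<mu> $ y - \<nu> $ y) * ?a y\<bar> \<le> (\<Sum>y\<in>(UNIV :: 'n set). D * \<Lambda>)"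
        by (rule order_trans[OF sum_abs], rule sum_mono, unfold abs_mult, intro mult_mono D rate_abs_bound) (use D0 in auto)
      moreover have "\<bar>\<Sum>y\<in>UNIV. \<nu> $ y * (?a y - ?b y)\<bar> \<le> (\<Sum>y\<in>UNIV. \<nu> $ y * (2 * L3 * d * L2 * d * D))"
      proof (rule order_trans[OF sum_abs], rule sum_mono)
        fix y
        show "\<bar>\<nu> $ y * (?a y - ?b y)\<bar> \<le> \<nu> $ y * (2 * L3 * d * L2 * d * D)"
          using glip[OF S D, of y x] simplex_nonneg[OF S(2), of y] by (simp add: abs_mult mult_left_mono)
      qed
      moreover have "(\<Sum>y\<in>UNIV. \<nu> $ y * (2 * L3 * d * L2 * d * D)) = 2 * L3 * d * L2 * d * D"
        using simplex_sum[OF S(2)] by (simp flip: sum_distrib_right)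
      moreover have "(\<Sum>y\<in>(UNIV :: 'n set). D * \<Lambda>) = d * \<Lambda> * D" by (simp add: d_def)
      ultimately show ?thesis unfolding distrib_right by linarith
    qed
    show "0 \<le> d * \<Lambda> + 2 * L3 * d * L2 * d" using d_pos \<Lambda>_pos L3(1) L2 by simp
  qed (use rate_generator A1 \<mu>0 in auto)
  then obtain m where m: "m 0 = \<mu>0" and mS: "\<And>t. 0 \<le> t \<Longrightarrow> m t \<in> prob_simplex"
    and dm: "\<And>t x. 0 \<le> t \<Longrightarrow> ((\<lambda>s. m s $ x) has_rate (\<Sum>y\<in>UNIV. m t $ y * g y (Delta y (Vv (m t))) $ x)) t"
    by blast
  have "equilibrium r \<mu>0 (\<lambda>t. Vv (m t)) m"
    unfolding system_def
  proof (intro conjI allI impI)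
    show "\<exists>B. \<forall>t\<ge>0. \<forall>x. \<bar>Vv (m t) $ x\<bar> \<le> B" using B mS component_le_norm_cart order_trans by meson
    show "m 0 = \<mu>0" by (rule m)
    fix t :: real and x assume t: "0 \<le> t"
    show "m t \<in> prob_simplex" by (rule mS[OF t])
    show "((\<lambda>s. m s $ x) has_rate (\<Sum>y\<in>UNIV. m t $ y * g y (Delta y (Vv (m t))) $ x)) t" by (rule dm[OF t])
    define v where "v = (\<chi> z. \<Sum>y\<in>UNIV. m t $ y * g y (Delta y (Vv (m t))) $ z)"
    have "((\<lambda>s. V x (m s)) has_rate (G x (m t) \<bullet> v)) t"
      by (rule chain_rule_simplex[OF G mS t]) (use dm[OF t] in \<open>simp_all add: v_def\<close>)
    moreover have "G x (m t) \<bullet> v = (\<Sum>y\<in>UNIV. \<Sum>z\<in>UNIV. m t $ y * simplex_deriv (V x) y z (m t) * g y (Delta y (Vv (m t))) $ z)"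
      unfolding simplex_deriv_of_gradient[OF G mS[OF t]] v_def by (rule transport_identity[OF rate_sum, symmetric])
    moreover have "r * V x (m t) = H x (Delta x (Vv (m t)))
      + (\<Sum>y\<in>UNIV. \<Sum>z\<in>UNIV. m t $ y * simplex_deriv (V x) y z (m t) * g y (Delta y (Vv (m t))) $ z) + F x (m t)"
      using V mS[OF t] unfolding master_solution_def Vv_def by blast
    ultimately show "((\<lambda>s. Vv (m s) $ x) has_rate (r * Vv (m t) $ x - H x (Delta x (Vv (m t))) - 1 * F x (m t) - 0 $ x)) t"
      by (simp add: Vv_def)
  qed
  then show ?thesis unfolding Vv_def by blast
qed

lemma master_unique:
  assumes V: "master_solution H g F r V" and r: "0 < r" "r < coupling.r0" and \<eta>: "\<eta> \<in> prob_simplex"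
  shows "V x \<eta> = value r \<eta> $ x"
proof -
  obtain m where e: "equilibrium r \<eta> (\<lambda>t. \<chi> w. V w (m t)) m" using master_equilibrium[OF V \<eta>] by blast
  show ?thesis using value_eq[OF e r] systemD(3)[OF e] by simp
qed

lemma mfg_solution_equilibrium: "mfg_solution H g F r \<mu>0 u m \<longleftrightarrow> equilibrium r \<mu>0 u m"
proof -
  have bd: "bounded (u ` {0..}) \<longleftrightarrow> (\<exists>B. \<forall>t\<ge>0. \<forall>x. \<bar>u t $ x\<bar> \<le> B)"
  proof
    assume "bounded (u ` {0..})"
    then obtain B where "\<And>t. 0 \<le> t \<Longrightarrow> norm (u t) \<le> B" by (auto simp: bounded_iff)
    then show "\<exists>B. \<forall>t\<ge>0. \<forall>x. \<bar>u t $ x\<bar> \<le> B" using component_le_norm_cart order_trans by meson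
  next
    assume "\<exists>B. \<forall>t\<ge>0. \<forall>x. \<bar>u t $ x\<bar> \<le> B"
    then obtain B where B: "\<And>t x. 0 \<le> t \<Longrightarrow> \<bar>u t $ x\<bar> \<le> B" by blast
    have "norm (u t) \<le> d * B" if "0 \<le> t" for t unfolding d_def by (rule norm_le_card_bound[OF B[OF that]])
    then show "bounded (u ` {0..})" by (auto simp: bounded_iff)
  qed
  have eq: "- (- r * u t $ x + H x (Delta x (u t)) + F x (m t)) = r * u t $ x - H x (Delta x (u t)) - 1 * F x (m t) - 0 $ x" for t x
    by simp
  show ?thesis unfolding mfg_solution_def system_def image_subset_iff Ball_def atLeast_iff bd eq by blast
qed

lemma stationary_equilibrium:
  assumes "stationary_solution H g F r u \<mu>"
  shows "equilibrium r \<mu> (\<lambda>_. u) (\<lambda>_. \<mu>)"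
proof -
  have s: "\<mu> \<in> prob_simplex" "\<And>x. r * u $ x - H x (Delta x u) - F x \<mu> = 0" "\<And>x. (\<Sum>y\<in>UNIV. \<mu> $ y * g y (Delta y u) $ x) = 0"
    using assms by (auto simp: stationary_solution_def algebra_simps)
  have "\<exists>B. \<forall>x. \<bar>u $ x\<bar> \<le> B" using component_le_norm_cart by blast
  then show ?thesis using s by (simp add: system_def)
qed

lemma constant_equilibrium_stationary:
  assumes e: "equilibrium r \<mu> u m" and const: "\<And>t. 0 \<le> t \<Longrightarrow> u t = u 0" "\<And>t. 0 \<le> t \<Longrightarrow> m t = \<mu>"
  shows "stationary_solution H g F r (u 0) \<mu>"
proof -
  have du: "((\<lambda>s. u s $ x) has_rate 0) 0" for x
  proof (rule half_line_transform[OF DERIV_const order_refl])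
    show "u 0 $ x = u s $ x" if "0 \<le> s" for s using const(1)[OF that] by (rule arg_cong[OF sym])
  qed
  have dm: "((\<lambda>s. m s $ x) has_rate 0) 0" for x
  proof (rule half_line_transform[OF DERIV_const order_refl])
    show "\<mu> $ x = m s $ x" if "0 \<le> s" for s using const(2)[OF that] by (rule arg_cong[OF sym])
  qed
  have m0: "m 0 = \<mu>" by (rule systemD(3)[OF e])
  have "r * u 0 $ x - H x (Delta x (u 0)) - 1 * F x (m 0) - 0 $ x = 0" for x
    by (rule half_line_deriv_unique[OF systemD(4)[OF e order_refl] du])
  then have "- r * u 0 $ x + H x (Delta x (u 0)) + F x \<mu> = 0" for x by (simp add: m0 algebra_simps)
  moreover have "(\<Sum>y\<in>UNIV. \<mu> $ y * g y (Delta y (u 0)) $ x) = 0" for x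
    using half_line_deriv_unique[OF systemD(5)[OF e order_refl, of x] dm] unfolding m0 .
  moreover have "\<mu> \<in> prob_simplex" using systemD(2)[OF e order_refl] unfolding m0 .
  ultimately show ?thesis unfolding stationary_solution_def by blast
qed

text \<open>Comparing an equilibrium with its own time shifts shows that \<open>m t\<close> converges exponentially.
  The equilibrium started at the limit does not move, by continuous dependence on the initial distribution.\<close>

lemma stationary_exists:
  assumes r: "0 < r" "r < coupling.r0"
  shows "\<exists>u \<mu>. stationary_solution H g F r u \<mu>"
proof -
  obtain u m where e: "equilibrium r (axis undefined 1) u m" using system_exists[OF r vertex_in_simplex] by blast
  have step: "l1 (m (s + t) - m t) \<le> 2 * C0 * exp (- (lam * t))" if st: "0 \<le> s" "0 \<le> t" for s t
  proof -
    have "l1 (m (s + t) - m t) \<le> C0 * exp (- (lam * t)) * l1 (m s - axis undefined 1)"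
      by (rule equilibrium_pair_decay(1)[OF equilibrium_shift[OF e st(1)] e r st(2)])
    also have "l1 (m s - axis undefined 1) \<le> l1 (m s) + l1 (- axis undefined 1 :: real ^ 'n)"
      using l1_triangle[of "m s" "- axis undefined 1"] by simp
    also have "\<dots> = 2" using simplex_l1[OF systemD(2)[OF e st(1)]] simplex_l1[OF vertex_in_simplex, of undefined]
      by (simp add: l1_def)
    finally show ?thesis using C0_nonneg by (simp add: mult_left_mono)
  qed
  have decay: "((\<lambda>t. 2 * C0 * exp (- (lam * t))) \<longlongrightarrow> 0) at_top"
  proof -
    have "((\<lambda>t. 2 * C0 * exp (- (lam * t))) \<longlongrightarrow> 2 * C0 * 0) at_top" by (intro tendsto_mult tendsto_const exp_decay_tendsto lam_pos)
    then show ?thesis by simp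
  qed
  then have decay_seq: "(\<lambda>k. 2 * C0 * exp (- (lam * real k))) \<longlonglongrightarrow> 0"
    by (rule filterlim_compose[OF _ filterlim_real_sequentially])
  have "Cauchy (\<lambda>k. m (real k))"
  proof (rule Cauchy_of_tail_bound[OF _ decay_seq])
    fix i j :: nat assume "i \<le> j"
    then have "dist (m (real i)) (m (real j)) \<le> l1 (m (real (j - i) + real i) - m (real i))"
      using norm_le_l1[of "m (real j) - m (real i)"] by (simp add: dist_norm norm_minus_commute of_nat_diff)
    also have "\<dots> \<le> 2 * C0 * exp (- (lam * real i))" by (rule step) auto
    finally show "dist (m (real i)) (m (real j)) \<le> 2 * C0 * exp (- (lam * real i))" .
  qed
  then obtain \<mu> where \<mu>: "(\<lambda>k. m (real k)) \<longlonglongrightarrow> \<mu>" using Cauchy_convergent convergent_def by blast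
  have \<mu>S: "\<mu> \<in> prob_simplex"
    by (rule closed_sequentially[OF closed_simplex _ \<mu>]) (simp add: systemD(2)[OF e])
  obtain u' m' where e': "equilibrium r \<mu> u' m'" using system_exists[OF r \<mu>S] by blast
  have m'const: "m' t = \<mu>" if t: "0 \<le> t" for t
  proof -
    have bound: "norm (m' t - m (real k)) \<le> C0 * (d * norm (\<mu> - m (real k))) + 2 * C0 * exp (- (lam * real k))" for k
    proof -
      have "norm (m' t - m (real k)) \<le> l1 (m' t - m (real k + t)) + l1 (m (t + real k) - m (real k))"
        using norm_le_l1[of "m' t - m (real k)"] l1_triangle[of "m' t - m (real k + t)" "m (real k + t) - m (real k)"]
        by (simp add: add.commute)
      also have "l1 (m' t - m (real k + t)) \<le> C0 * exp (- (lam * t)) * l1 (\<mu> - m (real k))"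
        by (rule equilibrium_pair_decay(1)[OF e' equilibrium_shift[OF e of_nat_0_le_iff] r t])
      also have "\<dots> \<le> C0 * 1 * (d * norm (\<mu> - m (real k)))"
        using C0_nonneg lam_pos t l1_le_norm[of "\<mu> - m (real k)"] l1_nonneg by (intro mult_mono) (auto simp: d_def)
      also have "l1 (m (t + real k) - m (real k)) \<le> 2 * C0 * exp (- (lam * real k))" by (rule step[OF t]) simp
      finally show ?thesis by simp
    qed
    have "(\<lambda>k. norm (m' t - m (real k))) \<longlonglongrightarrow> norm (m' t - \<mu>)" by (intro tendsto_intros \<mu>)
    moreover have "(\<lambda>k. C0 * (d * norm (\<mu> - m (real k))) + 2 * C0 * exp (- (lam * real k))) \<longlonglongrightarrow> C0 * (d * norm (\<mu> - \<mu>)) + 0"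
      by (intro tendsto_intros \<mu> decay_seq)
    ultimately have "norm (m' t - \<mu>) \<le> C0 * (d * norm (\<mu> - \<mu>)) + 0"
      by (intro tendsto_le[OF sequentially_bot]) (auto intro!: always_eventually bound)
    then show ?thesis by simp
  qed
  have "u' t = u' 0" if "0 \<le> t" for t
    using value_along[OF e' r that] value_eq[OF e' r] m'const[OF that] by simp
  then show ?thesis using constant_equilibrium_stationary[OF e' _ m'const] by blast
qed

text \<open>The discounted pairing of two equilibria is nonincreasing and tends to \<open>0\<close>, so it is
  nonnegative at the initial time.\<close>

lemma value_monotone:
  assumes S: "\<eta> \<in> prob_simplex" "\<theta> \<in> prob_simplex" and r: "0 < r" "r < coupling.r0"
  shows "0 \<le> (value r \<eta> - value r \<theta>) \<bullet> (\<eta> - \<theta>)"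
proof -
  obtain u m where e: "equilibrium r \<eta> u m" using system_exists[OF r S(1)] by blast
  obtain u' m' where e': "equilibrium r \<theta> u' m'" using system_exists[OF r S(2)] by blast
  define X where "X = (\<lambda>t. (u t - u' t) \<bullet> (m t - m' t))"
  note cp = equilibrium_pair_coupled[OF e e' r(1), of lam]
  have mono: "exp (- (r * T)) * X T \<le> X 0" if T: "0 \<le> T" for T
  proof -
    have "exp (- (r * T)) * X T \<le> exp (- (r * 0)) * X 0"
    proof (rule antimono_half_line[OF _ order_refl T])
      fix t :: real assume t: "0 \<le> t"
      obtain D where D: "(X has_rate D) t" and le: "D \<le> r * X t - c / 2 * (osc (u t - u' t))\<^sup>2"
        using coupled_pairD(5)[OF cp t] unfolding X_def by auto
      have "((\<lambda>t. exp (- (r * t)) * X t) has_rate (exp (- (r * t)) * (- r) * X t + exp (- (r * t)) * D)) t"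
        by (auto intro!: derivative_eq_intros D)
      then have "((\<lambda>t. exp (- (r * t)) * X t) has_rate (exp (- (r * t)) * (D - r * X t))) t"
        by (rule DERIV_cong) (simp add: algebra_simps)
      moreover have "0 \<le> c / 2 * (osc (u t - u' t))\<^sup>2" using pos by simp
      then have "exp (- (r * t)) * (D - r * X t) \<le> 0" using le by (intro mult_nonneg_nonpos) auto
      ultimately show "\<exists>D\<le>0. ((\<lambda>t. exp (- (r * t)) * X t) has_rate D) t" by blast
    qed
    then show ?thesis by simp
  qed
  have lower: "- (2 * K * (d * 2)) * exp (- (r * T)) \<le> exp (- (r * T)) * X T" if T: "0 \<le> T" for T
  proof -
    have "\<bar>X T\<bar> \<le> osc (u T - u' T) * l1 (m T - m' T)"
      unfolding X_def by (rule inner_le_osc_l1) (rule coupled_pairD(2)[OF cp T])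
    also have "\<dots> \<le> (2 * K) * (d * 2)"
    proof (intro mult_mono l1_nonneg)
      show "osc (u T - u' T) \<le> 2 * K"
      proof (rule osc_least)
        fix x y
        have "\<bar>u T $ x - u T $ y\<bar> \<le> K" "\<bar>u' T $ x - u' T $ y\<bar> \<le> K"
          using order_trans[OF osc_abs system_osc[OF e small_source_zero r(1) T]]
            order_trans[OF osc_abs system_osc[OF e' small_source_zero r(1) T]] by blast+
        then show "(u T - u' T) $ x - (u T - u' T) $ y \<le> 2 * K" unfolding vector_minus_component by linarith
      qed
      have "l1 (m T - m' T) \<le> d * norm (m T - m' T)" unfolding d_def by (rule l1_le_norm)
      also have "\<dots> \<le> d * 2" using d_pos systemD(2)[OF e T] systemD(2)[OF e' T] by (intro mult_left_mono simplex_diff_norm) auto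
      finally show "l1 (m T - m' T) \<le> d * 2" .
      have "0 \<le> K" using system_osc[OF e small_source_zero r(1) T] osc_nonneg[of "u T"] by linarith
      then show "0 \<le> 2 * K" by simp
    qed
    finally have "- (2 * K * (d * 2)) \<le> X T" by (simp add: abs_le_iff)
    then have "exp (- (r * T)) * - (2 * K * (d * 2)) \<le> exp (- (r * T)) * X T" by (intro mult_left_mono) auto
    then show ?thesis by (simp only: mult.commute)
  qed
  have "- X 0 \<le> (2 * K * (d * 2)) * exp (- (r * T))" if "0 \<le> T" for T
    using order_trans[OF lower[OF that] mono[OF that]] by (simp only: mult_minus_left minus_le_iff)
  then have "- X 0 \<le> 0" by (rule nonpos_of_decaying_bound[OF r(1)])
  then show ?thesis using systemD(3)[OF e] systemD(3)[OF e'] by (simp add: X_def value_eq[OF e r] value_eq[OF e' r])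
qed

lemma simplex_grad_bounds:
  fixes U :: "real ^ 'n \<Rightarrow> real" and y :: 'n
  assumes G: "simplex_gradient U G" and b: "\<And>\<eta>. \<eta> \<in> prob_simplex \<Longrightarrow> norm (G \<eta>) \<le> B"
    and L: "\<And>\<eta> \<zeta>. \<eta> \<in> prob_simplex \<Longrightarrow> \<zeta> \<in> prob_simplex \<Longrightarrow> norm (G \<eta> - G \<zeta>) \<le> L * norm (\<eta> - \<zeta>)"
    and S: "\<eta> \<in> prob_simplex" "\<zeta> \<in> prob_simplex"
  shows "norm (simplex_grad U y \<eta>) \<le> d * (2 * B)"
    and "norm (simplex_grad U y \<eta> - simplex_grad U y \<zeta>) \<le> d * (2 * L) * norm (\<eta> - \<zeta>)"
proof -
  have grad: "simplex_grad U y \<theta> = Delta y (G \<theta>)" if "\<theta> \<in> prob_simplex" for \<theta>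
    by (simp add: simplex_grad_def simplex_deriv_of_gradient[OF G that] vec_eq_iff)
  have D: "norm (Delta y v) \<le> d * (2 * norm v)" for v :: "real ^ 'n"
  proof -
    have "norm (Delta y v) \<le> d * osc v" unfolding d_def by (rule norm_Delta_le)
    also have "\<dots> \<le> d * (2 * norm v)" using d_pos by (intro mult_left_mono osc_norm) auto
    finally show ?thesis .
  qed
  have "d * (2 * norm (G \<eta>)) \<le> d * (2 * B)" using b[OF S(1)] d_pos by (intro mult_left_mono) auto
  then show "norm (simplex_grad U y \<eta>) \<le> d * (2 * B)" unfolding grad[OF S(1)] using D[of "G \<eta>"] by linarith
  have "d * (2 * norm (G \<eta> - G \<zeta>)) \<le> d * (2 * (L * norm (\<eta> - \<zeta>)))" using L[OF S] d_pos by (intro mult_left_mono) auto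
  then show "norm (simplex_grad U y \<eta> - simplex_grad U y \<zeta>) \<le> d * (2 * L) * norm (\<eta> - \<zeta>)"
    unfolding grad[OF S(1)] grad[OF S(2)] Delta_diff[symmetric] mult.assoc by (rule order_trans[OF D])
qed

definition "final_constant = au * d * K + (B0 + BF) + d * (2 * (2 * d * Cv)) + d * (2 * (9 * d * Cv)) + 1"

lemma final_constant_parts:
  "0 < final_constant" "au * d * K + (B0 + BF) + d * (2 * (2 * d * Cv)) \<le> final_constant" "d * (2 * (9 * d * Cv)) \<le> final_constant"
proof -
  have K: "0 \<le> K" using B_nonneg A1 by (simp add: K_def)
  have "0 \<le> au * d * K" "0 \<le> B0 + BF" "0 \<le> d * (2 * (2 * d * Cv))" "0 \<le> d * (2 * (9 * d * Cv))"
    using A1 K d_pos Cv_nonneg B_nonneg by simp_all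
  then show "0 < final_constant" "au * d * K + (B0 + BF) + d * (2 * (2 * d * Cv)) \<le> final_constant" "d * (2 * (9 * d * Cv)) \<le> final_constant"
    unfolding final_constant_def by linarith+
qed

lemma master_bounds:
  assumes U: "master_solution H g F r U" and r: "0 < r" "r < coupling.r0" and S: "\<eta> \<in> prob_simplex" "\<zeta> \<in> prob_simplex"
  shows "\<bar>r * U x \<eta>\<bar> + norm (simplex_grad (U x) y \<eta>) \<le> final_constant"
    and "norm (simplex_grad (U x) y \<eta> - simplex_grad (U x) y \<zeta>) \<le> final_constant * norm (\<eta> - \<zeta>)"
proof -
  obtain G where G: "simplex_gradient (\<lambda>\<eta>. value r \<eta> $ x) G" and b: "\<And>\<eta>. \<eta> \<in> prob_simplex \<Longrightarrow> norm (G \<eta>) \<le> 2 * d * Cv"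
    and L: "\<And>\<eta> \<zeta>. \<eta> \<in> prob_simplex \<Longrightarrow> \<zeta> \<in> prob_simplex \<Longrightarrow> norm (G \<eta> - G \<zeta>) \<le> 9 * d * Cv * norm (\<eta> - \<zeta>)"
    using value_gradient[OF r, of x] by blast
  have GU: "simplex_gradient (U x) G" by (rule simplex_gradient_cong[OF G]) (rule master_unique[OF U r])
  obtain u m where e: "equilibrium r \<eta> u m" using system_exists[OF r S(1)] by blast
  have "\<bar>r * u 0 $ x\<bar> \<le> au * d * K + (B0 + BF)" by (rule system_scaled_bound[OF e small_source_zero r(1) order_refl])
  then have "\<bar>r * U x \<eta>\<bar> \<le> au * d * K + (B0 + BF)" unfolding master_unique[OF U r S(1)] value_eq[OF e r] .
  then show "\<bar>r * U x \<eta>\<bar> + norm (simplex_grad (U x) y \<eta>) \<le> final_constant"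
    using simplex_grad_bounds(1)[OF GU b L S, of y] final_constant_parts(2) by linarith
  show "norm (simplex_grad (U x) y \<eta> - simplex_grad (U x) y \<zeta>) \<le> final_constant * norm (\<eta> - \<zeta>)"
    using simplex_grad_bounds(2)[OF GU b L S, of y] mult_right_mono[OF final_constant_parts(3) norm_ge_zero[of "\<eta> - \<zeta>"]] by linarith
qed

end

theorem proposition2p3:
  fixes al au :: real
    and f :: "'n::finite \<Rightarrow> real ^ 'n \<Rightarrow> real"
    and F :: "'n \<Rightarrow> real ^ 'n \<Rightarrow> real"
    and H :: "'n \<Rightarrow> real ^ 'n \<Rightarrow> real"
    and g :: "'n \<Rightarrow> real ^ 'n \<Rightarrow> real ^ 'n"
    and one :: 'n  \<comment> \<open>the state carrying the label 1\<close>
  assumes d: "CARD('n) \<ge> 2"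
    and H_def: "H = hamiltonian al au f"
    and g_def: "g = opt_rate al au f"
    and cost: "running_cost al au f"
    and A1: "0 < al" "al < au"
    and A2: "\<And>x p. \<exists>!a. minimizing_rate al au f x p a" "\<And>x. g x \<in> borel_measurable borel"
    and A3: "\<And>x. simplex_C1 (F x)" "\<And>x. \<exists>L. L-lipschitz_on prob_simplex (simplex_jac (F x))"
    and A4: "lasry_lions_monotone F"
    and A5: "\<And>x. regular_concave_at x (H x)"
  shows "\<exists>r0>0.
    (\<forall>r. 0 < r \<and> r < r0 \<longrightarrow> (\<exists>U. master_solution H g F r U))
    \<and> (\<forall>r. 0 < r \<and> r < r0 \<longrightarrow>
         (\<forall>U V. master_solution H g F r U \<and> master_solution H g F r V \<longrightarrow>
            (\<forall>x. \<forall>\<eta>\<in>prob_simplex. U x \<eta> = V x \<eta>))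
         \<and> (\<forall>\<mu>0\<in>prob_simplex. \<exists>u \<mu>. mfg_solution H g F r \<mu>0 u \<mu>)
         \<and> (\<exists>u \<mu>. stationary_solution H g F r u \<mu>)
         \<and> (\<forall>U. master_solution H g F r U \<longrightarrow>
              (\<forall>\<mu>0\<in>prob_simplex. \<forall>u \<mu>. mfg_solution H g F r \<mu>0 u \<mu> \<longrightarrow>
                 (\<forall>x. U x \<mu>0 = u 0 $ x))
            \<and> (\<forall>u \<mu>. stationary_solution H g F r u \<mu> \<longrightarrow>
                 (\<forall>x. U x \<mu> = u $ x))))
    \<and> (\<exists>C>0. \<forall>r U. 0 < r \<and> r < r0 \<and> master_solution H g F r U \<longrightarrow>
         (\<forall>x. simplex_differentiable (U x)
            \<and> (\<forall>\<eta>\<^sub>1\<in>prob_simplex. \<forall>\<eta>\<^sub>2\<in>prob_simplex.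
                 \<bar>r * U x \<eta>\<^sub>1\<bar> + norm (simplex_grad (U x) one \<eta>\<^sub>1) \<le> C
               \<and> norm (simplex_grad (U x) one \<eta>\<^sub>1 - simplex_grad (U x) one \<eta>\<^sub>2)
                   \<le> C * norm (\<eta>\<^sub>1 - \<eta>\<^sub>2))))
    \<and> (\<forall>r U. 0 < r \<and> r < r0 \<and> master_solution H g F r U \<longrightarrow> lasry_lions_monotone U)"
proof -
  interpret mean_field_game al au f F H g
    by (rule mean_field_game.intro[OF H_def g_def A1 A2(1) A3 A4 A5])
  obtain BF B0 Lg c LF GF where "mfg_constants al au f F H g BF B0 Lg c LF GF"
    using constants_exist by blast
  then interpret mfg_constants al au f F H g BF B0 Lg c LF GF .
  let ?r0 = coupling.r0
  have exist: "\<exists>U. master_solution H g F r U" if "0 < r \<and> r < ?r0" for r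
    using value_master that by blast
  have equil: "\<exists>u \<mu>. mfg_solution H g F r \<mu>0 u \<mu>" if "0 < r \<and> r < ?r0" "\<mu>0 \<in> prob_simplex" for r \<mu>0
    using system_exists that by (simp add: mfg_solution_equilibrium)
  have rep: "U x \<mu>0 = u 0 $ x"
    if "0 < r \<and> r < ?r0" "master_solution H g F r U" "\<mu>0 \<in> prob_simplex" "mfg_solution H g F r \<mu>0 u \<mu>" for r U \<mu>0 u \<mu> x
    using that master_unique[OF that(2) _ _ that(3), of x] value_eq[of r \<mu>0 u \<mu>] by (simp add: mfg_solution_equilibrium)
  have stat: "U x \<mu> = u $ x"
    if "0 < r \<and> r < ?r0" "master_solution H g F r U" "stationary_solution H g F r u \<mu>" for r U u \<mu> x
    using that rep[OF that(1,2) _ stationary_equilibrium[OF that(3), folded mfg_solution_equilibrium], of x]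
    by (simp add: stationary_solution_def)
  have unique: "U x \<eta> = V x \<eta>"
    if "0 < r \<and> r < ?r0" "master_solution H g F r U \<and> master_solution H g F r V" "\<eta> \<in> prob_simplex" for r U V x \<eta>
    using that master_unique[of r U \<eta> x] master_unique[of r V \<eta> x] by simp
  have mono: "lasry_lions_monotone U" if "0 < r \<and> r < ?r0 \<and> master_solution H g F r U" for r U
    unfolding lasry_lions_monotone_def
  proof (intro ballI)
    fix \<eta> \<theta> :: "real ^ 'n" assume S: "\<eta> \<in> prob_simplex" "\<theta> \<in> prob_simplex"
    have r: "0 < r" "r < ?r0" and U: "master_solution H g F r U" using that by auto
    show "(\<Sum>x\<in>UNIV. (U x \<eta> - U x \<theta>) * (\<eta> $ x - \<theta> $ x)) \<ge> 0"
      using value_monotone[OF S r] master_unique[OF U r] S by (simp add: inner_vec_def)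
  qed
  show ?thesis
  proof (rule exI[of _ ?r0], intro conjI)
    show "?r0 > 0" by (rule coupling.constants_pos(10))
    show "\<forall>r. 0 < r \<and> r < ?r0 \<longrightarrow> (\<exists>U. master_solution H g F r U)" using exist by blast
    show "\<forall>r. 0 < r \<and> r < ?r0 \<longrightarrow>
         (\<forall>U V. master_solution H g F r U \<and> master_solution H g F r V \<longrightarrow>
            (\<forall>x. \<forall>\<eta>\<in>prob_simplex. U x \<eta> = V x \<eta>))
         \<and> (\<forall>\<mu>0\<in>prob_simplex. \<exists>u \<mu>. mfg_solution H g F r \<mu>0 u \<mu>)
         \<and> (\<exists>u \<mu>. stationary_solution H g F r u \<mu>)
         \<and> (\<forall>U. master_solution H g F r U \<longrightarrow>
              (\<forall>\<mu>0\<in>prob_simplex. \<forall>u \<mu>. mfg_solution H g F r \<mu>0 u \<mu> \<longrightarrow>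
                 (\<forall>x. U x \<mu>0 = u 0 $ x))
            \<and> (\<forall>u \<mu>. stationary_solution H g F r u \<mu> \<longrightarrow>
                 (\<forall>x. U x \<mu> = u $ x)))"
    proof (intro allI impI conjI ballI)
      fix r assume r: "0 < r \<and> r < ?r0"
      show "\<exists>u \<mu>. stationary_solution H g F r u \<mu>" using stationary_exists r by blast
      show "\<exists>u \<mu>. mfg_solution H g F r \<mu>0 u \<mu>" if "\<mu>0 \<in> prob_simplex" for \<mu>0 by (rule equil[OF r that])
      show "U x \<eta> = V x \<eta>" if "master_solution H g F r U \<and> master_solution H g F r V" "\<eta> \<in> prob_simplex" for U V x \<eta>
        by (rule unique[OF r that])
      show "U x \<mu>0 = u 0 $ x" if "master_solution H g F r U" "\<mu>0 \<in> prob_simplex" "mfg_solution H g F r \<mu>0 u \<mu>" for U \<mu>0 u \<mu> x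
        by (rule rep[OF r that])
      show "U x \<mu> = u $ x" if "master_solution H g F r U" "stationary_solution H g F r u \<mu>" for U u \<mu> x
        by (rule stat[OF r that])
    qed
    show "\<exists>C>0. \<forall>r U. 0 < r \<and> r < ?r0 \<and> master_solution H g F r U \<longrightarrow>
         (\<forall>x. simplex_differentiable (U x)
            \<and> (\<forall>\<eta>\<^sub>1\<in>prob_simplex. \<forall>\<eta>\<^sub>2\<in>prob_simplex.
                 \<bar>r * U x \<eta>\<^sub>1\<bar> + norm (simplex_grad (U x) one \<eta>\<^sub>1) \<le> C
               \<and> norm (simplex_grad (U x) one \<eta>\<^sub>1 - simplex_grad (U x) one \<eta>\<^sub>2)
                   \<le> C * norm (\<eta>\<^sub>1 - \<eta>\<^sub>2)))"
    proof (intro exI[of _ final_constant] conjI final_constant_parts(1) allI impI ballI)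
      fix r U x assume a: "0 < r \<and> r < ?r0 \<and> master_solution H g F r U"
      then have r: "0 < r" "r < ?r0" and U: "master_solution H g F r U" by auto
      show "simplex_differentiable (U x)" using U by (simp add: master_solution_def simplex_C1_def)
      fix \<eta>\<^sub>1 \<eta>\<^sub>2 :: "real ^ 'n" assume S: "\<eta>\<^sub>1 \<in> prob_simplex" "\<eta>\<^sub>2 \<in> prob_simplex"
      show "\<bar>r * U x \<eta>\<^sub>1\<bar> + norm (simplex_grad (U x) one \<eta>\<^sub>1) \<le> final_constant"
        "norm (simplex_grad (U x) one \<eta>\<^sub>1 - simplex_grad (U x) one \<eta>\<^sub>2) \<le> final_constant * norm (\<eta>\<^sub>1 - \<eta>\<^sub>2)"
        by (rule master_bounds[OF U r S])+
    qed
    show "\<forall>r U. 0 < r \<and> r < ?r0 \<and> master_solution H g F r U \<longrightarrow> lasry_lions_monotone U" using mono by blast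
  qed
qed

end
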